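(* Let $T$ be a tree rooted at infinity with vertex set $V$, endowed with a locally doubling flow measure $m$. For the real interpolation spaces $[\cdot,\cdot]_{\theta,q}$ the following hold: (i) Let $1<p<p_1\le\infty$ and $\theta\in(0,1)$ be such that $\frac1p=1-\theta+\frac{\theta}{p_1}$. Then $[H^1(m),L^{p_1}(m)]_{\theta,p}=L^p(m)$. (ii) Let $1\le q_1<q<\infty$ and $\frac1q=\frac{1-\theta}{q_1}$ with $\theta\in(0,1)$. Then $[L^{q_1}(m),BMO(m)]_{\theta,q}=L^q(m)$. (iii) Let $1<q<\infty$ and $\frac1q=1-\theta$ with $\theta\in(0,1)$. Then $[H^1(m),BMO(m)]_{\theta,q}=L^q(m)$.
   Context: Tree with root at infinity: $T=(V,E)$ is an (undirected) tree with geodesic distance $d$, $o\in V$ is a fixed origin, and a half-infinite geodesic starting at $o$ is fixed, identified with a boundary point, the root. For $x\in V$ let $\Pi(x)$ be the vertex of this geodesic closest to $x$; the level of $x$ is $\ell(x)=d(o,\Pi(x))-d(\Pi(x),x)$. Write $x\ge y$ iff $\ell(x)-\ell(y)=d(x,y)$. The set of sons of $x$ is $s(x)=\{y\sim x:\ \ell(y)=\ell(x)-1\}$. Flow measure: a function $m:V\to(0,\infty)$ with $m(x)=\sum_{y\in s(x)}m(y)$ for all $x\in V$; also regarded as the measure $m(A)=\sum_{x\in A}m(x)$, with $\int_A f\,dm=\sum_{y\in A}f(y)m(y)$. It is locally doubling if for every $r>0$ there is $C_r>1$ with $m(B_{2r}(x))\le C_r m(B_r(x))$ for all $x\in V$,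 where $B_r(x)$ is the closed ball of radius $r$ for $d$. Admissible trapezoids: for integers $h''>h'\ge1$ and $x_0\in V$, $R_{h'}^{h''}(x_0)=\{x\in V:\ x\le x_0,\ \ell(x_0)-h''<\ell(x)\le \ell(x_0)-h'\}$. Fix $\beta\ge12$. $\mathcal R$ is the family of all singletons $\{x_0\}$ and all $R_{h'}^{h''}(x_0)$ with $2\le h''/h'\le\beta$, $x_0\in V$. $BMO(m)$: $f_R=\frac1{m(R)}\int_R f\,dm$; $BMO(m)$ is the space of functions $f:V\to\mathbb C$ with $\|f\|_{BMO}=\sup_{R\in\mathcal R}\frac1{m(R)}\int_R|f-f_R|\,dm<\infty$, modulo constants. $H^1(m)$: a $(1,\infty)$-atom is a function $a$ supported in some $R\in\mathcal R$ with $\|a\|_\infty\le m(R)^{-1}$ and $\int_R a\,dm=0$. $H^1(m)$ is the space of all $g\in L^1(m)$ of the form $g=\sum_j\lambda_ja_j$ with $a_j$ $(1,\infty)$-atoms and $\lambda_j\in\mathbb C$, $\sum_j|\lambda_j|<\infty$; $\|g\|_{H^1}$ is the infimum of $\sum_j|\lambda_j|$ over all such decompositions. Real interpolation: for compatible normed spaces $A_0,A_1$, $t>0$ and $a\in A_0+A_1$, $K(t,a;A_0,A_1)=\inf\{\|a_0\|_{A_0}+t\|a_1\|_{A_1}: a=a_0+a_1,\ a_i\in A_i\}$. For $q\in[1,\infty]$, $\theta\in(0,1)$, $[A_0,A_1]_{\theta,q}$ is the set of $a\in A_0+A_1$ for which $\|a\|_{\theta,q}=\big(\int_0^\infty[t^{-\theta}K(t,a;A_0,A_1)]^q\frac{dt}{t}\big)^{1/q}$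 (or $\sup_{t>0}t^{-\theta}K(t,a;A_0,A_1)$ if $q=\infty$) is finite. Equalities of spaces mean equality with equivalent norms; in couples involving $BMO(m)$, functions are considered modulo constants (for $1\le q<\infty$, $L^q(m)$ contains no nonzero constant since $m(V)=\infty$). *)

theory Defs
  imports "HOL-Probability.Essential_Supremum" "HOL-Library.Function_Algebras"
begin

section \<open>Trees with root at infinity\<close>

text \<open>Graphs are simple and undirected, given by an adjacency relation; the vertex set is the
  whole type.\<close>

definition graph_dist :: "('v \<Rightarrow> 'v \<Rightarrow> bool) \<Rightarrow> 'v \<Rightarrow> 'v \<Rightarrow> nat" where
  "graph_dist adj x y = (LEAST n. (adj ^^ n) x y)"

definition graph_cycle :: "('v \<Rightarrow> 'v \<Rightarrow> bool) \<Rightarrow> 'v list \<Rightarrow> bool" where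
  "graph_cycle adj xs \<longleftrightarrow>
     length xs \<ge> 3 \<and> distinct xs \<and> successively adj xs \<and> adj (last xs) (hd xs)"

text \<open>The ray \<open>\<omega>\<close> is the half-infinite geodesic representing the root; its initial vertex
  \<open>\<omega> 0\<close> is the origin.\<close>

locale rooted_tree =
  fixes adj :: "'v \<Rightarrow> 'v \<Rightarrow> bool" and \<omega> :: "nat \<Rightarrow> 'v"
  assumes adj_sym: "adj x y \<Longrightarrow> adj y x"
    and adj_irrefl: "\<not> adj x x"
    and connected: "adj\<^sup>*\<^sup>* x y"
    and acyclic: "\<not> graph_cycle adj xs"
    and ray: "int (graph_dist adj (\<omega> i) (\<omega> j)) = \<bar>int i - int j\<bar>"
begin

definition ray_proj :: "'v \<Rightarrow> 'v" where
  "ray_proj x = arg_min_on (graph_dist adj x) (range \<omega>)"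

definition level :: "'v \<Rightarrow> int" where
  "level x = int (graph_dist adj (\<omega> 0) (ray_proj x)) - int (graph_dist adj (ray_proj x) x)"

definition below :: "'v \<Rightarrow> 'v \<Rightarrow> bool" where
  "below y x \<longleftrightarrow> level x - level y = int (graph_dist adj x y)"

definition sons :: "'v \<Rightarrow> 'v set" where
  "sons x = {y. adj x y \<and> level y = level x - 1}"

definition trapezoid :: "int \<Rightarrow> int \<Rightarrow> 'v \<Rightarrow> 'v set" where
  "trapezoid h' h'' x\<^sub>0 =
     {x. below x x\<^sub>0 \<and> level x\<^sub>0 - h'' < level x \<and> level x \<le> level x\<^sub>0 - h'}"

definition admissible :: "real \<Rightarrow> 'v set set" where
  "admissible \<beta> = {{x\<^sub>0} | x\<^sub>0. True} \<union>
     {trapezoid h' h'' x\<^sub>0 | h' h'' x\<^sub>0.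
        1 \<le> h' \<and> h' < h'' \<and> 2 \<le> real_of_int h'' / real_of_int h'
        \<and> real_of_int h'' / real_of_int h' \<le> \<beta>}"

end


section \<open>Lebesgue norms\<close>

text \<open>Normed spaces are encoded by extended norms: the norm is \<open>top\<close> exactly
  off the space.\<close>

definition space_of :: "('a \<Rightarrow> ennreal) \<Rightarrow> 'a set" where
  "space_of N = {a. N a < top}"

text \<open>Real powers on \<open>ennreal\<close>, used for exponents \<open>p > 0\<close> only.\<close>

definition enn_powr :: "ennreal \<Rightarrow> real \<Rightarrow> ennreal" where
  "enn_powr x p = (if x = top then top else ennreal (enn2real x powr p))"

text \<open>The norm below is applied only to measures for which every function is measurable.\<close>

definition Lp_norm :: "'a measure \<Rightarrow> ereal \<Rightarrow> ('a \<Rightarrow> complex) \<Rightarrow> ennreal" where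
  "Lp_norm M p f =
     (if p = \<infinity> then esssup M (\<lambda>x. ennreal (cmod (f x)))
      else enn_powr (\<integral>\<^sup>+x. ennreal (cmod (f x) powr real_of_ereal p) \<partial>M)
             (1 / real_of_ereal p))"


section \<open>Flow measures, \<open>BMO\<close> and the atomic Hardy space\<close>

locale flow_tree = rooted_tree adj \<omega> for adj :: "'v \<Rightarrow> 'v \<Rightarrow> bool" and \<omega> +
  fixes m :: "'v \<Rightarrow> real"
  assumes m_pos: "m x > 0"
    and flow: "(m has_sum m x) (sons x)"
begin

definition flow_measure :: "'v measure" where
  "flow_measure = point_measure UNIV (\<lambda>x. ennreal (m x))"

definition locally_doubling :: bool where
  "locally_doubling \<longleftrightarrow> (\<forall>r>0::real. \<exists>C>1::real. \<forall>x.
     emeasure flow_measure {y. real (graph_dist adj x y) \<le> 2 * r}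
       \<le> ennreal C * emeasure flow_measure {y. real (graph_dist adj x y) \<le> r})"

definition average :: "'v set \<Rightarrow> ('v \<Rightarrow> complex) \<Rightarrow> complex" where
  "average R f = (LINT x:R|flow_measure. f x) /\<^sub>R measure flow_measure R"

text \<open>A seminorm on functions, vanishing on constants.\<close>

definition BMO_norm :: "real \<Rightarrow> ('v \<Rightarrow> complex) \<Rightarrow> ennreal" where
  "BMO_norm \<beta> f = (SUP R \<in> admissible \<beta>.
     (\<integral>\<^sup>+x\<in>R. ennreal (cmod (f x - average R f)) \<partial>flow_measure)
       / emeasure flow_measure R)"

definition atom :: "real \<Rightarrow> ('v \<Rightarrow> complex) \<Rightarrow> bool" where
  "atom \<beta> a \<longleftrightarrow> (\<exists>R \<in> admissible \<beta>. (\<forall>x. x \<notin> R \<longrightarrow> a x = 0)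
     \<and> Lp_norm flow_measure \<infinity> a \<le> inverse (emeasure flow_measure R)
     \<and> (LINT x:R|flow_measure. a x) = 0)"

text \<open>The series \<open>\<Sum>j. c j * a j\<close> represents \<open>g\<close> in the sense of convergence
  in \<open>L\<^sup>1\<close>.\<close>

definition atomic_decomp ::
    "real \<Rightarrow> ('v \<Rightarrow> complex) \<Rightarrow> (nat \<Rightarrow> complex) \<Rightarrow> (nat \<Rightarrow> 'v \<Rightarrow> complex) \<Rightarrow> bool" where
  "atomic_decomp \<beta> g c a \<longleftrightarrow>
     Lp_norm flow_measure 1 g < top \<and> (\<forall>j. atom \<beta> (a j)) \<and> summable (\<lambda>j. cmod (c j))
     \<and> (\<lambda>n. Lp_norm flow_measure 1 (\<lambda>x. g x - (\<Sum>j<n. c j * a j x))) \<longlonglongrightarrow> 0"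

definition H1_norm :: "real \<Rightarrow> ('v \<Rightarrow> complex) \<Rightarrow> ennreal" where
  "H1_norm \<beta> g = Inf {ennreal (\<Sum>j. cmod (c j)) | c a. atomic_decomp \<beta> g c a}"

end


section \<open>Functions modulo constants\<close>

quotient_type 'v fun_mod_const = "'v \<Rightarrow> complex" / "\<lambda>f g. \<exists>c. \<forall>x. f x = g x + c"
proof (rule equivpI)
  show "reflp (\<lambda>(f :: 'v \<Rightarrow> complex) g. \<exists>c. \<forall>x. f x = g x + c)"
    by (auto intro!: reflpI exI[of _ 0])
  show "symp (\<lambda>(f :: 'v \<Rightarrow> complex) g. \<exists>c. \<forall>x. f x = g x + c)"
  proof (rule sympI)
    fix f g :: "'v \<Rightarrow> complex" assume "\<exists>c. \<forall>x. f x = g x + c"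
    then obtain c where "\<forall>x. f x = g x + c" by blast
    then have "\<forall>x. g x = f x + (- c)" by simp
    then show "\<exists>c. \<forall>x. g x = f x + c" by blast
  qed
  show "transp (\<lambda>(f :: 'v \<Rightarrow> complex) g. \<exists>c. \<forall>x. f x = g x + c)"
  proof (rule transpI)
    fix f g h :: "'v \<Rightarrow> complex"
    assume "\<exists>c. \<forall>x. f x = g x + c" "\<exists>c. \<forall>x. g x = h x + c"
    then obtain c d where "\<forall>x. f x = g x + c" "\<forall>x. g x = h x + d" by blast
    then have "\<forall>x. f x = h x + (d + c)" by (simp add: add.assoc)
    then show "\<exists>c. \<forall>x. f x = h x + c" by blast
  qed
qed

instantiation fun_mod_const :: (type) ab_group_add
begin

lift_definition zero_fun_mod_const :: "'a fun_mod_const" is "\<lambda>_. 0" .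

lift_definition plus_fun_mod_const ::
    "'a fun_mod_const \<Rightarrow> 'a fun_mod_const \<Rightarrow> 'a fun_mod_const"
  is "\<lambda>f g x. f x + g x"
proof -
  fix f f' g g' :: "'a \<Rightarrow> complex"
  assume "\<exists>c. \<forall>x. f x = f' x + c" "\<exists>c. \<forall>x. g x = g' x + c"
  then obtain c d where "\<forall>x. f x = f' x + c" "\<forall>x. g x = g' x + d" by blast
  then have "\<forall>x. f x + g x = f' x + g' x + (c + d)" by simp
  then show "\<exists>c. \<forall>x. f x + g x = f' x + g' x + c" by blast
qed

lift_definition uminus_fun_mod_const :: "'a fun_mod_const \<Rightarrow> 'a fun_mod_const"
  is "\<lambda>f x. - f x"
proof -
  fix f f' :: "'a \<Rightarrow> complex"
  assume "\<exists>c. \<forall>x. f x = f' x + c"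
  then obtain c where "\<forall>x. f x = f' x + c" by blast
  then have "\<forall>x. - f x = - f' x + (- c)" by simp
  then show "\<exists>c. \<forall>x. - f x = - f' x + c" by blast
qed

definition minus_fun_mod_const ::
    "'a fun_mod_const \<Rightarrow> 'a fun_mod_const \<Rightarrow> 'a fun_mod_const" where
  "minus_fun_mod_const F G = F + (- G)"

instance
proof
  fix F G H :: "'a fun_mod_const"
  show "F + G + H = F + (G + H)"
    by transfer (auto intro!: exI[of _ 0] simp: add.assoc)
  show "F + G = G + F"
    by transfer (auto intro!: exI[of _ 0] simp: add.commute)
  show "0 + F = F"
    by transfer (auto intro!: exI[of _ 0])
  show "- F + F = 0"
    by transfer (auto intro!: exI[of _ 0])
  show "F - G = F + - G"
    by (rule minus_fun_mod_const_def)
qed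

end

text \<open>The quotient norm. For \<open>BMO\<close> the infimum runs over equal values; for \<open>H\<^sup>1\<close>
  and \<open>L\<^sup>q\<close>, \<open>q < \<infinity>\<close>, at most one representative has finite norm,
  because the flow measure is infinite.\<close>

definition mod_const_norm :: "(('v \<Rightarrow> complex) \<Rightarrow> ennreal) \<Rightarrow> 'v fun_mod_const \<Rightarrow> ennreal" where
  "mod_const_norm N F = (INF f \<in> {f. abs_fun_mod_const f = F}. N f)"


section \<open>Real interpolation\<close>

definition K_functional ::
    "('a :: ab_group_add \<Rightarrow> ennreal) \<Rightarrow> ('a \<Rightarrow> ennreal) \<Rightarrow> real \<Rightarrow> 'a \<Rightarrow> ennreal" where
  "K_functional N\<^sub>0 N\<^sub>1 t a = Inf {N\<^sub>0 a\<^sub>0 + ennreal t * N\<^sub>1 a\<^sub>1 | a\<^sub>0 a\<^sub>1.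
     a = a\<^sub>0 + a\<^sub>1 \<and> a\<^sub>0 \<in> space_of N\<^sub>0 \<and> a\<^sub>1 \<in> space_of N\<^sub>1}"

definition interp_norm ::
    "('a :: ab_group_add \<Rightarrow> ennreal) \<Rightarrow> ('a \<Rightarrow> ennreal) \<Rightarrow> real \<Rightarrow> ereal \<Rightarrow> 'a \<Rightarrow> ennreal" where
  "interp_norm N\<^sub>0 N\<^sub>1 \<theta> q a =
     (if \<exists>a\<^sub>0 \<in> space_of N\<^sub>0. \<exists>a\<^sub>1 \<in> space_of N\<^sub>1. a = a\<^sub>0 + a\<^sub>1
      then if q = \<infinity>
        then SUP t \<in> {0<..}. ennreal (t powr - \<theta>) * K_functional N\<^sub>0 N\<^sub>1 t a
        else enn_powr
          (\<integral>\<^sup>+t\<in>{0<..}. enn_powr (ennreal (t powr - \<theta>) * K_functional N\<^sub>0 N\<^sub>1 t a)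
             (real_of_ereal q) * ennreal (1 / t) \<partial>lborel)
          (1 / real_of_ereal q)
      else top)"

definition same_space :: "('a \<Rightarrow> ennreal) \<Rightarrow> ('a \<Rightarrow> ennreal) \<Rightarrow> bool" where
  "same_space N N' \<longleftrightarrow> space_of N = space_of N' \<and>
     (\<exists>C>0::real. \<forall>a \<in> space_of N. N a \<le> ennreal C * N' a \<and> N' a \<le> ennreal C * N a)"

end

theory Submission
  imports Defs
begin

text \<open>
  Averaging over dyadic scales replaces the interpolation norms by sums of
  \<open>K\<close>-functionals at the points \<open>2 ^ n\<close>.

  The inclusions of \<open>L\<^sup>p\<close> rest on a Calderon-Zygmund decomposition. Every large trapezoid is
  a union of boundedly many disjoint smaller ones of comparable measure, down to singletons, so
  stopping-time arguments work in it; as \<open>m(V) = \<infinity>\<close>, truncating \<open>f\<close> at every height and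
  subtracting averages over stopping sets splits \<open>f\<close> into a bounded part and a part whose
  \<open>H\<^sup>1\<close>-norm is controlled by the tail of \<open>f\<close> above that height.

  The reverse inclusions for \<open>BMO\<close> follow by duality: a finitely supported \<open>g\<close> with mean zero
  is split at all scales between \<open>H\<^sup>1\<close> and the dual Lebesgue space, the resulting pieces are
  paired with decompositions of \<open>f\<close>, and the pairings are summed by Hoelder's inequality. On an
  exhaustion of \<open>V\<close> this bounds the \<open>L\<^sup>q\<close>-distance of \<open>f\<close> to the constants.
\<close>

section \<open>Powers of extended nonnegative reals\<close>

text \<open>The flow measure need not be doubling on large balls, so balls do not support the usual
  stopping times. Trapezoids do: by the flow identity each generation of descendants of
  \<open>x\<close> has mass \<open>m x\<close>, hence the mass of a trapezoid is its number of
  levels times the mass of its apex. Cutting by levels or passing to the sons changes masses by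
  bounded factors; local doubling enters only through \<open>m_par_bound\<close>.

  The oscillation of \<open>f\<close> on a stopping set is unbounded and has to be decomposed again.
  Over all generations the L1 mass of \<open>f\<close> does not control the total cost, but the
  integral of \<open>cmod f powr r\<close> with any \<open>r > 1\<close> does; therefore tails are
  measured with an exponent \<open>1 < r < p\<close>.

  For BMO no maximal or sharp function is estimated: the lower bound is dual to the upper bound for
  the couple of H1 and a Lebesgue space. The couple of H1 and BMO needs no reiteration, since it is
  squeezed between H1 with the bounded functions and L1 with BMO.\<close>

lemma enn_powr_ennreal: "0 \<le> x \<Longrightarrow> enn_powr (ennreal x) p = ennreal (x powr p)"
  by (simp add: enn_powr_def)

lemma enn_powr_top [simp]: "enn_powr top p = top"
  by (simp add: enn_powr_def)

lemma enn_powr_0 [simp]: "enn_powr 0 p = 0"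
  by (simp add: enn_powr_def)

lemma enn_powr_1 [simp]: "enn_powr x 1 = x"
  by (cases x) (auto simp: enn_powr_def)

lemma enn_powr_eq_top_iff [simp]: "enn_powr x p = top \<longleftrightarrow> x = top"
  by (simp add: enn_powr_def)

lemma enn_powr_less_top_iff [simp]: "enn_powr x p < top \<longleftrightarrow> x < top"
  by (simp add: less_top[symmetric])

lemma enn_powr_eq_0_iff [simp]: "enn_powr x p = 0 \<longleftrightarrow> x = 0"
  by (cases x) (auto simp: enn_powr_def ennreal_eq_0_iff)

lemma enn_powr_mono:
  assumes "x \<le> y" "0 \<le> p"
  shows "enn_powr x p \<le> enn_powr y p"
proof (cases "y = top")
  case False
  then have "x \<noteq> top" using assms(1) by (auto simp: top_unique)
  with False assms show ?thesis
    by (cases x; cases y) (auto simp: enn_powr_ennreal intro!: ennreal_leI powr_mono2)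
qed simp

lemma enn_powr_mult:
  assumes "0 < p"
  shows "enn_powr (x * y) p = enn_powr x p * enn_powr y p"
proof -
  consider "x = 0 \<or> y = 0" | "x = top \<or> y = top" "x \<noteq> 0" "y \<noteq> 0"
    | "x \<noteq> top" "y \<noteq> top" by blast
  then show ?thesis
  proof cases
    case 2
    then have "x * y = top" by (auto simp: ennreal_mult_eq_top_iff)
    moreover have "enn_powr x p * enn_powr y p = top"
      using 2 by (auto simp: ennreal_mult_eq_top_iff)
    ultimately show ?thesis by simp
  next
    case 3
    then show ?thesis
      by (cases x; cases y)
        (auto simp: enn_powr_ennreal ennreal_mult'[symmetric] powr_mult)
  qed auto
qed

lemma enn_powr_powr: "enn_powr (enn_powr x p) q = enn_powr x (p * q)"
  by (cases x) (auto simp: enn_powr_ennreal powr_powr)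

lemma enn_powr_powr_inverse [simp]:
  assumes "p \<noteq> 0"
  shows "enn_powr (enn_powr x p) (1 / p) = x" "enn_powr (enn_powr x (1 / p)) p = x"
  using assms by (simp_all add: enn_powr_powr)

lemma measurable_enn_powr [measurable]: "(\<lambda>x. enn_powr x p) \<in> borel_measurable borel"
  unfolding enn_powr_def by measurable

lemma enn_powr_cmult:
  assumes "0 \<le> c" "0 < p"
  shows "enn_powr (ennreal c * x) p = ennreal (c powr p) * enn_powr x p"
  using assms by (simp add: enn_powr_mult enn_powr_ennreal)

section \<open>Inequalities of Young and Hoelder for extended values\<close>

lemma ennreal_Youngs_inequality:
  assumes "1 < p" "1 < q" "1 / p + 1 / q = 1"
  shows "u * v \<le> ennreal (1 / p) * enn_powr u p + ennreal (1 / q) * enn_powr v q"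
proof -
  have pq: "0 < p" "0 < q" using assms by auto
  show ?thesis
  proof (cases "u = top \<or> v = top")
    case True
    then show ?thesis using pq by (auto simp: ennreal_mult_top)
  next
    case False
    then obtain a b where ab: "u = ennreal a" "v = ennreal b" "0 \<le> a" "0 \<le> b"
      by (metis ennreal_cases)
    have "a * b \<le> a powr p / p + b powr q / q"
      using Youngs_inequality[of p q a b] assms ab by simp
    then have "ennreal (a * b) \<le> ennreal (a powr p / p + b powr q / q)"
      by (rule ennreal_leI)
    then show ?thesis
      using ab pq by (simp add: enn_powr_ennreal ennreal_mult'[symmetric] ennreal_plus[symmetric]
          del: ennreal_plus)
  qed
qed

lemma nn_integral_Holder:
  assumes [measurable]: "u \<in> borel_measurable M" "v \<in> borel_measurable M"
    and pq: "1 < p" "1 < q" "1 / p + 1 / q = 1"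
  shows "(\<integral>\<^sup>+x. u x * v x \<partial>M) \<le>
    enn_powr (\<integral>\<^sup>+x. enn_powr (u x) p \<partial>M) (1 / p) * enn_powr (\<integral>\<^sup>+x. enn_powr (v x) q \<partial>M) (1 / q)"
    (is "?L \<le> enn_powr ?U _ * enn_powr ?V _")
proof -
  have pq0: "0 < p" "0 < q" using pq by auto
  consider "?U = 0 \<or> ?V = 0" | "?U \<noteq> 0" "?V \<noteq> 0" "?U = top \<or> ?V = top"
    | "?U \<noteq> 0" "?V \<noteq> 0" "?U \<noteq> top" "?V \<noteq> top" by blast
  then show ?thesis
  proof cases
    \<comment> \<open>Since \<open>0 * top = 0\<close> in \<open>ennreal\<close>, a vanishing factor
      has to be treated first, whatever the other one is: the integrand is then null.\<close>
    case 1
    have "AE x in M. u x * v x = 0"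
      using 1
    proof
      assume "?U = 0"
      then have "AE x in M. enn_powr (u x) p = 0" by (subst (asm) nn_integral_0_iff_AE) auto
      then show ?thesis by eventually_elim simp
    next
      assume "?V = 0"
      then have "AE x in M. enn_powr (v x) q = 0" by (subst (asm) nn_integral_0_iff_AE) auto
      then show ?thesis by eventually_elim simp
    qed
    then have "?L = 0" by (subst nn_integral_0_iff_AE) auto
    then show ?thesis by simp
  next
    case 2
    then have "enn_powr ?U (1/p) * enn_powr ?V (1/q) = top"
      by (auto simp: ennreal_mult_eq_top_iff)
    then show ?thesis by simp
  next
    case 3
    then obtain U V where UV: "?U = ennreal U" "?V = ennreal V" "0 < U" "0 < V"
      by (metis ennreal_cases ennreal_0 less_eq_real_def)
    \<comment> \<open>After division by the norms \<open>a\<close> and \<open>b\<close> both power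
      integrals are 1, so integrating Young's inequality gives the total weight
      \<open>1 / p + 1 / q = 1\<close>.\<close>
    define a where "a = U powr (1 / p)"
    define b where "b = V powr (1 / q)"
    have ab: "0 < a" "0 < b" using UV by (auto simp: a_def b_def)
    have ap: "(1 / a) powr p = 1 / U" "(1 / b) powr q = 1 / V"
      using UV pq0 by (simp_all add: a_def b_def powr_divide powr_powr)
    have "?L \<le> (\<integral>\<^sup>+x. ennreal (a * b) * (ennreal (1 / p * (1 / U)) * enn_powr (u x) p
        + ennreal (1 / q * (1 / V)) * enn_powr (v x) q) \<partial>M)"
    proof (rule nn_integral_mono)
      fix x
      have "(ennreal (1 / a) * u x) * (ennreal (1 / b) * v x)
        \<le> ennreal (1 / p) * enn_powr (ennreal (1 / a) * u x) p
          + ennreal (1 / q) * enn_powr (ennreal (1 / b) * v x) q"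
        by (rule ennreal_Youngs_inequality[OF pq])
      also have "\<dots> = ennreal (1 / p * (1 / U)) * enn_powr (u x) p
        + ennreal (1 / q * (1 / V)) * enn_powr (v x) q"
        using ab pq0 UV by (simp add: enn_powr_cmult ap mult.assoc[symmetric] ennreal_mult'[symmetric])
      finally have "ennreal (a * b) * ((ennreal (1 / a) * u x) * (ennreal (1 / b) * v x)) \<le>
        ennreal (a * b) * (ennreal (1 / p * (1 / U)) * enn_powr (u x) p
        + ennreal (1 / q * (1 / V)) * enn_powr (v x) q)"
        by (rule mult_left_mono) simp
      moreover have "ennreal (a * b) * ((ennreal (1 / a) * u x) * (ennreal (1 / b) * v x)) =
          (ennreal (a * b) * (ennreal (1 / a) * ennreal (1 / b))) * (u x * v x)"
        by (simp only: mult_ac)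
      moreover have "ennreal (a * b) * (ennreal (1 / a) * ennreal (1 / b)) = 1"
        using ab by (simp add: ennreal_mult'[symmetric])
      ultimately show "u x * v x \<le> ennreal (a * b) * (ennreal (1 / p * (1 / U)) * enn_powr (u x) p
        + ennreal (1 / q * (1 / V)) * enn_powr (v x) q)" by simp
    qed
    also have "\<dots> = ennreal (a * b) * (ennreal (1 / p * (1 / U)) * ennreal U
        + ennreal (1 / q * (1 / V)) * ennreal V)"
      by (subst nn_integral_cmult, simp, subst nn_integral_add, simp, simp,
          subst nn_integral_cmult, simp, subst nn_integral_cmult, simp) (simp add: UV)
    also have "\<dots> = ennreal (a * b)"
    proof -
      have "ennreal (1 / p * (1 / U)) * ennreal U + ennreal (1 / q * (1 / V)) * ennreal V
          = ennreal (1 / p + 1 / q)"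
        using UV pq0 by (simp add: ennreal_mult'[symmetric] ennreal_plus[symmetric] del: ennreal_plus)
      then show ?thesis using pq by simp
    qed
    also have "\<dots> = enn_powr ?U (1 / p) * enn_powr ?V (1 / q)"
      using UV ab by (simp add: enn_powr_ennreal a_def b_def ennreal_mult')
    finally show ?thesis .
  qed
qed

section \<open>Geometric sums over dyadic scales\<close>

text \<open>A geometric series truncated at \<open>T\<close> is comparable with its last term. This
  is the discrete form of integrating \<open>t powr (a - 1)\<close> over \<open>(0, T)\<close>; the
  summations over dyadic scales and heights reduce to it or to its mirror image.\<close>

lemma nn_integral_count_space_geometric:
  fixes a T :: real
  assumes a: "0 < a" and T: "0 \<le> T"
  shows "(\<integral>\<^sup>+n. ennreal (2 powr (a * real_of_int n)) * indicator {n. 2 powr real_of_int n \<le> T} n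
    \<partial>count_space (UNIV :: int set)) \<le> ennreal (T powr a / (1 - 2 powr - a))"
proof (cases "T = 0")
  case True
  then show ?thesis by (simp add: indicator_def powr_ge_zero not_le)
next
  case False
  then have T: "0 < T" using T by simp
  define N where "N = \<lfloor>log 2 T\<rfloor>"
  have le_iff: "2 powr real_of_int n \<le> T \<longleftrightarrow> n \<le> N" for n :: int
    using T by (simp add: N_def le_floor_iff le_log_iff)
  have r: "0 < 2 powr - a" "2 powr - a < 1"
    using a by (auto simp: powr_less_one)
  have "(\<integral>\<^sup>+n. ennreal (2 powr (a * real_of_int n)) * indicator {n. 2 powr real_of_int n \<le> T} n
      \<partial>count_space (UNIV :: int set))
    = (\<integral>\<^sup>+n. ennreal (2 powr (a * real_of_int n)) \<partial>count_space {..N})"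
    by (subst nn_integral_count_space_indicator)
      (auto intro!: nn_integral_cong simp: le_iff indicator_def)
  also have "\<dots> = (\<integral>\<^sup>+i. ennreal (2 powr (a * real_of_int (N - int i))) \<partial>count_space UNIV)"
  proof (rule nn_integral_bij_count_space[symmetric])
    show "bij_betw (\<lambda>i. N - int i) UNIV {..N}"
      by (rule bij_betwI[of _ _ _ "\<lambda>n. nat (N - n)"]) auto
  qed
  also have "\<dots> = (\<Sum>i. ennreal (2 powr (a * real_of_int (N - int i))))"
    by (rule nn_integral_count_space_nat)
  also have "\<dots> = (\<Sum>i. ennreal (2 powr (a * N) * (2 powr - a) ^ i))"
    by (intro suminf_cong arg_cong[where f = ennreal])
      (simp add: algebra_simps powr_diff powr_minus powr_realpow[symmetric] powr_powr
        powr_mult[symmetric] field_simps powr_add[symmetric])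
  also have "\<dots> = ennreal (\<Sum>i. 2 powr (a * N) * (2 powr - a) ^ i)"
    using r by (intro suminf_ennreal2) (auto intro!: summable_mult summable_geometric)
  also have "\<dots> = ennreal (2 powr (a * N) / (1 - 2 powr - a))"
    using r by (subst suminf_mult) (auto intro!: summable_geometric simp: suminf_geometric)
  also have "\<dots> \<le> ennreal (T powr a / (1 - 2 powr - a))"
  proof (intro ennreal_leI divide_right_mono)
    have "2 powr (a * N) = (2 powr N) powr a" by (simp add: powr_powr mult.commute)
    also have "\<dots> \<le> T powr a" using a le_iff[of N] by (intro powr_mono2) auto
    finally show "2 powr (a * N) \<le> T powr a" .
  qed (use r in auto)
  finally show ?thesis .
qed

lemma nn_integral_count_space_geometric':
  fixes a T :: real
  assumes a: "0 < a" and T: "0 < T"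
  shows "(\<integral>\<^sup>+n. ennreal (2 powr (- a * real_of_int n)) * indicator {n. T \<le> 2 powr real_of_int n} n
    \<partial>count_space (UNIV :: int set)) \<le> ennreal (T powr - a / (1 - 2 powr - a))"
proof -
  have "(\<integral>\<^sup>+n. ennreal (2 powr (- a * real_of_int n)) * indicator {n. T \<le> 2 powr real_of_int n} n
      \<partial>count_space (UNIV :: int set))
    = (\<integral>\<^sup>+n. ennreal (2 powr (- a * real_of_int (- n)))
        * indicator {n. T \<le> 2 powr real_of_int n} (- n) \<partial>count_space (UNIV :: int set))"
    by (rule nn_integral_bij_count_space[symmetric]) (rule bij_uminus)
  also have "\<dots> = (\<integral>\<^sup>+n. ennreal (2 powr (a * real_of_int n))
        * indicator {n. 2 powr real_of_int n \<le> 1 / T} n \<partial>count_space (UNIV :: int set))"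
    using T by (intro nn_integral_cong) (auto simp: indicator_def powr_minus field_simps)
  also have "\<dots> \<le> ennreal ((1 / T) powr a / (1 - 2 powr - a))"
    using a T by (intro nn_integral_count_space_geometric) auto
  also have "(1 / T) powr a = T powr - a"
    using T by (simp add: powr_divide powr_minus_divide)
  finally show ?thesis .
qed

section \<open>Real interpolation\<close>

text \<open>The \<open>q\<close>-th power of the discrete norm, over all integers \<open>n\<close>.
  \<open>K\<close> is an arbitrary function of the scale, so the sum can also be formed for
  multiples of a K-functional.\<close>

definition dyadic_sum :: "real \<Rightarrow> real \<Rightarrow> (real \<Rightarrow> ennreal) \<Rightarrow> ennreal" where
  "dyadic_sum \<theta> q K = (\<integral>\<^sup>+n. enn_powr (ennreal (2 powr (- \<theta> * real_of_int n)) * K (2 powr real_of_int n)) q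
     \<partial>count_space (UNIV :: int set))"

definition interp_integral :: "real \<Rightarrow> real \<Rightarrow> (real \<Rightarrow> ennreal) \<Rightarrow> ennreal" where
  "interp_integral \<theta> q K = (\<integral>\<^sup>+t\<in>{0<..}. enn_powr (ennreal (t powr - \<theta>) * K t) q * ennreal (1 / t) \<partial>lborel)"

text \<open>The blocks from \<open>2 ^ n\<close> to \<open>2 ^ (n + 1)\<close> partition the
  half-line, and the block of \<open>n\<close> has length \<open>2 ^ n\<close>.\<close>

lemma dyadic_step_integral:
  fixes c :: "int \<Rightarrow> ennreal"
  shows "(\<integral>\<^sup>+t\<in>{0<..}. c \<lfloor>log 2 t\<rfloor> \<partial>lborel)
    = (\<integral>\<^sup>+n. c n * ennreal (2 powr real_of_int n) \<partial>count_space UNIV)"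
proof -
  let ?I = "\<lambda>n::int. {2 powr real_of_int n ..< 2 powr (real_of_int n + 1)}"
  have "(\<integral>\<^sup>+t\<in>{0<..}. c \<lfloor>log 2 t\<rfloor> \<partial>lborel)
    = (\<integral>\<^sup>+t. (\<integral>\<^sup>+n. c n * indicator (?I n) t \<partial>count_space UNIV) \<partial>lborel)"
  proof (rule nn_integral_cong)
    fix t :: real
    show "c \<lfloor>log 2 t\<rfloor> * indicator {0<..} t = (\<integral>\<^sup>+n. c n * indicator (?I n) t \<partial>count_space UNIV)"
    proof (cases "0 < t")
      case True
      have "t \<in> ?I n \<longleftrightarrow> n = \<lfloor>log 2 t\<rfloor>" for n :: int
        using True by (auto simp: floor_eq_iff le_log_iff log_less_iff eq_commute[of n])
      then have "(\<integral>\<^sup>+n. c n * indicator (?I n) t \<partial>count_space UNIV)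
        = (\<integral>\<^sup>+n. c n * indicator {\<lfloor>log 2 t\<rfloor>} n \<partial>count_space UNIV)"
        by (intro nn_integral_cong) (auto simp: indicator_def)
      also have "\<dots> = c \<lfloor>log 2 t\<rfloor>" by (subst nn_integral_indicator_singleton) auto
      finally show ?thesis using True by simp
    next
      case False
      then have "indicator (?I n) t = (0 :: ennreal)" for n :: int
        by (auto simp: indicator_def) (smt (verit) powr_ge_zero powr_gt_zero)
      then show ?thesis using False by simp
    qed
  qed
  also have "\<dots> = (\<integral>\<^sup>+n. (\<integral>\<^sup>+t. c n * indicator (?I n) t \<partial>lborel) \<partial>count_space UNIV)"
    by (rule nn_integral_count_space_nn_integral) auto
  also have "\<dots> = (\<integral>\<^sup>+n. c n * ennreal (2 powr real_of_int n) \<partial>count_space UNIV)"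
    by (intro nn_integral_cong, subst nn_integral_cmult_indicator) (auto simp: powr_add)
  finally show ?thesis .
qed

lemma powr_floor_log:
  fixes t :: real
  assumes "0 < t"
  shows "2 powr real_of_int \<lfloor>log 2 t\<rfloor> \<le> t" "t < 2 * 2 powr real_of_int \<lfloor>log 2 t\<rfloor>"
proof -
  have t: "t = 2 powr (log 2 t)" using assms by simp
  have "2 powr real_of_int \<lfloor>log 2 t\<rfloor> \<le> 2 powr (log 2 t)" by (rule powr_mono) auto
  then show "2 powr real_of_int \<lfloor>log 2 t\<rfloor> \<le> t" using assms by simp
  have "2 powr (log 2 t) < 2 powr (real_of_int \<lfloor>log 2 t\<rfloor> + 1)" by (rule powr_less_mono) auto
  then show "t < 2 * 2 powr real_of_int \<lfloor>log 2 t\<rfloor>" using assms by (simp add: powr_add)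
qed

text \<open>A K-functional is nondecreasing in the scale while \<open>K t / t\<close> is
  nonincreasing. These two facts make it constant up to a factor 2 on each dyadic block, whence
  integral and sum are comparable.\<close>

locale K_like =
  fixes K :: "real \<Rightarrow> ennreal"
  assumes mono: "0 < s \<Longrightarrow> s \<le> t \<Longrightarrow> K s \<le> K t"
    and scale: "0 < s \<Longrightarrow> s \<le> t \<Longrightarrow> K t \<le> ennreal (t / s) * K s"
begin

lemma interp_integral_le_dyadic_sum:
  assumes "0 < \<theta>" "1 \<le> q"
  shows "interp_integral \<theta> q K \<le> ennreal (2 powr q) * dyadic_sum \<theta> q K"
proof -
  let ?c = "\<lambda>n::int. ennreal (2 powr q)
      * (enn_powr (ennreal (2 powr (- \<theta> * real_of_int n)) * K (2 powr real_of_int n)) q)"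
  \<comment> \<open>The factor \<open>2 powr - n\<close> dominates \<open>1 / t\<close> on the block
    and cancels its length afterwards; \<open>2 powr q\<close> comes from
    \<open>K t \<le> 2 * K s\<close>.\<close>
  have "interp_integral \<theta> q K
    \<le> (\<integral>\<^sup>+t\<in>{0<..}. ?c \<lfloor>log 2 t\<rfloor> * ennreal (2 powr - real_of_int \<lfloor>log 2 t\<rfloor>) \<partial>lborel)"
    unfolding interp_integral_def
  proof (rule nn_integral_mono)
    fix t :: real
    show "enn_powr (ennreal (t powr - \<theta>) * K t) q * ennreal (1 / t) * indicator {0<..} t
      \<le> ?c \<lfloor>log 2 t\<rfloor> * ennreal (2 powr - real_of_int \<lfloor>log 2 t\<rfloor>) * indicator {0<..} t"
    proof (cases "0 < t")
      case True
      define n where "n = \<lfloor>log 2 t\<rfloor>"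
      define s where "s = 2 powr real_of_int n"
      have s: "0 < s" "s \<le> t" "t \<le> 2 * s"
        using powr_floor_log[OF True] unfolding s_def n_def by auto
      have "K t \<le> ennreal (t / s) * K s" using s by (intro scale) auto
      also have "\<dots> \<le> ennreal 2 * K s"
        using s by (intro mult_right_mono ennreal_leI) (auto simp: field_simps)
      finally have K: "K t \<le> ennreal 2 * K s" .
      have "ennreal (t powr - \<theta>) * K t \<le> ennreal (s powr - \<theta>) * (ennreal 2 * K s)"
        using s assms K by (intro mult_mono ennreal_leI powr_mono2') auto
      also have "\<dots> = ennreal 2 * (ennreal (s powr - \<theta>) * K s)" by (simp only: mult_ac)
      finally have "enn_powr (ennreal (t powr - \<theta>) * K t) q
        \<le> enn_powr (ennreal 2 * (ennreal (s powr - \<theta>) * K s)) q"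
        using assms by (intro enn_powr_mono) auto
      also have "\<dots> = ?c n" using assms
        by (subst enn_powr_cmult) (auto simp: s_def powr_powr mult.commute)
      finally have "enn_powr (ennreal (t powr - \<theta>) * K t) q \<le> ?c n" .
      moreover have "ennreal (1 / t) \<le> ennreal (2 powr - real_of_int n)"
        using s by (intro ennreal_leI) (simp add: s_def powr_minus_divide frac_le)
      ultimately show ?thesis using True by (simp add: n_def mult_mono)
    qed simp
  qed
  also have "\<dots> = (\<integral>\<^sup>+n. ?c n * ennreal (2 powr - real_of_int n) * ennreal (2 powr real_of_int n) \<partial>count_space UNIV)"
    by (rule dyadic_step_integral)
  also have "\<dots> = (\<integral>\<^sup>+n. ?c n \<partial>count_space UNIV)"
    by (simp add: mult.assoc ennreal_mult'[symmetric] powr_add[symmetric])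
  also have "\<dots> = ennreal (2 powr q) * dyadic_sum \<theta> q K"
    unfolding dyadic_sum_def by (rule nn_integral_cmult) simp
  finally show ?thesis .
qed

lemma dyadic_sum_le_interp_integral:
  assumes "0 < \<theta>" "1 \<le> q"
  shows "dyadic_sum \<theta> q K \<le> ennreal (2 powr (\<theta> * q + 1)) * interp_integral \<theta> q K"
proof -
  \<comment> \<open>Two losses are divided out in advance: \<open>2 powr (\<theta> * q)\<close> from
    moving the weight from \<open>s\<close> to \<open>t\<close>, and 2 from replacing
    \<open>1 / s\<close> by \<open>1 / t\<close>.\<close>
  let ?r = "ennreal (2 powr - (\<theta> * q + 1))"
  let ?c = "\<lambda>n::int. ?r * enn_powr (ennreal (2 powr (- \<theta> * real_of_int n)) * K (2 powr real_of_int n)) q"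
  have "?r * dyadic_sum \<theta> q K = (\<integral>\<^sup>+n. ?c n \<partial>count_space UNIV)"
    unfolding dyadic_sum_def by (rule nn_integral_cmult[symmetric]) simp
  also have "\<dots> = (\<integral>\<^sup>+n. (?c n * ennreal (2 powr - real_of_int n)) * ennreal (2 powr real_of_int n) \<partial>count_space UNIV)"
    by (simp add: mult.assoc ennreal_mult'[symmetric] powr_add[symmetric])
  also have "\<dots> = (\<integral>\<^sup>+t\<in>{0<..}. ?c \<lfloor>log 2 t\<rfloor> * ennreal (2 powr - real_of_int \<lfloor>log 2 t\<rfloor>) \<partial>lborel)"
    by (rule dyadic_step_integral[symmetric])
  also have "\<dots> \<le> interp_integral \<theta> q K"
    unfolding interp_integral_def
  proof (rule nn_integral_mono)
    fix t :: real
    show "?c \<lfloor>log 2 t\<rfloor> * ennreal (2 powr - real_of_int \<lfloor>log 2 t\<rfloor>) * indicator {0<..} t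
      \<le> enn_powr (ennreal (t powr - \<theta>) * K t) q * ennreal (1 / t) * indicator {0<..} t"
    proof (cases "0 < t")
      case True
      define n where "n = \<lfloor>log 2 t\<rfloor>"
      define s where "s = 2 powr real_of_int n"
      have s: "0 < s" "s \<le> t" "t \<le> 2 * s"
        using powr_floor_log[OF True] unfolding s_def n_def by auto
      have "ennreal (s powr - \<theta>) * K s \<le> ennreal (2 powr \<theta> * t powr - \<theta>) * K t"
      proof (intro mult_mono ennreal_leI mono)
        have "s powr - \<theta> = 2 powr \<theta> * (2 * s) powr - \<theta>"
          using s by (simp add: powr_mult powr_minus field_simps)
        also have "\<dots> \<le> 2 powr \<theta> * t powr - \<theta>"
          using s assms True by (intro mult_left_mono powr_mono2') auto
        finally show "s powr - \<theta> \<le> 2 powr \<theta> * t powr - \<theta>" .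
      qed (use s in auto)
      also have "\<dots> = ennreal (2 powr \<theta>) * (ennreal (t powr - \<theta>) * K t)"
        by (simp add: ennreal_mult' mult.assoc)
      finally have "enn_powr (ennreal (s powr - \<theta>) * K s) q
        \<le> enn_powr (ennreal (2 powr \<theta>) * (ennreal (t powr - \<theta>) * K t)) q"
        using assms by (intro enn_powr_mono) auto
      also have "\<dots> = ennreal (2 powr (\<theta> * q)) * enn_powr (ennreal (t powr - \<theta>) * K t) q" using assms
        by (subst enn_powr_cmult) (auto simp: powr_powr)
      finally have 1: "enn_powr (ennreal (s powr - \<theta>) * K s) q
        \<le> ennreal (2 powr (\<theta> * q)) * enn_powr (ennreal (t powr - \<theta>) * K t) q" .
      have 2: "ennreal (2 powr - real_of_int n) \<le> ennreal (2 * (1 / t))"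
        using s True by (intro ennreal_leI) (simp add: s_def powr_minus_divide field_simps)
      have "?r * enn_powr (ennreal (s powr - \<theta>) * K s) q * ennreal (2 powr - real_of_int n) \<le>
        ?r * (ennreal (2 powr (\<theta> * q)) * enn_powr (ennreal (t powr - \<theta>) * K t) q) * ennreal (2 * (1 / t))"
        using 1 2 by (intro mult_mono) auto
      also have "ennreal (2 * (1/t)) = ennreal 2 * ennreal (1 / t)"
        by (rule ennreal_mult') simp
      also have "?r * (ennreal (2 powr (\<theta> * q)) * enn_powr (ennreal (t powr - \<theta>) * K t) q)
          * (ennreal 2 * ennreal (1 / t))
         = (?r * (ennreal (2 powr (\<theta> * q)) * ennreal 2)) * (enn_powr (ennreal (t powr - \<theta>) * K t) q * ennreal (1 / t))"
        by (simp only: mult_ac)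
      also have "ennreal (2 powr (\<theta> * q)) * ennreal 2 = ennreal (2 powr (\<theta> * q + 1))"
        by (simp add: powr_add ennreal_mult')
      also have "?r * \<dots> = 1"
        by (simp add: ennreal_mult'[symmetric] powr_add[symmetric])
      finally show ?thesis using True by (simp add: n_def s_def powr_powr mult.commute)
    qed simp
  qed
  finally have "ennreal (2 powr (\<theta> * q + 1)) * (?r * dyadic_sum \<theta> q K)
    \<le> ennreal (2 powr (\<theta> * q + 1)) * interp_integral \<theta> q K"
    by (rule mult_left_mono) simp
  moreover have "ennreal (2 powr (\<theta> * q + 1)) * ?r = 1"
    by (simp add: ennreal_mult'[symmetric] powr_add[symmetric])
  ultimately show ?thesis by (simp add: mult.assoc[symmetric])
qed

end

text \<open>The infimum runs over decompositions with finite norms only; for any other decomposition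
  the right-hand side is \<open>top\<close> because \<open>t > 0\<close>, so no finiteness has to be
  checked in applications.\<close>

lemma K_functional_le:
  assumes "a = a\<^sub>0 + a\<^sub>1" "0 < t"
  shows "K_functional N\<^sub>0 N\<^sub>1 t a \<le> N\<^sub>0 a\<^sub>0 + ennreal t * N\<^sub>1 a\<^sub>1"
proof (cases "N\<^sub>0 a\<^sub>0 < top \<and> N\<^sub>1 a\<^sub>1 < top")
  case True
  then show ?thesis
    unfolding K_functional_def space_of_def using assms by (intro Inf_lower) blast
next
  case False
  then have "N\<^sub>0 a\<^sub>0 + ennreal t * N\<^sub>1 a\<^sub>1 = top"
    using assms(2) by (auto simp: less_top[symmetric] ennreal_mult_eq_top_iff)
  then show ?thesis by (metis top_greatest)
qed

lemma K_functional_lessE: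
  assumes "K_functional N\<^sub>0 N\<^sub>1 t a < x"
  obtains a\<^sub>0 a\<^sub>1 where "a = a\<^sub>0 + a\<^sub>1" "N\<^sub>0 a\<^sub>0 + ennreal t * N\<^sub>1 a\<^sub>1 < x" "N\<^sub>0 a\<^sub>0 < top"
      "N\<^sub>1 a\<^sub>1 < top"
  using assms unfolding K_functional_def space_of_def Inf_less_iff by blast

lemma K_functional_greatest:
  assumes "\<And>a\<^sub>0 a\<^sub>1. a = a\<^sub>0 + a\<^sub>1 \<Longrightarrow> N\<^sub>0 a\<^sub>0 < top \<Longrightarrow> N\<^sub>1 a\<^sub>1 < top \<Longrightarrow> x \<le> N\<^sub>0 a\<^sub>0 + ennreal t * N\<^sub>1 a\<^sub>1"
  shows "x \<le> K_functional N\<^sub>0 N\<^sub>1 t a"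
  unfolding K_functional_def space_of_def using assms by (intro Inf_greatest) blast

lemma ennreal_le_div_mult:
  assumes "0 < c" "ennreal (1 / c) * x \<le> y"
  shows "x \<le> ennreal c * y"
proof -
  have "x = ennreal c * (ennreal (1 / c) * x)"
    using assms(1) by (simp add: mult.assoc[symmetric] ennreal_mult'[symmetric])
  also have "\<dots> \<le> ennreal c * y" using assms(2) by (rule mult_left_mono) simp
  finally show ?thesis .
qed

lemma K_like_K_functional: "K_like (\<lambda>t. K_functional N\<^sub>0 N\<^sub>1 t a)"
proof
  fix s t :: real assume st: "0 < s" "s \<le> t"
  show "K_functional N\<^sub>0 N\<^sub>1 s a \<le> K_functional N\<^sub>0 N\<^sub>1 t a"
  proof (rule K_functional_greatest)
    fix a\<^sub>0 a\<^sub>1 assume "a = a\<^sub>0 + a\<^sub>1"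
    then have "K_functional N\<^sub>0 N\<^sub>1 s a \<le> N\<^sub>0 a\<^sub>0 + ennreal s * N\<^sub>1 a\<^sub>1"
      using st by (intro K_functional_le)
    also have "\<dots> \<le> N\<^sub>0 a\<^sub>0 + ennreal t * N\<^sub>1 a\<^sub>1"
      using st by (intro add_left_mono mult_right_mono ennreal_leI) auto
    finally show "K_functional N\<^sub>0 N\<^sub>1 s a \<le> N\<^sub>0 a\<^sub>0 + ennreal t * N\<^sub>1 a\<^sub>1" .
  qed
  show "K_functional N\<^sub>0 N\<^sub>1 t a \<le> ennreal (t / s) * K_functional N\<^sub>0 N\<^sub>1 s a"
  proof (rule ennreal_le_div_mult)
    show "ennreal (1 / (t / s)) * K_functional N\<^sub>0 N\<^sub>1 t a \<le> K_functional N\<^sub>0 N\<^sub>1 s a"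
    proof (rule K_functional_greatest)
      fix a\<^sub>0 a\<^sub>1 assume "a = a\<^sub>0 + a\<^sub>1"
      then have "K_functional N\<^sub>0 N\<^sub>1 t a \<le> N\<^sub>0 a\<^sub>0 + ennreal t * N\<^sub>1 a\<^sub>1"
        using st by (intro K_functional_le) auto
      then have "ennreal (1 / (t / s)) * K_functional N\<^sub>0 N\<^sub>1 t a
        \<le> ennreal (1 / (t / s)) * (N\<^sub>0 a\<^sub>0 + ennreal t * N\<^sub>1 a\<^sub>1)"
        by (rule mult_left_mono) simp
      also have "\<dots> = ennreal (s / t) * N\<^sub>0 a\<^sub>0 + ennreal s * N\<^sub>1 a\<^sub>1"
        using st by (simp add: distrib_left mult.assoc[symmetric] ennreal_mult'[symmetric])
      also have "\<dots> \<le> 1 * N\<^sub>0 a\<^sub>0 + ennreal s * N\<^sub>1 a\<^sub>1"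
      proof (intro add_right_mono mult_right_mono)
        have "ennreal (s / t) \<le> ennreal 1" using st by (intro ennreal_leI) auto
        then show "ennreal (s / t) \<le> 1" by simp
      qed simp
      finally show "ennreal (1 / (t / s)) * K_functional N\<^sub>0 N\<^sub>1 t a \<le> N\<^sub>0 a\<^sub>0 + ennreal s * N\<^sub>1 a\<^sub>1"
        by simp
    qed
  qed (use st in auto)
qed

lemma dyadic_sum_ge_term:
  "enn_powr (ennreal (2 powr (- \<theta> * real_of_int n)) * K (2 powr real_of_int n)) q \<le> dyadic_sum \<theta> q K"
  unfolding dyadic_sum_def by (rule nn_integral_ge_point) simp

text \<open>Off the sum space the K-functional is an infimum over the empty set, hence
  \<open>top\<close>, and a single \<open>top\<close> term makes the dyadic sum and with it the
  integral infinite. The case distinction in \<open>interp_norm\<close> is thus automatic for finite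
  \<open>q\<close>.\<close>

lemma interp_norm_eq:
  assumes "0 < \<theta>" "1 \<le> q"
  shows "interp_norm N\<^sub>0 N\<^sub>1 \<theta> (ereal q) a
    = enn_powr (interp_integral \<theta> q (\<lambda>t. K_functional N\<^sub>0 N\<^sub>1 t a)) (1 / q)"
proof (cases "\<exists>a\<^sub>0 \<in> space_of N\<^sub>0. \<exists>a\<^sub>1 \<in> space_of N\<^sub>1. a = a\<^sub>0 + a\<^sub>1")
  case True
  then show ?thesis by (simp add: interp_norm_def interp_integral_def)
next
  case False
  interpret K_like "\<lambda>t. K_functional N\<^sub>0 N\<^sub>1 t a" by (rule K_like_K_functional)
  from False have K: "K_functional N\<^sub>0 N\<^sub>1 t a = top" for t
    by (intro top_le K_functional_greatest) (auto simp: space_of_def)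
  have "dyadic_sum \<theta> q (\<lambda>t. K_functional N\<^sub>0 N\<^sub>1 t a) = top"
    using dyadic_sum_ge_term[of \<theta> 0 "\<lambda>t. K_functional N\<^sub>0 N\<^sub>1 t a" q] by (simp add: K top_unique)
  then have "interp_integral \<theta> q (\<lambda>t. K_functional N\<^sub>0 N\<^sub>1 t a) = top"
    using dyadic_sum_le_interp_integral[OF assms] by (auto simp: top_unique ennreal_mult_eq_top_iff)
  then show ?thesis using False by (simp add: interp_norm_def)
qed

definition dyadic_norm :: "real \<Rightarrow> real \<Rightarrow> (real \<Rightarrow> ennreal) \<Rightarrow> ennreal" where
  "dyadic_norm \<theta> q K = enn_powr (dyadic_sum \<theta> q K) (1 / q)"

lemma interp_norm_le_dyadic_norm:
  assumes "0 < \<theta>" "1 \<le> q"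
  shows "interp_norm N\<^sub>0 N\<^sub>1 \<theta> (ereal q) a \<le> ennreal 2 * dyadic_norm \<theta> q (\<lambda>t. K_functional N\<^sub>0 N\<^sub>1 t a)"
proof -
  interpret K_like "\<lambda>t. K_functional N\<^sub>0 N\<^sub>1 t a" by (rule K_like_K_functional)
  have "interp_norm N\<^sub>0 N\<^sub>1 \<theta> (ereal q) a
    \<le> enn_powr (ennreal (2 powr q) * dyadic_sum \<theta> q (\<lambda>t. K_functional N\<^sub>0 N\<^sub>1 t a)) (1 / q)"
    unfolding interp_norm_eq[OF assms]
    using assms by (intro enn_powr_mono interp_integral_le_dyadic_sum) auto
  also have "\<dots> = ennreal 2 * dyadic_norm \<theta> q (\<lambda>t. K_functional N\<^sub>0 N\<^sub>1 t a)"
    using assms by (subst enn_powr_cmult) (auto simp: powr_powr dyadic_norm_def)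
  finally show ?thesis .
qed

lemma dyadic_norm_le_interp_norm:
  assumes "0 < \<theta>" "\<theta> < 1" "1 \<le> q"
  shows "dyadic_norm \<theta> q (\<lambda>t. K_functional N\<^sub>0 N\<^sub>1 t a) \<le> ennreal 4 * interp_norm N\<^sub>0 N\<^sub>1 \<theta> (ereal q) a"
proof -
  interpret K_like "\<lambda>t. K_functional N\<^sub>0 N\<^sub>1 t a" by (rule K_like_K_functional)
  have "dyadic_norm \<theta> q (\<lambda>t. K_functional N\<^sub>0 N\<^sub>1 t a)
    \<le> enn_powr (ennreal (2 powr (\<theta> * q + 1)) * interp_integral \<theta> q (\<lambda>t. K_functional N\<^sub>0 N\<^sub>1 t a)) (1 / q)"
    unfolding dyadic_norm_def
    using assms by (intro enn_powr_mono dyadic_sum_le_interp_integral) auto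
  also have "\<dots> = ennreal ((2 powr (\<theta> * q + 1)) powr (1 / q)) * interp_norm N\<^sub>0 N\<^sub>1 \<theta> (ereal q) a"
    using assms by (subst enn_powr_cmult) (auto simp: interp_norm_eq)
  also have "\<dots> \<le> ennreal 4 * interp_norm N\<^sub>0 N\<^sub>1 \<theta> (ereal q) a"
  proof (intro mult_right_mono ennreal_leI)
    \<comment> \<open>The constant is \<open>2 powr (\<theta> + 1 / q)\<close>, and both summands
      are at most 1.\<close>
    have "(\<theta> * q + 1) / q \<le> 2"
    proof -
      have "\<theta> * q + 1 \<le> 2 * q" using assms mult_right_mono[of \<theta> 1 q] by linarith
      then show ?thesis using assms by (simp add: pos_divide_le_eq)
    qed
    then have "2 powr ((\<theta> * q + 1) / q) \<le> 2 powr (2::real)" by (intro powr_mono) auto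
    then show "(2 powr (\<theta> * q + 1)) powr (1 / q) \<le> 4" by (simp add: powr_powr)
  qed simp
  finally show ?thesis .
qed

lemma dyadic_norm_mono:
  assumes "0 < q" "0 \<le> c" "\<And>t. 0 < t \<Longrightarrow> K t \<le> ennreal c * K' t"
  shows "dyadic_norm \<theta> q K \<le> ennreal c * dyadic_norm \<theta> q K'"
proof -
  have "dyadic_sum \<theta> q K \<le> (\<integral>\<^sup>+n. ennreal (c powr q) * enn_powr (ennreal (2 powr (- \<theta> * real_of_int n)) * K' (2 powr real_of_int n)) q
     \<partial>count_space (UNIV :: int set))"
    unfolding dyadic_sum_def
  proof (rule nn_integral_mono)
    fix n :: int
    have "ennreal (2 powr (- \<theta> * real_of_int n)) * K (2 powr real_of_int n)
      \<le> ennreal (2 powr (- \<theta> * real_of_int n)) * (ennreal c * K' (2 powr real_of_int n))"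
      by (intro mult_left_mono assms) auto
    also have "\<dots> = ennreal c * (ennreal (2 powr (- \<theta> * real_of_int n)) * K' (2 powr real_of_int n))"
      by (simp only: mult_ac)
    finally have "enn_powr (ennreal (2 powr (- \<theta> * real_of_int n)) * K (2 powr real_of_int n)) q
      \<le> enn_powr \<dots> q" using assms by (intro enn_powr_mono) auto
    then show "enn_powr (ennreal (2 powr (- \<theta> * real_of_int n)) * K (2 powr real_of_int n)) q
      \<le> ennreal (c powr q) * enn_powr (ennreal (2 powr (- \<theta> * real_of_int n)) * K' (2 powr real_of_int n)) q"
      using assms by (simp add: enn_powr_cmult)
  qed
  also have "\<dots> = ennreal (c powr q) * dyadic_sum \<theta> q K'"
    unfolding dyadic_sum_def by (rule nn_integral_cmult) simp
  finally have "dyadic_norm \<theta> q K \<le> enn_powr (ennreal (c powr q) * dyadic_sum \<theta> q K') (1 / q)"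
    unfolding dyadic_norm_def using assms by (intro enn_powr_mono) auto
  then show ?thesis
    using assms by (simp add: enn_powr_cmult powr_powr dyadic_norm_def)
qed

section \<open>Dyadic sums from levelwise bounds, and dual pairings\<close>

lemma int_last_true:
  fixes P :: "int \<Rightarrow> bool"
  assumes "P i" "\<And>j. k \<le> j \<Longrightarrow> \<not> P j"
  obtains j where "P j" "\<not> P (j + 1)"
proof -
  define d where "d = (LEAST n. \<not> P (i + int n))"
  have ex: "\<not> P (i + int (nat (k - i)))" using assms(2)[of "i + int (nat (k - i))"] by linarith
  have d: "\<not> P (i + int d)" unfolding d_def using ex by (rule LeastI)
  then have "d \<noteq> 0" using assms(1) by (metis add.right_neutral of_nat_0)
  then have "P (i + int (d - 1))"
    using not_less_Least[of "d - 1" "\<lambda>n. \<not> P (i + int n)"] unfolding d_def by auto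
  moreover have "i + int (d - 1) + 1 = i + int d" using \<open>d \<noteq> 0\<close> by linarith
  ultimately show ?thesis using d that by metis
qed

text \<open>At scale \<open>t\<close> the relevant level is the last \<open>j\<close> with \<open>t * B j < A j\<close>; it is not required
  that \<open>A\<close> and \<open>B\<close> be monotone.\<close>

lemma dyadic_sum_le_levels:
  fixes A B :: "int \<Rightarrow> real"
  assumes \<theta>: "0 < \<theta>" "\<theta> < 1" and p: "1 \<le> p" and \<kappa>: "0 \<le> \<kappa>"
    and K: "\<And>j n. K (2 powr real_of_int n) \<le> ennreal (A j + 2 powr real_of_int n * B j)"
    and nonneg: "\<And>j. 0 \<le> A j" "\<And>j. 0 \<le> B j" and Bstep: "\<And>j. B (j + 1) \<le> \<kappa> * B j"
    and Atail: "\<And>t. 0 < t \<Longrightarrow> \<exists>k. \<forall>j\<ge>k. A j \<le> t * B j"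
    and Bzero: "\<And>e. 0 < e \<Longrightarrow> \<exists>j. B j \<le> e"
  shows "dyadic_sum \<theta> p K \<le> ennreal ((2 * \<kappa>) powr p / (1 - 2 powr - ((1 - \<theta>) * p))) *
    (\<integral>\<^sup>+j. ennreal (A j powr ((1 - \<theta>) * p) * B j powr (\<theta> * p)) \<partial>count_space UNIV)"
proof -
  define \<alpha> where "\<alpha> = (1 - \<theta>) * p"
  have \<alpha>: "0 < \<alpha>" using \<theta> p by (simp add: \<alpha>_def)
  have r: "0 < 1 - 2 powr - \<alpha>" using \<alpha> by (simp add: powr_less_one)
  \<comment> \<open>Level \<open>j\<close> is charged at scale \<open>n\<close> only if
    \<open>2 ^ n * B j < A j\<close>. After exchanging the sums, the scales at fixed
    \<open>j\<close> form a geometric series ending at \<open>A j / B j\<close>.\<close>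
  let ?F = "\<lambda>j n. ennreal ((2 * \<kappa> * B j) powr p * 2 powr (\<alpha> * real_of_int n))
    * indicator {n. 2 powr real_of_int n * B j < A j} n"
  have "dyadic_sum \<theta> p K \<le> (\<integral>\<^sup>+n. (\<integral>\<^sup>+j. ?F j n \<partial>count_space UNIV) \<partial>count_space UNIV)"
    unfolding dyadic_sum_def
  proof (rule nn_integral_mono)
    fix n :: int
    define t where "t = 2 powr real_of_int n"
    have t: "0 < t" by (simp add: t_def)
    obtain k where k: "\<And>j. k \<le> j \<Longrightarrow> A j \<le> t * B j" using Atail[OF t] by blast
    show "enn_powr (ennreal (2 powr (- \<theta> * real_of_int n)) * K (2 powr real_of_int n)) p
      \<le> (\<integral>\<^sup>+j. ?F j n \<partial>count_space UNIV)"
    proof (cases "\<exists>j. t * B j < A j")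
      case True
      \<comment> \<open>The estimate is used at \<open>j + 1\<close>, where the first term no longer
        dominates; \<open>Bstep\<close> carries it back to \<open>j\<close>, the level that is
        charged.\<close>
      then obtain j where j: "t * B j < A j" "\<not> t * B (j + 1) < A (j + 1)"
        using int_last_true[of "\<lambda>j. t * B j < A j"] k by (metis not_less)
      have "K t \<le> ennreal (A (j + 1) + t * B (j + 1))" using K[of n "j + 1"] by (simp add: t_def)
      also have "\<dots> \<le> ennreal (2 * t * (\<kappa> * B j))"
        using j(2) mult_left_mono[OF Bstep[of j], of t] t by (intro ennreal_leI) linarith
      finally have "ennreal (2 powr (- \<theta> * real_of_int n)) * K t
        \<le> ennreal (2 powr (- \<theta> * real_of_int n)) * ennreal (2 * t * (\<kappa> * B j))"
        by (rule mult_left_mono) simp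
      also have "\<dots> = ennreal ((2 * \<kappa> * B j) * 2 powr ((1 - \<theta>) * real_of_int n))"
        using nonneg[of j] \<kappa>
        by (subst ennreal_mult'[symmetric])
          (auto simp: t_def algebra_simps powr_diff powr_minus field_simps)
      finally have "enn_powr (ennreal (2 powr (- \<theta> * real_of_int n)) * K t) p \<le>
        enn_powr \<dots> p" using p by (intro enn_powr_mono) auto
      also have "\<dots> = ?F j n"
        using nonneg[of j] \<kappa> j(1)
        by (subst enn_powr_ennreal) (auto simp: powr_mult powr_powr t_def \<alpha>_def algebra_simps)
      also have "\<dots> \<le> (\<integral>\<^sup>+j. ?F j n \<partial>count_space UNIV)" by (rule nn_integral_ge_point) simp
      finally show ?thesis by (simp add: t_def)
    next
      \<comment> \<open>Now \<open>A j \<le> t * B j\<close> for all \<open>j\<close>, and small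
        values of \<open>B\<close> force \<open>K t = 0\<close>.\<close>
      case False
      have "K t \<le> ennreal e" if "0 < e" for e
      proof -
        have "0 < e / (2 * t)" using t that by simp
        then obtain j where j: "B j \<le> e / (2 * t)" using Bzero by blast
        have "K t \<le> ennreal (A j + t * B j)" using K[of n j] by (simp add: t_def)
        also have "\<dots> \<le> ennreal (2 * t * (e / (2 * t)))"
          using False mult_left_mono[OF j, of "2 * t"] t
          by (intro ennreal_leI) (auto simp: not_less intro: order_trans[of _ "t * B j + t * B j"])
        finally show ?thesis using t by simp
      qed
      then have "K t \<le> 0" by (metis add_0 ennreal_le_epsilon)
      then show ?thesis by (simp add: t_def)
    qed
  qed
  also have "\<dots> = (\<integral>\<^sup>+j. (\<integral>\<^sup>+n. ?F j n \<partial>count_space UNIV) \<partial>count_space UNIV)"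
    by (rule nn_integral_count_space_nn_integral) auto
  also have "\<dots> \<le> (\<integral>\<^sup>+j. ennreal ((2 * \<kappa>) powr p / (1 - 2 powr - \<alpha>)) *
      ennreal (A j powr ((1 - \<theta>) * p) * B j powr (\<theta> * p)) \<partial>count_space UNIV)"
  proof (rule nn_integral_mono)
    fix j :: int
    show "(\<integral>\<^sup>+n. ?F j n \<partial>count_space UNIV) \<le> ennreal ((2 * \<kappa>) powr p / (1 - 2 powr - \<alpha>)) *
      ennreal (A j powr ((1 - \<theta>) * p) * B j powr (\<theta> * p))"
    proof (cases "B j = 0")
      case False
      then have B: "0 < B j" using nonneg[of j] by simp
      have "(\<integral>\<^sup>+n. ?F j n \<partial>count_space UNIV) \<le>
        (\<integral>\<^sup>+n. ennreal ((2 * \<kappa> * B j) powr p) * (ennreal (2 powr (\<alpha> * real_of_int n))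
          * indicator {n. 2 powr real_of_int n \<le> A j / B j} n) \<partial>count_space UNIV)"
        using B by (intro nn_integral_mono) (auto simp: indicator_def ennreal_mult' field_simps)
      also have "\<dots> = ennreal ((2 * \<kappa> * B j) powr p) * (\<integral>\<^sup>+n. ennreal (2 powr (\<alpha> * real_of_int n))
          * indicator {n. 2 powr real_of_int n \<le> A j / B j} n \<partial>count_space UNIV)"
        by (rule nn_integral_cmult) simp
      also have "\<dots> \<le> ennreal ((2 * \<kappa> * B j) powr p) * ennreal ((A j / B j) powr \<alpha> / (1 - 2 powr - \<alpha>))"
        using B nonneg[of j] \<alpha> by (intro mult_left_mono nn_integral_count_space_geometric) auto
      also have "\<dots> = ennreal ((2 * \<kappa>) powr p / (1 - 2 powr - \<alpha>) * (A j powr ((1 - \<theta>) * p) * B j powr (\<theta> * p)))"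
      proof -
        have "B j powr p = B j powr (\<theta> * p) * B j powr \<alpha>"
          by (simp add: powr_add[symmetric] \<alpha>_def algebra_simps)
        then show ?thesis
          using B nonneg[of j] \<kappa> r
          by (subst ennreal_mult''[symmetric]) (auto simp: powr_mult powr_divide \<alpha>_def[symmetric])
      qed
      also have "\<dots> = ennreal ((2 * \<kappa>) powr p / (1 - 2 powr - \<alpha>))
          * ennreal (A j powr ((1 - \<theta>) * p) * B j powr (\<theta> * p))"
        using r by (intro ennreal_mult) auto
      finally show ?thesis .
    qed simp
  qed
  also have "\<dots> = ennreal ((2 * \<kappa>) powr p / (1 - 2 powr - \<alpha>)) *
      (\<integral>\<^sup>+j. ennreal (A j powr ((1 - \<theta>) * p) * B j powr (\<theta> * p)) \<partial>count_space UNIV)"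
    by (rule nn_integral_cmult) simp
  finally show ?thesis by (simp add: \<alpha>_def)
qed

text \<open>Telescoping near-optimal decompositions of \<open>g\<close> at the scales \<open>2 ^ n\<close> writes \<open>g\<close> as a sum
  of pieces small in both norms; a functional is then estimated piece by piece.\<close>

lemma functional_le_dyadic_norms:
  fixes \<Lambda> :: "'a :: ab_group_add \<Rightarrow> 'b :: real_normed_vector"
    and N\<^sub>0 N\<^sub>1 :: "'a \<Rightarrow> ennreal" and Kf :: "real \<Rightarrow> ennreal"
  assumes \<theta>: "0 < \<theta>" "\<theta> < 1" and pq: "1 < p" "1 < q" "1 / p + 1 / q = 1"
    and tri: "\<And>x y. N\<^sub>0 (x - y) \<le> N\<^sub>0 x + N\<^sub>0 y" "\<And>x y. N\<^sub>1 (x - y) \<le> N\<^sub>1 x + N\<^sub>1 y"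
    and add: "\<And>x y. N\<^sub>0 x < top \<Longrightarrow> N\<^sub>0 y < top \<Longrightarrow> \<Lambda> (x + y) = \<Lambda> x + \<Lambda> y"
    and bound: "\<And>t x. 0 < t \<Longrightarrow> N\<^sub>0 x < top \<Longrightarrow> N\<^sub>1 x < top \<Longrightarrow>
      ennreal (norm (\<Lambda> x)) \<le> Kf t * (N\<^sub>1 x + ennreal (1 / t) * N\<^sub>0 x)"
    and zero: "N\<^sub>0 0 = 0" "N\<^sub>1 0 = 0"
    and g: "N\<^sub>0 g < top" "N\<^sub>1 g < top"
    and fin: "dyadic_sum \<theta> p Kf < top" "dyadic_sum (1 - \<theta>) q (\<lambda>t. K_functional N\<^sub>0 N\<^sub>1 t g) < top"
  shows "ennreal (norm (\<Lambda> g)) \<le> ennreal 6 *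
    (dyadic_norm \<theta> p Kf * dyadic_norm (1 - \<theta>) q (\<lambda>t. K_functional N\<^sub>0 N\<^sub>1 t g))"
proof -
  let ?e = "\<lambda>n::int. 2 powr real_of_int n"
  let ?Kg = "\<lambda>t. K_functional N\<^sub>0 N\<^sub>1 t g"
  interpret Kg: K_like ?Kg by (rule K_like_K_functional)
  have pq0: "0 < p" "0 < q" using pq by auto
  define a b where "a = enn2real (N\<^sub>0 g)" and "b = enn2real (N\<^sub>1 g)"
  have ab: "N\<^sub>0 g = ennreal a" "N\<^sub>1 g = ennreal b" "0 \<le> a" "0 \<le> b"
    using g by (auto simp: a_def b_def)
  \<comment> \<open>One term is bounded by the whole sum, so on the dyadic scales \<open>Kf\<close>
    grows at most like \<open>t powr \<theta>\<close>; this makes the two ends of the telescope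
    vanish.\<close>
  have Kf_bound: "Kf (?e n) \<le> ennreal (2 powr (\<theta> * n)) * dyadic_norm \<theta> p Kf" for n :: int
  proof -
    have "ennreal (2 powr (- \<theta> * n)) * Kf (?e n)
        = enn_powr (enn_powr (ennreal (2 powr (- \<theta> * n)) * Kf (?e n)) p) (1 / p)"
      using pq0 by simp
    also have "\<dots> \<le> dyadic_norm \<theta> p Kf"
      unfolding dyadic_norm_def using pq0 by (intro enn_powr_mono dyadic_sum_ge_term) auto
    finally have "ennreal (1 / 2 powr (\<theta> * n)) * Kf (?e n) \<le> dyadic_norm \<theta> p Kf"
      by (simp add: powr_minus_divide)
    then show ?thesis by (rule ennreal_le_div_mult[rotated]) simp
  qed
  define D where "D = enn2real (dyadic_norm \<theta> p Kf)"
  have D: "dyadic_norm \<theta> p Kf = ennreal D" "0 \<le> D"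
    using fin by (auto simp: D_def dyadic_norm_def)
  define k where "k n = enn2real (Kf (?e n))" for n
  have k: "Kf (?e n) = ennreal (k n)" "0 \<le> k n" "k n \<le> 2 powr (\<theta> * n) * D" for n
  proof -
    have le: "Kf (?e n) \<le> ennreal (2 powr (\<theta> * n) * D)"
      using Kf_bound[of n] D by (simp add: ennreal_mult')
    then show "Kf (?e n) = ennreal (k n)"
      by (auto simp: k_def intro!: ennreal_enn2real[symmetric] intro: le_less_trans)
    then show "k n \<le> 2 powr (\<theta> * n) * D" using le D by simp
  qed (simp add: k_def)
  define l where "l n = enn2real (?Kg (?e n))" for n
  have l_le: "?Kg (?e n) \<le> ennreal a" "?Kg (?e n) \<le> ennreal (?e n * b)" for n
    using K_functional_le[of g g 0 "?e n" N\<^sub>0 N\<^sub>1] K_functional_le[of g 0 g "?e n" N\<^sub>0 N\<^sub>1] ab zero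
    by (auto simp: ennreal_mult')
  have l: "?Kg (?e n) = ennreal (l n)" "0 \<le> l n" for n
    using le_less_trans[OF l_le(1)[of n] ennreal_less_top] by (simp_all add: l_def)
  have l_le_a: "l n \<le> a" and l_le_b: "l n \<le> ?e n * b" for n
    using l_le(1)[of n] l_le(2)[of n] ab unfolding l(1) by (simp_all add: ennreal_le_iff)
  have lstep: "l (n + 1) \<le> 2 * l n" for n
  proof -
    have "?Kg (?e (n + 1)) \<le> ennreal (?e (n + 1) / ?e n) * ?Kg (?e n)"
      by (intro Kg.scale) auto
    also have "?e (n + 1) / ?e n = 2" by (simp add: powr_add)
    finally have "ennreal (l (n + 1)) \<le> ennreal 2 * ennreal (l n)" unfolding l(1) .
    then have "ennreal (l (n + 1)) \<le> ennreal (2 * l n)"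
      by (simp only: ennreal_mult'[symmetric] zero_le_numeral)
    then show ?thesis using l(2)[of n] by (simp add: ennreal_le_iff)
  qed
  have bndR: "norm (\<Lambda> x) \<le> k n * (s + r / ?e n)"
    if "N\<^sub>0 x \<le> ennreal r" "N\<^sub>1 x \<le> ennreal s" "0 \<le> r" "0 \<le> s" for x r s n
  proof -
    have "ennreal (norm (\<Lambda> x)) \<le> Kf (?e n) * (N\<^sub>1 x + ennreal (1 / ?e n) * N\<^sub>0 x)"
      using that by (intro bound) (auto intro: le_less_trans)
    also have "\<dots> \<le> ennreal (k n) * (ennreal s + ennreal (1 / ?e n) * ennreal r)"
      using that k by (intro mult_mono add_mono) auto
    also have "\<dots> = ennreal (k n * (s + r / ?e n))"
      using that k by (simp add: ennreal_mult'[symmetric] ennreal_plus[symmetric] del: ennreal_plus)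
    finally show ?thesis using that k by (subst (asm) ennreal_le_iff) auto
  qed
  define T where "T = (\<lambda>M N. \<Sum>n\<in>{- int M..<int N}. k n / ?e n * l n)"
  have finite_bound: "norm (\<Lambda> g) \<le> 6 * T M N + 3 * b * k (- int M) + 3 * a * (k (int N) / ?e (int N))"
    for M N :: nat
  proof (rule field_le_epsilon)
    fix \<delta> :: real assume \<delta>: "0 < \<delta>"
    \<comment> \<open>Collects everything that multiplies the slack \<epsilon> of the near-optimal
      decompositions. For fixed \<open>M\<close> and \<open>N\<close> it is a finite number, so
      \<epsilon> can be adapted to it.\<close>
    define R where "R = (\<Sum>n\<in>{- int M..<int N}. 4 * (k n / ?e n))
      + 2 * (k (- int M) / ?e (- int M)) + 2 * (k (int N) / ?e (int N))"
    have R: "0 \<le> R" using k by (auto simp: R_def intro!: add_nonneg_nonneg sum_nonneg)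
    define \<epsilon> where "\<epsilon> = \<delta> / (R + 1)"
    have \<epsilon>: "0 < \<epsilon>" "\<epsilon> * R \<le> \<delta>" using \<delta> R by (auto simp: \<epsilon>_def field_simps)
    have "\<exists>u. N\<^sub>0 u \<le> ennreal (l n + \<epsilon>) \<and> N\<^sub>1 (g - u) \<le> ennreal ((l n + \<epsilon>) / ?e n)" for n
    proof -
      have "?Kg (?e n) < ennreal (l n + \<epsilon>)" using l[of n] \<epsilon> by (simp add: ennreal_lessI)
      then obtain u v where uv: "g = u + v" "N\<^sub>0 u + ennreal (?e n) * N\<^sub>1 v < ennreal (l n + \<epsilon>)"
        by (rule K_functional_lessE)
      have "N\<^sub>0 u \<le> N\<^sub>0 u + ennreal (?e n) * N\<^sub>1 v" by simp
      with uv(2) have 1: "N\<^sub>0 u \<le> ennreal (l n + \<epsilon>)" by (metis dual_order.strict_trans2 less_imp_le)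
      have "ennreal (?e n) * N\<^sub>1 v \<le> N\<^sub>0 u + ennreal (?e n) * N\<^sub>1 v" by simp
      with uv(2) have "ennreal (?e n) * N\<^sub>1 v \<le> ennreal (l n + \<epsilon>)"
        by (metis dual_order.strict_trans2 less_imp_le)
      then have "N\<^sub>1 v \<le> ennreal (1 / ?e n) * ennreal (l n + \<epsilon>)"
        by (intro ennreal_le_div_mult) auto
      then have "N\<^sub>1 v \<le> ennreal ((l n + \<epsilon>) / ?e n)"
        by (simp add: ennreal_mult'[symmetric] del: ennreal_plus)
      moreover have "v = g - u" using uv(1) by simp
      ultimately show ?thesis using 1 by blast
    qed
    then obtain u where u: "\<And>n. N\<^sub>0 (u n) \<le> ennreal (l n + \<epsilon>)"
      "\<And>n. N\<^sub>1 (g - u n) \<le> ennreal ((l n + \<epsilon>) / ?e n)" by metis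
    have utop: "N\<^sub>0 (u n) < top" for n using u(1)[of n] by (auto intro: le_less_trans)
    have diff_top: "N\<^sub>0 (x - y) < top" if "N\<^sub>0 x < top" "N\<^sub>0 y < top" for x y
      using tri(1)[of x y] that by (auto intro: le_less_trans)
    \<comment> \<open>A difference of neighbours has \<open>N\<^sub>0\<close> at most
      \<open>l (n + 1) + l n \<le> 3 * l n\<close> and, seen as a difference of the remainders
      \<open>g - u n\<close>, \<open>N\<^sub>1\<close> at most \<open>3 * l n / 2 ^ n\<close>, up to
      \<epsilon>. The two 3s add up to the constant 6.\<close>
    have step: "norm (\<Lambda> (u (n + 1) - u n)) \<le> 6 * (k n / ?e n * l n) + \<epsilon> * (4 * (k n / ?e n))" for n
    proof -
      have 0: "N\<^sub>0 (u (n + 1) - u n) \<le> ennreal (3 * l n + 2 * \<epsilon>)"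
      proof -
        have "N\<^sub>0 (u (n + 1) - u n) \<le> ennreal (l (n + 1) + \<epsilon>) + ennreal (l n + \<epsilon>)"
          using tri(1) add_mono[OF u(1)[of "n + 1"] u(1)[of n]] order_trans by blast
        also have "\<dots> = ennreal (l (n + 1) + \<epsilon> + (l n + \<epsilon>))"
          using l \<epsilon> by (intro ennreal_plus[symmetric]) (auto simp: add_nonneg_nonneg less_imp_le)
        also have "\<dots> \<le> ennreal (3 * l n + 2 * \<epsilon>)"
          using lstep[of n] by (intro ennreal_leI) auto
        finally show ?thesis .
      qed
      have 1: "N\<^sub>1 (u (n + 1) - u n) \<le> ennreal ((3 * l n + 2 * \<epsilon>) / ?e n)"
      proof -
        have "N\<^sub>1 (u (n + 1) - u n) = N\<^sub>1 ((g - u n) - (g - u (n + 1)))" by simp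
        also have "\<dots> \<le> ennreal ((l n + \<epsilon>) / ?e n) + ennreal ((l (n + 1) + \<epsilon>) / ?e (n + 1))"
          using tri(2) add_mono[OF u(2)[of n] u(2)[of "n + 1"]] order_trans by blast
        also have "\<dots> = ennreal ((l n + \<epsilon>) / ?e n + (l (n + 1) + \<epsilon>) / ?e (n + 1))"
          using l \<epsilon> by (intro ennreal_plus[symmetric]) (auto simp: add_nonneg_nonneg less_imp_le)
        also have "\<dots> \<le> ennreal ((3 * l n + 2 * \<epsilon>) / ?e n)"
        proof (rule ennreal_leI)
          have "(l (n + 1) + \<epsilon>) / ?e (n + 1) \<le> (2 * l n + \<epsilon>) / ?e n"
            using lstep[of n] l[of n] l[of "n + 1"] \<epsilon> by (intro frac_le) auto
          then show "(l n + \<epsilon>) / ?e n + (l (n + 1) + \<epsilon>) / ?e (n + 1) \<le> (3 * l n + 2 * \<epsilon>) / ?e n"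
            by (simp add: add_divide_distrib)
        qed
        finally show ?thesis .
      qed
      have "norm (\<Lambda> (u (n + 1) - u n)) \<le> k n * ((3 * l n + 2 * \<epsilon>) / ?e n + (3 * l n + 2 * \<epsilon>) / ?e n)"
        using l \<epsilon> by (intro bndR 0 1) (auto simp: add_nonneg_nonneg less_imp_le)
      also have "\<dots> = 6 * (k n / ?e n * l n) + \<epsilon> * (4 * (k n / ?e n))" by (simp add: field_simps)
      finally show ?thesis .
    qed
    \<comment> \<open>Additivity of \<Lambda> is available where \<open>N\<^sub>0\<close> is finite,
      which holds for every \<open>u n\<close>.\<close>
    have tele: "\<Lambda> (u (i + int d)) = \<Lambda> (u i) + (\<Sum>n\<in>{i..<i + int d}. \<Lambda> (u (n + 1) - u n))" for i d
    proof (induction d)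
      case (Suc d)
      have "{i..<i + int (Suc d)} = insert (i + int d) {i..<i + int d}" by auto
      moreover have "\<Lambda> (u (i + int (Suc d))) = \<Lambda> (u (i + int d) + (u (i + int d + 1) - u (i + int d)))"
        by (simp add: algebra_simps)
      moreover have "\<dots> = \<Lambda> (u (i + int d)) + \<Lambda> (u (i + int d + 1) - u (i + int d))"
        by (intro add utop diff_top)
      ultimately show ?case using Suc by simp
    qed simp
    have low: "norm (\<Lambda> (u (- int M))) \<le> 3 * b * k (- int M) + \<epsilon> * (2 * (k (- int M) / ?e (- int M)))"
    proof -
      let ?n = "- int M"
      have 0: "N\<^sub>0 (u ?n) \<le> ennreal (?e ?n * b + \<epsilon>)"
        using l_le_b[of ?n] by (intro order_trans[OF u(1)] ennreal_leI) auto
      have "N\<^sub>1 (u ?n) = N\<^sub>1 (g - (g - u ?n))" by simp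
      also have "\<dots> \<le> ennreal b + ennreal ((l ?n + \<epsilon>) / ?e ?n)"
        using tri(2)[of g "g - u ?n"] u(2)[of ?n] ab by (auto intro: order_trans add_left_mono)
      also have "\<dots> = ennreal (b + (l ?n + \<epsilon>) / ?e ?n)"
        using l[of ?n] \<epsilon> ab by (intro ennreal_plus[symmetric]) auto
      also have "\<dots> \<le> ennreal (2 * b + \<epsilon> / ?e ?n)"
      proof (rule ennreal_leI)
        have "l ?n / ?e ?n \<le> b" using l_le_b[of ?n] by (simp add: pos_divide_le_eq mult.commute)
        then show "b + (l ?n + \<epsilon>) / ?e ?n \<le> 2 * b + \<epsilon> / ?e ?n" by (simp add: add_divide_distrib)
      qed
      finally have 1: "N\<^sub>1 (u ?n) \<le> ennreal (2 * b + \<epsilon> / ?e ?n)" .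
      have "norm (\<Lambda> (u ?n)) \<le> k ?n * ((2 * b + \<epsilon> / ?e ?n) + (?e ?n * b + \<epsilon>) / ?e ?n)"
        using ab \<epsilon> by (intro bndR 0 1) auto
      also have "\<dots> = 3 * b * k ?n + \<epsilon> * (2 * (k ?n / ?e ?n))"
        by (simp add: field_simps)
      finally show ?thesis .
    qed
    have high: "norm (\<Lambda> (g - u (int N)))
        \<le> 3 * a * (k (int N) / ?e (int N)) + \<epsilon> * (2 * (k (int N) / ?e (int N)))"
    proof -
      let ?n = "int N"
      have 1: "N\<^sub>1 (g - u ?n) \<le> ennreal ((a + \<epsilon>) / ?e ?n)"
        using l_le_a[of ?n] by (intro order_trans[OF u(2)] ennreal_leI divide_right_mono) auto
      have "N\<^sub>0 (g - u ?n) \<le> ennreal a + ennreal (l ?n + \<epsilon>)"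
        using tri(1)[of g "u ?n"] u(1)[of ?n] ab by (auto intro: order_trans add_left_mono)
      also have "\<dots> = ennreal (a + (l ?n + \<epsilon>))"
        using l[of ?n] \<epsilon> ab by (intro ennreal_plus[symmetric]) auto
      also have "\<dots> \<le> ennreal (2 * a + \<epsilon>)"
        using l_le_a[of ?n] by (intro ennreal_leI) auto
      finally have 0: "N\<^sub>0 (g - u ?n) \<le> ennreal (2 * a + \<epsilon>)" .
      have "norm (\<Lambda> (g - u ?n)) \<le> k ?n * ((a + \<epsilon>) / ?e ?n + (2 * a + \<epsilon>) / ?e ?n)"
        using ab \<epsilon> by (intro bndR 0 1) auto
      also have "\<dots> = 3 * a * (k ?n / ?e ?n) + \<epsilon> * (2 * (k ?n / ?e ?n))"
        by (simp add: field_simps)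
      finally show ?thesis .
    qed
    have "\<Lambda> g = \<Lambda> (u (int N) + (g - u (int N)))" by simp
    also have "\<dots> = \<Lambda> (u (int N)) + \<Lambda> (g - u (int N))"
      using g by (intro add utop diff_top)
    also have "\<Lambda> (u (int N)) = \<Lambda> (u (- int M)) + (\<Sum>n\<in>{- int M..<int N}. \<Lambda> (u (n + 1) - u n))"
      using tele[of "- int M" "M + N"] by simp
    finally have "norm (\<Lambda> g) \<le> norm (\<Lambda> (u (- int M))) + norm (\<Sum>n\<in>{- int M..<int N}. \<Lambda> (u (n + 1) - u n))
        + norm (\<Lambda> (g - u (int N)))"
      by (metis (no_types, lifting) add_right_mono norm_triangle_ineq order_trans)
    also have "norm (\<Sum>n\<in>{- int M..<int N}. \<Lambda> (u (n + 1) - u n))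
      \<le> (\<Sum>n\<in>{- int M..<int N}. 6 * (k n / ?e n * l n) + \<epsilon> * (4 * (k n / ?e n)))"
      by (intro sum_norm_le step)
    also have "\<dots> = 6 * T M N + \<epsilon> * (\<Sum>n\<in>{- int M..<int N}. 4 * (k n / ?e n))"
      by (simp add: T_def sum.distrib sum_distrib_left)
    finally have "norm (\<Lambda> g)
        \<le> 6 * T M N + 3 * b * k (- int M) + 3 * a * (k (int N) / ?e (int N)) + \<epsilon> * R"
      using low high by (simp add: R_def distrib_left)
    with \<epsilon> show "norm (\<Lambda> g) \<le> 6 * T M N + 3 * b * k (- int M) + 3 * a * (k (int N) / ?e (int N)) + \<delta>"
      by linarith
  qed
  define D' where "D' = enn2real (dyadic_norm (1 - \<theta>) q ?Kg)"
  have D': "dyadic_norm (1 - \<theta>) q ?Kg = ennreal D'" "0 \<le> D'"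
    using fin by (auto simp: D'_def dyadic_norm_def)
  \<comment> \<open>The factor \<open>1 / 2 ^ n\<close> splits into the weights
    \<open>2 powr (- \<theta> * n)\<close> and \<open>2 powr (- (1 - \<theta>) * n)\<close> of the
    two dyadic norms, so Hoelder's inequality for the counting measure applies.\<close>
  have T_le: "T M N \<le> D * D'" for M N
  proof -
    let ?u = "\<lambda>n::int. ennreal (2 powr (- \<theta> * real_of_int n)) * Kf (?e n)"
    let ?v = "\<lambda>n::int. ennreal (2 powr (- (1 - \<theta>) * real_of_int n)) * ?Kg (?e n)"
    have uv: "ennreal (k n / ?e n * l n) = ?u n * ?v n" for n
    proof -
      have "?u n * ?v n = ennreal ((2 powr (- \<theta> * real_of_int n) * k n) * (2 powr (- (1 - \<theta>) * real_of_int n) * l n))"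
        using k l by (simp add: ennreal_mult)
      also have "(2 powr (- \<theta> * real_of_int n) * k n) * (2 powr (- (1 - \<theta>) * real_of_int n) * l n)
        = (2 powr (- \<theta> * real_of_int n) * 2 powr (- (1 - \<theta>) * real_of_int n)) * (k n * l n)" by simp
      also have "2 powr (- \<theta> * real_of_int n) * 2 powr (- (1 - \<theta>) * real_of_int n) = 1 / ?e n"
        by (simp add: powr_add[symmetric] powr_minus_divide[symmetric] algebra_simps)
      finally show ?thesis by simp
    qed
    have "ennreal (T M N) = (\<Sum>n\<in>{- int M..<int N}. ?u n * ?v n)"
      unfolding T_def uv[symmetric] using k l by (intro sum_ennreal[symmetric]) auto
    also have "\<dots> = (\<integral>\<^sup>+n. ?u n * ?v n \<partial>count_space {- int M..<int N})"
      by (rule nn_integral_count_space_finite[symmetric]) simp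
    also have "\<dots> \<le> (\<integral>\<^sup>+n. ?u n * ?v n \<partial>count_space UNIV)"
      by (subst nn_integral_count_space_indicator) (auto intro!: nn_integral_mono simp: indicator_def)
    also have "\<dots> \<le> dyadic_norm \<theta> p Kf * dyadic_norm (1 - \<theta>) q ?Kg"
      unfolding dyadic_norm_def dyadic_sum_def by (rule nn_integral_Holder) (use pq in auto)
    also have "\<dots> = ennreal (D * D')" using D D' by (simp add: ennreal_mult)
    finally show ?thesis using D D' by (subst (asm) ennreal_le_iff) auto
  qed
  \<comment> \<open>Both ends of the telescope go to infinity; the boundary terms decay like
    \<open>2 powr (- \<theta> * N)\<close> and \<open>2 powr (- (1 - \<theta>) * N)\<close>.\<close>
  have "norm (\<Lambda> g) \<le> 6 * (D * D')"
  proof (rule LIMSEQ_le_const)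
    let ?X = "\<lambda>N. 6 * (D * D') + 3 * b * D * (2 powr - \<theta>) ^ N + 3 * a * D * (2 powr - (1 - \<theta>)) ^ N"
    have "?X \<longlonglongrightarrow> 6 * (D * D') + 3 * b * D * 0 + 3 * a * D * 0"
      using \<theta> by (intro tendsto_intros LIMSEQ_realpow_zero) (auto intro!: powr_less_one)
    then show "?X \<longlonglongrightarrow> 6 * (D * D')" by simp
    have "norm (\<Lambda> g) \<le> ?X N" for N
    proof -
      have 1: "k (- int N) \<le> D * (2 powr - \<theta>) ^ N"
        using k(3)[of "- int N"] by (simp add: powr_realpow[symmetric] powr_powr mult.commute)
      have "k (int N) / ?e (int N) \<le> 2 powr (\<theta> * int N) * D / ?e (int N)"
        by (intro divide_right_mono k(3)) auto
      also have "\<dots> = D * (2 powr - (1 - \<theta>)) ^ N"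
        by (simp add: powr_realpow[symmetric] powr_powr powr_diff[symmetric] field_simps)
          (simp add: powr_add[symmetric] powr_diff powr_minus field_simps)
      finally have 2: "k (int N) / ?e (int N) \<le> D * (2 powr - (1 - \<theta>)) ^ N" .
      show ?thesis
        using finite_bound[of N N] T_le[of N N] mult_left_mono[OF 1, of "3 * b"]
          mult_left_mono[OF 2, of "3 * a"] ab by (simp add: mult.assoc)
    qed
    then show "\<exists>N. \<forall>n\<ge>N. norm (\<Lambda> g) \<le> ?X n" by blast
  qed
  then have "ennreal (norm (\<Lambda> g)) \<le> ennreal (6 * (D * D'))" by (rule ennreal_leI)
  also have "\<dots> = ennreal 6 * (dyadic_norm \<theta> p Kf * dyadic_norm (1 - \<theta>) q ?Kg)"
    using D D' by (simp add: ennreal_mult)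
  finally show ?thesis .
qed

section \<open>Trees\<close>

context rooted_tree
begin

lemma ex_relpowp: "\<exists>n. (adj ^^ n) x y"
  using connected[of x y] by (auto simp: rtranclp_power)

abbreviation dst where "dst \<equiv> graph_dist adj"

lemma relpowp_dst: "(adj ^^ dst x y) x y"
  unfolding graph_dist_def using ex_relpowp by (rule LeastI_ex)

lemma dst_le: "(adj ^^ n) x y \<Longrightarrow> dst x y \<le> n"
  unfolding graph_dist_def by (rule Least_le)

lemma relpowp_sym: "(adj ^^ n) x y \<Longrightarrow> (adj ^^ n) y x"
proof (induction n arbitrary: y)
  case (Suc n)
  then obtain z where "(adj ^^ n) x z" "adj z y" by auto
  then have "adj y z" "(adj ^^ n) z x" using Suc adj_sym by auto
  then show ?case by (rule relpowp_Suc_I2)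
qed auto

lemma dst_sym: "dst x y = dst y x"
  using dst_le[OF relpowp_sym[OF relpowp_dst]] by (meson antisym)

lemma dst_self [simp]: "dst x x = 0"
  using dst_le[of 0 x x] by simp

lemma dst_eq_0_iff [simp]: "dst x y = 0 \<longleftrightarrow> x = y"
  using relpowp_dst[of x y] by auto

lemma dst_triangle: "dst x z \<le> dst x y + dst y z"
  using relpowp_dst[of x y] relpowp_dst[of y z] by (intro dst_le) (auto simp: relpowp_add)

lemma dst_adj_le: "adj x y \<Longrightarrow> dst x z \<le> Suc (dst y z)"
  using relpowp_dst[of y z] by (intro dst_le relpowp_Suc_I2)

lemma dst_SucE:
  assumes "dst x z = Suc n"
  obtains y where "adj x y" "dst y z = n"
proof -
  have "(adj ^^ Suc n) x z" using relpowp_dst[of x z] assms by simp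
  then obtain y where y: "adj x y" "(adj ^^ n) y z" by (rule relpowp_Suc_E2)
  then have "dst y z = n" using dst_le[OF y(2)] dst_adj_le[OF y(1), of z] assms by simp
  with y show ?thesis using that by blast
qed

lemma geodesicE:
  obtains p where "p 0 = x" "\<And>i. i < dst x z \<Longrightarrow> adj (p i) (p (Suc i))"
    "\<And>i. i \<le> dst x z \<Longrightarrow> dst (p i) z = dst x z - i"
proof -
  have "\<exists>p. p 0 = x \<and> (\<forall>i<n. adj (p i) (p (Suc i))) \<and> (\<forall>i\<le>n. dst (p i) z = n - i)"
    if "dst x z = n" for n
    using that
  proof (induction n arbitrary: x)
    case 0
    then show ?case by (intro exI[of _ "\<lambda>_. x"]) auto
  next
    case (Suc n)
    then obtain y where y: "adj x y" "dst y z = n" by (auto elim: dst_SucE)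
    from Suc.IH[OF y(2)] obtain p where p: "p 0 = y" "\<forall>i<n. adj (p i) (p (Suc i))"
      "\<forall>i\<le>n. dst (p i) z = n - i" by blast
    show ?case
      using p y Suc.prems by (intro exI[of _ "case_nat x p"]) (auto split: nat.split)
  qed
  from this[OF refl] show ?thesis using that by blast
qed

lemma successively_map_upt:
  "successively P (map f [i..<j]) \<longleftrightarrow> (\<forall>k. i \<le> k \<and> Suc k < j \<longrightarrow> P (f k) (f (Suc k)))"
  unfolding successively_conv_nth
proof (auto, goal_cases)
  case (1 k)
  from this(1)[rule_format, of "k - i"] 1(2,3) show ?case by auto
qed

text \<open>Geodesics to \<open>z\<close> from two points at the same distance, followed up to their first meeting
  point, form a cycle with any short connection of the two points.\<close>

lemma no_two_geodesics:
  assumes d: "dst x z = dst y z" and xy: "x \<noteq> y"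
    and xs: "xs = [] \<and> adj x y \<or> (\<exists>w. xs = [w] \<and> adj w x \<and> adj w y \<and> dst w z = Suc (dst x z))"
  shows False
proof -
  define n where "n = dst x z"
  obtain p where p: "p 0 = x" "\<And>i. i < n \<Longrightarrow> adj (p i) (p (Suc i))" "\<And>i. i \<le> n \<Longrightarrow> dst (p i) z = n - i"
    using geodesicE[of x z] unfolding n_def by blast
  obtain q where q: "q 0 = y" "\<And>i. i < n \<Longrightarrow> adj (q i) (q (Suc i))" "\<And>i. i \<le> n \<Longrightarrow> dst (q i) z = n - i"
    using geodesicE[of y z] d unfolding n_def by metis
  have "p n = q n" using p(3)[of n] q(3)[of n] by simp
  \<comment> \<open>The first index at which the geodesics meet. Before it they are disjoint, since
    a common point has one distance to \<open>z\<close> and hence the same index on both.\<close>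
  define k where "k = (LEAST i. p i = q i)"
  have k: "p k = q k" "k \<le> n" unfolding k_def
    using \<open>p n = q n\<close> by (auto intro: LeastI Least_le)
  have lt: "p i \<noteq> q i" if "i < k" for i using that not_less_Least unfolding k_def by blast
  have k0: "0 < k" using k p q xy by (metis gr0I)
  have dist_neq: "p i \<noteq> q j" if "i \<le> k" "j < k" for i j
  proof
    assume eq: "p i = q j"
    have "n - i = n - j" using p(3)[of i] q(3)[of j] that k eq by auto
    then have "i = j" using that k by auto
    then show False using lt that eq by auto
  qed
  have inj: "inj_on p {..k}" "inj_on q {..k}"
    using p(3) q(3) k by (auto intro!: inj_onI) (metis diff_diff_cancel le_trans)+
  \<comment> \<open>Along the first geodesic to the meeting point and back along the second. The
    meeting point is listed once, so the length is \<open>2 * k + 1\<close>, which is at least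
    3.\<close>
  define ys where "ys = map p [0..<Suc k] @ rev (map q [0..<k])"
  have ys: "distinct ys" unfolding ys_def
    using dist_neq inj by (auto simp: distinct_map intro: inj_on_subset simp del: upt_Suc
        simp: less_Suc_eq_le)
  have succ: "successively adj ys"
  proof -
    have 1: "successively adj (map p [0..<Suc k])"
      unfolding successively_map_upt using p(2) k by auto
    have 2: "successively adj (rev (map q [0..<k]))"
      unfolding successively_rev successively_map_upt using q(2) k adj_sym by auto
    have 3: "adj (p k) (q (k - 1))"
      using q(2)[of "k - 1"] k k0 adj_sym by auto
    have 4: "last (map p [0..<Suc k]) = p k" by simp
    have 5: "hd (rev (map q [0..<k])) = q (k - 1)"
      using k0 by (simp add: hd_rev last_map)
    show ?thesis unfolding ys_def using 1 2 3 4 5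
      by (subst successively_append_iff) (auto simp del: upt_Suc)
  qed
  have hd: "hd ys = x" unfolding ys_def using p by (simp add: hd_append hd_map del: upt_Suc)
  have last: "last ys = y" unfolding ys_def using q k0 by (simp add: last_rev hd_map)
  have len: "length ys = 2 * k + 1" by (simp add: ys_def)
  have far: "dst v z \<le> n" if "v \<in> set ys" for v
    using that p(3) q(3) k unfolding ys_def by (auto simp: less_Suc_eq_le simp del: upt_Suc)
  have "graph_cycle adj (xs @ ys)"
    using xs
  proof
    assume "xs = [] \<and> adj x y"
    then show ?thesis
      unfolding graph_cycle_def using ys succ hd last len k0 adj_sym by auto
  next
    assume "\<exists>w. xs = [w] \<and> adj w x \<and> adj w y \<and> dst w z = Suc (dst x z)"
    then obtain w where w: "xs = [w]" "adj w x" "adj w y" "dst w z = Suc n" by (auto simp: n_def)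
    have "w \<notin> set ys" using far w(4) by fastforce
    then show ?thesis
      unfolding graph_cycle_def using w ys succ hd last len k0 adj_sym
      by (cases ys) (auto simp: successively_Cons)
  qed
  then show False using acyclic by blast
qed

text \<open>Two adjacent points equally far from \<open>z\<close> would close an odd cycle: trees
  are bipartite.\<close>

lemma adj_dst_neq: "adj x y \<Longrightarrow> dst x z \<noteq> dst y z"
  using no_two_geodesics[of x z y "[]"] adj_irrefl by blast

lemma adj_dst_cases:
  assumes "adj x y"
  shows "dst x z = Suc (dst y z) \<or> dst y z = Suc (dst x z)"
  using adj_dst_neq[OF assms, of z] dst_adj_le[OF assms, of z] dst_adj_le[OF adj_sym[OF assms], of z]
  by linarith

text \<open>The first step of a geodesic from \<open>w\<close> to \<open>z\<close> is unique; the
  uniqueness of parents rests on this.\<close>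

lemma closer_unique:
  assumes "adj w x" "adj w y" "dst w z = Suc (dst x z)" "dst w z = Suc (dst y z)"
  shows "x = y"
  using no_two_geodesics[of x z y "[w]"] assms by auto

section \<open>The ray and the level function\<close>

lemma ray_adj: "adj (\<omega> i) (\<omega> (Suc i))"
proof -
  have "dst (\<omega> i) (\<omega> (Suc i)) = 1" using ray[of i "Suc i"] by simp
  then obtain y where "adj (\<omega> i) y" "dst y (\<omega> (Suc i)) = 0" by (metis One_nat_def dst_SucE)
  then show ?thesis by simp
qed

lemma dst_ray: "dst (\<omega> i) (\<omega> j) = (if i \<le> j then j - i else i - j)"
  using ray[of i j] by (auto split: if_splits)

lemma ray_inj: "\<omega> i = \<omega> j \<Longrightarrow> i = j"
  using ray[of i j] by simp

lemma ray_projE: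
  obtains k where "ray_proj x = \<omega> k" "\<And>i. dst x (\<omega> k) \<le> dst x (\<omega> i)"
proof -
  have "\<exists>y\<in>range \<omega>. ray_proj x = y \<and> (\<forall>z\<in>range \<omega>. dst x y \<le> dst x z)"
  proof -
    define k where "k = arg_min (dst x) (\<lambda>y. y \<in> range \<omega>)"
    have "k \<in> range \<omega> \<and> (\<forall>y. y \<in> range \<omega> \<longrightarrow> dst x k \<le> dst x y)"
      unfolding k_def by (rule arg_min_nat_lemma[of _ "\<omega> 0"]) auto
    then show ?thesis by (auto simp: ray_proj_def arg_min_on_def k_def)
  qed
  then show ?thesis using that by auto
qed

text \<open>The distance to \<open>\<omega> i\<close> has no strict local maximum in \<open>i\<close>, so it increases beyond its
  minimum: the level is a Busemann function.\<close>

lemma dst_ray_eventually: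
  obtains k where "\<And>n. k \<le> n \<Longrightarrow> level x = int n - int (dst x (\<omega> n))"
proof -
  obtain k where k: "ray_proj x = \<omega> k" "\<And>i. dst x (\<omega> k) \<le> dst x (\<omega> i)" using ray_projE[of x] by blast
  have step: "dst x (\<omega> (Suc (k + j))) = Suc (dst x (\<omega> (k + j)))" for j
  proof (induction j)
    case 0
    show ?case using adj_dst_cases[OF ray_adj[of k], of x] k(2)[of "Suc k"]
      by (auto simp: dst_sym[of _ x])
  next
    case (Suc j)
    show ?case
    proof (rule ccontr)
      assume neq: "dst x (\<omega> (Suc (k + Suc j))) \<noteq> Suc (dst x (\<omega> (k + Suc j)))"
      let ?w = "\<omega> (Suc (k + j))"
      have "dst x ?w = Suc (dst x (\<omega> (Suc (Suc (k + j)))))"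
        using adj_dst_cases[OF ray_adj[of "Suc (k + j)"], of x] neq by (auto simp: dst_sym[of _ x])
      \<comment> \<open>A drop after a rise would give \<open>?w\<close> two neighbours on the ray
        that are closer to \<open>x\<close>, and these must coincide.\<close>
      then have "\<omega> (Suc (Suc (k + j))) = \<omega> (k + j)"
        using Suc by (intro closer_unique[of ?w _ _ x] ray_adj adj_sym[OF ray_adj]) (auto
            simp: dst_sym[of _ x])
      then show False by (auto dest: ray_inj)
    qed
  qed
  have add: "dst x (\<omega> (k + j)) = dst x (\<omega> k) + j" for j
    by (induction j) (use step in auto)
  have "level x = int n - int (dst x (\<omega> n))" if "k \<le> n" for n
  proof -
    have "dst x (\<omega> n) = dst x (\<omega> k) + (n - k)" using add[of "n - k"] that by simp
    then show ?thesis using that by (simp add: level_def k(1) dst_ray dst_sym[of "\<omega> k" x])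
  qed
  then show ?thesis by (rule that)
qed

lemma level_adj_cases:
  assumes "adj x y"
  shows "level y = level x + 1 \<or> level x = level y + 1"
proof -
  obtain k where k: "\<And>n. k \<le> n \<Longrightarrow> level x = int n - int (dst x (\<omega> n))"
    using dst_ray_eventually[of x] by blast
  obtain l where l: "\<And>n. l \<le> n \<Longrightarrow> level y = int n - int (dst y (\<omega> n))"
    using dst_ray_eventually[of y] by blast
  show ?thesis
    using adj_dst_cases[OF assms, of "\<omega> (max k l)"] k[of "max k l"] l[of "max k l"] by linarith
qed

lemma level_eventually:
  obtains k where "\<And>n. k \<le> n \<Longrightarrow> level x = int n - int (dst x (\<omega> n))"
    "\<And>n. k \<le> n \<Longrightarrow> level y = int n - int (dst y (\<omega> n))"
proof -
  obtain k where k: "\<And>n. k \<le> n \<Longrightarrow> level x = int n - int (dst x (\<omega> n))"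
    using dst_ray_eventually[of x] by blast
  obtain l where l: "\<And>n. l \<le> n \<Longrightarrow> level y = int n - int (dst y (\<omega> n))"
    using dst_ray_eventually[of y] by blast
  show ?thesis by (rule that[of "max k l"]) (use k l in auto)
qed

text \<open>The parent is the first step towards \<open>\<omega> n\<close> for large
  \<open>n\<close>, and that step is unique by \<open>closer_unique\<close>.\<close>

lemma parent_ex1: "\<exists>!y. adj x y \<and> level y = level x + 1"
proof (rule ex_ex1I)
  obtain k where k: "\<And>n. k \<le> n \<Longrightarrow> level x = int n - int (dst x (\<omega> n))"
    using dst_ray_eventually[of x] by blast
  obtain n where n: "k \<le> n" "\<omega> n \<noteq> x"
    by (metis le_refl le_SucI n_not_Suc_n ray_inj)
  then obtain d where "dst x (\<omega> n) = Suc d"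
    by (metis dst_eq_0_iff not0_implies_Suc)
  then obtain y where y: "adj x y" "dst y (\<omega> n) = d" by (rule dst_SucE)
  obtain l where l: "\<And>n. l \<le> n \<Longrightarrow> level y = int n - int (dst y (\<omega> n))"
    using dst_ray_eventually[of y] by blast
  \<comment> \<open>The formula for the level of \<open>y\<close> may hold only from
    \<open>l\<close> on; the triangle inequality carries the distance from \<open>\<omega> n\<close>
    to \<open>\<omega> N\<close>.\<close>
  define N where "N = max n l"
  have "dst y (\<omega> N) \<le> d + (N - n)"
    using dst_triangle[of y "\<omega> N" "\<omega> n"] y by (simp add: dst_ray N_def)
  then have "level y \<ge> level x + 1"
    using k[of n] l[of N] n \<open>dst x (\<omega> n) = Suc d\<close> by (auto simp: N_def)
  then show "\<exists>y. adj x y \<and> level y = level x + 1"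
    using y level_adj_cases[OF y(1)] by (intro exI[of _ y]) linarith
next
  fix y y' assume *: "adj x y \<and> level y = level x + 1" "adj x y' \<and> level y' = level x + 1"
  obtain k where k: "\<And>n. k \<le> n \<Longrightarrow> level x = int n - int (dst x (\<omega> n))"
    "\<And>n. k \<le> n \<Longrightarrow> level y = int n - int (dst y (\<omega> n))" using level_eventually[of x y] by blast
  obtain l where l: "\<And>n. l \<le> n \<Longrightarrow> level y' = int n - int (dst y' (\<omega> n))"
    using dst_ray_eventually[of y'] by blast
  show "y = y'"
    by (rule closer_unique[of x y y' "\<omega> (max k l)"])
      (use * k[of "max k l"] l[of "max k l"] in auto)
qed

section \<open>Parents and generations of descendants\<close>

definition par where "par x = (THE y. adj x y \<and> level y = level x + 1)"

lemma adj_par: "adj x (par x)" and level_par [simp]: "level (par x) = level x + 1"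
  using theI'[OF parent_ex1[of x]] unfolding par_def by auto

lemma par_eqI: "adj x y \<Longrightarrow> level y = level x + 1 \<Longrightarrow> par x = y"
  using parent_ex1[of x] adj_par level_par by blast

lemma sons_eq: "sons x = {y. par y = x}"
proof (intro set_eqI iffI)
  fix y assume "y \<in> sons x"
  then have "adj x y" "level y = level x - 1" by (auto simp: sons_def)
  then show "y \<in> {y. par y = x}" using par_eqI[of y x] adj_sym by auto
next
  fix y assume "y \<in> {y. par y = x}"
  then show "y \<in> sons x" using adj_par[of y] adj_sym by (auto simp: sons_def)
qed

lemma level_par_pow [simp]: "level ((par ^^ n) x) = level x + int n"
  by (induction n) auto

lemma relpowp_par: "(adj ^^ n) x ((par ^^ n) x)"
  by (induction n) (auto intro: adj_par)

lemma abs_level_diff_le: "\<bar>level x - level y\<bar> \<le> int (dst x y)"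
proof -
  have "(adj ^^ n) x y \<Longrightarrow> \<bar>level x - level y\<bar> \<le> int n" for n
  proof (induction n arbitrary: y)
    case (Suc n)
    then obtain z where z: "(adj ^^ n) x z" "adj z y" by auto
    from Suc.IH[OF z(1)] level_adj_cases[OF z(2)] show ?case by linarith
  qed simp
  then show ?thesis using relpowp_dst by blast
qed

lemma dst_par_pow: "dst x ((par ^^ n) x) = n"
  using dst_le[OF relpowp_par[of n x]] abs_level_diff_le[of x "(par ^^ n) x"] by simp

text \<open>The level changes by one per edge, so a path of length \<open>level x - level y\<close>
  from \<open>y\<close> to \<open>x\<close> must ascend at every step, and an ascending step leads
  to the parent.\<close>

lemma below_iff: "below y x \<longleftrightarrow> (\<exists>n. (par ^^ n) y = x)"
proof
  assume "below y x"
  then have eq: "level x - level y = int (dst x y)" by (simp add: below_def)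
  have "level x - level y = int n \<Longrightarrow> dst y x = n \<Longrightarrow> (par ^^ n) y = x" for n y
  proof (induction n arbitrary: y)
    case 0
    then show ?case by simp
  next
    case (Suc n)
    from Suc.prems(2) obtain z where z: "adj y z" "dst z x = n" by (rule dst_SucE)
    have "level x - level z \<le> int n" using abs_level_diff_le[of z x] z(2) by linarith
    then have "level z = level y + 1" using level_adj_cases[OF z(1)] Suc.prems(1) by linarith
    then have "par y = z" using z(1) by (intro par_eqI)
    then show ?case using Suc.IH[of z] z(2) Suc.prems(1) \<open>level z = level y + 1\<close>
      by (simp add: funpow_swap1)
  qed
  from this[OF eq] show "\<exists>n. (par ^^ n) y = x" by (auto simp: dst_sym)
next
  assume "\<exists>n. (par ^^ n) y = x"
  then show "below y x" using dst_par_pow by (auto simp: below_def dst_sym)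
qed

lemma par_ray: "par (\<omega> n) = \<omega> (Suc n)" and level_ray [simp]: "level (\<omega> n) = int n"
proof -
  have lev: "level (\<omega> n) = int n" for n
  proof -
    obtain k where k: "\<And>j. k \<le> j \<Longrightarrow> level (\<omega> n) = int j - int (dst (\<omega> n) (\<omega> j))"
      using dst_ray_eventually[of "\<omega> n"] by blast
    show ?thesis using k[of "max k n"] by (auto simp: dst_ray)
  qed
  show "level (\<omega> n) = int n" by (rule lev)
  show "par (\<omega> n) = \<omega> (Suc n)" using ray_adj by (intro par_eqI) (auto simp: lev)
qed

lemma par_pow_ray: "(par ^^ j) (\<omega> n) = \<omega> (n + j)"
  by (induction j) (auto simp: par_ray)

lemma eventually_below_ray: "\<exists>N. \<forall>n\<ge>N. below x (\<omega> n)"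
proof -
  obtain k where "\<And>n. k \<le> n \<Longrightarrow> level x = int n - int (dst x (\<omega> n))"
    using dst_ray_eventually[of x] by blast
  then show ?thesis by (intro exI[of _ k]) (auto simp: below_def dst_sym)
qed

definition desc :: "nat \<Rightarrow> 'v \<Rightarrow> 'v set" where "desc k x = {y. (par ^^ k) y = x}"

lemma desc_0 [simp]: "desc 0 x = {x}" by (simp add: desc_def)

lemma desc_Suc: "desc (Suc k) x = (\<Union>y\<in>sons x. desc k y)"
  by (auto simp: desc_def sons_eq)

lemma trapezoid_eq: "trapezoid h' h'' x = (\<Union>k\<in>{k. h' \<le> int k \<and> int k < h''}. desc k x)"
  by (auto simp: trapezoid_def below_iff desc_def)

lemma level_desc: "y \<in> desc k x \<Longrightarrow> level y = level x - int k"
  by (auto simp: desc_def)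

lemma desc_disjoint:
  assumes "(k, x) \<noteq> (l, y)" "k = l \<or> x = y"
  shows "desc k x \<inter> desc l y = {}"
proof -
  have False if "z \<in> desc k x" "z \<in> desc l y" for z
  proof -
    have xy: "x = (par ^^ k) z" "y = (par ^^ l) z" using that by (simp_all add: desc_def)
    have lev: "level z = level x - int k" "level z = level y - int l"
      using that level_desc by blast+
    from assms(2) show False
    proof
      assume "k = l"
      then have "x = y" using xy by metis
      then show False using assms(1) \<open>k = l\<close> by blast
    next
      assume "x = y"
      have "k = l" using lev unfolding \<open>x = y\<close> by linarith
      then show False using assms(1) \<open>x = y\<close> by blast
    qed
  qed
  then show ?thesis by blast
qed

end

section \<open>Lebesgue norms of a flow measure\<close>

context flow_tree
begin

abbreviation "M \<equiv> flow_measure"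

lemma space_M [simp]: "space M = UNIV" and sets_M [simp]: "sets M = UNIV"
  by (auto simp: flow_measure_def space_point_measure sets_point_measure)

lemma measurable_M [measurable, simp]: "f \<in> M \<rightarrow>\<^sub>M borel"
  by (simp add: flow_measure_def)

text \<open>No point is a null set. Hence essential suprema are suprema, and convergence in L1 will
  imply convergence at every point.\<close>

lemma AE_M [simp]: "(AE x in M. P x) \<longleftrightarrow> (\<forall>x. P x)"
  unfolding flow_measure_def AE_point_measure by (simp add: m_pos)

lemma nn_integral_M: "(\<integral>\<^sup>+x. f x \<partial>M) = (\<integral>\<^sup>+x. ennreal (m x) * f x \<partial>count_space UNIV)"
  by (simp add: flow_measure_def point_measure_def nn_integral_density)

lemma nn_integral_M_finite:
  assumes "finite A" "\<And>x. x \<notin> A \<Longrightarrow> f x = 0"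
  shows "(\<integral>\<^sup>+x. f x \<partial>M) = (\<Sum>x\<in>A. ennreal (m x) * f x)"
  unfolding nn_integral_M using assms by (intro nn_integral_count_space') auto

lemma nn_integral_M_ge_point: "ennreal (m x) * f x \<le> (\<integral>\<^sup>+x. f x \<partial>M)"
  unfolding nn_integral_M by (rule nn_integral_ge_point) simp

abbreviation w :: "'v set \<Rightarrow> real" where "w \<equiv> sum m"

lemma m_nonneg [simp]: "0 \<le> m x" using m_pos[of x] by simp

lemma w_nonneg [simp]: "0 \<le> w A" by (simp add: sum_nonneg)

lemma w_pos: "finite A \<Longrightarrow> A \<noteq> {} \<Longrightarrow> 0 < w A" using m_pos by (simp add: sum_pos)

lemma emeasure_M: "finite A \<Longrightarrow> emeasure M A = ennreal (w A)"
  by (simp add: flow_measure_def emeasure_point_measure_finite2 sum_ennreal)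

lemma measure_M: "finite A \<Longrightarrow> measure M A = w A"
  by (simp add: Sigma_Algebra.measure_def emeasure_M)

lemma integral_M_finite:
  fixes f :: "'v \<Rightarrow> complex"
  assumes "finite A" "\<And>x. x \<notin> A \<Longrightarrow> f x = 0"
  shows "integrable M f" "(LINT x|M. f x) = (\<Sum>x\<in>A. m x *\<^sub>R f x)"
proof -
  have eq: "f = (\<lambda>x. \<Sum>a\<in>A. indicator {a} x *\<^sub>R f a)"
  proof
    fix x
    have "(\<Sum>a\<in>A. indicator {a} x *\<^sub>R f a) = (\<Sum>a\<in>A. if x = a then f a else 0)"
      by (intro sum.cong) auto
    then show "f x = (\<Sum>a\<in>A. indicator {a} x *\<^sub>R f a)" using assms by simp
  qed
  have int: "integrable M (\<lambda>x. indicator {a} x *\<^sub>R f a)" for a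
    by (intro integrable_scaleR_left integrable_real_indicator) (auto simp: emeasure_M)
  show "integrable M f" by (subst eq) (intro Bochner_Integration.integrable_sum int)
  have "(LINT x|M. indicator {a} x *\<^sub>R f a) = m a *\<^sub>R f a" for a
    by (subst integral_scaleR_left) (auto simp: measure_M emeasure_M intro!: integrable_real_indicator)
  then show "(LINT x|M. f x) = (\<Sum>x\<in>A. m x *\<^sub>R f x)"
    by (subst eq, subst Bochner_Integration.integral_sum[OF int]) simp
qed

lemma set_integral_M:
  fixes f :: "'v \<Rightarrow> complex"
  assumes "finite R"
  shows "(LINT x:R|M. f x) = (\<Sum>x\<in>R. m x *\<^sub>R f x)"
  unfolding set_lebesgue_integral_def
  by (subst integral_M_finite(2)[OF assms]) (auto intro!: sum.cong)

lemma average_eq: "finite R \<Longrightarrow> average R f = (\<Sum>x\<in>R. m x *\<^sub>R f x) /\<^sub>R w R"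
  by (simp add: average_def set_integral_M measure_M)

section \<open>Triangle and Hoelder inequalities for Lebesgue norms\<close>

definition power_integral :: "real \<Rightarrow> ('v \<Rightarrow> complex) \<Rightarrow> ennreal" where
  "power_integral p f = (\<integral>\<^sup>+x. ennreal (cmod (f x) powr p) \<partial>M)"

lemma Lp_norm_real: "Lp_norm M (ereal p) f = enn_powr (power_integral p f) (1 / p)"
  by (simp add: Lp_norm_def power_integral_def)

lemma Lp_norm_1: "Lp_norm M 1 f = (\<integral>\<^sup>+x. ennreal (cmod (f x)) \<partial>M)"
  using Lp_norm_real[of 1 f] by (simp add: power_integral_def one_ereal_def)

lemma Lp_norm_real_powr:
  assumes "0 < p" shows "enn_powr (Lp_norm M (ereal p) f) p = power_integral p f"
  using assms by (simp add: Lp_norm_real)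

lemma Lp_norm_infinity_le_iff: "Lp_norm M \<infinity> f \<le> c \<longleftrightarrow> (\<forall>x. ennreal (cmod (f x)) \<le> c)"
proof -
  have "(\<forall>x. ennreal (cmod (f x)) \<le> esssup M (\<lambda>x. ennreal (cmod (f x))))"
    using esssup_AE[of "\<lambda>x. ennreal (cmod (f x))" M] by simp
  moreover have "esssup M (\<lambda>x. ennreal (cmod (f x))) \<le> c" if "\<forall>x. ennreal (cmod (f x)) \<le> c"
    using that by (intro esssup_I) auto
  ultimately show ?thesis by (auto simp: Lp_norm_def intro: order_trans)
qed

lemma Lp_norm_infinity_ge: "ennreal (cmod (f x)) \<le> Lp_norm M \<infinity> f"
  using Lp_norm_infinity_le_iff[of f "Lp_norm M \<infinity> f"] by blast

lemma power_integral_mono: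
  assumes "\<And>x. cmod (f x) \<le> cmod (g x)" "0 \<le> p"
  shows "power_integral p f \<le> power_integral p g"
  unfolding power_integral_def using assms by (intro nn_integral_mono ennreal_leI powr_mono2) auto

lemma Lp_norm_mono:
  assumes "\<And>x. cmod (f x) \<le> cmod (g x)" "1 \<le> p"
  shows "Lp_norm M p f \<le> Lp_norm M p g"
proof (cases p)
  case (real r)
  then show ?thesis using assms by (auto simp: Lp_norm_real intro!: enn_powr_mono power_integral_mono)
next
  case PInf
  have "ennreal (cmod (f x)) \<le> Lp_norm M \<infinity> g" for x
    using ennreal_leI[OF assms(1)[of x]] Lp_norm_infinity_ge[of g x] by (rule order_trans)
  then show ?thesis using PInf by (simp add: Lp_norm_infinity_le_iff)
qed (use assms in simp)

lemma Lp_norm_zero [simp]: "1 \<le> p \<Longrightarrow> Lp_norm M p (\<lambda>x. 0) = 0"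
proof (cases p)
  case PInf
  have "Lp_norm M \<infinity> (\<lambda>x. 0) \<le> 0" by (subst Lp_norm_infinity_le_iff) simp
  then show ?thesis using PInf by simp
qed (auto simp: Lp_norm_real power_integral_def)

lemma power_integral_zero_iff: "power_integral p f = 0 \<longleftrightarrow> (\<forall>x. f x = 0)"
  unfolding power_integral_def by (subst nn_integral_0_iff_AE) (auto simp: ennreal_eq_0_iff)

text \<open>Convexity of the power function with weights \<open>a / (a + b)\<close> and
  \<open>b / (a + b)\<close>. With \<open>a\<close> and \<open>b\<close> the norms of two functions,
  integrating it gives Minkowski's inequality.\<close>

lemma powr_convex_combination:
  fixes x y a b p :: real
  assumes "0 < a" "0 < b" "0 \<le> x" "0 \<le> y" "1 \<le> p"
  shows "(x + y) powr p \<le> (a + b) powr p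
      * (a / (a + b) * (x / a) powr p + b / (a + b) * (y / b) powr p)"
proof -
  have conv: "(s * u + t * v) powr p \<le> s * u powr p + t * v powr p"
    if "0 < s" "0 < t" "s + t = 1" "0 \<le> u" "0 \<le> v" for s t u v
  proof (cases "u = 0 \<or> v = 0")
    case False
    then show ?thesis
      using convex_onD[OF powr_convex[OF assms(5)], of t u v] that by (auto simp: eq_diff_eq[symmetric])
  next
    case True
    \<comment> \<open>If one argument is 0, only \<open>r powr p \<le> r\<close> for weights
      \<open>r\<close> in \<open>(0, 1]\<close> is left.\<close>
    have "r powr p \<le> r" if "0 < r" "r \<le> 1" for r :: real
      using powr_mono'[of 1 p r] that assms(5) by simp
    then have "s powr p \<le> s" "t powr p \<le> t" using that by auto
    then show ?thesis using True that by (auto simp: powr_mult mult_right_mono)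
  qed
  have "(x + y) powr p = ((a + b) * (a / (a + b) * (x / a) + b / (a + b) * (y / b))) powr p"
  proof -
    have "a / (a + b) * (x / a) + b / (a + b) * (y / b) = (x + y) / (a + b)"
      using assms by (simp add: add_divide_distrib)
    then show ?thesis using assms by simp
  qed
  also have "\<dots> = (a + b) powr p * (a / (a + b) * (x / a) + b / (a + b) * (y / b)) powr p"
    by (rule powr_mult)
  also have "\<dots> \<le> (a + b) powr p * (a / (a + b) * (x / a) powr p + b / (a + b) * (y / b) powr p)"
    using assms by (intro mult_left_mono conv) (auto simp: add_divide_distrib[symmetric])
  finally show ?thesis .
qed

lemma Lp_norm_triangle_real:
  assumes p: "1 \<le> p"
  shows "Lp_norm M (ereal p) (\<lambda>x. f x + g x) \<le> Lp_norm M (ereal p) f + Lp_norm M (ereal p) g"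
proof -
  let ?F = "power_integral p f" and ?G = "power_integral p g"
  consider "?F = top \<or> ?G = top" | "?F = 0" | "?G = 0" | "?F \<noteq> top" "?G \<noteq> top" "?F \<noteq> 0" "?G \<noteq> 0"
    by blast
  then show ?thesis
  proof cases
    case 4
    define a b where "a = enn2real (Lp_norm M (ereal p) f)" and "b = enn2real (Lp_norm M (ereal p) g)"
    have ab: "Lp_norm M (ereal p) f = ennreal a" "Lp_norm M (ereal p) g = ennreal b"
      using 4 by (auto simp: a_def b_def Lp_norm_real less_top[symmetric])
    have pos: "0 < a" "0 < b"
      using 4 by (auto simp: a_def b_def Lp_norm_real enn2real_positive_iff less_top[symmetric] zero_less_iff_neq_zero)
    have F: "?F = ennreal (a powr p)" "?G = ennreal (b powr p)"
      using Lp_norm_real_powr[of p f] Lp_norm_real_powr[of p g] p ab pos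
      by (simp_all add: enn_powr_ennreal)
    have "power_integral p (\<lambda>x. f x + g x) \<le> (\<integral>\<^sup>+x.
        ennreal ((a + b) powr p * (a / (a + b) / a powr p)) * ennreal (cmod (f x) powr p) +
        ennreal ((a + b) powr p * (b / (a + b) / b powr p)) * ennreal (cmod (g x) powr p) \<partial>M)"
      unfolding power_integral_def
    proof (rule nn_integral_mono)
      fix x
      have "cmod (f x + g x) powr p \<le> (cmod (f x) + cmod (g x)) powr p"
        using p by (intro powr_mono2 norm_triangle_ineq) auto
      also have "\<dots> \<le> (a + b) powr p
          * (a / (a + b) * (cmod (f x) / a) powr p + b / (a + b) * (cmod (g x) / b) powr p)"
        using pos p by (intro powr_convex_combination) auto
      also have "\<dots> = (a + b) powr p * (a / (a + b) / a powr p) * cmod (f x) powr p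
        + (a + b) powr p * (b / (a + b) / b powr p) * cmod (g x) powr p"
        using pos by (simp add: powr_divide distrib_left)
      finally show "ennreal (cmod (f x + g x) powr p) \<le>
        ennreal ((a + b) powr p * (a / (a + b) / a powr p)) * ennreal (cmod (f x) powr p) +
        ennreal ((a + b) powr p * (b / (a + b) / b powr p)) * ennreal (cmod (g x) powr p)"
        using pos by (simp add: ennreal_mult[symmetric] ennreal_plus[symmetric] ennreal_leI
            del: ennreal_plus)
    qed
    also have "\<dots> = ennreal ((a + b) powr p * (a / (a + b) / a powr p)) * ?F
        + ennreal ((a + b) powr p * (b / (a + b) / b powr p)) * ?G"
      unfolding power_integral_def by (subst nn_integral_add, simp, simp) (simp add: nn_integral_cmult)
    also have "\<dots> = ennreal ((a + b) powr p * (a / (a + b) + b / (a + b)))"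
      using pos unfolding F
      by (simp add: ennreal_mult[symmetric] ennreal_plus[symmetric] distrib_left del: ennreal_plus)
    also have "\<dots> = ennreal ((a + b) powr p)"
      using pos by (simp add: add_divide_distrib[symmetric])
    finally have "Lp_norm M (ereal p) (\<lambda>x. f x + g x) \<le> enn_powr (ennreal ((a + b) powr p)) (1 / p)"
      unfolding Lp_norm_real using p by (intro enn_powr_mono) auto
    also have "\<dots> = ennreal a + ennreal b"
      using pos p by (simp add: enn_powr_ennreal powr_powr)
    finally show ?thesis by (simp add: ab)
  next
    case 1
    then show ?thesis by (auto simp: Lp_norm_real)
  next
    case 2
    then have "f = (\<lambda>x. 0)" by (auto simp: power_integral_zero_iff)
    then show ?thesis using p by simp
  next
    case 3
    then have "g = (\<lambda>x. 0)" by (auto simp: power_integral_zero_iff)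
    then show ?thesis using p by simp
  qed
qed

lemma Lp_norm_uminus [simp]: "Lp_norm M p (\<lambda>x. - f x) = Lp_norm M p f"
  by (simp add: Lp_norm_def)

lemma Lp_norm_triangle:
  assumes p: "1 \<le> p"
  shows "Lp_norm M p (\<lambda>x. f x + g x) \<le> Lp_norm M p f + Lp_norm M p g"
proof (cases p)
  case (real r)
  then show ?thesis using p by (auto intro: Lp_norm_triangle_real)
next
  case PInf
  have "ennreal (cmod (f x + g x)) \<le> Lp_norm M \<infinity> f + Lp_norm M \<infinity> g" for x
  proof -
    have "ennreal (cmod (f x + g x)) \<le> ennreal (cmod (f x)) + ennreal (cmod (g x))"
      by (simp add: ennreal_plus[symmetric] ennreal_leI norm_triangle_ineq del: ennreal_plus)
    also have "\<dots> \<le> Lp_norm M \<infinity> f + Lp_norm M \<infinity> g"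
      by (intro add_mono Lp_norm_infinity_ge)
    finally show ?thesis .
  qed
  then show ?thesis using PInf by (simp add: Lp_norm_infinity_le_iff)
qed (use p in simp)

lemma Lp_norm_triangle_diff:
  assumes "1 \<le> p"
  shows "Lp_norm M p (f - g) \<le> Lp_norm M p f + Lp_norm M p g"
  using Lp_norm_triangle[OF assms, of f "\<lambda>x. - g x"] by (simp add: fun_diff_def)

text \<open>Formulated with conjugate exponents in \<open>ereal\<close>, where
  \<open>1 / \<infinity> = 0\<close>, so that the endpoints 1 and \<infinity> are covered by the
  same statement.\<close>

lemma Lp_Holder:
  assumes pq: "1 \<le> p" "1 \<le> q" "1 / p + 1 / q = (1::ereal)"
  shows "(\<integral>\<^sup>+x. ennreal (cmod (f x * g x)) \<partial>M) \<le> Lp_norm M p f * Lp_norm M q g"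
proof -
  have inf: "(\<integral>\<^sup>+x. ennreal (cmod (f x * g x)) \<partial>M) \<le> Lp_norm M 1 f * Lp_norm M \<infinity> g" for f g
  proof -
    have "(\<integral>\<^sup>+x. ennreal (cmod (f x * g x)) \<partial>M) \<le> (\<integral>\<^sup>+x. ennreal (cmod (f x)) * Lp_norm M \<infinity> g \<partial>M)"
      by (intro nn_integral_mono) (auto simp: norm_mult ennreal_mult
          intro!: mult_left_mono Lp_norm_infinity_ge)
    then show ?thesis by (simp add: nn_integral_multc Lp_norm_1)
  qed
  show ?thesis
  proof (cases p; cases q)
    fix r s assume rs: "p = ereal r" "q = ereal s"
    have "1 \<le> r" "1 \<le> s" using pq rs by auto
    moreover have eq: "1 / r + 1 / s = 1"
      using pq rs \<open>1 \<le> r\<close> \<open>1 \<le> s\<close> by (auto simp: one_ereal_def)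
    ultimately have "1 < r" "1 < s" by (auto simp: less_le)
    then have "(\<integral>\<^sup>+x. ennreal (cmod (f x)) * ennreal (cmod (g x)) \<partial>M) \<le>
      enn_powr (\<integral>\<^sup>+x. enn_powr (ennreal (cmod (f x))) r \<partial>M) (1 / r) *
      enn_powr (\<integral>\<^sup>+x. enn_powr (ennreal (cmod (g x))) s \<partial>M) (1 / s)"
      using eq by (intro nn_integral_Holder) auto
    then show ?thesis
      by (simp add: rs Lp_norm_real power_integral_def enn_powr_ennreal norm_mult ennreal_mult)
  next
    fix r assume "p = ereal r" "q = \<infinity>"
    moreover have "r = 1" using pq \<open>p = ereal r\<close> \<open>q = \<infinity>\<close> by (auto simp: one_ereal_def)
    ultimately show ?thesis using inf[of f g] by (simp add: one_ereal_def)
  next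
    fix r assume "q = ereal r" "p = \<infinity>"
    moreover have "r = 1" using pq \<open>q = ereal r\<close> \<open>p = \<infinity>\<close> by (auto simp: one_ereal_def)
    ultimately show ?thesis using inf[of g f] by (simp add: one_ereal_def mult.commute)
  qed (use pq in auto)
qed

end

section \<open>Doubling and trapezoids\<close>

locale doubling_flow_tree = flow_tree adj \<omega> m
  for adj :: "'v \<Rightarrow> 'v \<Rightarrow> bool" and \<omega> :: "nat \<Rightarrow> 'v" and m :: "'v \<Rightarrow> real" +
  assumes doubling: locally_doubling
begin

text \<open>Doubling is applied at radius \<open>1 / 2\<close>: there the ball is a point, while the
  ball of radius 1 contains the parent and the sons. Each son has mass at least
  \<open>m x / C\<close>, and finitely many of them have together at most \<open>C * m x\<close>, so
  there are at most \<open>C * C\<close> sons.\<close>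

lemma m_par_bound:
  "\<exists>C\<ge>1. (\<forall>x. m (par x) \<le> C * m x) \<and> (\<forall>x. finite (sons x))"
proof -
  obtain C :: real where C: "1 < C" "\<And>x. emeasure M {y. real (dst x y) \<le> 2 * (1/2)}
       \<le> ennreal C * emeasure M {y. real (dst x y) \<le> 1/2}"
    using doubling unfolding locally_doubling_def by (metis half_gt_zero_iff zero_less_one)
  have ball0: "{y. real (dst x y) \<le> 1/2} = {x}" for x
  proof -
    have "real n \<le> 1/2 \<longleftrightarrow> n = 0" for n by (cases n) auto
    then show ?thesis by auto
  qed
  have ball: "emeasure M {y. dst x y \<le> 1} \<le> ennreal (C * m x)" for x
  proof -
    have "{y. real (dst x y) \<le> 2 * (1/2)} = {y. dst x y \<le> 1}" by auto
    then show ?thesis using C(2)[of x] C(1) unfolding ball0 by (simp add: emeasure_M ennreal_mult)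
  qed
  have le: "w F \<le> C * m x" if "finite F" "\<And>y. y \<in> F \<Longrightarrow> dst x y \<le> 1" for F x
  proof -
    have "ennreal (w F) \<le> emeasure M {y. dst x y \<le> 1}"
      using that by (subst emeasure_M[symmetric]) (auto intro!: emeasure_mono)
    also note ball
    finally show ?thesis using C by (simp add: ennreal_le_iff)
  qed
  have adj1: "dst x y \<le> 1" if "adj x y" for x y
    using dst_adj_le[OF that, of y] by simp
  have 1: "m (par x) \<le> C * m x" for x using le[of "{par x}" x] adj1[OF adj_par] by simp
  have "finite (sons x)" for x
  proof (rule ccontr)
    assume inf: "infinite (sons x)"
    obtain n :: nat where n: "C * C < real n" using reals_Archimedean2 by blast
    obtain F where F: "F \<subseteq> sons x" "finite F" "card F = n"
      using infinite_arbitrarily_large[OF inf] by blast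
    have "real n * m x \<le> (\<Sum>y\<in>F. C * m y)"
      using F 1 by (subst F(3)[symmetric]) (intro sum_bounded_below, auto simp: sons_eq)
    also have "\<dots> = C * w F" by (simp add: sum_distrib_left)
    also have "\<dots> \<le> C * (C * m x)"
    proof (intro mult_left_mono le)
      show "dst x y \<le> 1" if "y \<in> F" for y using that F by (intro adj1) (auto simp: sons_def)
    qed (use F C in auto)
    finally have "real n * m x \<le> (C * C) * m x" by simp
    then show False using n m_pos[of x] by simp
  qed
  then show ?thesis using 1 C(1) by (intro exI[of _ C]) auto
qed

lemma finite_sons: "finite (sons x)"
  using m_par_bound by blast

lemma w_sons: "w (sons x) = m x"
  using flow[of x] has_sum_finite[OF finite_sons[of x], of m] has_sum_unique by blast

lemma m_le_par: "m x \<le> m (par x)"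
  unfolding w_sons[of "par x", symmetric]
  using finite_sons by (intro member_le_sum) (auto simp: sons_eq)

text \<open>The flow identity iterated: mass is conserved from one generation to the next.\<close>

lemma finite_desc: "finite (desc k x)" and w_desc: "w (desc k x) = m x"
proof -
  have "finite (desc k x) \<and> w (desc k x) = m x"
  proof (induction k arbitrary: x)
    case (Suc k)
    have "w (desc (Suc k) x) = (\<Sum>y\<in>sons x. w (desc k y))"
      unfolding desc_Suc using Suc finite_sons desc_disjoint by (intro sum.UNION_disjoint) auto
    then show ?case using Suc finite_sons w_sons by (auto simp: desc_Suc)
  qed simp
  then show "finite (desc k x)" "w (desc k x) = m x" by auto
qed

lemma finite_trapezoid: "finite (trapezoid h h' x)"
proof -
  have "{k. h \<le> int k \<and> int k < h'} \<subseteq> {..nat h'}" by auto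
  then have "finite {k. h \<le> int k \<and> int k < h'}" by (rule finite_subset) simp
  then show ?thesis by (auto simp: trapezoid_eq finite_desc)
qed

lemma w_trapezoid:
  assumes "0 \<le> h" "h \<le> h'"
  shows "w (trapezoid h h' x) = real_of_int (h' - h) * m x"
proof -
  have eq: "{k. h \<le> int k \<and> int k < h'} = {nat h..<nat h'}" using assms by auto
  have "w (trapezoid h h' x) = (\<Sum>k\<in>{nat h..<nat h'}. w (desc k x))"
    unfolding trapezoid_eq eq using finite_desc desc_disjoint by (intro sum.UNION_disjoint) auto
  then show ?thesis using assms by (simp add: w_desc of_nat_diff)
qed

text \<open>Lowering the apex by one level lowers both heights by one. This changes their ratio, so
  a recursion through the sons needs some room in the admissible ratios.\<close>

lemma trapezoid_sons:
  "1 \<le> h \<Longrightarrow> trapezoid h h' x = (\<Union>y\<in>sons x. trapezoid (h - 1) (h' - 1) y)"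
proof (intro set_eqI iffI)
  fix z assume h: "1 \<le> h" and "z \<in> trapezoid h h' x"
  then obtain k where k: "h \<le> int k" "int k < h'" "z \<in> desc k x" by (auto simp: trapezoid_eq)
  then obtain j where j: "k = Suc j" using h by (cases k) auto
  then obtain y where "y \<in> sons x" "z \<in> desc j y" using k by (auto simp: desc_Suc)
  then show "z \<in> (\<Union>y\<in>sons x. trapezoid (h - 1) (h' - 1) y)"
    using k j by (auto simp: trapezoid_eq intro!: bexI[of _ y] exI[of _ j])
next
  fix z assume "z \<in> (\<Union>y\<in>sons x. trapezoid (h - 1) (h' - 1) y)"
  then obtain y j where "y \<in> sons x" "z \<in> desc j y" "h - 1 \<le> int j" "int j < h' - 1"
    by (auto simp: trapezoid_eq)
  then show "z \<in> trapezoid h h' x"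
    by (auto simp: trapezoid_eq desc_Suc intro!: exI[of _ "Suc j"])
qed

lemma trapezoid_split:
  "h \<le> h' \<Longrightarrow> h' \<le> h'' \<Longrightarrow> trapezoid h h'' x = trapezoid h h' x \<union> trapezoid h' h'' x"
  by (auto simp: trapezoid_def)

lemma trapezoid_disjoint:
  "h' \<le> l \<Longrightarrow> trapezoid h h' x \<inter> trapezoid l l' x = {}"
  by (auto simp: trapezoid_def)

lemma trapezoid_sons_disjoint:
  assumes "y \<in> sons x" "z \<in> sons x" "y \<noteq> z"
  shows "trapezoid h h' y \<inter> trapezoid h h' z = {}"
proof -
  have "level y = level z" using assms by (simp add: sons_def)
  have False if v: "v \<in> desc j y" "v \<in> desc k z" for v j k
  proof -
    have "j = k" using level_desc[OF v(1)] level_desc[OF v(2)] \<open>level y = level z\<close> by linarith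
    then show False using desc_disjoint[of j y j z] assms v by auto
  qed
  then show ?thesis by (auto simp: trapezoid_eq)
qed

lemma trapezoid_nonempty:
  assumes "0 \<le> h" "h < h'"
  shows "trapezoid h h' x \<noteq> {}"
  using w_trapezoid[of h h' x] assms m_pos[of x] by auto

end

section \<open>Dyadic grids of trapezoids and an exhaustion of the tree\<close>

text \<open>A dyadic grid below one set: a finite hierarchy of partitions in which every composite
  member belongs to \<open>\<A>\<close>, every child has at least the fraction \<open>1 / D\<close>
  of the mass of its parent, and the leaves are singletons. Induction over it is the descent of a
  stopping-time argument.\<close>

inductive dyadic_set :: "('a set \<Rightarrow> real) \<Rightarrow> 'a set set \<Rightarrow> real \<Rightarrow> 'a set \<Rightarrow> bool" for w \<A> D where
  singleton: "dyadic_set w \<A> D {x}"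
| union: "finite \<C> \<Longrightarrow> (\<And>c. c \<in> \<C> \<Longrightarrow> dyadic_set w \<A> D c) \<Longrightarrow> disjoint \<C> \<Longrightarrow>
    (\<And>c. c \<in> \<C> \<Longrightarrow> w (\<Union>\<C>) \<le> D * w c) \<Longrightarrow> \<Union>\<C> \<in> \<A> \<Longrightarrow> \<Union>\<C> \<noteq> {} \<Longrightarrow> dyadic_set w \<A> D (\<Union>\<C>)"

context doubling_flow_tree
begin

lemma trapezoid_admissible:
  assumes "1 \<le> h" "2 * h \<le> h'" "real_of_int h' \<le> \<beta> * real_of_int h"
  shows "trapezoid h h' x \<in> admissible \<beta>"
proof -
  have "h < h'" using assms by linarith
  moreover have "2 \<le> real_of_int h' / real_of_int h" "real_of_int h' / real_of_int h \<le> \<beta>"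
    using assms by (auto simp: field_simps)
  ultimately show ?thesis using assms(1) unfolding admissible_def by blast
qed

text \<open>If \<open>h' \<ge> 4 * h\<close>, the levels are cut at \<open>2 * h\<close>. Otherwise
  the sons take over with heights \<open>h - 1\<close> and \<open>h' - 1\<close>, whose ratio may
  grow but stays at most 8 because \<open>h' < 4 * h\<close> and \<open>h \<ge> 2\<close>. For
  \<open>h = 1\<close> at most two levels remain, and these are split into points.\<close>

lemma dyadic_trapezoids:
  assumes \<beta>: "8 \<le> \<beta>"
  obtains D where "1 \<le> D" "\<And>h h' x. 1 \<le> h \<Longrightarrow> 2 * h \<le> h' \<Longrightarrow> h' \<le> 8 * h \<Longrightarrow>
    dyadic_set w (admissible \<beta>) D (trapezoid h h' x)"
proof -
  obtain C where C: "1 \<le> C" "\<And>x. m (par x) \<le> C * m x" using m_par_bound by blast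
  \<comment> \<open>A cut compares at most \<open>7 * h\<close> levels with at least
    \<open>h\<close> levels, the sons lose a factor \<open>C\<close>, and in the last case mass at
    most \<open>2 * m x\<close> is compared with a point at depth at most 2, whose mass is at least
    \<open>m x / (C * C)\<close>.\<close>
  define D where "D = 7 + 2 * C * C"
  have "C \<le> C * C" using mult_left_mono[OF C(1), of C] C(1) by linarith
  then have D: "7 \<le> D" "C \<le> D" "2 * C * C \<le> D"
    using C(1) unfolding D_def mult.assoc by linarith+
  have adm: "trapezoid h h' x \<in> admissible \<beta>" if "1 \<le> h" "2 * h \<le> h'" "h' \<le> 8 * h" for h h' x
  proof (rule trapezoid_admissible)
    have "real_of_int h' \<le> 8 * real_of_int h" using that(3) by linarith
    also have "\<dots> \<le> \<beta> * real_of_int h" using \<beta> that by (intro mult_right_mono) auto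
    finally show "real_of_int h' \<le> \<beta> * real_of_int h" .
  qed (use that in auto)
  have "dyadic_set w (admissible \<beta>) D (trapezoid h h' x)"
    if "1 \<le> h" "2 * h \<le> h'" "h' \<le> 8 * h" for h h' x
    using that
  \<comment> \<open>The quantity \<open>2 * h' - h\<close> decreases for both parts of a cut and
    drops by one for the sons.\<close>
  proof (induction "nat (2 * h' - h)" arbitrary: h h' x rule: less_induct)
    case less
    have adm: "trapezoid h h' x \<in> admissible \<beta>" using less.prems by (intro adm) auto
    have ne: "trapezoid h h' x \<noteq> {}" using less.prems by (intro trapezoid_nonempty) auto
    have wR: "w (trapezoid h h' x) = real_of_int (h' - h) * m x"
      using less.prems by (intro w_trapezoid) auto
    consider "4 * h \<le> h'" | "h' < 4 * h" "2 \<le> h" | "h' < 4 * h" "h = 1" using less.prems by linarith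
    then show ?case
    proof cases
      case 1
      let ?C = "{trapezoid h (2 * h) x, trapezoid (2 * h) h' x}"
      have eq: "\<Union>?C = trapezoid h h' x"
        using trapezoid_split[of h "2 * h" h' x] less.prems by auto
      have "dyadic_set w (admissible \<beta>) D (\<Union>?C)"
      proof (rule dyadic_set.union)
        show "disjoint ?C"
          using trapezoid_disjoint[of "2*h" "2*h" h x h'] by (auto simp: pairwise_def disjnt_def)
        show "dyadic_set w (admissible \<beta>) D c" if "c \<in> ?C" for c
          using that less.prems 1 by (auto intro!: less.hyps)
        show "w (\<Union>?C) \<le> D * w c" if c: "c \<in> ?C" for c
        proof -
          have "real_of_int h * m x \<le> w c"
            using that 1 less.prems w_trapezoid[of h "2 * h" x] w_trapezoid[of "2 * h" h' x]
            by (auto intro!: mult_right_mono)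
          then have "7 * (real_of_int h * m x) \<le> D * w c"
            using D less.prems by (intro mult_mono) auto
          moreover have "real_of_int (h' - h) * m x \<le> (7 * real_of_int h) * m x"
            using less.prems by (intro mult_right_mono) auto
          ultimately show ?thesis unfolding eq wR by simp
        qed
      qed (use adm ne eq in auto)
      then show ?thesis unfolding eq .
    next
      case 2
      let ?C = "(\<lambda>y. trapezoid (h - 1) (h' - 1) y) ` sons x"
      have eq: "\<Union>?C = trapezoid h h' x"
        using trapezoid_sons[of h h' x] less.prems by simp
      have "dyadic_set w (admissible \<beta>) D (\<Union>?C)"
      proof (rule dyadic_set.union)
        show "disjoint ?C"
          using trapezoid_sons_disjoint unfolding pairwise_def disjnt_def by blast
        show "dyadic_set w (admissible \<beta>) D c" if "c \<in> ?C" for c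
          using that less.prems 2 by (auto intro!: less.hyps)
        show "w (\<Union>?C) \<le> D * w c" if c: "c \<in> ?C" for c
        proof -
          obtain y where y: "y \<in> sons x" "c = trapezoid (h - 1) (h' - 1) y" using c by auto
          have "m x \<le> D * m y"
            using C(2)[of y] y(1) D m_nonneg[of y] mult_right_mono[of C D "m y"] by (auto simp: sons_eq)
          then have "real_of_int (h' - h) * m x \<le> real_of_int (h' - h) * (D * m y)"
            using less.prems by (intro mult_left_mono) auto
          moreover have "w c = real_of_int (h' - h) * m y"
            using y w_trapezoid[of "h - 1" "h' - 1" y] 2 less.prems by simp
          ultimately show ?thesis unfolding eq wR by (simp add: mult_ac)
        qed
      qed (use adm ne eq finite_sons in auto)
      then show ?thesis unfolding eq .
    next
      case 3
      let ?C = "(\<lambda>y. {y}) ` trapezoid h h' x"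
      have eq: "\<Union>?C = trapezoid h h' x" by auto
      have "dyadic_set w (admissible \<beta>) D (\<Union>?C)"
      proof (rule dyadic_set.union)
        show "disjoint ?C" by (auto simp: pairwise_def disjnt_def)
        show "dyadic_set w (admissible \<beta>) D c" if "c \<in> ?C" for c
          using that by (auto intro: dyadic_set.singleton)
        show "w (\<Union>?C) \<le> D * w c" if c: "c \<in> ?C" for c
        proof -
          obtain y k where y: "y \<in> desc k x" "c = {y}" "1 \<le> k" "k < 3"
            using c 3 by (auto simp: trapezoid_eq)
          have "m x \<le> C * C * m y"
          proof -
            consider "k = 1" | "k = 2" using y by linarith
            then show ?thesis
            proof cases
              case 1
              then have "m x \<le> C * m y" using y C(2)[of y] by (simp add: desc_def)
              also have "\<dots> \<le> C * C * m y" using C(1) by (intro mult_right_mono) auto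
              finally show ?thesis .
            next
              case 2
              then have "x = par (par y)" using y by (simp add: desc_def numeral_2_eq_2)
              then have "m x \<le> C * m (par y)" using C(2)[of "par y"] by simp
              also have "\<dots> \<le> C * (C * m y)" using C by (intro mult_left_mono) auto
              finally show ?thesis by simp
            qed
          qed
          then have "2 * m x \<le> 2 * C * C * m y" by simp
          also have "\<dots> \<le> D * m y" using D by (intro mult_right_mono) auto
          finally have "2 * m x \<le> D * w c" using y by simp
          moreover have "real_of_int (h' - h) * m x \<le> 2 * m x"
            using 3 by (intro mult_right_mono) auto
          ultimately show ?thesis unfolding eq wR by simp
        qed
      qed (use adm ne finite_trapezoid in auto)
      then show ?thesis unfolding eq .
    qed
  qed
  then show ?thesis using D by (intro that[of D]) auto
qed

lemma m_ray_ge: "m (\<omega> 0) \<le> m (\<omega> n)"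
proof (induction n)
  case (Suc n)
  then show ?case using m_le_par[of "\<omega> n"] by (simp add: par_ray)
qed simp

text \<open>With \<open>N = n + 1\<close>: the descendants of \<open>\<omega> (2 * N)\<close> at
  levels above \<open>- 6 * N\<close> and up to \<open>N\<close>. The ratio 8 of the heights
  provides a dyadic grid, and since the apex rises by two levels per step, the window of levels
  grows in both directions.\<close>

definition exhaustion :: "nat \<Rightarrow> 'v set" where
  "exhaustion n = trapezoid (int (Suc n)) (8 * int (Suc n)) (\<omega> (2 * Suc n))"

lemma finite_exhaustion: "finite (exhaustion n)"
  by (simp add: exhaustion_def finite_trapezoid)

lemma exhaustion_mono: "n \<le> k \<Longrightarrow> exhaustion n \<subseteq> exhaustion k"
proof
  fix x assume nk: "n \<le> k" and x: "x \<in> exhaustion n"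
  then obtain j where j: "(par ^^ j) x = \<omega> (2 * Suc n)"
    by (auto simp: exhaustion_def trapezoid_def below_iff)
  have "(par ^^ (2 * (k - n) + j)) x = \<omega> (2 * Suc n + 2 * (k - n))"
    by (simp add: funpow_add j par_pow_ray del: funpow.simps)
  also have "2 * Suc n + 2 * (k - n) = 2 * Suc k" using nk by simp
  finally have "below x (\<omega> (2 * Suc k))" unfolding below_iff by blast
  then show "x \<in> exhaustion k"
    using x nk by (auto simp: exhaustion_def trapezoid_def)
qed

lemma exhaustion_eventually: "\<exists>N. \<forall>n\<ge>N. x \<in> exhaustion n"
proof -
  obtain N where N: "\<And>n. N \<le> n \<Longrightarrow> below x (\<omega> n)" using eventually_below_ray by blast
  show ?thesis
  proof (intro exI allI impI)
    fix n assume n: "N + nat \<bar>level x\<bar> \<le> n"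
    then have "below x (\<omega> (2 * Suc n))" by (intro N) auto
    then show "x \<in> exhaustion n" using n by (auto simp: exhaustion_def trapezoid_def)
  qed
qed

text \<open>The masses are unbounded, so a finitely supported function has arbitrarily small mean
  modulus on a large member of the exhaustion.\<close>

lemma w_exhaustion_ge: "real n * m (\<omega> 0) \<le> w (exhaustion n)"
proof -
  have "real n * m (\<omega> 0) \<le> (7 * real (Suc n)) * m (\<omega> (2 * Suc n))"
    by (intro mult_mono m_ray_ge) auto
  also have "\<dots> = w (exhaustion n)"
    unfolding exhaustion_def by (subst w_trapezoid) auto
  finally show ?thesis .
qed

lemma finite_admissible: "R \<in> admissible \<beta> \<Longrightarrow> finite R"
  by (auto simp: admissible_def finite_trapezoid)

lemma admissible_nonempty: "{} \<notin> admissible \<beta>"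
proof
  assume "{} \<in> admissible \<beta>"
  then obtain h h' x where "1 \<le> h" "h < h'" "trapezoid h h' x = {}"
    by (force simp: admissible_def)
  then show False using trapezoid_nonempty[of h h' x] by simp
qed

end

section \<open>The atomic Hardy space and \<open>BMO\<close>\<close>

lemma norm_sums_le_suminf:
  fixes f :: "nat \<Rightarrow> 'b :: banach"
  assumes "f sums s"
  shows "ennreal (norm s) \<le> (\<Sum>j. ennreal (norm (f j)))"
proof (cases "(\<Sum>j. ennreal (norm (f j))) = top")
  case False
  then have sm: "summable (\<lambda>j. norm (f j))" by (intro summable_suminf_not_top) auto
  have "norm s \<le> (\<Sum>j. norm (f j))"
    using summable_norm[OF sm] assms by (simp add: sums_iff)
  then show ?thesis by (subst suminf_ennreal2[OF _ sm]) (auto intro: ennreal_leI)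
qed simp

text \<open>Absolute convergence along the enumeration of pairs allows summing by rows. It is needed
  because an atomic decomposition is a single sequence, so a series of decompositions has to be
  re-enumerated.\<close>

lemma sums_prod_decode:
  fixes F :: "nat \<times> nat \<Rightarrow> 'b :: {second_countable_topology, banach}"
  assumes norm: "summable (\<lambda>i. norm (F (prod_decode i)))"
    and inner: "\<And>k. (\<lambda>j. F (k, j)) sums s k" and outer: "s sums T"
  shows "(\<lambda>i. F (prod_decode i)) sums T"
proof -
  define a where "a = (\<Sum>i. F (prod_decode i))"
  have sa: "(\<lambda>i. F (prod_decode i)) sums a"
    unfolding a_def by (intro summable_sums summable_norm_cancel[OF norm])
  have "((\<lambda>i. F (prod_decode i)) has_sum a) UNIV"
    by (rule norm_summable_imp_has_sum[OF norm sa])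
  then have F: "(F has_sum a) UNIV"
    using has_sum_reindex_bij_betw[OF bij_prod_decode, of F a] by simp
  have "(\<lambda>i. norm (F (prod_decode i))) summable_on UNIV"
    using norm by (simp add: summable_on_UNIV_nonneg_real_iff)
  then have "(\<lambda>p. norm (F p)) summable_on (Sigma UNIV (\<lambda>_. UNIV))"
    using summable_on_reindex_bij_betw[OF bij_prod_decode, of "\<lambda>p. norm (F p)"]
    unfolding UNIV_Times_UNIV by blast
  then have abs: "(\<lambda>j. norm (F (k, j))) summable_on UNIV" for k
    using Infinite_Sum.abs_summable_on_Sigma_iff[where f = F and A = UNIV and B = "\<lambda>_. UNIV"] by blast
  have "((\<lambda>j. F (k, j)) has_sum s k) UNIV" for k
  proof -
    obtain b where b: "((\<lambda>j. F (k, j)) has_sum b) UNIV"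
      using abs_summable_summable[OF abs[of k]] by (auto simp: summable_on_def)
    then have "(\<lambda>j. F (k, j)) sums b" by (rule has_sum_imp_sums)
    then have "b = s k" using inner[of k] by (rule sums_unique2)
    then show ?thesis using b by simp
  qed
  then have "(s has_sum a) UNIV"
    using F by (intro has_sum_Sigma[where f = F and a = a and A = UNIV and B = "\<lambda>_. UNIV"]) (auto
        intro: uniformly_continuous_add)
  then have "s sums a" by (rule has_sum_imp_sums)
  then have "a = T" using outer by (rule sums_unique2)
  with sa show ?thesis by simp
qed

context doubling_flow_tree
begin

section \<open>Atoms and atomic decompositions\<close>

lemma atomI:
  assumes R: "R \<in> admissible \<beta>" and supp: "\<And>x. x \<notin> R \<Longrightarrow> a x = 0"
    and bound: "\<And>x. cmod (a x) \<le> 1 / w R" and mean: "(\<Sum>x\<in>R. m x *\<^sub>R a x) = 0"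
  shows "atom \<beta> a"
proof -
  have fin: "finite R" "0 < w R" using finite_admissible[OF R] admissible_nonempty R w_pos by metis+
  have "Lp_norm M \<infinity> a \<le> inverse (emeasure M R)"
    unfolding Lp_norm_infinity_le_iff
    using bound fin by (auto simp: emeasure_M inverse_ennreal divide_inverse intro!: ennreal_leI)
  then show ?thesis unfolding atom_def using R supp mean set_integral_M[OF fin(1), of a] by auto
qed

lemma atomE:
  assumes "atom \<beta> a"
  obtains R where "R \<in> admissible \<beta>" "finite R" "0 < w R" "\<And>x. x \<notin> R \<Longrightarrow> a x = 0"
    "\<And>x. cmod (a x) \<le> 1 / w R" "(\<Sum>x\<in>R. m x *\<^sub>R a x) = 0"
proof -
  obtain R where R: "R \<in> admissible \<beta>" "\<forall>x. x \<notin> R \<longrightarrow> a x = 0"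
    "Lp_norm M \<infinity> a \<le> inverse (emeasure M R)" "(LINT x:R|M. a x) = 0"
    using assms unfolding atom_def by blast
  have fin: "finite R" "0 < w R"
    using finite_admissible[OF R(1)] admissible_nonempty R(1) w_pos by metis+
  have "cmod (a x) \<le> 1 / w R" for x
  proof -
    have "ennreal (cmod (a x)) \<le> ennreal (1 / w R)"
      using R(3) fin unfolding Lp_norm_infinity_le_iff
      by (simp add: emeasure_M inverse_ennreal divide_inverse)
    then show ?thesis using fin by (subst (asm) ennreal_le_iff) auto
  qed
  then show ?thesis using that R fin set_integral_M[OF fin(1), of a] by auto
qed

lemma atom_L1: "atom \<beta> a \<Longrightarrow> Lp_norm M 1 a \<le> 1"
proof (elim atomE)
  fix R assume R: "finite R" "0 < w R" "\<And>x. x \<notin> R \<Longrightarrow> a x = 0" "\<And>x. cmod (a x) \<le> 1 / w R"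
  have "Lp_norm M 1 a = (\<Sum>x\<in>R. ennreal (m x) * ennreal (cmod (a x)))"
    unfolding Lp_norm_1 using R by (intro nn_integral_M_finite) auto
  also have "\<dots> \<le> (\<Sum>x\<in>R. ennreal (m x) * ennreal (1 / w R))"
    using R by (intro sum_mono mult_left_mono ennreal_leI) auto
  also have "\<dots> = (\<Sum>x\<in>R. ennreal (m x * (1 / w R)))"
    using R by (intro sum.cong refl ennreal_mult[symmetric]) auto
  also have "\<dots> = ennreal (\<Sum>x\<in>R. m x * (1 / w R))"
    using R by (intro sum_ennreal) auto
  also have "(\<Sum>x\<in>R. m x * (1 / w R)) = 1"
    using R by (simp add: sum_divide_distrib[symmetric])
  finally show ?thesis by simp
qed

lemma atom_zero: "atom \<beta> (\<lambda>x. 0)"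
proof (rule atomI)
  show "{undefined} \<in> admissible \<beta>" by (auto simp: admissible_def)
qed auto

lemma L1_sums_le:
  assumes "\<And>x. (\<lambda>j. h j x) sums g x"
  shows "Lp_norm M 1 g \<le> (\<Sum>j. Lp_norm M 1 (h j))"
proof -
  have "Lp_norm M 1 g \<le> (\<integral>\<^sup>+x. (\<Sum>j. ennreal (cmod (h j x))) \<partial>M)"
    unfolding Lp_norm_1 using assms by (intro nn_integral_mono norm_sums_le_suminf)
  also have "\<dots> = (\<Sum>j. Lp_norm M 1 (h j))"
    unfolding Lp_norm_1 by (rule nn_integral_suminf) simp
  finally show ?thesis .
qed

lemma L1_cmult_atom:
  assumes "atom \<beta> a"
  shows "Lp_norm M 1 (\<lambda>x. c * a x) \<le> ennreal (cmod c)"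
proof -
  have "Lp_norm M 1 (\<lambda>x. c * a x) = ennreal (cmod c) * Lp_norm M 1 a"
    unfolding Lp_norm_1 by (simp add: norm_mult ennreal_mult nn_integral_cmult)
  also have "\<dots> \<le> ennreal (cmod c) * 1" by (intro mult_left_mono atom_L1[OF assms]) simp
  finally show ?thesis by simp
qed

text \<open>Atoms have L1 norm at most 1, so the tails of the coefficient series bound the
  remainders in L1; convergence at every point then suffices to identify the sum.\<close>

lemma atomic_decompI:
  assumes at: "\<And>j. atom \<beta> (a j)" and sm: "summable (\<lambda>j. cmod (c j))"
    and sums: "\<And>x. (\<lambda>j. c j * a j x) sums g x"
  shows "atomic_decomp \<beta> g c a"
proof -
  have tail: "Lp_norm M 1 (\<lambda>x. g x - (\<Sum>j<n. c j * a j x)) \<le> ennreal (\<Sum>j. cmod (c (j + n)))" for n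
  proof -
    have "(\<lambda>j. c (j + n) * a (j + n) x) sums (g x - (\<Sum>j<n. c j * a j x))" for x
      using sums[of x] by (subst sums_iff_shift') simp
    then have "Lp_norm M 1 (\<lambda>x. g x - (\<Sum>j<n. c j * a j x))
        \<le> (\<Sum>j. Lp_norm M 1 (\<lambda>x. c (j + n) * a (j + n) x))"
      by (rule L1_sums_le)
    also have "\<dots> \<le> (\<Sum>j. ennreal (cmod (c (j + n))))"
      by (intro suminf_le L1_cmult_atom[OF at]) auto
    also have "\<dots> = ennreal (\<Sum>j. cmod (c (j + n)))"
      using sm by (intro suminf_ennreal2) (auto simp: summable_iff_shift[of "\<lambda>j. cmod (c j)"])
    finally show ?thesis .
  qed
  have "(\<lambda>n. Lp_norm M 1 (\<lambda>x. g x - (\<Sum>j<n. c j * a j x))) \<longlonglongrightarrow> 0"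
  proof (rule tendsto_sandwich[OF _ _ tendsto_const])
    have "(\<lambda>n. \<Sum>j. cmod (c (j + n))) \<longlonglongrightarrow> 0" by (rule suminf_exist_split2[OF sm])
    then show "(\<lambda>n. ennreal (\<Sum>j. cmod (c (j + n)))) \<longlonglongrightarrow> 0"
      using sm by (subst ennreal_tendsto_0_iff) (auto intro!: suminf_nonneg
          simp: summable_iff_shift[of "\<lambda>j. cmod (c j)"])
  qed (use tail in auto)
  moreover have "Lp_norm M 1 g < top" using tail[of 0] by (auto intro: le_less_trans)
  ultimately show ?thesis unfolding atomic_decomp_def using at sm by blast
qed

text \<open>The error at \<open>x\<close> enters the L1 norm with the positive weight
  \<open>m x\<close>, so it tends to 0 as well.\<close>

lemma atomic_decomp_sums:
  assumes "atomic_decomp \<beta> g c a"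
  shows "(\<lambda>j. c j * a j x) sums g x"
proof -
  have lim: "(\<lambda>n. Lp_norm M 1 (\<lambda>x. g x - (\<Sum>j<n. c j * a j x))) \<longlonglongrightarrow> 0"
    using assms by (simp add: atomic_decomp_def)
  have "(\<lambda>n. ennreal (m x * cmod (g x - (\<Sum>j<n. c j * a j x)))) \<longlonglongrightarrow> 0"
  proof (rule tendsto_sandwich[OF _ _ tendsto_const lim])
    have "ennreal (m x * cmod (g x - (\<Sum>j<n. c j * a j x)))
      \<le> Lp_norm M 1 (\<lambda>x. g x - (\<Sum>j<n. c j * a j x))" for n
      unfolding Lp_norm_1
      using nn_integral_M_ge_point[of x "\<lambda>x. ennreal (cmod (g x - (\<Sum>j<n. c j * a j x)))"]
      by (simp add: ennreal_mult)
    then show "eventually (\<lambda>n. ennreal (m x * cmod (g x - (\<Sum>j<n. c j * a j x)))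
      \<le> Lp_norm M 1 (\<lambda>x. g x - (\<Sum>j<n. c j * a j x))) sequentially" by simp
  qed simp
  then have "(\<lambda>n. m x * cmod (g x - (\<Sum>j<n. c j * a j x))) \<longlonglongrightarrow> 0"
    by (subst (asm) ennreal_tendsto_0_iff) auto
  then have "(\<lambda>n. (1 / m x) * (m x * cmod (g x - (\<Sum>j<n. c j * a j x)))) \<longlonglongrightarrow> (1 / m x) * 0"
    by (intro tendsto_intros)
  then have "(\<lambda>n. cmod (g x - (\<Sum>j<n. c j * a j x))) \<longlonglongrightarrow> 0"
    using m_pos[of x] by (simp add: mult.assoc[symmetric])
  then have "(\<lambda>n. g x - (\<Sum>j<n. c j * a j x)) \<longlonglongrightarrow> 0" by (simp only: tendsto_norm_zero_iff)
  then have "(\<lambda>n. g x - (g x - (\<Sum>j<n. c j * a j x))) \<longlonglongrightarrow> g x - 0" by (intro tendsto_intros)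
  then show ?thesis by (simp add: sums_def)
qed

lemma H1_norm_le:
  "(\<And>j. atom \<beta> (a j)) \<Longrightarrow> summable (\<lambda>j. cmod (c j)) \<Longrightarrow> (\<And>x. (\<lambda>j. c j * a j x) sums g x) \<Longrightarrow>
    H1_norm \<beta> g \<le> ennreal (\<Sum>j. cmod (c j))"
  unfolding H1_norm_def by (intro Inf_lower) (blast intro: atomic_decompI)

lemma H1_norm_lessE:
  assumes "H1_norm \<beta> g < y"
  obtains c a where "atomic_decomp \<beta> g c a" "ennreal (\<Sum>j. cmod (c j)) < y"
  using assms unfolding H1_norm_def Inf_less_iff by blast

lemma L1_le_H1: "Lp_norm M 1 g \<le> H1_norm \<beta> g"
  unfolding H1_norm_def
proof (rule Inf_greatest, clarify)
  fix c a assume dec: "atomic_decomp \<beta> g c a"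
  then have "Lp_norm M 1 g \<le> (\<Sum>j. Lp_norm M 1 (\<lambda>x. c j * a j x))"
    by (intro L1_sums_le atomic_decomp_sums)
  also have "\<dots> \<le> (\<Sum>j. ennreal (cmod (c j)))"
    using dec by (intro suminf_le L1_cmult_atom) (auto simp: atomic_decomp_def)
  also have "\<dots> = ennreal (\<Sum>j. cmod (c j))"
    using dec by (intro suminf_ennreal2) (auto simp: atomic_decomp_def)
  finally show "Lp_norm M 1 g \<le> ennreal (\<Sum>j. cmod (c j))" .
qed

text \<open>The atoms of near-optimal decompositions with errors \<open>e / 2 ^ (k + 1)\<close> are
  merged into one sequence. The decomposition on the whole tree has infinitely many pieces, so
  subadditivity is needed for series and not just for finite sums.\<close>

lemma H1_norm_sums_le:
  assumes g: "\<And>x. (\<lambda>k. g k x) sums G x"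
  shows "H1_norm \<beta> G \<le> (\<Sum>k. H1_norm \<beta> (g k))"
proof (rule ennreal_le_epsilon)
  fix e :: real assume fin: "(\<Sum>k. H1_norm \<beta> (g k)) < top" and e: "0 < e"
  have fin_k: "H1_norm \<beta> (g k) < top" for k
    using fin ennreal_suminf_lessD less_top by blast
  have "\<exists>c a. atomic_decomp \<beta> (g k) c a \<and> ennreal (\<Sum>j. cmod (c j))
      \<le> H1_norm \<beta> (g k) + ennreal (e * (1/2) ^ Suc k)" for k
  proof -
    have "H1_norm \<beta> (g k) < H1_norm \<beta> (g k) + ennreal (e * (1/2) ^ Suc k)"
      using fin_k[of k] e
      by (cases "H1_norm \<beta> (g k)") (auto simp: ennreal_plus[symmetric] ennreal_less_iff
        simp del: ennreal_plus)
    then obtain c a where "atomic_decomp \<beta> (g k) c a"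
      "ennreal (\<Sum>j. cmod (c j)) < H1_norm \<beta> (g k) + ennreal (e * (1/2) ^ Suc k)" by (rule H1_norm_lessE)
    then show ?thesis by (blast intro: less_imp_le)
  qed
  then obtain c a where dec: "\<And>k. atomic_decomp \<beta> (g k) (c k) (a k)"
    and le: "\<And>k. ennreal (\<Sum>j. cmod (c k j)) \<le> H1_norm \<beta> (g k) + ennreal (e * (1/2) ^ Suc k)" by metis
  have at: "atom \<beta> (a k j)" and sm: "summable (\<lambda>j. cmod (c k j))" for k j
    using dec[of k] by (auto simp: atomic_decomp_def)
  define c' where "c' = (\<lambda>(k, j). c k j)"
  define a' where "a' = (\<lambda>(k, j). a k j)"
  have total: "(\<Sum>i. ennreal (cmod (c' (prod_decode i)))) \<le> (\<Sum>k. H1_norm \<beta> (g k)) + ennreal e"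
  proof -
    have "(\<Sum>i. ennreal (cmod (c' (prod_decode i)))) = (\<Sum>k. ennreal (\<Sum>j. cmod (c k j)))"
      by (rule suminf_ennreal_2dimen) (simp add: c'_def suminf_ennreal2 sm)
    also have "\<dots> \<le> (\<Sum>k. H1_norm \<beta> (g k) + ennreal (e * (1/2) ^ Suc k))"
      by (intro suminf_le le) auto
    also have "\<dots> = (\<Sum>k. H1_norm \<beta> (g k)) + (\<Sum>k. ennreal (e * (1/2) ^ Suc k))"
      by (intro suminf_add[symmetric]) auto
    also have "(\<Sum>k. ennreal (e * (1/2) ^ Suc k)) = ennreal (\<Sum>k. e * (1/2) ^ Suc k)"
      using e by (intro suminf_ennreal2 summable_mult sums_summable[OF power_half_series]) auto
    also have "(\<Sum>k. e * (1/2) ^ Suc k) = e"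
      using sums_mult[OF power_half_series, of e] by (simp add: sums_iff)
    finally show ?thesis .
  qed
  have "(\<Sum>k. H1_norm \<beta> (g k)) + ennreal e < top" using fin by simp
  then have sm': "summable (\<lambda>i. cmod (c' (prod_decode i)))"
    using total by (intro summable_suminf_not_top) (auto simp: top_unique)
  have "H1_norm \<beta> G \<le> ennreal (\<Sum>i. cmod (c' (prod_decode i)))"
  proof (rule H1_norm_le)
    show "atom \<beta> (a' (prod_decode i))" for i by (simp add: a'_def at split: prod.split)
    show "summable (\<lambda>i. cmod (c' (prod_decode i)))" by (rule sm')
    fix x
    have "(\<lambda>i. (\<lambda>p. c' p * a' p x) (prod_decode i)) sums G x"
    proof (rule sums_prod_decode)
      \<comment> \<open>At a fixed point all atoms are bounded by \<open>1 / m x\<close>, whatever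
        their supports; together with the summable coefficients this gives absolute convergence of
        the double series at \<open>x\<close>.\<close>
      have "cmod (a k j x) \<le> 1 / m x" for k j
      proof -
        have "ennreal (m x * cmod (a k j x)) \<le> Lp_norm M 1 (a k j)"
          unfolding Lp_norm_1 using nn_integral_M_ge_point[of x "\<lambda>x. ennreal (cmod (a k j x))"]
          by (simp add: ennreal_mult)
        also have "\<dots> \<le> ennreal 1" using atom_L1[OF at] by simp
        finally have "m x * cmod (a k j x) \<le> 1" by (subst (asm) ennreal_le_iff) auto
        then show ?thesis using m_pos[of x] by (simp add: field_simps)
      qed
      then have "norm (c' (prod_decode i) * a' (prod_decode i) x)
          \<le> cmod (c' (prod_decode i)) * (1 / m x)" for i
        unfolding norm_mult by (intro mult_left_mono) (auto simp: a'_def split: prod.split)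
      then show "summable (\<lambda>i. norm (c' (prod_decode i) * a' (prod_decode i) x))"
        by (intro summable_comparison_test'[OF summable_mult2[OF sm', of "1 / m x"]]) auto
      show "(\<lambda>j. c' (k, j) * a' (k, j) x) sums g k x" for k
        using atomic_decomp_sums[OF dec[of k]] by (simp add: c'_def a'_def)
    qed (rule g)
    then show "(\<lambda>i. c' (prod_decode i) * a' (prod_decode i) x) sums G x" by simp
  qed
  also have "\<dots> = (\<Sum>i. ennreal (cmod (c' (prod_decode i))))"
    by (intro suminf_ennreal2[symmetric] sm') simp
  also note total
  finally show "H1_norm \<beta> G \<le> (\<Sum>k. H1_norm \<beta> (g k)) + ennreal e" .
qed

lemma H1_norm_zero [simp]: "H1_norm \<beta> (\<lambda>x. 0) = 0"
  using H1_norm_le[of \<beta> "\<lambda>_ _. 0" "\<lambda>_. 0" "\<lambda>_. 0"] atom_zero by simp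

lemma H1_norm_add: "H1_norm \<beta> (\<lambda>x. f x + g x) \<le> H1_norm \<beta> f + H1_norm \<beta> g"
proof -
  define h where "h k = (if k = 0 then f else if k = 1 then g else (\<lambda>x. 0))" for k :: nat
  have "(\<lambda>k. h k x) sums (\<Sum>k\<in>{0, 1}. h k x)" for x
    by (rule sums_finite) (auto simp: h_def)
  then have "H1_norm \<beta> (\<lambda>x. f x + g x) \<le> (\<Sum>k. H1_norm \<beta> (h k))"
    by (intro H1_norm_sums_le) (simp add: h_def)
  also have "\<dots> = (\<Sum>k\<in>{0, 1}. H1_norm \<beta> (h k))"
    by (rule suminf_finite) (auto simp: h_def)
  finally show ?thesis by (simp add: h_def)
qed

lemma H1_norm_sum_le:
  "finite I \<Longrightarrow> H1_norm \<beta> (\<lambda>x. \<Sum>i\<in>I. f i x) \<le> (\<Sum>i\<in>I. H1_norm \<beta> (f i))"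
proof (induction rule: finite_induct)
  case (insert i I)
  then show ?case
    using H1_norm_add[of \<beta> "f i" "\<lambda>x. \<Sum>i\<in>I. f i x"] by (auto intro: order_trans add_left_mono)
qed simp

lemma H1_norm_uminus_le: "H1_norm \<beta> (\<lambda>x. - g x) \<le> H1_norm \<beta> g"
  unfolding H1_norm_def[of \<beta> g]
proof (rule Inf_greatest, clarify)
  fix c a assume dec: "atomic_decomp \<beta> g c a"
  have "(\<lambda>j. - (c j) * a j x) sums (- g x)" for x
    using sums_minus[OF atomic_decomp_sums[OF dec, of x]] by simp
  then have "H1_norm \<beta> (\<lambda>x. - g x) \<le> ennreal (\<Sum>j. cmod (- c j))"
    using dec by (intro H1_norm_le[of \<beta> a]) (auto simp: atomic_decomp_def)
  then show "H1_norm \<beta> (\<lambda>x. - g x) \<le> ennreal (\<Sum>j. cmod (c j))" by simp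
qed

lemma H1_norm_diff: "H1_norm \<beta> (f - g) \<le> H1_norm \<beta> f + H1_norm \<beta> g"
proof -
  have "H1_norm \<beta> (f - g) \<le> H1_norm \<beta> f + H1_norm \<beta> (\<lambda>x. - g x)"
    using H1_norm_add[of \<beta> f "\<lambda>x. - g x"] by (simp add: fun_diff_def)
  also have "\<dots> \<le> H1_norm \<beta> f + H1_norm \<beta> g" by (intro add_left_mono H1_norm_uminus_le)
  finally show ?thesis .
qed

lemma H1_norm_le_mean_zero:
  assumes R: "R \<in> admissible \<beta>" and supp: "\<And>x. x \<notin> R \<Longrightarrow> f x = 0"
    and bound: "\<And>x. cmod (f x) \<le> B" and mean: "(\<Sum>x\<in>R. m x *\<^sub>R f x) = 0"
  shows "H1_norm \<beta> f \<le> ennreal (B * w R)"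
proof (cases "B = 0")
  case True
  then have "f = (\<lambda>x. 0)" using bound by auto
  then show ?thesis by simp
next
  case False
  have B: "0 < B" using False bound[of undefined] norm_ge_zero[of "f undefined"] by linarith
  have wR: "0 < w R" using finite_admissible[OF R] admissible_nonempty R w_pos by metis
  define b where "b = B * w R"
  have b: "0 < b" using B wR by (simp add: b_def)
  \<comment> \<open>A decomposition is an infinite sequence, so the single atom is followed by zero
    functions, which are atoms too.\<close>
  define a where "a j = (if j = 0 then (\<lambda>x. f x / of_real b) else (\<lambda>x. 0))" for j :: nat
  define c where "c j = (if j = 0 then complex_of_real b else 0)" for j :: nat
  have "atom \<beta> (\<lambda>x. f x / of_real b)"
  proof (rule atomI[OF R])
    show "cmod (f x / of_real b) \<le> 1 / w R" for x
    proof -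
      have "cmod (f x / of_real b) = cmod (f x) / b" using b by (simp add: norm_divide)
      also have "\<dots> \<le> B / b" using bound b by (intro divide_right_mono) auto
      also have "\<dots> = 1 / w R" using B by (simp add: b_def)
      finally show ?thesis .
    qed
    have "(\<Sum>x\<in>R. m x *\<^sub>R (f x / of_real b)) = (\<Sum>x\<in>R. m x *\<^sub>R f x) / of_real b"
      by (simp add: sum_divide_distrib scaleR_conv_of_real)
    then show "(\<Sum>x\<in>R. m x *\<^sub>R (f x / of_real b)) = 0" using mean by simp
  qed (use supp in simp)
  then have at: "atom \<beta> (a j)" for j by (simp add: a_def atom_zero)
  have sc: "(\<lambda>j. cmod (c j)) sums (\<Sum>j\<in>{0}. cmod (c j))"
    by (rule sums_finite) (auto simp: c_def)
  have "(\<lambda>j. c j * a j x) sums (\<Sum>j\<in>{0}. c j * a j x)" for x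
    by (rule sums_finite) (auto simp: c_def)
  then have "H1_norm \<beta> f \<le> ennreal (\<Sum>j. cmod (c j))"
    using b at sc by (intro H1_norm_le[of \<beta> a]) (auto simp: a_def c_def sums_iff)
  also have "(\<Sum>j. cmod (c j)) = b" using sc b by (simp add: sums_iff c_def)
  finally show ?thesis by (simp add: b_def)
qed

section \<open>Mean oscillation\<close>

lemma BMO_norm_ge:
  assumes R: "R \<in> admissible \<beta>"
  shows "ennreal ((\<Sum>x\<in>R. m x * cmod (f x - average R f)) / w R) \<le> BMO_norm \<beta> f"
proof -
  have fin: "finite R" "0 < w R" using finite_admissible[OF R] admissible_nonempty R w_pos by metis+
  have "(\<integral>\<^sup>+x\<in>R. ennreal (cmod (f x - average R f)) \<partial>M)
      = (\<Sum>x\<in>R. ennreal (m x) * ennreal (cmod (f x - average R f)))"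
    using fin by (subst nn_integral_M_finite[of R]) auto
  also have "\<dots> = ennreal (\<Sum>x\<in>R. m x * cmod (f x - average R f))"
    by (subst sum_ennreal[symmetric]) (auto simp: ennreal_mult)
  finally have "ennreal ((\<Sum>x\<in>R. m x * cmod (f x - average R f)) / w R)
    = (\<integral>\<^sup>+x\<in>R. ennreal (cmod (f x - average R f)) \<partial>M) / emeasure M R"
    using fin by (simp add: emeasure_M divide_ennreal sum_nonneg)
  also have "\<dots> \<le> BMO_norm \<beta> f" unfolding BMO_norm_def by (intro SUP_upper R)
  finally show ?thesis .
qed

lemma BMO_norm_leI:
  assumes "\<And>R. R \<in> admissible \<beta> \<Longrightarrow> finite R \<Longrightarrow> 0 < w R \<Longrightarrow>
    ennreal ((\<Sum>x\<in>R. m x * cmod (f x - average R f)) / w R) \<le> B"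
  shows "BMO_norm \<beta> f \<le> B"
  unfolding BMO_norm_def
proof (rule SUP_least)
  fix R assume R: "R \<in> admissible \<beta>"
  have fin: "finite R" "0 < w R" using finite_admissible[OF R] admissible_nonempty R w_pos by metis+
  have "(\<integral>\<^sup>+x\<in>R. ennreal (cmod (f x - average R f)) \<partial>M)
      = (\<Sum>x\<in>R. ennreal (m x) * ennreal (cmod (f x - average R f)))"
    using fin by (subst nn_integral_M_finite[of R]) auto
  also have "\<dots> = ennreal (\<Sum>x\<in>R. m x * cmod (f x - average R f))"
    by (subst sum_ennreal[symmetric]) (auto simp: ennreal_mult)
  finally show "(\<integral>\<^sup>+x\<in>R. ennreal (cmod (f x - average R f)) \<partial>M) / emeasure M R \<le> B"
    using fin assms[OF R] by (simp add: emeasure_M divide_ennreal sum_nonneg)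
qed

lemma sum_mean_diff:
  assumes "finite R" "0 < w R"
  shows "(\<Sum>x\<in>R. m x *\<^sub>R (f x - average R f)) = 0"
proof -
  have "(\<Sum>x\<in>R. m x *\<^sub>R (f x - average R f)) = (\<Sum>x\<in>R. m x *\<^sub>R f x) - w R *\<^sub>R average R f"
    by (simp add: scaleR_diff_right sum_subtractf scaleR_sum_left)
  then show ?thesis using assms by (simp add: average_eq)
qed

lemma cmod_average_diff_le:
  assumes "finite R" "0 < w R"
  shows "cmod (average R f - z) \<le> (\<Sum>x\<in>R. m x * cmod (f x - z)) / w R"
proof -
  have "average R f - z = (\<Sum>x\<in>R. m x *\<^sub>R (f x - z)) /\<^sub>R w R"
    using assms by (simp add: average_eq scaleR_diff_right sum_subtractf scaleR_sum_left[symmetric])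
  then have "cmod (average R f - z) = cmod (\<Sum>x\<in>R. m x *\<^sub>R (f x - z)) / w R"
    using assms by (simp add: divide_inverse mult.commute)
  also have "\<dots> \<le> (\<Sum>x\<in>R. m x * cmod (f x - z)) / w R"
    using assms by (intro divide_right_mono sum_norm_le) auto
  finally show ?thesis .
qed

text \<open>The distance of the mean of \<open>f\<close> to \<open>z\<close> is at most the mean of
  the distance of \<open>f\<close> to \<open>z\<close>, so replacing the mean by any constant costs
  a factor 2.\<close>

lemma oscillation_le:
  assumes "finite R" "0 < w R"
  shows "(\<Sum>x\<in>R. m x * cmod (f x - average R f)) \<le> 2 * (\<Sum>x\<in>R. m x * cmod (f x - z))"
proof -
  have "(\<Sum>x\<in>R. m x * cmod (f x - average R f))
      \<le> (\<Sum>x\<in>R. m x * cmod (f x - z) + m x * cmod (average R f - z))"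
  proof (rule sum_mono)
    fix x
    have "cmod (f x - average R f) \<le> cmod (f x - z) + cmod (average R f - z)"
      using norm_triangle_ineq4[of "f x - z" "average R f - z"] by simp
    then show "m x * cmod (f x - average R f) \<le> m x * cmod (f x - z) + m x * cmod (average R f - z)"
      by (simp add: distrib_left[symmetric] mult_left_mono)
  qed
  also have "\<dots> = (\<Sum>x\<in>R. m x * cmod (f x - z)) + w R * cmod (average R f - z)"
    by (simp add: sum.distrib sum_distrib_right)
  also have "w R * cmod (average R f - z) \<le> (\<Sum>x\<in>R. m x * cmod (f x - z))"
    using cmod_average_diff_le[OF assms, of f z] assms by (simp add: field_simps)
  finally show ?thesis by simp
qed

text \<open>The image of \<open>f\<close> is compared with the constant
  \<open>P (average R f)\<close> instead of its own mean. This is what permits truncating complex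
  functions without leaving BMO.\<close>

lemma BMO_norm_Lipschitz:
  assumes "\<And>z y. cmod (P z - P y) \<le> cmod (z - y)"
  shows "BMO_norm \<beta> (\<lambda>x. P (f x)) \<le> 2 * BMO_norm \<beta> f"
proof (rule BMO_norm_leI)
  fix R assume R: "R \<in> admissible \<beta>" "finite R" "0 < w R"
  have "(\<Sum>x\<in>R. m x * cmod (P (f x) - average R (\<lambda>x. P (f x))))
    \<le> 2 * (\<Sum>x\<in>R. m x * cmod (P (f x) - P (average R f)))"
    using R by (intro oscillation_le)
  also have "\<dots> \<le> 2 * (\<Sum>x\<in>R. m x * cmod (f x - average R f))"
    using assms by (intro mult_left_mono sum_mono) auto
  finally have "ennreal ((\<Sum>x\<in>R. m x * cmod (P (f x) - average R (\<lambda>x. P (f x)))) / w R)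
    \<le> ennreal (2 * ((\<Sum>x\<in>R. m x * cmod (f x - average R f)) / w R))"
    using R by (intro ennreal_leI) (simp add: divide_right_mono)
  also have "\<dots> = ennreal 2 * ennreal ((\<Sum>x\<in>R. m x * cmod (f x - average R f)) / w R)"
    by (rule ennreal_mult') simp
  also have "\<dots> \<le> ennreal 2 * BMO_norm \<beta> f" by (intro mult_left_mono BMO_norm_ge R) simp
  also have "\<dots> = 2 * BMO_norm \<beta> f" by simp
  finally show "ennreal ((\<Sum>x\<in>R. m x * cmod (P (f x) - average R (\<lambda>x. P (f x)))) / w R)
      \<le> 2 * BMO_norm \<beta> f" .
qed

lemma BMO_norm_add_const: "BMO_norm \<beta> (\<lambda>x. f x + c) = BMO_norm \<beta> f"
proof -
  have le: "BMO_norm \<beta> (\<lambda>x. f x + c) \<le> BMO_norm \<beta> f" for f c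
  proof (rule BMO_norm_leI)
    fix R assume R: "R \<in> admissible \<beta>" "finite R" "0 < w R"
    have "average R (\<lambda>x. f x + c) = average R f + c"
      using R by (simp add: average_eq scaleR_add_right sum.distrib scaleR_sum_left[symmetric])
    then show "ennreal ((\<Sum>x\<in>R. m x * cmod (f x + c - average R (\<lambda>x. f x + c))) / w R) \<le> BMO_norm \<beta> f"
      using BMO_norm_ge[OF R(1), of f] by simp
  qed
  from le[of f c] le[of "\<lambda>x. f x + c" "- c"] show ?thesis by simp
qed

lemma BMO_norm_le_infinity: "BMO_norm \<beta> f \<le> 2 * Lp_norm M \<infinity> f"
proof (rule BMO_norm_leI)
  fix R assume R: "R \<in> admissible \<beta>" "finite R" "0 < w R"
  show "ennreal ((\<Sum>x\<in>R. m x * cmod (f x - average R f)) / w R) \<le> 2 * Lp_norm M \<infinity> f"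
  proof (cases "Lp_norm M \<infinity> f")
    case (real B)
    have "cmod (f x) \<le> B" for x
      using Lp_norm_infinity_ge[of f x] real by (simp add: ennreal_le_iff)
    then have "(\<Sum>x\<in>R. m x * cmod (f x - 0)) \<le> (\<Sum>x\<in>R. m x * B)"
      by (intro sum_mono mult_left_mono) auto
    then have "(\<Sum>x\<in>R. m x * cmod (f x - average R f)) \<le> 2 * (w R * B)"
      using oscillation_le[OF R(2,3), of f 0] by (simp add: sum_distrib_right)
    then have "(\<Sum>x\<in>R. m x * cmod (f x - average R f)) / w R \<le> 2 * B"
      using R by (simp add: field_simps)
    then have "ennreal ((\<Sum>x\<in>R. m x * cmod (f x - average R f)) / w R) \<le> ennreal (2 * B)"
      by (rule ennreal_leI)
    then show ?thesis using real by (simp add: ennreal_mult)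
  qed (simp add: ennreal_mult_top)
qed

section \<open>The pairing of H1 with bounded functions in BMO\<close>

text \<open>The bound \<open>B\<close> makes the integral and the passage to the limit in L1
  legitimate but does not enter the estimate; applied to truncations, the result is uniform in the
  height of truncation.\<close>

lemma H1_BMO_pairing:
  assumes bounded: "\<And>x. cmod (\<phi> x) \<le> B" and BMO: "BMO_norm \<beta> \<phi> < top" and H1: "H1_norm \<beta> G < top"
  shows "integrable M (\<lambda>x. \<phi> x * G x)"
    "ennreal (cmod (LINT x|M. \<phi> x * G x)) \<le> BMO_norm \<beta> \<phi> * H1_norm \<beta> G"
proof -
  have B: "0 \<le> B" using bounded[of undefined] norm_ge_zero order_trans by blast
  have int: "integrable M (\<lambda>x. \<phi> x * g x)"
    and int_le: "ennreal (cmod (LINT x|M. \<phi> x * g x)) \<le> ennreal B * Lp_norm M 1 g"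
    if "Lp_norm M 1 g < top" for g
  proof -
    have le: "(\<integral>\<^sup>+x. ennreal (norm (\<phi> x * g x)) \<partial>M) \<le> ennreal B * Lp_norm M 1 g"
    proof -
      have "(\<integral>\<^sup>+x. ennreal (norm (\<phi> x * g x)) \<partial>M) \<le> (\<integral>\<^sup>+x. ennreal B * ennreal (cmod (g x)) \<partial>M)"
        using bounded B by (intro nn_integral_mono) (simp add: norm_mult ennreal_mult[symmetric] ennreal_leI mult_right_mono)
      then show ?thesis by (simp add: nn_integral_cmult Lp_norm_1)
    qed
    also have "\<dots> < top" using that by (simp add: ennreal_mult_less_top)
    finally show int: "integrable M (\<lambda>x. \<phi> x * g x)" by (simp add: integrable_iff_bounded)
    show "ennreal (cmod (LINT x|M. \<phi> x * g x)) \<le> ennreal B * Lp_norm M 1 g"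
      using integral_norm_bound_ennreal[OF int] le by (rule order_trans)
  qed
  show "integrable M (\<lambda>x. \<phi> x * G x)" using le_less_trans[OF L1_le_H1 H1] by (rule int)
  define N where "N = enn2real (BMO_norm \<beta> \<phi>)"
  have N: "BMO_norm \<beta> \<phi> = ennreal N" "0 \<le> N" using BMO by (auto simp: N_def)
  have atom: "cmod (LINT x|M. \<phi> x * a x) \<le> N" if "atom \<beta> a" for a
    using that
  proof (rule atomE)
    fix R assume R: "R \<in> admissible \<beta>" "finite R" "0 < w R" "\<And>x. x \<notin> R \<Longrightarrow> a x = 0"
      "\<And>x. cmod (a x) \<le> 1 / w R" "(\<Sum>x\<in>R. m x *\<^sub>R a x) = 0"
    have "(LINT x|M. \<phi> x * a x) = (\<Sum>x\<in>R. m x *\<^sub>R (\<phi> x * a x))"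
      using R by (intro integral_M_finite) auto
    \<comment> \<open>The mean of \<phi> can be subtracted because the atom has integral 0; the size
      bound of the atom then leaves the mean oscillation of \<phi>.\<close>
    also have "\<dots> = (\<Sum>x\<in>R. m x *\<^sub>R ((\<phi> x - average R \<phi>) * a x)) + average R \<phi> * (\<Sum>x\<in>R. m x *\<^sub>R a x)"
      by (simp add: sum_distrib_left sum.distrib[symmetric] algebra_simps)
    also have "\<dots> = (\<Sum>x\<in>R. m x *\<^sub>R ((\<phi> x - average R \<phi>) * a x))" using R by simp
    finally have "cmod (LINT x|M. \<phi> x * a x) \<le> (\<Sum>x\<in>R. m x * cmod (\<phi> x - average R \<phi>) * (1 / w R))"
    proof (simp only:, intro sum_norm_le)
      fix x
      have "cmod (m x *\<^sub>R ((\<phi> x - average R \<phi>) * a x)) = m x * cmod (\<phi> x - average R \<phi>) * cmod (a x)"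
        by (simp add: norm_mult)
      also have "\<dots> \<le> m x * cmod (\<phi> x - average R \<phi>) * (1 / w R)"
        using R by (intro mult_left_mono) auto
      finally show "cmod (m x *\<^sub>R ((\<phi> x - average R \<phi>) * a x))
          \<le> m x * cmod (\<phi> x - average R \<phi>) * (1 / w R)" .
    qed
    also have "\<dots> = (\<Sum>x\<in>R. m x * cmod (\<phi> x - average R \<phi>)) / w R"
      by (simp add: sum_divide_distrib)
    also have "\<dots> \<le> N" using BMO_norm_ge[OF R(1), of \<phi>] N by (simp add: ennreal_le_iff)
    finally show ?thesis .
  qed
  \<comment> \<open>Partial sums are estimated atom by atom; the remainder costs \<open>B\<close>
    times its L1 norm, which tends to 0.\<close>
  have main: "ennreal (cmod (LINT x|M. \<phi> x * G x)) \<le> ennreal (N * (\<Sum>j. cmod (c j)))"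
    if dec: "atomic_decomp \<beta> G c a" for c a
  proof (rule LIMSEQ_le_const)
    have at: "atom \<beta> (a j)" and sm: "summable (\<lambda>j. cmod (c j))" for j
      using dec by (auto simp: atomic_decomp_def)
    let ?d = "\<lambda>n. Lp_norm M 1 (\<lambda>x. G x - (\<Sum>j<n. c j * a j x))"
    have lim: "?d \<longlonglongrightarrow> 0" using dec by (simp add: atomic_decomp_def)
    then have "(\<lambda>n. ennreal (N * (\<Sum>j. cmod (c j))) + ennreal B * ?d n) \<longlonglongrightarrow> ennreal (N * (\<Sum>j. cmod (c j)))
        + ennreal B * 0"
      by (intro tendsto_add tendsto_const ennreal_tendsto_cmult) auto
    then show "(\<lambda>n. ennreal (N * (\<Sum>j. cmod (c j))) + ennreal B * ?d n) \<longlonglongrightarrow> ennreal (N * (\<Sum>j. cmod (c j)))"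
      by simp
    have "eventually (\<lambda>n. ?d n < top) sequentially" using lim by (rule order_tendstoD) simp
    then obtain n0 where n0: "\<And>n. n0 \<le> n \<Longrightarrow> ?d n < top" by (auto simp: eventually_sequentially)
    have "ennreal (cmod (LINT x|M. \<phi> x * G x)) \<le> ennreal (N * (\<Sum>j. cmod (c j))) + ennreal B * ?d n"
      if "n0 \<le> n" for n
    proof -
      have ia: "integrable M (\<lambda>x. \<phi> x * (c j * a j x))" for j
        by (rule int[OF le_less_trans[OF L1_cmult_atom[OF at] ennreal_less_top]])
      have eq: "(LINT x|M. \<phi> x * G x)
          = (\<Sum>j<n. LINT x|M. \<phi> x * (c j * a j x)) + (LINT x|M. \<phi> x * (G x - (\<Sum>j<n. c j * a j x)))"
      proof -
        have "(LINT x|M. \<phi> x * G x)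
            = (LINT x|M. (\<Sum>j<n. \<phi> x * (c j * a j x)) + \<phi> x * (G x - (\<Sum>j<n. c j * a j x)))"
          by (intro Bochner_Integration.integral_cong) (auto
              simp: sum_distrib_left[symmetric] algebra_simps)
        also have "\<dots> = (LINT x|M. (\<Sum>j<n. \<phi> x * (c j * a j x)))
            + (LINT x|M. \<phi> x * (G x - (\<Sum>j<n. c j * a j x)))"
          using n0[OF that]
          by (intro Bochner_Integration.integral_add Bochner_Integration.integrable_sum ia int)
        finally show ?thesis using ia by (simp add: Bochner_Integration.integral_sum)
      qed
      have "cmod (\<Sum>j<n. LINT x|M. \<phi> x * (c j * a j x)) \<le> (\<Sum>j<n. cmod (c j) * N)"
      proof (rule sum_norm_le)
        fix j
        have "(LINT x|M. \<phi> x * (c j * a j x)) = c j * (LINT x|M. \<phi> x * a j x)"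
          by (subst integral_mult_right_zero[symmetric]) (simp add: mult_ac)
        then show "cmod (LINT x|M. \<phi> x * (c j * a j x)) \<le> cmod (c j) * N"
          using atom[OF at] by (simp add: norm_mult mult_left_mono)
      qed
      also have "\<dots> = N * (\<Sum>j<n. cmod (c j))" by (simp add: sum_distrib_left mult.commute)
      also have "\<dots> \<le> N * (\<Sum>j. cmod (c j))"
        using N by (intro mult_left_mono sum_le_suminf sm) auto
      finally have 1: "cmod (\<Sum>j<n. LINT x|M. \<phi> x * (c j * a j x)) \<le> N * (\<Sum>j. cmod (c j))" .
      have "ennreal (cmod (LINT x|M. \<phi> x * G x)) \<le> ennreal (cmod (\<Sum>j<n. LINT x|M. \<phi> x * (c j * a j x)))
          + ennreal (cmod (LINT x|M. \<phi> x * (G x - (\<Sum>j<n. c j * a j x))))"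
        unfolding eq by (simp add: ennreal_plus[symmetric] ennreal_leI norm_triangle_ineq
            del: ennreal_plus)
      also have "\<dots> \<le> ennreal (N * (\<Sum>j. cmod (c j))) + ennreal B * ?d n"
        using 1 n0[OF that] by (intro add_mono ennreal_leI int_le)
      finally show ?thesis .
    qed
    then show "\<exists>n0. \<forall>n\<ge>n0. ennreal (cmod (LINT x|M. \<phi> x * G x))
        \<le> ennreal (N * (\<Sum>j. cmod (c j))) + ennreal B * ?d n" by blast
  qed
  show "ennreal (cmod (LINT x|M. \<phi> x * G x)) \<le> BMO_norm \<beta> \<phi> * H1_norm \<beta> G"
  proof (rule ennreal_le_epsilon)
    fix e :: real assume e: "0 < e"
    define h where "h = enn2real (H1_norm \<beta> G)"
    have h: "H1_norm \<beta> G = ennreal h" "0 \<le> h" using H1 by (auto simp: h_def)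
    have "H1_norm \<beta> G < ennreal (h + e / (N + 1))" using h N e by (simp add: ennreal_lessI)
    then obtain c a where ca: "atomic_decomp \<beta> G c a"
      "ennreal (\<Sum>j. cmod (c j)) < ennreal (h + e / (N + 1))"
      by (rule H1_norm_lessE)
    have "(\<Sum>j. cmod (c j)) \<le> h + e / (N + 1)"
      using ca(2) h N e by (subst (asm) ennreal_less_iff) (auto intro!: suminf_nonneg
          simp: less_imp_le ca(1)[unfolded atomic_decomp_def])
    then have "N * (\<Sum>j. cmod (c j)) \<le> N * (h + e / (N + 1))" using N by (intro mult_left_mono)
    also have "\<dots> \<le> N * h + e"
    proof -
      have "N * (e / (N + 1)) \<le> e" using N e by (simp add: field_simps)
      then show ?thesis by (simp add: distrib_left)
    qed
    finally have "ennreal (N * (\<Sum>j. cmod (c j))) \<le> ennreal (N * h + e)" by (rule ennreal_leI)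
    with main[OF ca(1)] have "ennreal (cmod (LINT x|M. \<phi> x * G x)) \<le> ennreal (N * h + e)"
      by (rule order_trans)
    then show "ennreal (cmod (LINT x|M. \<phi> x * G x)) \<le> BMO_norm \<beta> \<phi> * H1_norm \<beta> G + ennreal e"
      using N h e by (simp add: ennreal_mult ennreal_plus)
  qed
qed

section \<open>Calderon-Zygmund decompositions\<close>

definition avg :: "'v set \<Rightarrow> ('v \<Rightarrow> complex) \<Rightarrow> real" where
  "avg R f = (\<Sum>x\<in>R. m x * cmod (f x)) / w R"

definition osc :: "'v set \<Rightarrow> ('v \<Rightarrow> complex) \<Rightarrow> 'v \<Rightarrow> complex" where
  "osc R f x = (if x \<in> R then f x - average R f else 0)"

abbreviation "dyadic \<beta> \<equiv> dyadic_set w (admissible \<beta>)"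

lemma dyadic_admissible: "dyadic \<beta> D R \<Longrightarrow> R \<in> admissible \<beta>"
  by (induction rule: dyadic_set.induct) (auto simp: admissible_def)

lemma dyadic_finite: "dyadic \<beta> D R \<Longrightarrow> finite R"
  using dyadic_admissible finite_admissible by blast

lemma dyadic_w_pos: "dyadic \<beta> D R \<Longrightarrow> 0 < w R"
  using dyadic_admissible admissible_nonempty dyadic_finite w_pos by metis

lemma avg_nonneg: "0 \<le> avg R f"
  by (simp add: avg_def sum_nonneg)

lemma avg_mult: "0 < w R \<Longrightarrow> avg R f * w R = (\<Sum>x\<in>R. m x * cmod (f x))"
  by (simp add: avg_def)

lemma cmod_average_le: "finite R \<Longrightarrow> 0 < w R \<Longrightarrow> cmod (average R f) \<le> avg R f"
  using cmod_average_diff_le[of R f 0] by (simp add: avg_def)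

lemma sum_osc: "finite R \<Longrightarrow> 0 < w R \<Longrightarrow> (\<Sum>x\<in>R. m x *\<^sub>R osc R f x) = 0"
  using sum_mean_diff[of R f] by (simp add: osc_def)

text \<open>Descend the grid and stop at the first sets on which the mean of \<open>cmod f\<close>
  exceeds \<tau>. Their parents were not stopped, so comparability of masses bounds their means by
  \<open>D * \<tau>\<close>; a branch that never stops ends at a singleton, where the mean is the
  value itself.\<close>

lemma stopping_sets:
  assumes "dyadic \<beta> D R" "1 \<le> D" "0 \<le> \<tau>" "avg R f \<le> \<tau>"
  shows "\<exists>\<S>. finite \<S> \<and> disjoint \<S> \<and>
    (\<forall>S\<in>\<S>. dyadic \<beta> D S \<and> S \<subseteq> R \<and> \<tau> < avg S f \<and> avg S f \<le> D * \<tau>) \<and>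
    (\<forall>x\<in>R - \<Union>\<S>. cmod (f x) \<le> \<tau>)"
  using assms(1,4)
proof (induction rule: dyadic_set.induct)
  case (singleton x)
  then have "cmod (f x) \<le> \<tau>" using m_pos[of x] by (simp add: avg_def)
  then show ?case by (intro exI[of _ "{}"]) auto
next
  case (union \<C>)
  have dy: "dyadic \<beta> D (\<Union>\<C>)" using union by (intro dyadic_set.union) auto
  have fin: "finite (\<Union>\<C>)" "0 < w (\<Union>\<C>)" using dyadic_finite dyadic_w_pos dy by blast+
  have "\<exists>\<S>. finite \<S> \<and> disjoint \<S> \<and>
    (\<forall>S\<in>\<S>. dyadic \<beta> D S \<and> S \<subseteq> c \<and> \<tau> < avg S f \<and> avg S f \<le> D * \<tau>) \<and>
    (\<forall>x\<in>c - \<Union>\<S>. cmod (f x) \<le> \<tau>)" if c: "c \<in> \<C>" for c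
  proof (cases "avg c f \<le> \<tau>")
    case True
    then show ?thesis using union.IH[OF c] by blast
  next
    case False
    have wc: "0 < w c" using union.hyps(2)[OF c] dyadic_w_pos by blast
    have "avg c f * w c \<le> avg (\<Union>\<C>) f * w (\<Union>\<C>)"
      unfolding avg_mult[OF wc] avg_mult[OF fin(2)]
      using c fin(1) by (intro sum_mono2) auto
    also have "\<dots> \<le> \<tau> * (D * w c)"
      using union.prems union.hyps(4)[OF c] assms avg_nonneg[of "\<Union>\<C>" f] by (intro mult_mono) auto
    finally have "avg c f \<le> D * \<tau>" using wc by (simp add: mult.commute mult.left_commute)
    then show ?thesis using False union.hyps(2)[OF c] by (intro exI[of _ "{c}"]) auto
  qed
  then obtain \<S> where \<S>: "\<And>c. c \<in> \<C> \<Longrightarrow> finite (\<S> c)" "\<And>c. c \<in> \<C> \<Longrightarrow> disjoint (\<S> c)"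
    "\<And>c S. c \<in> \<C> \<Longrightarrow> S \<in> \<S> c \<Longrightarrow> dyadic \<beta> D S \<and> S \<subseteq> c \<and> \<tau> < avg S f \<and> avg S f \<le> D * \<tau>"
    "\<And>c x. c \<in> \<C> \<Longrightarrow> x \<in> c - \<Union>(\<S> c) \<Longrightarrow> cmod (f x) \<le> \<tau>" by metis
  have "disjoint (\<Union>c\<in>\<C>. \<S> c)"
  proof (intro pairwiseI)
    fix S S' assume "S \<in> (\<Union>c\<in>\<C>. \<S> c)" "S' \<in> (\<Union>c\<in>\<C>. \<S> c)" and neq: "S \<noteq> S'"
    then obtain c c' where c: "c \<in> \<C>" "S \<in> \<S> c" "c' \<in> \<C>" "S' \<in> \<S> c'" by blast
    show "disjnt S S'"
    proof (cases "c = c'")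
      case True
      then show ?thesis using c \<S>(2) neq by (auto simp: pairwise_def)
    next
      case False
      then have "disjnt c c'" using union.hyps(3) c by (auto simp: pairwise_def)
      then show ?thesis using \<S>(3)[OF c(1,2)] \<S>(3)[OF c(3,4)] by (meson disjnt_subset1 disjnt_subset2)
    qed
  qed
  moreover have "finite (\<Union>c\<in>\<C>. \<S> c)" using union.hyps(1) \<S>(1) by blast
  ultimately show ?case
  proof (intro exI[of _ "\<Union>c\<in>\<C>. \<S> c"] conjI)
    show "\<forall>S\<in>(\<Union>c\<in>\<C>. \<S> c). dyadic \<beta> D S \<and> S \<subseteq> \<Union>\<C> \<and> \<tau> < avg S f \<and> avg S f \<le> D * \<tau>"
    proof
      fix S assume "S \<in> (\<Union>c\<in>\<C>. \<S> c)"
      then obtain c where "c \<in> \<C>" "S \<in> \<S> c" by blast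
      then show "dyadic \<beta> D S \<and> S \<subseteq> \<Union>\<C> \<and> \<tau> < avg S f \<and> avg S f \<le> D * \<tau>"
        using \<S>(3)[of c S] by auto
    qed
    show "\<forall>x\<in>\<Union>\<C> - \<Union>(\<Union>c\<in>\<C>. \<S> c). cmod (f x) \<le> \<tau>"
    proof
      fix x assume x: "x \<in> \<Union>\<C> - \<Union>(\<Union>c\<in>\<C>. \<S> c)"
      then obtain c where "c \<in> \<C>" "x \<in> c" by blast
      then show "cmod (f x) \<le> \<tau>" using \<S>(4)[of c x] x by auto
    qed
  qed
qed

text \<open>The good part is \<open>f\<close> off the stopping sets and the mean of \<open>f\<close>
  on each of them, which preserves the integral and does not increase the L1 norm. The bad part is a
  sum of oscillations that may still be unbounded.\<close>

lemma Calderon_Zygmund_step: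
  assumes R: "dyadic \<beta> D R" "1 \<le> D" "0 \<le> \<tau>" "avg R f \<le> \<tau>"
  shows "\<exists>\<S> g. finite \<S> \<and> disjoint \<S> \<and>
    (\<forall>S\<in>\<S>. dyadic \<beta> D S \<and> S \<subseteq> R \<and> \<tau> < avg S f) \<and>
    (\<forall>x. x \<notin> R \<longrightarrow> g x = 0) \<and> (\<forall>x. cmod (g x) \<le> D * \<tau>) \<and>
    (\<forall>x. (if x \<in> R then f x else 0) = g x + (\<Sum>S\<in>\<S>. osc S f x)) \<and>
    (\<Sum>x\<in>R. m x *\<^sub>R g x) = (\<Sum>x\<in>R. m x *\<^sub>R f x) \<and>
    (\<Sum>x\<in>R. m x * cmod (g x)) \<le> (\<Sum>x\<in>R. m x * cmod (f x))"
proof -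
  obtain \<S> where \<S>: "finite \<S>" "disjoint \<S>"
    "\<And>S. S \<in> \<S> \<Longrightarrow> dyadic \<beta> D S \<and> S \<subseteq> R \<and> \<tau> < avg S f \<and> avg S f \<le> D * \<tau>"
    "\<And>x. x \<in> R - \<Union>\<S> \<Longrightarrow> cmod (f x) \<le> \<tau>"
    using stopping_sets[OF R] by metis
  have finR: "finite R" using R dyadic_finite by blast
  have S: "finite S" "0 < w S" "S \<subseteq> R" if "S \<in> \<S>" for S
    using \<S>(3)[OF that] dyadic_finite dyadic_w_pos by blast+
  \<comment> \<open>Subtraction makes the decomposition hold by definition. By disjointness at most
    one oscillation is nonzero at a point, so on a stopping set the mean remains.\<close>
  define g where "g x = (if x \<in> R then f x else 0) - (\<Sum>S\<in>\<S>. osc S f x)" for x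
  have g_in: "g x = average S f" if x: "x \<in> S" "S \<in> \<S>" for x S
  proof -
    have "osc S' f x = 0" if "S' \<in> \<S> - {S}" for S'
      using that \<S>(2) x by (auto simp: osc_def pairwise_def disjnt_def)
    then have "(\<Sum>S'\<in>\<S>. osc S' f x) = osc S f x"
      using \<S>(1) x by (subst sum.remove[OF _ x(2)]) auto
    then show ?thesis using x S(3)[OF x(2)] by (auto simp: g_def osc_def)
  qed
  have g_out: "g x = (if x \<in> R then f x else 0)" if "x \<notin> \<Union>\<S>" for x
    using that by (auto simp: g_def osc_def intro!: sum.neutral)
  show ?thesis
  proof (intro exI[of _ \<S>] exI[of _ g] conjI allI impI)
    show "g x = 0" if "x \<notin> R" for x using that S(3) g_out[of x] by auto
    show "cmod (g x) \<le> D * \<tau>" for x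
    proof (cases "x \<in> \<Union>\<S>")
      case True
      then obtain S where x: "x \<in> S" "S \<in> \<S>" by blast
      then have "cmod (g x) \<le> avg S f" using g_in S cmod_average_le by metis
      then show ?thesis using \<S>(3)[OF x(2)] by linarith
    next
      case False
      have "\<tau> \<le> D * \<tau>" using R(2,3) mult_right_mono[of 1 D \<tau>] by simp
      then show ?thesis using g_out[OF False] \<S>(4)[of x] False R(3) by (cases "x \<in> R") auto
    qed
    show "(\<Sum>x\<in>R. m x *\<^sub>R g x) = (\<Sum>x\<in>R. m x *\<^sub>R f x)"
    proof -
      have "(\<Sum>x\<in>R. m x *\<^sub>R g x) = (\<Sum>x\<in>R. m x *\<^sub>R f x) - (\<Sum>x\<in>R. \<Sum>S\<in>\<S>. m x *\<^sub>R osc S f x)"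
        by (simp add: g_def scaleR_diff_right sum_subtractf scaleR_sum_right)
      also have "(\<Sum>x\<in>R. \<Sum>S\<in>\<S>. m x *\<^sub>R osc S f x) = (\<Sum>S\<in>\<S>. \<Sum>x\<in>R. m x *\<^sub>R osc S f x)"
        by (rule sum.swap)
      also have "\<dots> = 0"
      proof (rule sum.neutral, rule ballI)
        fix S assume "S \<in> \<S>"
        then have "(\<Sum>x\<in>R. m x *\<^sub>R osc S f x) = (\<Sum>x\<in>S. m x *\<^sub>R osc S f x)"
          using S finR by (intro sum.mono_neutral_right) (auto simp: osc_def)
        then show "(\<Sum>x\<in>R. m x *\<^sub>R osc S f x) = 0" using sum_osc S \<open>S \<in> \<S>\<close> by simp
      qed
      finally show ?thesis by simp
    qed
    have split: "(\<Sum>x\<in>R. h x) = (\<Sum>x\<in>R - \<Union>\<S>. h x) + (\<Sum>S\<in>\<S>. \<Sum>x\<in>S. h x)" for h :: "'v \<Rightarrow> real"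
    proof -
      have "\<Union>\<S> \<subseteq> R" using S by blast
      then have "(\<Sum>x\<in>R. h x) = (\<Sum>x\<in>R - \<Union>\<S>. h x) + (\<Sum>x\<in>\<Union>\<S>. h x)"
        using finR by (rule sum.subset_diff)
      also have "(\<Sum>x\<in>\<Union>\<S>. h x) = (\<Sum>S\<in>\<S>. \<Sum>x\<in>S. h x)"
        using S \<S>(2) by (subst sum.Union_disjoint) (auto simp: pairwise_def disjnt_def)
      finally show ?thesis .
    qed
    have "(\<Sum>x\<in>S. m x * cmod (g x)) \<le> (\<Sum>x\<in>S. m x * cmod (f x))" if S': "S \<in> \<S>" for S
    proof -
      have "(\<Sum>x\<in>S. m x * cmod (g x)) = w S * cmod (average S f)"
        using g_in S' by (simp add: sum_distrib_right)
      also have "\<dots> \<le> w S * avg S f" using S[OF S'] by (intro mult_left_mono cmod_average_le) auto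
      also have "\<dots> = (\<Sum>x\<in>S. m x * cmod (f x))" using S(2)[OF S'] by (simp add: avg_def)
      finally show ?thesis .
    qed
    then have "(\<Sum>S\<in>\<S>. \<Sum>x\<in>S. m x * cmod (g x)) \<le> (\<Sum>S\<in>\<S>. \<Sum>x\<in>S. m x * cmod (f x))"
      by (rule sum_mono)
    moreover have "(\<Sum>x\<in>R - \<Union>\<S>. m x * cmod (g x)) = (\<Sum>x\<in>R - \<Union>\<S>. m x * cmod (f x))"
      using g_out by (intro sum.cong) auto
    ultimately show "(\<Sum>x\<in>R. m x * cmod (g x)) \<le> (\<Sum>x\<in>R. m x * cmod (f x))"
      using split[of "\<lambda>x. m x * cmod (g x)"] split[of "\<lambda>x. m x * cmod (f x)"] by linarith
  qed (use \<S> in \<open>auto simp: g_def\<close>)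
qed

text \<open>Jensen's inequality, obtained from Young's inequality by pairing
  \<open>cmod (f y)\<close> with the constant \<open>x powr (r - 1)\<close>, whose conjugate power
  is \<open>x powr r\<close>.\<close>

lemma avg_powr_le:
  assumes "finite R" "0 < w R" "1 < r"
  shows "avg R f powr r * w R \<le> (\<Sum>x\<in>R. m x * cmod (f x) powr r)"
proof (cases "avg R f = 0")
  case False
  define x where "x = avg R f"
  have x: "0 < x" using False avg_nonneg[of R f] by (simp add: x_def)
  define s where "s = r / (r - 1)"
  have s: "1 < s" "1 / r + 1 / s = 1" using assms by (auto simp: s_def field_simps)
  have s1: "(x powr (r - 1)) powr s = x powr r" using assms by (simp add: powr_powr s_def)
  have "x powr r * w R = x powr (r - 1) * (x * w R)"
    using x by (simp add: powr_mult_base mult.assoc[symmetric] mult.commute[of _ x])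
  also have "\<dots> = (\<Sum>y\<in>R. m y * (cmod (f y) * x powr (r - 1)))"
  proof -
    have "x * w R = (\<Sum>y\<in>R. m y * cmod (f y))" unfolding x_def by (rule avg_mult[OF assms(2)])
    then show ?thesis by (simp add: sum_distrib_left mult_ac)
  qed
  also have "\<dots> \<le> (\<Sum>y\<in>R. m y * (cmod (f y) powr r / r + x powr r / s))"
  proof (intro sum_mono mult_left_mono)
    fix y
    show "cmod (f y) * x powr (r - 1) \<le> cmod (f y) powr r / r + x powr r / s"
      using Youngs_inequality[OF assms(3) s, of "cmod (f y)" "x powr (r - 1)"] s1 by simp
  qed simp
  also have "\<dots> = (\<Sum>y\<in>R. m y * cmod (f y) powr r) / r + w R * (x powr r / s)"
    by (simp add: distrib_left sum.distrib sum_divide_distrib sum_distrib_right)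
  finally have "x powr r * w R * (1 - 1 / s) \<le> (\<Sum>y\<in>R. m y * cmod (f y) powr r) / r"
    by (simp add: algebra_simps)
  moreover have "1 - 1 / s = 1 / r" using s by linarith
  ultimately show ?thesis using assms by (simp add: x_def field_simps)
qed (simp add: sum_nonneg)

text \<open>Brings the cost of an atom on \<open>R\<close> with height \<open>avg R f\<close> into
  the form in which it can be charged to the integral of the \<open>r\<close>-th power.\<close>

lemma avg_mult_w_le:
  assumes "finite R" "0 < w R" "1 < r" "0 < avg R f"
  shows "avg R f * w R \<le> avg R f powr (1 - r) * (\<Sum>x\<in>R. m x * cmod (f x) powr r)"
proof -
  have "avg R f * w R = avg R f powr (1 - r) * (avg R f powr r * w R)"
    using assms(4) by (simp add: mult.assoc[symmetric] powr_add[symmetric])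
  also have "\<dots> \<le> avg R f powr (1 - r) * (\<Sum>x\<in>R. m x * cmod (f x) powr r)"
    using assms by (intro mult_left_mono avg_powr_le) auto
  finally show ?thesis .
qed

text \<open>Stopping at twice the average makes the averages grow geometrically along the recursion,
  so that the factor \<open>avg R f powr (1 - r)\<close> absorbs the costs of all generations.\<close>

lemma H1_norm_osc_le:
  assumes R: "dyadic \<beta> D R" and D: "1 \<le> D" and r: "1 < r"
  shows "H1_norm \<beta> (osc R f) \<le> ennreal ((2 * D + 1) / (1 - 2 powr (1 - r))
    * (avg R f powr (1 - r) * (\<Sum>x\<in>R. m x * cmod (f x) powr r)))"
  using R
proof (induction "card R" arbitrary: R rule: less_induct)
  case less
  define C where "C = (2 * D + 1) / (1 - 2 powr (1 - r))"
  have q: "0 < 1 - 2 powr (1 - r)" using r by (simp add: powr_less_one)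
  have CE: "C * (1 - 2 powr (1 - r)) = 2 * D + 1" using q r by (simp add: C_def)
  have C: "0 \<le> C" using D q by (simp add: C_def)
  \<comment> \<open>\<open>C\<close> is the fixed point of the recursion: one generation costs
    \<open>2 * D + 1\<close>, and the later ones cost \<open>C\<close> reduced by
    \<open>2 powr (1 - r)\<close>, since the means have at least doubled.\<close>
  have C2: "(2 * D + 1) + 2 powr (1 - r) * C = C" using CE by (simp add: algebra_simps)
  have fin: "finite R" "0 < w R" using less.prems dyadic_finite dyadic_w_pos by blast+
  define A where "A S = (\<Sum>x\<in>S. m x * cmod (f x) powr r)" for S
  have A0: "0 \<le> A S" for S by (simp add: A_def sum_nonneg)
  define x where "x = avg R f"
  show ?case
  proof (cases "x = 0")
    case True
    then have "(\<Sum>y\<in>R. m y * cmod (f y)) = 0" using fin by (simp add: x_def avg_def)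
    then have f0: "f y = 0" if "y \<in> R" for y
      using that fin m_pos[of y] by (auto simp: sum_nonneg_eq_0_iff)
    then have "osc R f = (\<lambda>x. 0)" using fin by (auto simp: osc_def average_eq)
    then show ?thesis by simp
  next
    case False
    then have x: "0 < x" using avg_nonneg[of R f] by (simp add: x_def)
    obtain \<S> g where \<S>: "finite \<S>" "disjoint \<S>"
      "\<And>S. S \<in> \<S> \<Longrightarrow> dyadic \<beta> D S \<and> S \<subseteq> R \<and> 2 * x < avg S f"
      and g: "\<And>y. y \<notin> R \<Longrightarrow> g y = 0" "\<And>y. cmod (g y) \<le> D * (2 * x)"
        "\<And>y. (if y \<in> R then f y else 0) = g y + (\<Sum>S\<in>\<S>. osc S f y)"
        "(\<Sum>y\<in>R. m y *\<^sub>R g y) = (\<Sum>y\<in>R. m y *\<^sub>R f y)"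
      using Calderon_Zygmund_step[OF less.prems D, of "2 * x" f] x unfolding x_def[symmetric] by auto
    have S: "finite S" "0 < w S" "S \<subseteq> R" "2 * x < avg S f" if "S \<in> \<S>" for S
      using \<S>(3)[OF that] dyadic_finite dyadic_w_pos by blast+
    \<comment> \<open>The good part minus the mean of \<open>f\<close> has integral 0 on
      \<open>R\<close> and modulus at most \<open>2 * D * x + x\<close>, so it is a multiple of an
      atom.\<close>
    define h where "h y = g y - (if y \<in> R then average R f else 0)" for y
    have "osc R f y = h y + (\<Sum>S\<in>\<S>. osc S f y)" for y
      using g(3)[of y] by (auto simp: h_def osc_def split: if_splits)
    then have "osc R f = (\<lambda>y. h y + (\<Sum>S\<in>\<S>. osc S f y))" by blast
    then have "H1_norm \<beta> (osc R f) \<le> H1_norm \<beta> h + H1_norm \<beta> (\<lambda>y. \<Sum>S\<in>\<S>. osc S f y)"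
      using H1_norm_add by metis
    also have "\<dots> \<le> H1_norm \<beta> h + (\<Sum>S\<in>\<S>. H1_norm \<beta> (osc S f))"
      by (intro add_left_mono H1_norm_sum_le \<S>(1))
    also have "H1_norm \<beta> h \<le> ennreal (((2 * D + 1) * x) * w R)"
    proof (rule H1_norm_le_mean_zero[OF dyadic_admissible[OF less.prems]])
      show "h y = 0" if "y \<notin> R" for y using that g(1) by (simp add: h_def)
      have "cmod (average R f) \<le> x" using cmod_average_le[OF fin] by (simp add: x_def)
      then show "cmod (h y) \<le> (2 * D + 1) * x" for y
        using g(2)[of y] norm_triangle_ineq4[of "g y" "average R f"] x
        by (auto simp: h_def algebra_simps)
      have "(\<Sum>y\<in>R. m y *\<^sub>R h y) = (\<Sum>y\<in>R. m y *\<^sub>R g y) - (\<Sum>y\<in>R. m y *\<^sub>R average R f)"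
        by (simp add: h_def scaleR_diff_right sum_subtractf)
      also have "\<dots> = (\<Sum>y\<in>R. m y *\<^sub>R (f y - average R f))"
        by (simp add: g(4) scaleR_diff_right sum_subtractf)
      finally show "(\<Sum>y\<in>R. m y *\<^sub>R h y) = 0" using sum_mean_diff[OF fin] by simp
    qed
    also have "(\<Sum>S\<in>\<S>. H1_norm \<beta> (osc S f))
        \<le> (\<Sum>S\<in>\<S>. ennreal (C * (2 powr (1 - r) * x powr (1 - r) * A S)))"
    proof (rule sum_mono)
      fix S assume S': "S \<in> \<S>"
      \<comment> \<open>The mean on \<open>S\<close> exceeds twice the mean on \<open>R\<close>. So
        stopping sets are proper subsets, and the induction on cardinality applies.\<close>
      have "S \<noteq> R" using S(4)[OF S'] x by (auto simp: x_def)
      then have "card S < card R" using S(3)[OF S'] fin by (intro psubset_card_mono) auto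
      then have "H1_norm \<beta> (osc S f) \<le> ennreal (C * (avg S f powr (1 - r) * A S))"
        using less.hyps \<S>(3)[OF S'] by (simp add: C_def A_def)
      also have "\<dots> \<le> ennreal (C * ((2 * x) powr (1 - r) * A S))"
        using S(4)[OF S'] x C A0 r
        by (intro ennreal_leI mult_left_mono mult_right_mono powr_mono2') auto
      finally show "H1_norm \<beta> (osc S f) \<le> ennreal (C * (2 powr (1 - r) * x powr (1 - r) * A S))"
        using x by (simp add: powr_mult)
    qed
    also have "\<dots> = ennreal (\<Sum>S\<in>\<S>. C * (2 powr (1 - r) * x powr (1 - r) * A S))"
      using C A0 by (intro sum_ennreal) auto
    also have "(\<Sum>S\<in>\<S>. C * (2 powr (1 - r) * x powr (1 - r) * A S))
      = C * (2 powr (1 - r) * x powr (1 - r)) * (\<Sum>S\<in>\<S>. A S)"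
      by (simp add: sum_distrib_left mult.assoc)
    also have "ennreal (((2 * D + 1) * x) * w R) + ennreal \<dots> \<le> ennreal (C * (x powr (1 - r) * A R))"
    proof -
      have AS: "(\<Sum>S\<in>\<S>. A S) \<le> A R"
      proof -
        have "(\<Sum>S\<in>\<S>. A S) = (\<Sum>y\<in>\<Union>\<S>. m y * cmod (f y) powr r)"
          unfolding A_def
          using S \<S>(2) by (subst sum.Union_disjoint) (auto simp: pairwise_def disjnt_def)
        also have "\<dots> \<le> A R" unfolding A_def using S fin by (intro sum_mono2) auto
        finally show ?thesis .
      qed
      have "x * w R \<le> x powr (1 - r) * A R"
        using avg_mult_w_le[OF fin r, of f] x by (simp add: x_def A_def)
      then have "(2 * D + 1) * (x * w R) \<le> (2 * D + 1) * (x powr (1 - r) * A R)"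
        using D by (intro mult_left_mono) auto
      moreover have "C * (2 powr (1 - r) * x powr (1 - r)) * (\<Sum>S\<in>\<S>. A S)
          \<le> C * (2 powr (1 - r) * x powr (1 - r)) * A R"
        using AS C by (intro mult_left_mono) auto
      ultimately have "(2 * D + 1) * x * w R + C * (2 powr (1 - r) * x powr (1 - r)) * (\<Sum>S\<in>\<S>. A S)
        \<le> ((2 * D + 1) + 2 powr (1 - r) * C) * (x powr (1 - r) * A R)"
        by (simp add: algebra_simps)
      also have "\<dots> = C * (x powr (1 - r) * A R)" by (simp only: C2)
      finally have "ennreal ((2 * D + 1) * x * w R + C * (2 powr (1 - r) * x powr (1 - r)) * (\<Sum>S\<in>\<S>. A S))
        \<le> ennreal (C * (x powr (1 - r) * A R))" by (rule ennreal_leI)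
      then show ?thesis using D x C A0
        by (subst ennreal_plus[symmetric]) (auto intro!: mult_nonneg_nonneg sum_nonneg)
    qed
    finally show ?thesis by (simp add: C_def x_def A_def add_mono)
  qed
qed

text \<open>A single stop at the prescribed height, after which the oscillation on each stopping set
  is decomposed completely. As the means there exceed \<tau> and \<open>1 - r < 0\<close>, the
  factor \<open>avg S f powr (1 - r)\<close> is at most \<open>\<tau> powr (1 - r)\<close>.\<close>

lemma local_Calderon_Zygmund:
  assumes R: "dyadic \<beta> D R" and D: "1 \<le> D" and r: "1 < r" and \<tau>: "0 < \<tau>" "avg R f \<le> \<tau>"
  shows "\<exists>g b. (\<forall>x. (if x \<in> R then f x else 0) = g x + b x) \<and> (\<forall>x. x \<notin> R \<longrightarrow> g x = 0) \<and>
    (\<forall>x. cmod (g x) \<le> D * \<tau>) \<and> (\<Sum>x\<in>R. m x * cmod (g x)) \<le> (\<Sum>x\<in>R. m x * cmod (f x)) \<and>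
    H1_norm \<beta> b \<le> ennreal ((2 * D + 1) / (1 - 2 powr (1 - r)) * (\<tau> powr (1 - r) * (\<Sum>x\<in>R. m x * cmod (f x) powr r)))"
proof -
  define C where "C = (2 * D + 1) / (1 - 2 powr (1 - r))"
  have q: "0 < 1 - 2 powr (1 - r)" using r by (simp add: powr_less_one)
  have C: "0 \<le> C" using D q by (auto simp: C_def field_simps)
  have fin: "finite R" "0 < w R" using R dyadic_finite dyadic_w_pos by blast+
  define A where "A S = (\<Sum>x\<in>S. m x * cmod (f x) powr r)" for S
  have A0: "0 \<le> A S" for S by (simp add: A_def sum_nonneg)
  obtain \<S> g where \<S>: "finite \<S>" "disjoint \<S>"
      "\<And>S. S \<in> \<S> \<Longrightarrow> dyadic \<beta> D S \<and> S \<subseteq> R \<and> \<tau> < avg S f"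
      and g: "\<And>y. y \<notin> R \<Longrightarrow> g y = 0" "\<And>y. cmod (g y) \<le> D * \<tau>"
        "\<And>y. (if y \<in> R then f y else 0) = g y + (\<Sum>S\<in>\<S>. osc S f y)"
        "(\<Sum>x\<in>R. m x * cmod (g x)) \<le> (\<Sum>x\<in>R. m x * cmod (f x))"
    using Calderon_Zygmund_step[OF R D, of \<tau> f] \<tau> by auto
  have S: "finite S" "S \<subseteq> R" "\<tau> < avg S f" if "S \<in> \<S>" for S
    using \<S>(3)[OF that] dyadic_finite by blast+
  have "H1_norm \<beta> (\<lambda>y. \<Sum>S\<in>\<S>. osc S f y) \<le> (\<Sum>S\<in>\<S>. H1_norm \<beta> (osc S f))"
    by (intro H1_norm_sum_le \<S>(1))
  also have "\<dots> \<le> (\<Sum>S\<in>\<S>. ennreal (C * (\<tau> powr (1 - r) * A S)))"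
  proof (rule sum_mono)
    fix S assume S': "S \<in> \<S>"
    have "H1_norm \<beta> (osc S f) \<le> ennreal (C * (avg S f powr (1 - r) * A S))"
      using H1_norm_osc_le[of \<beta> D S r f] \<S>(3)[OF S'] D r by (simp add: C_def A_def)
    also have "\<dots> \<le> ennreal (C * (\<tau> powr (1 - r) * A S))"
      using S(3)[OF S'] \<tau> C A0 r by (intro ennreal_leI mult_left_mono mult_right_mono powr_mono2') auto
    finally show "H1_norm \<beta> (osc S f) \<le> ennreal (C * (\<tau> powr (1 - r) * A S))" .
  qed
  also have "\<dots> = ennreal (\<Sum>S\<in>\<S>. C * (\<tau> powr (1 - r) * A S))"
    using C A0 by (intro sum_ennreal) auto
  also have "\<dots> \<le> ennreal (C * (\<tau> powr (1 - r) * A R))"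
  proof -
    have "(\<Sum>S\<in>\<S>. A S) = (\<Sum>y\<in>\<Union>\<S>. m y * cmod (f y) powr r)"
      unfolding A_def using S \<S>(2) by (subst sum.Union_disjoint) (auto simp: pairwise_def disjnt_def)
    also have "\<dots> \<le> A R" unfolding A_def using S fin by (intro sum_mono2) auto
    finally have "C * \<tau> powr (1 - r) * (\<Sum>S\<in>\<S>. A S) \<le> C * \<tau> powr (1 - r) * A R"
      using C by (intro mult_left_mono) auto
    then show ?thesis by (intro ennreal_leI) (simp add: sum_distrib_left mult.assoc)
  qed
  finally have "H1_norm \<beta> (\<lambda>y. \<Sum>S\<in>\<S>. osc S f y) \<le> ennreal (C * (\<tau> powr (1 - r) * A R))" .
  then show ?thesis using g
    by (intro exI[of _ g] exI[of _ "\<lambda>y. \<Sum>S\<in>\<S>. osc S f y"]) (auto simp: C_def A_def)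
qed

end

lemma eventually_powr_tail:
  fixes a c e :: real
  assumes "0 < a" "0 < e"
  shows "\<exists>k::int. \<forall>j\<ge>k. c * 2 powr (- a * real_of_int j) \<le> e"
proof (cases "c \<le> 0")
  case True
  then have "c * 2 powr (- a * real_of_int j) \<le> e" for j :: int
    using assms mult_nonpos_nonneg[OF True powr_ge_zero, of 2 "- a * real_of_int j"] by linarith
  then show ?thesis by blast
next
  case False
  then have c: "0 < c" by simp
  show ?thesis
  proof (intro exI allI impI)
    fix j :: int assume "\<lceil>log 2 (c / e) / a\<rceil> \<le> j"
    then have "log 2 (c / e) \<le> a * j" using assms by (simp add: ceiling_le_iff field_simps)
    then have "2 powr (- a * j) \<le> 2 powr (- log 2 (c / e))" by (intro powr_mono) auto
    also have "\<dots> = e / c" using c assms by (simp add: powr_minus)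
    finally show "c * 2 powr (- a * j) \<le> e" using c by (simp add: field_simps)
  qed
qed

text \<open>Turns a product of two level bounds into a sum, so that each of them can be summed over
  the levels by itself.\<close>

lemma powr_weighted_le_add:
  fixes x y a :: real
  assumes "0 \<le> x" "0 \<le> y" "0 < a" "a < 1"
  shows "x powr a * y powr (1 - a) \<le> x + y"
proof (cases "x = 0 \<or> y = 0")
  case False
  then have "x powr a * y powr (1 - a) \<le> a * x + (1 - a) * y"
    using assms by (intro Youngs_inequality_0) auto
  also have "\<dots> \<le> 1 * x + 1 * y" using assms by (intro add_mono mult_right_mono) auto
  finally show ?thesis by simp
qed (use assms in auto)

context doubling_flow_tree
begin

section \<open>Decomposition on the whole tree\<close>

lemma dyadic_exhaustion:
  assumes "8 \<le> \<beta>"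
  shows "\<exists>D\<ge>1. \<forall>n. dyadic \<beta> D (exhaustion n)"
proof (rule dyadic_trapezoids[OF assms])
  fix D assume "1 \<le> D" and D: "\<And>h h' x. 1 \<le> h \<Longrightarrow> 2 * h \<le> h' \<Longrightarrow> h' \<le> 8 * h \<Longrightarrow> dyadic \<beta> D (trapezoid h h' x)"
  have "dyadic \<beta> D (exhaustion n)" for n unfolding exhaustion_def by (rule D) auto
  with \<open>1 \<le> D\<close> show ?thesis by blast
qed

lemma SUP_exhaustion:
  "(SUP n. \<integral>\<^sup>+x\<in>exhaustion n. u x \<partial>M) = (\<integral>\<^sup>+x. u x \<partial>M)"
proof -
  have "(\<integral>\<^sup>+x. (SUP n. u x * indicator (exhaustion n) x) \<partial>M) = (SUP n. \<integral>\<^sup>+x\<in>exhaustion n. u x \<partial>M)"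
  proof (rule nn_integral_monotone_convergence_SUP)
    show "incseq (\<lambda>n x. u x * indicator (exhaustion n) x)"
      using exhaustion_mono by (auto simp: incseq_def le_fun_def indicator_def)
  qed simp
  moreover have "(SUP n. u x * indicator (exhaustion n) x) = u x" for x
  proof (rule antisym)
    obtain n where "x \<in> exhaustion n" using exhaustion_eventually by blast
    then show "u x \<le> (SUP n. u x * indicator (exhaustion n) x)"
      by (intro SUP_upper2[of n]) auto
  qed (auto intro!: SUP_least simp: indicator_def)
  ultimately show ?thesis by simp
qed

lemma set_power_integral_finite:
  assumes "finite P"
  shows "(\<integral>\<^sup>+x\<in>P. ennreal (cmod (h x) powr r) \<partial>M) = ennreal (\<Sum>x\<in>P. m x * cmod (h x) powr r)"
proof -
  have "(\<integral>\<^sup>+x\<in>P. ennreal (cmod (h x) powr r) \<partial>M) = (\<Sum>x\<in>P. ennreal (m x) * ennreal (cmod (h x) powr r))"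
    using assms by (subst nn_integral_M_finite[of P]) auto
  then show ?thesis by (simp add: ennreal_mult[symmetric])
qed

text \<open>The part of \<open>h\<close> far out is decomposed at smaller and smaller heights \<open>\<tau> / 2 ^ Suc k\<close>; the
  cost remains summable because the corresponding tails are chosen small enough.\<close>

lemma global_Calderon_Zygmund:
  assumes ex: "\<And>n. dyadic \<beta> D (exhaustion n)" and D: "1 \<le> D" and r: "1 < r" and \<tau>: "0 < \<tau>"
    and h: "power_integral r h = ennreal S" "0 \<le> S" and large: "\<And>x. h x \<noteq> 0 \<Longrightarrow> \<tau> \<le> cmod (h x)"
  shows "\<exists>g b. (\<forall>x. h x = g x + b x) \<and> (\<forall>x. cmod (g x) \<le> D * \<tau>) \<and>
    Lp_norm M 1 g \<le> ennreal (2 * (\<tau> powr (1 - r) * S)) \<and>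
    H1_norm \<beta> b \<le> ennreal ((2 * D + 1) / (1 - 2 powr (1 - r)) * 2 powr r * (\<tau> powr (1 - r) * S))"
proof -
  define C where "C = (2 * D + 1) / (1 - 2 powr (1 - r))"
  have q: "0 < 1 - 2 powr (1 - r)" using r by (simp add: powr_less_one)
  have C: "0 \<le> C" using D q by (auto simp: C_def)
  define A where "A P = (\<Sum>x\<in>P. m x * cmod (h x) powr r)" for P
  have A_mono: "A P \<le> A Q" if "P \<subseteq> Q" "finite Q" for P Q
    unfolding A_def using that by (intro sum_mono2) auto
  have SUP: "(SUP n. ennreal (A (exhaustion n))) = ennreal S"
    using SUP_exhaustion[of "\<lambda>x. ennreal (cmod (h x) powr r)"] h
    by (simp add: set_power_integral_finite finite_exhaustion A_def power_integral_def)
  have A_le: "A (exhaustion n) \<le> S" for n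
  proof -
    have "ennreal (A (exhaustion n)) \<le> ennreal S" unfolding SUP[symmetric] by (intro SUP_upper) auto
    then show ?thesis using h by (simp add: ennreal_le_iff)
  qed
  \<comment> \<open>Halving the heights makes the cost per unit of tail grow like
    \<open>2 powr (k * (r - 1))\<close>; tails decaying like \<open>2 powr (- k * r)\<close> beat
    this by a factor \<open>2 ^ k\<close>.\<close>
  have "\<exists>n. S - A (exhaustion n) \<le> 2 powr (- (real k + 1) * r) * S" for k
  proof (cases "S = 0")
    case True
    then show ?thesis by (auto simp: A_def sum_nonneg)
  next
    case False
    then have "ennreal (S - 2 powr (- (real k + 1) * r) * S) < ennreal S"
      using h r by (intro ennreal_lessI) auto
    then obtain n where "ennreal (S - 2 powr (- (real k + 1) * r) * S) < ennreal (A (exhaustion n))"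
      unfolding SUP[symmetric] less_SUP_iff by blast
    then have "S - 2 powr (- (real k + 1) * r) * S < A (exhaustion n)"
      by (metis ennreal_leI not_less)
    then show ?thesis by (intro exI[of _ n]) linarith
  qed
  then obtain \<nu> where \<nu>: "\<And>k. S - A (exhaustion (\<nu> k)) \<le> 2 powr (- (real k + 1) * r) * S" by metis
  \<comment> \<open>Partial sums make the indices increasing while keeping
    \<open>\<nu> k \<le> n k\<close>; the summand \<open>k\<close> ensures that the sets
    \<open>P k\<close> cover the tree.\<close>
  define n where "n k = k + (\<Sum>i\<le>k. \<nu> i)" for k
  have n: "\<nu> k \<le> n k" "k \<le> n k" "n k \<le> n (Suc k)" for k
    by (auto simp: n_def intro: order_trans[OF member_le_sum[of k "{..k}" \<nu>]])
  \<comment> \<open>\<open>P 0\<close> is empty, so the first shell contains the whole of the first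
    finite set, and the tail bound for \<open>k = 0\<close> is trivial.\<close>
  define P where "P k = (case k of 0 \<Rightarrow> {} | Suc j \<Rightarrow> exhaustion (n j))" for k
  have P_fin: "finite (P k)" for k by (auto simp: P_def finite_exhaustion split: nat.split)
  have P_mono: "P k \<subseteq> P (Suc k)" for k
    using exhaustion_mono[OF n(3)] by (auto simp: P_def split: nat.split)
  have P_tail: "S - A (P k) \<le> 2 powr (- real k * r) * S" for k
  proof (cases k)
    case 0
    then show ?thesis by (simp add: P_def A_def)
  next
    case (Suc j)
    have "A (exhaustion (\<nu> j)) \<le> A (P k)"
      using Suc exhaustion_mono[OF n(1)[of j]] by (intro A_mono) (auto simp: P_def finite_exhaustion)
    then show ?thesis using \<nu>[of j] Suc by (simp add: algebra_simps)
  qed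
  have P_le: "A (P k) \<le> S" for k
    using A_le h by (cases k) (auto simp: P_def A_def)
  define H where "H k x = (if x \<in> P (Suc k) - P k then h x else 0)" for k x
  have H_powr: "(\<Sum>x\<in>Q. m x * cmod (H k x) powr r) \<le> 2 powr (- real k * r) * S"
    if "P (Suc k) \<subseteq> Q" "finite Q" for k Q
  proof -
    have "(\<Sum>x\<in>Q. m x * cmod (H k x) powr r) = (\<Sum>x\<in>P (Suc k) - P k. m x * cmod (H k x) powr r)"
      using that by (intro sum.mono_neutral_right) (auto simp: H_def)
    also have "\<dots> = A (P (Suc k) - P k)" unfolding A_def by (intro sum.cong) (auto simp: H_def)
    also have "\<dots> = A (P (Suc k)) - A (P k)"
      unfolding A_def using P_mono P_fin by (intro sum_diff)
    also have "\<dots> \<le> S - A (P k)" using P_le by simp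
    also note P_tail
    finally show ?thesis .
  qed
  have H_sums: "(\<lambda>k. H k x) sums h x" for x
  proof -
    define F where "F k = (if x \<in> P k then h x else 0)" for k
    have "F \<longlonglongrightarrow> h x"
    proof (rule tendsto_eventually)
      obtain N where N: "\<And>n. N \<le> n \<Longrightarrow> x \<in> exhaustion n" using exhaustion_eventually by blast
      have "x \<in> P k" if "Suc N \<le> k" for k
        using that N[of "n (k - 1)"] n(2)[of "k - 1"] by (cases k) (auto simp: P_def)
      then show "eventually (\<lambda>k. F k = h x) sequentially"
        unfolding eventually_sequentially F_def by (intro exI[of _ "Suc N"]) auto
    qed
    then have "(\<lambda>k. F (Suc k) - F k) sums (h x - F 0)" by (rule telescope_sums)
    moreover have "F (Suc k) - F k = H k x" for k
      using P_mono[of k] by (auto simp: F_def H_def)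
    moreover have "F 0 = 0" by (simp add: F_def P_def)
    ultimately show ?thesis by simp
  qed
  \<comment> \<open>The heights sum to \<tau>, which keeps the sum of all good parts below
    \<open>D * \<tau>\<close>.\<close>
  define t where "t k = \<tau> * (1/2) ^ Suc k" for k :: nat
  have t: "0 < t k" for k using \<tau> by (simp add: t_def)
  have cost: "t k powr (1 - r) * 2 powr (- real k * r) = 2 powr (r - 1) * \<tau> powr (1 - r) * (1/2) ^ k"
    for k
  proof -
    have half: "((1/2::real) ^ j) = 2 powr (- real j)" for j
      by (simp add: powr_minus_divide powr_realpow power_one_over)
    have "t k powr (1 - r) = \<tau> powr (1 - r) * 2 powr (- real (Suc k) * (1 - r))"
      using \<tau> unfolding t_def half by (simp add: powr_mult powr_powr)
    moreover have "2 powr (- real (Suc k) * (1 - r)) * 2 powr (- real k * r)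
        = 2 powr (r - 1) * 2 powr (- real k)"
      by (simp add: powr_add[symmetric] algebra_simps)
    ultimately show ?thesis unfolding half by simp
  qed
  have "\<exists>g b. (\<forall>x. H k x = g x + b x) \<and> (\<forall>x. cmod (g x) \<le> D * t k) \<and>
    Lp_norm M 1 g \<le> ennreal (\<tau> powr (1 - r) * (2 powr (- real k * r) * S)) \<and>
    H1_norm \<beta> b \<le> ennreal (C * (t k powr (1 - r) * (2 powr (- real k * r) * S)))" for k
  proof -
    define B where "B = (\<Sum>x\<in>P (Suc k). m x * cmod (H k x))"
    \<comment> \<open>The mean modulus of \<open>H k\<close> is pushed below \<open>t k\<close> by
      enlarging the set around its fixed support; this is where the infinite mass of the tree is
      used.\<close>
    obtain N0 :: nat where N0: "B / (m (\<omega> 0) * t k) \<le> real N0" using real_arch_simple by blast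
    define N where "N = max N0 (n k)"
    let ?R = "exhaustion N"
    have PR: "P (Suc k) \<subseteq> ?R" using exhaustion_mono[of "n k" N] by (simp add: P_def N_def)
    have dy: "dyadic \<beta> D ?R" by (rule ex)
    have wR: "0 < w ?R" using dy by (rule dyadic_w_pos)
    have "avg ?R (H k) \<le> t k"
    proof -
      have "(\<Sum>x\<in>?R. m x * cmod (H k x)) = B"
        unfolding B_def using PR finite_exhaustion by (intro sum.mono_neutral_right) (auto simp: H_def)
      moreover have "B \<le> t k * w ?R"
      proof -
        have "B \<le> t k * (real N0 * m (\<omega> 0))"
          using N0 t[of k] m_pos[of "\<omega> 0"] by (simp add: field_simps)
        also have "\<dots> \<le> t k * (real N * m (\<omega> 0))"
          using t[of k] by (intro mult_left_mono mult_right_mono) (auto simp: N_def)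
        also have "\<dots> \<le> t k * w ?R" using t[of k] w_exhaustion_ge by (intro mult_left_mono) auto
        finally show ?thesis .
      qed
      ultimately show ?thesis using wR by (simp add: avg_def field_simps)
    qed
    from local_Calderon_Zygmund[OF dy D r t this] obtain g b where gb:
      "\<And>x. (if x \<in> ?R then H k x else 0) = g x + b x" "\<And>x. x \<notin> ?R \<Longrightarrow> g x = 0" "\<And>x. cmod (g x) \<le> D * t k"
      "(\<Sum>x\<in>?R. m x * cmod (g x)) \<le> (\<Sum>x\<in>?R. m x * cmod (H k x))"
      "H1_norm \<beta> b \<le> ennreal (C * (t k powr (1 - r) * (\<Sum>x\<in>?R. m x * cmod (H k x) powr r)))"
      unfolding C_def by blast
    have "H k x = g x + b x" for x using gb(1)[of x] PR by (auto simp: H_def split: if_splits)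
    moreover have "Lp_norm M 1 g \<le> ennreal (\<tau> powr (1 - r) * (2 powr (- real k * r) * S))"
    proof -
      have "Lp_norm M 1 g = (\<Sum>x\<in>?R. ennreal (m x) * ennreal (cmod (g x)))"
        unfolding Lp_norm_1 using gb(2) finite_exhaustion by (intro nn_integral_M_finite) auto
      also have "\<dots> = ennreal (\<Sum>x\<in>?R. m x * cmod (g x))"
        by (simp add: ennreal_mult[symmetric])
      also have "\<dots> \<le> ennreal (\<tau> powr (1 - r) * (2 powr (- real k * r) * S))"
      proof (rule ennreal_leI)
        note gb(4)
        \<comment> \<open>Where \<open>H k\<close> is nonzero it has modulus at least \<tau>,
          however small \<open>t k\<close> is, so its L1 norm is controlled by \<open>r\<close>-th
          powers with the same factor at every stage.\<close>
        also have "(\<Sum>x\<in>?R. m x * cmod (H k x)) \<le> (\<Sum>x\<in>?R. \<tau> powr (1 - r) * (m x * cmod (H k x) powr r))"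
        proof (rule sum_mono)
          fix x
          show "m x * cmod (H k x) \<le> \<tau> powr (1 - r) * (m x * cmod (H k x) powr r)"
          proof (cases "H k x = 0")
            case False
            then have "H k x = h x" "h x \<noteq> 0" by (auto simp: H_def split: if_splits)
            then have le: "\<tau> \<le> cmod (H k x)" using large by simp
            have "cmod (H k x) = cmod (H k x) powr (1 - r) * cmod (H k x) powr r"
              using False by (simp add: powr_add[symmetric])
            also have "\<dots> \<le> \<tau> powr (1 - r) * cmod (H k x) powr r"
              using le \<tau> r by (intro mult_right_mono powr_mono2') auto
            finally have "m x * cmod (H k x) \<le> m x * (\<tau> powr (1 - r) * cmod (H k x) powr r)"
              by (rule mult_left_mono) simp
            then show ?thesis by (simp add: mult_ac)
          qed simp
        qed
        also have "\<dots> = \<tau> powr (1 - r) * (\<Sum>x\<in>?R. m x * cmod (H k x) powr r)"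
          by (simp add: sum_distrib_left)
        also have "\<dots> \<le> \<tau> powr (1 - r) * (2 powr (- real k * r) * S)"
          using H_powr[OF PR finite_exhaustion] by (intro mult_left_mono) auto
        finally show "(\<Sum>x\<in>?R. m x * cmod (g x)) \<le> \<tau> powr (1 - r) * (2 powr (- real k * r) * S)" .
      qed
      finally show ?thesis .
    qed
    moreover have "H1_norm \<beta> b \<le> ennreal (C * (t k powr (1 - r) * (2 powr (- real k * r) * S)))"
      using H_powr[OF PR finite_exhaustion] C
      by (intro order_trans[OF gb(5)] ennreal_leI mult_left_mono) auto
    ultimately show ?thesis using gb(3) by blast
  qed
  then obtain g b where gb: "\<And>k x. H k x = g k x + b k x" "\<And>k x. cmod (g k x) \<le> D * t k"
    "\<And>k. Lp_norm M 1 (g k) \<le> ennreal (\<tau> powr (1 - r) * (2 powr (- real k * r) * S))"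
    "\<And>k. H1_norm \<beta> (b k) \<le> ennreal (C * (t k powr (1 - r) * (2 powr (- real k * r) * S)))"
    by metis
  define G where "G x = (\<Sum>k. g k x)" for x
  have t_sums: "(\<lambda>k. D * t k) sums (D * \<tau>)"
    using sums_mult[OF sums_mult[OF power_half_series, of \<tau>], of D] by (simp add: t_def)
  have g_sm: "summable (\<lambda>k. norm (g k x))" for x
    using gb(2)[of _ x] by (intro summable_comparison_test'[OF sums_summable[OF t_sums]]) auto
  have g_sums: "(\<lambda>k. g k x) sums G x" for x
    unfolding G_def using summable_norm_cancel[OF g_sm] by (rule summable_sums)
  have b_sums: "(\<lambda>k. b k x) sums (h x - G x)" for x
    using sums_diff[OF H_sums g_sums, of x x] gb(1)[of _ x] by simp
  have geo: "(\<lambda>k. K * (1/2) ^ k) sums (2 * K)" for K :: real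
    using sums_mult[OF geometric_sums[of "1/2::real"], of K] by (simp add: mult.commute[of 2 K])
  show ?thesis
  proof (rule exI[of _ G], rule exI[of _ "\<lambda>x. h x - G x"], intro conjI allI)
    show "cmod (G x) \<le> D * \<tau>" for x
    proof -
      have "cmod (G x) \<le> (\<Sum>k. norm (g k x))" unfolding G_def by (rule summable_norm[OF g_sm])
      also have "\<dots> \<le> (\<Sum>k. D * t k)" by (intro suminf_le gb(2) g_sm sums_summable[OF t_sums])
      also have "\<dots> = D * \<tau>" using t_sums by (simp add: sums_iff)
      finally show ?thesis .
    qed
    have "Lp_norm M 1 G \<le> (\<Sum>k. Lp_norm M 1 (g k))" by (rule L1_sums_le[OF g_sums])
    also have "\<dots> \<le> (\<Sum>k. ennreal ((\<tau> powr (1 - r) * S) * (1/2) ^ k))"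
    proof (intro suminf_le)
      fix k
      have "2 powr (- real k * r) \<le> 2 powr (- real k)"
        using r mult_left_mono[of 1 r "real k"] by (intro powr_mono) auto
      also have "\<dots> = (1/2) ^ k" by (simp add: powr_minus_divide powr_realpow power_one_over)
      finally have "(\<tau> powr (1 - r) * S) * 2 powr (- real k * r) \<le> (\<tau> powr (1 - r) * S) * (1/2) ^ k"
        using h by (intro mult_left_mono) auto
      then show "Lp_norm M 1 (g k) \<le> ennreal ((\<tau> powr (1 - r) * S) * (1/2) ^ k)"
        by (intro order_trans[OF gb(3)] ennreal_leI) (simp add: mult_ac)
    qed auto
    also have "\<dots> = ennreal (2 * (\<tau> powr (1 - r) * S))"
      using geo[of "\<tau> powr (1 - r) * S"] h by (subst suminf_ennreal2) (auto simp: sums_iff)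
    finally show "Lp_norm M 1 G \<le> ennreal (2 * (\<tau> powr (1 - r) * S))" .
    have "H1_norm \<beta> (\<lambda>x. h x - G x) \<le> (\<Sum>k. H1_norm \<beta> (b k))" by (rule H1_norm_sums_le[OF b_sums])
    also have "\<dots> \<le> (\<Sum>k. ennreal ((C * 2 powr (r - 1) * \<tau> powr (1 - r) * S) * (1/2) ^ k))"
    proof (intro suminf_le)
      fix k
      have "C * (t k powr (1 - r) * (2 powr (- real k * r) * S))
          = C * (t k powr (1 - r) * 2 powr (- real k * r)) * S"
        by simp
      also have "\<dots> = (C * 2 powr (r - 1) * \<tau> powr (1 - r) * S) * (1/2) ^ k"
        unfolding cost by simp
      finally have eq: "C * (t k powr (1 - r) * (2 powr (- real k * r) * S))
        = (C * 2 powr (r - 1) * \<tau> powr (1 - r) * S) * (1/2) ^ k" .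
      show "H1_norm \<beta> (b k) \<le> ennreal ((C * 2 powr (r - 1) * \<tau> powr (1 - r) * S) * (1/2) ^ k)"
        unfolding eq[symmetric] by (rule gb(4))
    qed auto
    also have "\<dots> = ennreal (2 * (C * 2 powr (r - 1) * \<tau> powr (1 - r) * S))"
      using geo[of "C * 2 powr (r - 1) * \<tau> powr (1 - r) * S"] h C
      by (subst suminf_ennreal2) (auto simp: sums_iff)
    also have "2 * (C * 2 powr (r - 1) * \<tau> powr (1 - r) * S) = C * 2 powr r * (\<tau> powr (1 - r) * S)"
      by (simp add: powr_diff)
    finally show "H1_norm \<beta> (\<lambda>x. h x - G x)
      \<le> ennreal ((2 * D + 1) / (1 - 2 powr (1 - r)) * 2 powr r * (\<tau> powr (1 - r) * S))" by (simp add: C_def)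
  qed simp
qed

section \<open>Estimates of the \<open>K\<close>-functional from above\<close>

text \<open>The tail of \<open>f\<close> above height \<tau>. With \<open>1 < r < p\<close> it
  controls the H1 norm of a bad part and is finite on \<open>L^p\<close>; with \<open>r\<close> the
  exponent of the first Lebesgue space it serves plain truncation.\<close>

definition upper_part :: "real \<Rightarrow> real \<Rightarrow> ('v \<Rightarrow> complex) \<Rightarrow> ennreal" where
  "upper_part r \<tau> f = (\<integral>\<^sup>+x. ennreal (if \<tau> < cmod (f x) then cmod (f x) powr r else 0) \<partial>M)"

lemma upper_part_le:
  assumes "r \<le> p" "0 < \<tau>"
  shows "upper_part r \<tau> f \<le> ennreal (\<tau> powr (r - p)) * power_integral p f"
proof -
  have "upper_part r \<tau> f \<le> (\<integral>\<^sup>+x. ennreal (\<tau> powr (r - p)) * ennreal (cmod (f x) powr p) \<partial>M)"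
    unfolding upper_part_def
  proof (rule nn_integral_mono)
    fix x
    have "cmod (f x) powr r \<le> \<tau> powr (r - p) * cmod (f x) powr p" if "\<tau> < cmod (f x)"
    proof -
      have "cmod (f x) powr r = cmod (f x) powr (r - p) * cmod (f x) powr p"
        using that assms by (simp add: powr_add[symmetric])
      also have "\<dots> \<le> \<tau> powr (r - p) * cmod (f x) powr p"
        using that assms by (intro mult_right_mono powr_mono2') auto
      finally show ?thesis .
    qed
    then show "ennreal (if \<tau> < cmod (f x) then cmod (f x) powr r else 0)
      \<le> ennreal (\<tau> powr (r - p)) * ennreal (cmod (f x) powr p)"
      by (auto simp: ennreal_mult[symmetric] intro!: ennreal_leI)
  qed
  also have "\<dots> = ennreal (\<tau> powr (r - p)) * power_integral p f"
    unfolding power_integral_def by (rule nn_integral_cmult) simp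
  finally show ?thesis .
qed

text \<open>A layer-cake argument: for fixed \<open>x\<close> only heights below
  \<open>cmod (f x)\<close> count, and their weights sum to a multiple of
  \<open>cmod (f x) powr (p - r)\<close>, which completes the exponent \<open>r\<close> to
  \<open>p\<close>.\<close>

lemma upper_part_sum_le:
  assumes "0 \<le> r" "r < p"
  shows "(\<integral>\<^sup>+j. ennreal (2 powr ((p - r) * real_of_int j)) * upper_part r (2 powr real_of_int j) f \<partial>count_space (UNIV :: int set))
    \<le> ennreal (1 / (1 - 2 powr - (p - r))) * power_integral p f"
proof -
  have q: "0 < 1 - 2 powr - (p - r)" using assms by (simp add: powr_less_one)
  have "(\<integral>\<^sup>+j. ennreal (2 powr ((p - r) * real_of_int j)) * upper_part r (2 powr real_of_int j) f \<partial>count_space (UNIV :: int set))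
    = (\<integral>\<^sup>+j. (\<integral>\<^sup>+x. ennreal (2 powr ((p - r) * real_of_int j)) *
        ennreal (if 2 powr real_of_int j < cmod (f x) then cmod (f x) powr r else 0) \<partial>M) \<partial>count_space (UNIV :: int set))"
    unfolding upper_part_def by (intro nn_integral_cong nn_integral_cmult[symmetric]) simp
  also have "\<dots> = (\<integral>\<^sup>+x. (\<integral>\<^sup>+j. ennreal (2 powr ((p - r) * real_of_int j)) *
        ennreal (if 2 powr real_of_int j < cmod (f x) then cmod (f x) powr r else 0) \<partial>count_space (UNIV :: int set)) \<partial>M)"
    by (rule nn_integral_count_space_nn_integral[symmetric]) auto
  also have "\<dots> \<le> (\<integral>\<^sup>+x. ennreal (1 / (1 - 2 powr - (p - r))) * ennreal (cmod (f x) powr p) \<partial>M)"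
  proof (rule nn_integral_mono)
    fix x
    have "(\<integral>\<^sup>+j. ennreal (2 powr ((p - r) * real_of_int j)) *
        ennreal (if 2 powr real_of_int j < cmod (f x) then cmod (f x) powr r else 0) \<partial>count_space (UNIV :: int set))
      \<le> (\<integral>\<^sup>+j. ennreal (cmod (f x) powr r) * (ennreal (2 powr ((p - r) * real_of_int j)) *
        indicator {j. 2 powr real_of_int j \<le> cmod (f x)} j) \<partial>count_space (UNIV :: int set))"
      by (intro nn_integral_mono) (auto simp: indicator_def mult.commute)
    also have "\<dots> = ennreal (cmod (f x) powr r) * (\<integral>\<^sup>+j. ennreal (2 powr ((p - r) * real_of_int j)) *
        indicator {j. 2 powr real_of_int j \<le> cmod (f x)} j \<partial>count_space (UNIV :: int set))"
      by (rule nn_integral_cmult) simp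
    also have "\<dots> \<le> ennreal (cmod (f x) powr r)
        * ennreal (cmod (f x) powr (p - r) / (1 - 2 powr - (p - r)))"
      using assms by (intro mult_left_mono nn_integral_count_space_geometric) auto
    also have "\<dots> = ennreal (1 / (1 - 2 powr - (p - r))) * ennreal (cmod (f x) powr p)"
      using q by (auto simp: ennreal_mult[symmetric] powr_add[symmetric])
    finally show "(\<integral>\<^sup>+j. ennreal (2 powr ((p - r) * real_of_int j)) *
        ennreal (if 2 powr real_of_int j < cmod (f x) then cmod (f x) powr r else 0) \<partial>count_space (UNIV :: int set))
      \<le> ennreal (1 / (1 - 2 powr - (p - r))) * ennreal (cmod (f x) powr p)" .
  qed
  also have "\<dots> = ennreal (1 / (1 - 2 powr - (p - r))) * power_integral p f"
    unfolding power_integral_def by (rule nn_integral_cmult) simp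
  finally show ?thesis .
qed

text \<open>A density whose integral bounds the \<open>s\<close>-th powers of the good part at
  height \<tau>. Where \<open>f\<close> is large, the decomposition controls the good part only
  through \<open>r\<close>-th powers of \<open>f\<close>, hence the first branch; the two branches
  agree at \<open>cmod (f x) = \<tau>\<close>.\<close>

definition truncated :: "real \<Rightarrow> real \<Rightarrow> real \<Rightarrow> ('v \<Rightarrow> complex) \<Rightarrow> 'v \<Rightarrow> real" where
  "truncated r s \<tau> f x =
    (if \<tau> < cmod (f x) then \<tau> powr (s - r) * cmod (f x) powr r else cmod (f x) powr s)"

lemma truncated_nonneg [simp]: "0 \<le> truncated r s \<tau> f x"
  by (simp add: truncated_def)

text \<open>Gives finiteness for \<open>f\<close> in \<open>L^p\<close> and, because
  \<open>p < s\<close> in the application, the decay of the level bounds for small heights.\<close>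

lemma truncated_le:
  assumes "r \<le> p" "p \<le> s" "0 < \<tau>"
  shows "truncated r s \<tau> f x \<le> \<tau> powr (s - p) * cmod (f x) powr p"
proof (cases "\<tau> < cmod (f x)")
  case True
  have "\<tau> powr (s - r) * cmod (f x) powr r = \<tau> powr (s - p) * (\<tau> powr (p - r) * cmod (f x) powr r)"
    using assms by (simp add: mult.assoc[symmetric] powr_add[symmetric])
  also have "\<dots> \<le> \<tau> powr (s - p) * (cmod (f x) powr (p - r) * cmod (f x) powr r)"
    using assms True by (intro mult_left_mono mult_right_mono powr_mono2) auto
  also have "\<dots> = \<tau> powr (s - p) * cmod (f x) powr p" using assms True by (simp add: powr_add[symmetric])
  finally show ?thesis using True by (simp add: truncated_def)
next
  case False
  have "cmod (f x) powr s = cmod (f x) powr (s - p) * cmod (f x) powr p"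
    using assms by (simp add: powr_add[symmetric])
  also have "\<dots> \<le> \<tau> powr (s - p) * cmod (f x) powr p"
    using assms False by (intro mult_right_mono powr_mono2) auto
  finally show ?thesis using False by (simp add: truncated_def)
qed

lemma truncated_mono:
  assumes "0 < r" "r \<le> s" "0 < \<tau>" "\<tau> \<le> \<sigma>"
  shows "truncated r s \<tau> f x \<le> truncated r s \<sigma> f x"
proof -
  consider "\<sigma> < cmod (f x)" | "\<tau> < cmod (f x)" "cmod (f x) \<le> \<sigma>" | "cmod (f x) \<le> \<tau>" by linarith
  then show ?thesis
  proof cases
    case 1
    then show ?thesis using assms by (auto simp: truncated_def intro!: mult_right_mono powr_mono2)
  next
    case 2
    have "\<tau> powr (s - r) * cmod (f x) powr r \<le> cmod (f x) powr (s - r) * cmod (f x) powr r"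
      using 2 assms by (intro mult_right_mono powr_mono2) auto
    also have "\<dots> = cmod (f x) powr s" using 2 assms by (simp add: powr_add[symmetric])
    finally show ?thesis using 2 by (simp add: truncated_def)
  qed (use assms in \<open>simp add: truncated_def\<close>)
qed

text \<open>A factor \<open>2 powr s\<close> for the integral is a factor 2 for the norm in
  \<open>L^s\<close>, as the growth condition \<open>Bstep\<close> on the level bounds
  demands.\<close>

lemma truncated_double:
  assumes "0 < r" "r \<le> s" "0 < \<tau>"
  shows "truncated r s (2 * \<tau>) f x \<le> 2 powr s * truncated r s \<tau> f x"
proof -
  have 2: "2 powr (s - r) \<le> 2 powr s" "1 \<le> 2 powr s"
    using assms by (auto intro!: powr_mono ge_one_powr_ge_zero)
  consider "2 * \<tau> < cmod (f x)" | "\<tau> < cmod (f x)" "cmod (f x) \<le> 2 * \<tau>" | "cmod (f x) \<le> \<tau>" by linarith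
  then show ?thesis
  proof cases
    case 1
    have "(2 * \<tau>) powr (s - r) * cmod (f x) powr r
        = 2 powr (s - r) * (\<tau> powr (s - r) * cmod (f x) powr r)"
      using assms by (simp add: powr_mult)
    also have "\<dots> \<le> 2 powr s * (\<tau> powr (s - r) * cmod (f x) powr r)"
      using 2 by (intro mult_right_mono) auto
    finally show ?thesis using 1 assms by (simp add: truncated_def)
  next
    case 2
    have "cmod (f x) powr s = cmod (f x) powr (s - r) * cmod (f x) powr r"
      using 2 assms by (simp add: powr_add[symmetric])
    also have "\<dots> \<le> (2 * \<tau>) powr (s - r) * cmod (f x) powr r"
      using 2 assms by (intro mult_right_mono powr_mono2) auto
    also have "\<dots> = 2 powr (s - r) * (\<tau> powr (s - r) * cmod (f x) powr r)"
      using assms by (simp add: powr_mult)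
    also have "\<dots> \<le> 2 powr s * (\<tau> powr (s - r) * cmod (f x) powr r)"
      using \<open>2 powr (s - r) \<le> 2 powr s\<close> by (intro mult_right_mono) auto
    finally show ?thesis using 2 by (simp add: truncated_def)
  next
    case 3
    then show ?thesis using assms mult_right_mono[OF 2(2), of "cmod (f x) powr s"]
      by (simp add: truncated_def)
  qed
qed

text \<open>For fixed \<open>x\<close> the heights split at \<open>cmod (f x)\<close>: below it the
  terms grow with exponent \<open>p - r\<close>, above it they decay with exponent
  \<open>s - p\<close>. Both geometric sums converge because \<open>r < p < s\<close>.\<close>

lemma truncated_sum_le:
  assumes "0 \<le> r" "r < p" "p < s"
  shows "(\<integral>\<^sup>+j. ennreal (2 powr ((p - s) * real_of_int j)) * (\<integral>\<^sup>+x. ennreal (truncated r s (2 powr real_of_int j) f x) \<partial>M) \<partial>count_space (UNIV :: int set))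
    \<le> ennreal (1 / (1 - 2 powr - (p - r)) + 1 / (1 - 2 powr - (s - p))) * power_integral p f"
proof -
  have q: "0 < 1 - 2 powr - (p - r)" "0 < 1 - 2 powr - (s - p)"
    using assms by (auto simp: powr_less_one)
  let ?e = "\<lambda>j::int. 2 powr real_of_int j"
  have "(\<integral>\<^sup>+j. ennreal (2 powr ((p - s) * real_of_int j)) * (\<integral>\<^sup>+x. ennreal (truncated r s (?e j) f x) \<partial>M) \<partial>count_space (UNIV :: int set))
    = (\<integral>\<^sup>+j. (\<integral>\<^sup>+x. ennreal (2 powr ((p - s) * real_of_int j)) * ennreal (truncated r s (?e j) f x) \<partial>M) \<partial>count_space (UNIV :: int set))"
    by (intro nn_integral_cong nn_integral_cmult[symmetric]) simp
  also have "\<dots> = (\<integral>\<^sup>+x. (\<integral>\<^sup>+j. ennreal (2 powr ((p - s) * real_of_int j)) * ennreal (truncated r s (?e j) f x) \<partial>count_space (UNIV :: int set)) \<partial>M)"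
    by (rule nn_integral_count_space_nn_integral[symmetric]) auto
  also have "\<dots> \<le> (\<integral>\<^sup>+x. ennreal (1 / (1 - 2 powr - (p - r)) + 1 / (1 - 2 powr - (s - p))) * ennreal (cmod (f x) powr p) \<partial>M)"
  proof (rule nn_integral_mono)
    fix x
    show "(\<integral>\<^sup>+j. ennreal (2 powr ((p - s) * real_of_int j)) * ennreal (truncated r s (?e j) f x) \<partial>count_space (UNIV :: int set))
      \<le> ennreal (1 / (1 - 2 powr - (p - r)) + 1 / (1 - 2 powr - (s - p))) * ennreal (cmod (f x) powr p)"
    proof (cases "f x = 0")
      case True
      then have "truncated r s (?e j) f x = 0" for j by (simp add: truncated_def)
      then show ?thesis by simp
    next
      case False
      have "(\<integral>\<^sup>+j. ennreal (2 powr ((p - s) * real_of_int j)) * ennreal (truncated r s (?e j) f x) \<partial>count_space (UNIV :: int set))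
        \<le> (\<integral>\<^sup>+j. ennreal (cmod (f x) powr r) * (ennreal (2 powr ((p - r) * real_of_int j)) * indicator {j. ?e j \<le> cmod (f x)} j)
          + ennreal (cmod (f x) powr s) * (ennreal (2 powr (- (s - p) * real_of_int j)) * indicator {j. cmod (f x) \<le> ?e j} j) \<partial>count_space UNIV)"
      proof (rule nn_integral_mono)
        fix j :: int
        show "ennreal (2 powr ((p - s) * real_of_int j)) * ennreal (truncated r s (?e j) f x)
          \<le> ennreal (cmod (f x) powr r) * (ennreal (2 powr ((p - r) * real_of_int j)) * indicator {j. ?e j \<le> cmod (f x)} j)
          + ennreal (cmod (f x) powr s) * (ennreal (2 powr (- (s - p) * real_of_int j)) * indicator {j. cmod (f x) \<le> ?e j} j)"
        proof (cases "?e j < cmod (f x)")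
          case True
          have "2 powr ((p - s) * real_of_int j) * (?e j powr (s - r) * cmod (f x) powr r)
            = cmod (f x) powr r * 2 powr ((p - r) * real_of_int j)"
            by (simp add: powr_powr mult.assoc[symmetric] powr_add[symmetric]) (simp add: algebra_simps)
          then have "ennreal (2 powr ((p - s) * real_of_int j)) * ennreal (truncated r s (?e j) f x)
            = ennreal (cmod (f x) powr r) * ennreal (2 powr ((p - r) * real_of_int j))"
            using True by (simp add: truncated_def ennreal_mult'[symmetric])
          then show ?thesis using True by simp
        next
          case False
          then show ?thesis by (simp add: truncated_def mult.commute)
        qed
      qed
      also have "\<dots> = ennreal (cmod (f x) powr r)
          * (\<integral>\<^sup>+j. ennreal (2 powr ((p - r) * real_of_int j)) * indicator {j. ?e j \<le> cmod (f x)} j \<partial>count_space (UNIV :: int set))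
          + ennreal (cmod (f x) powr s) * (\<integral>\<^sup>+j. ennreal (2 powr (- (s - p) * real_of_int j)) * indicator {j. cmod (f x) \<le> ?e j} j \<partial>count_space (UNIV :: int set))"
        by (subst nn_integral_add, simp, simp, subst nn_integral_cmult, simp, subst nn_integral_cmult, simp, rule refl)
      also have "\<dots> \<le> ennreal (cmod (f x) powr r)
          * ennreal (cmod (f x) powr (p - r) / (1 - 2 powr - (p - r)))
          + ennreal (cmod (f x) powr s) * ennreal (cmod (f x) powr - (s - p) / (1 - 2 powr - (s - p)))"
        using assms False
        by (intro add_mono mult_left_mono nn_integral_count_space_geometric nn_integral_count_space_geometric') auto
      also have "\<dots> = ennreal (cmod (f x) powr p / (1 - 2 powr - (p - r)))
          + ennreal (cmod (f x) powr p / (1 - 2 powr - (s - p)))"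
        using False by (simp add: ennreal_mult'[symmetric] powr_add[symmetric])
      also have "\<dots> = ennreal (1 / (1 - 2 powr - (p - r)) + 1 / (1 - 2 powr - (s - p)))
          * ennreal (cmod (f x) powr p)"
        using q by (simp add: ennreal_plus[symmetric] ennreal_mult'[symmetric] distrib_right
            del: ennreal_plus)
      finally show ?thesis .
    qed
  qed
  also have "\<dots> = ennreal (1 / (1 - 2 powr - (p - r)) + 1 / (1 - 2 powr - (s - p))) * power_integral p f"
    unfolding power_integral_def by (rule nn_integral_cmult) simp
  finally show ?thesis .
qed

end

lemma le_ennreal_mult_top: "0 < c \<Longrightarrow> y = top \<Longrightarrow> x \<le> ennreal c * y"
  by (simp add: ennreal_mult_top)

context doubling_flow_tree
begin

text \<open>The values above \<tau> pass through the decomposition on the whole tree, the others are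
  kept. The good part is bounded by a multiple of \<tau> and has controlled L1 norm, hence
  controlled \<open>s\<close>-th powers for every \<open>s > 1\<close>, with one decomposition for
  all \<open>s\<close>.\<close>

lemma level_decomposition:
  assumes ex: "\<And>n. dyadic \<beta> D (exhaustion n)" and D: "1 \<le> D" and r: "1 < r" and \<tau>: "0 < \<tau>"
    and a: "upper_part r \<tau> f = ennreal a" "0 \<le> a"
  shows "\<exists>u v. f = u + v \<and>
    H1_norm \<beta> u \<le> ennreal ((2 * D + 1) / (1 - 2 powr (1 - r)) * 2 powr r * (\<tau> powr (1 - r) * a)) \<and>
    (\<forall>x. cmod (v x) \<le> (D + 1) * \<tau>) \<and>
    (\<forall>s>1. power_integral s v \<le> ennreal (2 powr s * (1 + 2 * D powr (s - 1))) * (\<integral>\<^sup>+x. ennreal (truncated r s \<tau> f x) \<partial>M))"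
proof -
  define h where "h x = (if \<tau> < cmod (f x) then f x else 0)" for x
  have "power_integral r h = upper_part r \<tau> f"
    unfolding power_integral_def upper_part_def by (intro nn_integral_cong) (simp add: h_def)
  then have h: "power_integral r h = ennreal a" using a by simp
  have large: "\<tau> \<le> cmod (h x)" if "h x \<noteq> 0" for x using that by (auto simp: h_def split: if_splits)
  obtain g b where gb: "\<And>x. h x = g x + b x" "\<And>x. cmod (g x) \<le> D * \<tau>"
    "Lp_norm M 1 g \<le> ennreal (2 * (\<tau> powr (1 - r) * a))"
    "H1_norm \<beta> b \<le> ennreal ((2 * D + 1) / (1 - 2 powr (1 - r)) * 2 powr r * (\<tau> powr (1 - r) * a))"
    using global_Calderon_Zygmund[OF ex D r \<tau> h a(2) large] by blast
  define l where "l x = (if \<tau> < cmod (f x) then 0 else f x)" for x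
  define v where "v x = l x + g x" for x
  have "f = b + v"
  proof
    fix x
    have "f x = h x + l x" by (simp add: h_def l_def)
    then show "f x = (b + v) x" using gb(1)[of x] by (simp add: v_def)
  qed
  moreover have "cmod (v x) \<le> (D + 1) * \<tau>" for x
  proof -
    have "cmod (v x) \<le> cmod (l x) + cmod (g x)" unfolding v_def by (rule norm_triangle_ineq)
    also have "\<dots> \<le> \<tau> + D * \<tau>" using gb(2) \<tau> by (intro add_mono) (auto simp: l_def)
    finally show ?thesis by (simp add: algebra_simps)
  qed
  moreover have "power_integral s v
      \<le> ennreal (2 powr s * (1 + 2 * D powr (s - 1))) * (\<integral>\<^sup>+x. ennreal (truncated r s \<tau> f x) \<partial>M)"
    if s: "1 < s" for s
  proof -
    define L where "L = (\<integral>\<^sup>+x. ennreal (cmod (l x) powr s) \<partial>M)"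
    have "(\<integral>\<^sup>+x. ennreal (truncated r s \<tau> f x) \<partial>M)
      = (\<integral>\<^sup>+x. ennreal (cmod (l x) powr s) + ennreal (\<tau> powr (s - r)) * ennreal (if \<tau> < cmod (f x) then cmod (f x) powr r else 0) \<partial>M)"
      by (intro nn_integral_cong) (simp add: truncated_def l_def ennreal_mult)
    also have "\<dots> = L + ennreal (\<tau> powr (s - r)) * ennreal a"
      unfolding L_def a(1)[symmetric] upper_part_def
      by (subst nn_integral_add) (simp_all add: nn_integral_cmult)
    finally have tr: "(\<integral>\<^sup>+x. ennreal (truncated r s \<tau> f x) \<partial>M) = L + ennreal (\<tau> powr (s - r) * a)"
      using a by (simp add: ennreal_mult)
    have "power_integral s v \<le> (\<integral>\<^sup>+x. ennreal (2 powr s) * (ennreal (cmod (l x) powr s)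
      + ennreal ((D * \<tau>) powr (s - 1)) * ennreal (cmod (g x))) \<partial>M)"
      unfolding power_integral_def
    proof (rule nn_integral_mono)
      fix x
      have add: "(y + z) powr s \<le> 2 powr s * (y powr s + z powr s)" if "0 \<le> y" "0 \<le> z" for y z :: real
      proof -
        have "(y + z) powr s \<le> (2 * max y z) powr s" using that s by (intro powr_mono2) auto
        also have "\<dots> = 2 powr s * max y z powr s" using that by (simp add: powr_mult)
        also have "\<dots> \<le> 2 powr s * (y powr s + z powr s)" by (intro mult_left_mono) (auto simp: max_def)
        finally show ?thesis .
      qed
      have "cmod (v x) powr s \<le> (cmod (l x) + cmod (g x)) powr s"
        unfolding v_def using s by (intro powr_mono2 norm_triangle_ineq) auto
      also have "\<dots> \<le> 2 powr s * (cmod (l x) powr s + cmod (g x) powr s)" by (rule add) auto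
      also have "\<dots> \<le> 2 powr s * (cmod (l x) powr s + (D * \<tau>) powr (s - 1) * cmod (g x))"
      proof (intro mult_left_mono add_left_mono)
        \<comment> \<open>All but one of the \<open>s\<close> powers are absorbed by the bound
          \<open>D * \<tau>\<close>; the remaining one is left to the L1 norm of
          \<open>g\<close>.\<close>
        have "cmod (g x) powr s = cmod (g x) powr (s - 1) * cmod (g x)"
          by (cases "g x = 0") (simp_all add: powr_diff)
        also have "\<dots> \<le> (D * \<tau>) powr (s - 1) * cmod (g x)"
          using gb(2)[of x] s by (intro mult_right_mono powr_mono2) auto
        finally show "cmod (g x) powr s \<le> (D * \<tau>) powr (s - 1) * cmod (g x)" .
      qed auto
      finally show "ennreal (cmod (v x) powr s) \<le> ennreal (2 powr s) * (ennreal (cmod (l x) powr s)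
        + ennreal ((D * \<tau>) powr (s - 1)) * ennreal (cmod (g x)))"
        by (simp add: ennreal_mult[symmetric] ennreal_plus[symmetric] ennreal_leI del: ennreal_plus)
    qed
    also have "\<dots> = ennreal (2 powr s) * (L + ennreal ((D * \<tau>) powr (s - 1)) * Lp_norm M 1 g)"
      unfolding L_def Lp_norm_1 by (simp add: nn_integral_cmult nn_integral_add)
    also have "\<dots> \<le> ennreal (2 powr s)
        * (L + ennreal ((D * \<tau>) powr (s - 1)) * ennreal (2 * (\<tau> powr (1 - r) * a)))"
      by (intro mult_left_mono add_left_mono gb(3)) auto
    also have "ennreal ((D * \<tau>) powr (s - 1)) * ennreal (2 * (\<tau> powr (1 - r) * a))
      = ennreal (2 * D powr (s - 1)) * ennreal (\<tau> powr (s - r) * a)"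
    proof -
      have "(D * \<tau>) powr (s - 1) * (2 * (\<tau> powr (1 - r) * a))
          = 2 * D powr (s - 1) * ((\<tau> powr (s - 1) * \<tau> powr (1 - r)) * a)"
        using D \<tau> by (simp add: powr_mult)
      also have "\<tau> powr (s - 1) * \<tau> powr (1 - r) = \<tau> powr (s - r)" by (simp add: powr_add[symmetric])
      finally have eq: "(D * \<tau>) powr (s - 1) * (2 * (\<tau> powr (1 - r) * a))
          = 2 * D powr (s - 1) * (\<tau> powr (s - r) * a)" .
      have "ennreal ((D * \<tau>) powr (s - 1)) * ennreal (2 * (\<tau> powr (1 - r) * a))
        = ennreal ((D * \<tau>) powr (s - 1) * (2 * (\<tau> powr (1 - r) * a)))"
        by (rule ennreal_mult'[symmetric]) simp
      also have "\<dots> = ennreal (2 * D powr (s - 1)) * ennreal (\<tau> powr (s - r) * a)"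
        unfolding eq by (rule ennreal_mult') simp
      finally show ?thesis .
    qed
    also have "ennreal (2 powr s) * (L + ennreal (2 * D powr (s - 1)) * ennreal (\<tau> powr (s - r) * a))
      \<le> ennreal (2 powr s) * (ennreal (1 + 2 * D powr (s - 1)) * L + ennreal (1 + 2 * D powr (s - 1)) * ennreal (\<tau> powr (s - r) * a))"
    proof (intro mult_left_mono add_mono mult_right_mono ennreal_leI)
      have "ennreal 1 * L \<le> ennreal (1 + 2 * D powr (s - 1)) * L"
        by (intro mult_right_mono ennreal_leI) auto
      then show "L \<le> ennreal (1 + 2 * D powr (s - 1)) * L" by simp
    qed auto
    also have "\<dots> = (ennreal (2 powr s) * ennreal (1 + 2 * D powr (s - 1)))
        * (L + ennreal (\<tau> powr (s - r) * a))"
      by (simp only: distrib_left mult.assoc)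
    also have "ennreal (2 powr s) * ennreal (1 + 2 * D powr (s - 1))
        = ennreal (2 powr s * (1 + 2 * D powr (s - 1)))"
      by (rule ennreal_mult'[symmetric]) simp
    finally show ?thesis unfolding tr .
  qed
  ultimately show ?thesis using gb(4) by blast
qed

section \<open>Dyadic sums of K-functionals\<close>

lemma upper_part_finite:
  assumes "r \<le> p" "0 < \<tau>" "power_integral p f = ennreal S" "0 \<le> S"
  shows "\<exists>a. upper_part r \<tau> f = ennreal a \<and> 0 \<le> a \<and> a \<le> \<tau> powr (r - p) * S"
proof -
  have le: "upper_part r \<tau> f \<le> ennreal (\<tau> powr (r - p) * S)"
    using upper_part_le[OF assms(1,2), of f] assms by (simp add: ennreal_mult)
  then have "upper_part r \<tau> f \<noteq> top" by (auto simp: top_unique)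
  then obtain a where "upper_part r \<tau> f = ennreal a" "0 \<le> a" by (cases "upper_part r \<tau> f") auto
  with le show ?thesis using assms by (intro exI[of _ a]) (simp add: ennreal_le_iff)
qed

text \<open>At level \<open>j\<close>, \<open>A j\<close> is a multiple of
  \<open>2 powr ((1 - r) * j)\<close> times the tail above \<open>2 ^ j\<close>, and
  \<open>B j\<close> is a multiple of \<open>2 ^ j\<close>. Since
  \<open>(1 - \<theta>) * p = 1\<close>, their weighted product is a multiple of the summand in
  \<open>upper_part_sum_le\<close>.\<close>

lemma dyadic_sum_H1_Linf_le:
  assumes \<beta>: "8 \<le> \<beta>" and p: "1 < p" and \<theta>: "0 < \<theta>" "\<theta> < 1" and eq: "1 / p = 1 - \<theta>"
  shows "\<exists>C>0. \<forall>f. dyadic_sum \<theta> p (\<lambda>t. K_functional (H1_norm \<beta>) (Lp_norm M \<infinity>) t f)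
      \<le> ennreal C * power_integral p f"
proof -
  obtain D where D: "1 \<le> D" and ex: "\<And>n. dyadic \<beta> D (exhaustion n)"
    using dyadic_exhaustion[OF \<beta>] by blast
  \<comment> \<open>Any exponent strictly between 1 and \<open>p\<close> would serve.\<close>
  define r where "r = (1 + p) / 2"
  have r: "1 < r" "r < p" using p by (auto simp: r_def)
  define K0 where "K0 = (2 * D + 1) / (1 - 2 powr (1 - r)) * 2 powr r"
  have "0 < 1 - 2 powr (1 - r)" using r by (simp add: powr_less_one)
  then have K0: "0 < K0" using D by (simp add: K0_def)
  have q: "0 < 1 - 2 powr - (p - r)" using r by (simp add: powr_less_one)
  have q1: "0 < 1 - 2 powr - (1::real)" by (simp add: powr_minus)
  have \<theta>p: "(1 - \<theta>) * p = 1" "\<theta> * p = p - 1"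
  proof -
    show 1: "(1 - \<theta>) * p = 1" using eq[symmetric] p by simp
    then show "\<theta> * p = p - 1" by (simp add: algebra_simps)
  qed
  let ?e = "\<lambda>j::int. 2 powr real_of_int j"
  define C1 where "C1 = K0 * (D + 1) powr (p - 1)"
  have C1: "0 < C1" using K0 D by (simp add: C1_def)
  define C2 where "C2 = 4 powr p / (1 - 2 powr - 1)"
  have C2: "0 < C2" using q1 by (simp add: C2_def)
  show ?thesis
  proof (intro exI[of _ "C2 * (C1 * (1 / (1 - 2 powr - (p - r))))"] conjI allI)
    show pos: "0 < C2 * (C1 * (1 / (1 - 2 powr - (p - r))))" using C1 C2 q by simp
    fix f
    show "dyadic_sum \<theta> p (\<lambda>t. K_functional (H1_norm \<beta>) (Lp_norm M \<infinity>) t f)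
      \<le> ennreal (C2 * (C1 * (1 / (1 - 2 powr - (p - r))))) * power_integral p f"
    proof (cases "power_integral p f")
      case top
      then show ?thesis by (intro le_ennreal_mult_top pos)
    next
      case (real S)
      have "\<exists>a. upper_part r (?e j) f = ennreal a \<and> 0 \<le> a \<and> a \<le> ?e j powr (r - p) * S" for j
        using upper_part_finite[of r p "?e j" f S] r real by simp
      then obtain a where a: "\<And>j. upper_part r (?e j) f = ennreal (a j)" "\<And>j. 0 \<le> a j"
        "\<And>j. a j \<le> ?e j powr (r - p) * S" by metis
      define A where "A j = K0 * (?e j powr (1 - r) * a j)" for j
      define B where "B j = (D + 1) * ?e j" for j
      have nonneg: "0 \<le> A j" "0 \<le> B j" for j using K0 a(2)[of j] D by (auto simp: A_def B_def)
      have INT: "dyadic_sum \<theta> p (\<lambda>t. K_functional (H1_norm \<beta>) (Lp_norm M \<infinity>) t f)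
        \<le> ennreal ((2 * 2) powr p / (1 - 2 powr - ((1 - \<theta>) * p))) *
          (\<integral>\<^sup>+j. ennreal (A j powr ((1 - \<theta>) * p) * B j powr (\<theta> * p)) \<partial>count_space UNIV)"
      proof (rule dyadic_sum_le_levels)
        fix j n
        obtain u v where uv: "f = u + v" "H1_norm \<beta> u \<le> ennreal (A j)" "\<And>x. cmod (v x) \<le> B j"
          using level_decomposition[OF ex D r(1) _ a(1)[of j] a(2)[of j]]
          unfolding A_def B_def K0_def by auto
        have "K_functional (H1_norm \<beta>) (Lp_norm M \<infinity>) (?e n) f
            \<le> H1_norm \<beta> u + ennreal (?e n) * Lp_norm M \<infinity> v"
          using uv by (intro K_functional_le) auto
        also have "\<dots> \<le> ennreal (A j) + ennreal (?e n) * ennreal (B j)"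
          using uv by (intro add_mono mult_left_mono) (auto simp: Lp_norm_infinity_le_iff
              intro: ennreal_leI)
        also have "\<dots> = ennreal (A j + ?e n * B j)" using nonneg by (simp add: ennreal_mult ennreal_plus)
        finally show "K_functional (H1_norm \<beta>) (Lp_norm M \<infinity>) (?e n) f \<le> ennreal (A j + ?e n * B j)" .
      next
        fix t :: real assume t: "0 < t"
        obtain k where k: "\<And>j. k \<le> j \<Longrightarrow> K0 * S * 2 powr (- p * real_of_int j) \<le> t * (D + 1)"
          using eventually_powr_tail[of p "t * (D + 1)" "K0 * S"] p t D by auto
        have "A j \<le> t * B j" if "k \<le> j" for j
        proof -
          have "A j \<le> K0 * (?e j powr (1 - r) * (?e j powr (r - p) * S))"
            unfolding A_def using a(3) K0 by (intro mult_left_mono) auto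
          also have "\<dots> = K0 * S * 2 powr (- p * real_of_int j) * ?e j"
          proof -
            have "?e j powr (1 - r) * ?e j powr (r - p) = 2 powr (- p * real_of_int j) * ?e j"
              by (simp add: powr_powr powr_add[symmetric] algebra_simps)
            then show ?thesis by (simp add: mult.assoc mult.left_commute)
          qed
          also have "\<dots> \<le> t * (D + 1) * ?e j" using k[OF that] by (intro mult_right_mono) auto
          finally show ?thesis by (simp add: B_def mult.assoc)
        qed
        then show "\<exists>k. \<forall>j\<ge>k. A j \<le> t * B j" by blast
      next
        fix e :: real assume "0 < e"
        then obtain k where "(D + 1) * 2 powr (- 1 * real_of_int k) \<le> e"
          using eventually_powr_tail[of 1 e "D + 1"] by auto
        then show "\<exists>j. B j \<le> e" by (intro exI[of _ "- k"]) (simp add: B_def)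
      qed (use \<theta> p nonneg in \<open>auto simp: B_def powr_add\<close>)
      have "(\<integral>\<^sup>+j. ennreal (A j powr ((1 - \<theta>) * p) * B j powr (\<theta> * p)) \<partial>count_space UNIV)
        = (\<integral>\<^sup>+j. ennreal C1 * (ennreal (2 powr ((p - r) * real_of_int j)) * upper_part r (?e j) f) \<partial>count_space UNIV)"
      proof (rule nn_integral_cong)
        fix j
        have "A j powr ((1 - \<theta>) * p) * B j powr (\<theta> * p)
          = C1 * ((?e j powr (1 - r) * ?e j powr (p - 1)) * a j)"
          using nonneg[of j] D by (simp add: \<theta>p A_def B_def C1_def powr_mult)
        also have "?e j powr (1 - r) * ?e j powr (p - 1) = 2 powr ((p - r) * real_of_int j)"
          by (simp add: powr_powr powr_add[symmetric] algebra_simps)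
        finally show "ennreal (A j powr ((1 - \<theta>) * p) * B j powr (\<theta> * p))
          = ennreal C1 * (ennreal (2 powr ((p - r) * real_of_int j)) * upper_part r (?e j) f)"
          using C1 a by (simp add: ennreal_mult)
      qed
      also have "\<dots> = ennreal C1
          * (\<integral>\<^sup>+j. ennreal (2 powr ((p - r) * real_of_int j)) * upper_part r (?e j) f \<partial>count_space UNIV)"
        by (rule nn_integral_cmult) simp
      also have "\<dots> \<le> ennreal C1 * (ennreal (1 / (1 - 2 powr - (p - r))) * power_integral p f)"
        using r by (intro mult_left_mono upper_part_sum_le) auto
      finally have X: "(\<integral>\<^sup>+j. ennreal (A j powr ((1 - \<theta>) * p) * B j powr (\<theta> * p)) \<partial>count_space UNIV)
        \<le> ennreal C1 * (ennreal (1 / (1 - 2 powr - (p - r))) * power_integral p f)" .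
      have c2: "(2 * 2) powr p / (1 - 2 powr - ((1 - \<theta>) * p)) = C2" by (simp add: C2_def \<theta>p)
      have c: "ennreal (C2 * (C1 * (1 / (1 - 2 powr - (p - r)))))
        = ennreal C2 * (ennreal C1 * ennreal (1 / (1 - 2 powr - (p - r))))"
        using C1 C2 by (simp only: ennreal_mult' less_imp_le)
      show ?thesis using order_trans[OF INT[unfolded c2] mult_left_mono[OF X]]
        unfolding c by (simp only: mult.assoc zero_le)
    qed
  qed
qed

text \<open>Here \<open>B j\<close> is the root of an integral, so the weighted product of
  \<open>A j\<close> and \<open>B j\<close> is no longer linear in quantities that can be summed.
  The relation between the exponents makes it a weighted geometric mean of two such quantities,
  which is bounded by their sum.\<close>

lemma dyadic_sum_H1_Lp_le:
  assumes \<beta>: "8 \<le> \<beta>" and p: "1 < p" "p < s" and \<theta>: "0 < \<theta>" "\<theta> < 1" and eq: "1 / p = 1 - \<theta> + \<theta> / s"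
  shows "\<exists>C>0. \<forall>f. dyadic_sum \<theta> p (\<lambda>t. K_functional (H1_norm \<beta>) (Lp_norm M (ereal s)) t f)
      \<le> ennreal C * power_integral p f"
proof -
  obtain D where D: "1 \<le> D" and ex: "\<And>n. dyadic \<beta> D (exhaustion n)"
    using dyadic_exhaustion[OF \<beta>] by blast
  define r where "r = (1 + p) / 2"
  have r: "1 < r" "r < p" using p by (auto simp: r_def)
  have s: "1 < s" using p by simp
  define K0 where "K0 = (2 * D + 1) / (1 - 2 powr (1 - r)) * 2 powr r"
  have "0 < 1 - 2 powr (1 - r)" using r by (simp add: powr_less_one)
  then have K0: "0 < K0" using D by (simp add: K0_def)
  have q: "0 < 1 - 2 powr - (p - r)" "0 < 1 - 2 powr - (s - p)" using r p by (auto simp: powr_less_one)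
  \<comment> \<open>With this weight the relation between the exponents reads
    \<open>\<theta> * p = s * (1 - \<alpha>)\<close>, so the root in \<open>B j\<close>
    disappears.\<close>
  define \<alpha> where "\<alpha> = (1 - \<theta>) * p"
  have \<alpha>: "0 < \<alpha>" "\<theta> * p = s * (1 - \<alpha>)" "\<alpha> < 1"
  proof -
    show "0 < \<alpha>" using \<theta> p by (simp add: \<alpha>_def)
    have "1 = p * (1 - \<theta> + \<theta> / s)" using eq[symmetric] p by simp
    then have 1: "1 - \<alpha> = \<theta> * p / s" by (simp add: \<alpha>_def algebra_simps)
    then show "\<theta> * p = s * (1 - \<alpha>)" using s by simp
    have "0 < \<theta> * p / s" using \<theta> p s by simp
    then show "\<alpha> < 1" using 1 by linarith
  qed
  have qa: "0 < 1 - 2 powr - \<alpha>" using \<alpha> by (simp add: powr_less_one)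
  let ?e = "\<lambda>j::int. 2 powr real_of_int j"
  define C1 where "C1 = 2 powr s * (1 + 2 * D powr (s - 1))"
  have C1: "0 < C1" using D by (simp add: C1_def add_pos_nonneg)
  define C2 where "C2 = 4 powr p / (1 - 2 powr - \<alpha>)"
  have C2: "0 < C2" using qa by (simp add: C2_def)
  define C3 where "C3 = K0 * (1 / (1 - 2 powr - (p - r))) + C1
      * (1 / (1 - 2 powr - (p - r)) + 1 / (1 - 2 powr - (s - p)))"
  have C3: "0 < C3" using C1 K0 q by (auto simp: C3_def intro!: add_pos_nonneg)
  show ?thesis
  proof (intro exI[of _ "C2 * C3"] conjI allI)
    show pos: "0 < C2 * C3" using C2 C3 by simp
    fix f
    show "dyadic_sum \<theta> p (\<lambda>t. K_functional (H1_norm \<beta>) (Lp_norm M (ereal s)) t f)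
        \<le> ennreal (C2 * C3) * power_integral p f"
    proof (cases "power_integral p f")
      case top
      then show ?thesis by (intro le_ennreal_mult_top pos)
    next
      case (real S)
      have "\<exists>a. upper_part r (?e j) f = ennreal a \<and> 0 \<le> a \<and> a \<le> ?e j powr (r - p) * S" for j
        using upper_part_finite[of r p "?e j" f S] r real by simp
      then obtain a where a: "\<And>j. upper_part r (?e j) f = ennreal (a j)" "\<And>j. 0 \<le> a j"
        "\<And>j. a j \<le> ?e j powr (r - p) * S" by metis
      define T where "T j = (\<integral>\<^sup>+x. ennreal (truncated r s (?e j) f x) \<partial>M)" for j
      have T_le: "T j \<le> ennreal (?e j powr (s - p) * S)" for j
      proof -
        have "T j \<le> (\<integral>\<^sup>+x. ennreal (?e j powr (s - p)) * ennreal (cmod (f x) powr p) \<partial>M)"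
          unfolding T_def using r p
          by (intro nn_integral_mono) (auto simp: ennreal_mult[symmetric]
              intro!: ennreal_leI truncated_le)
        also have "\<dots> = ennreal (?e j powr (s - p)) * ennreal S"
          using real by (simp add: nn_integral_cmult power_integral_def)
        finally show ?thesis using real by (simp add: ennreal_mult)
      qed
      define \<psi> where "\<psi> j = enn2real (T j)" for j
      have T: "T j = ennreal (\<psi> j)" for j
        using le_less_trans[OF T_le[of j] ennreal_less_top] by (simp add: \<psi>_def)
      have \<psi>0: "0 \<le> \<psi> j" for j by (simp add: \<psi>_def)
      have \<psi>_le: "\<psi> j \<le> ?e j powr (s - p) * S" for j
        using T_le[of j] T[of j] real by (simp add: ennreal_le_iff)
      have \<psi>_mono: "\<psi> 0 \<le> \<psi> j" if "0 \<le> j" for j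
      proof -
        have "T 0 \<le> T j" unfolding T_def using that r p
          by (intro nn_integral_mono ennreal_leI truncated_mono) (auto simp: ge_one_powr_ge_zero)
        then show ?thesis using T[of 0] T[of j] \<psi>0 by (simp add: ennreal_le_iff)
      qed
      have \<psi>_step: "\<psi> (j + 1) \<le> 2 powr s * \<psi> j" for j
      proof -
        have "T (j + 1) \<le> (\<integral>\<^sup>+x. ennreal (2 powr s) * ennreal (truncated r s (?e j) f x) \<partial>M)"
          unfolding T_def using truncated_double[of r s "?e j" f] r p
          by (intro nn_integral_mono) (auto simp: ennreal_mult[symmetric] powr_add mult.commute[of _ 2]
              intro!: ennreal_leI)
        also have "\<dots> = ennreal (2 powr s) * T j" unfolding T_def by (simp add: nn_integral_cmult)
        finally show ?thesis
          using T[of j] T[of "j + 1"] \<psi>0 by (simp add: ennreal_mult[symmetric] ennreal_le_iff)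
      qed
      define A where "A j = K0 * (?e j powr (1 - r) * a j)" for j
      define B where "B j = (C1 * \<psi> j) powr (1 / s)" for j
      have nonneg: "0 \<le> A j" "0 \<le> B j" for j using K0 a(2)[of j] by (auto simp: A_def B_def)
      have A_le: "A j \<le> K0 * S * 2 powr (- (p - 1) * real_of_int j)" for j
      proof -
        have "A j \<le> K0 * (?e j powr (1 - r) * (?e j powr (r - p) * S))"
          unfolding A_def using a(3) K0 by (intro mult_left_mono) auto
        also have "\<dots> = K0 * S * (?e j powr (1 - r) * ?e j powr (r - p))" by simp
        also have "?e j powr (1 - r) * ?e j powr (r - p) = 2 powr (- (p - 1) * real_of_int j)"
          by (simp add: powr_powr powr_add[symmetric] algebra_simps)
        finally show ?thesis .
      qed
      have INT: "dyadic_sum \<theta> p (\<lambda>t. K_functional (H1_norm \<beta>) (Lp_norm M (ereal s)) t f)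
        \<le> ennreal ((2 * 2) powr p / (1 - 2 powr - ((1 - \<theta>) * p))) *
          (\<integral>\<^sup>+j. ennreal (A j powr ((1 - \<theta>) * p) * B j powr (\<theta> * p)) \<partial>count_space UNIV)"
      proof (rule dyadic_sum_le_levels)
        fix j n
        obtain u v where uv: "f = u + v" "H1_norm \<beta> u \<le> ennreal (A j)"
          "power_integral s v \<le> ennreal C1 * T j"
          using level_decomposition[OF ex D r(1) _ a(1)[of j] a(2)[of j]] s
          unfolding A_def T_def K0_def C1_def by auto
        have "Lp_norm M (ereal s) v \<le> enn_powr (ennreal C1 * T j) (1 / s)"
          unfolding Lp_norm_real using uv s by (intro enn_powr_mono) auto
        also have "\<dots> = ennreal (B j)"
          using C1 \<psi>0[of j] by (simp add: T B_def ennreal_mult[symmetric] enn_powr_ennreal)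
        finally have v: "Lp_norm M (ereal s) v \<le> ennreal (B j)" .
        have "K_functional (H1_norm \<beta>) (Lp_norm M (ereal s)) (?e n) f
            \<le> H1_norm \<beta> u + ennreal (?e n) * Lp_norm M (ereal s) v"
          using uv by (intro K_functional_le) auto
        also have "\<dots> \<le> ennreal (A j) + ennreal (?e n) * ennreal (B j)"
          using uv v by (intro add_mono mult_left_mono) auto
        also have "\<dots> = ennreal (A j + ?e n * B j)" using nonneg by (simp add: ennreal_mult ennreal_plus)
        finally show "K_functional (H1_norm \<beta>) (Lp_norm M (ereal s)) (?e n) f
            \<le> ennreal (A j + ?e n * B j)" .
      next
        fix j
        have "B (j + 1) \<le> (2 powr s * (C1 * \<psi> j)) powr (1 / s)"
          unfolding B_def using \<psi>_step[of j] C1 \<psi>0 s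
          by (intro powr_mono2) (auto simp: mult.left_commute[of "2 powr s"])
        also have "\<dots> = 2 * B j" using C1 \<psi>0[of j] s by (simp add: B_def powr_mult powr_powr)
        finally show "B (j + 1) \<le> 2 * B j" .
      next
        fix t :: real assume t: "0 < t"
        show "\<exists>k. \<forall>j\<ge>k. A j \<le> t * B j"
        \<comment> \<open>For \<open>j \<ge> 0\<close> the bound \<open>B j\<close> is at least
          \<open>B 0\<close>, which is positive unless \<open>f = 0\<close>, while
          \<open>A j\<close> tends to 0.\<close>
        proof (cases "\<psi> 0 = 0")
          case True
          then have "T 0 = 0" using T[of 0] by simp
          then have "truncated r s (?e 0) f x = 0" for x
            unfolding T_def by (subst (asm) nn_integral_0_iff_AE) (auto simp: ennreal_eq_0_iff antisym)
          then have "f x = 0" for x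
            by (metis norm_eq_zero powr_eq_0_iff truncated_def mult_eq_0_iff zero_neq_numeral)
          then have "upper_part r (?e j) f = 0" for j by (simp add: upper_part_def)
          then have "A j = 0" for j using a(1)[of j] a(2)[of j] by (simp add: A_def)
          then show ?thesis using t nonneg by auto
        next
          case False
          then have B0: "0 < B 0" using \<psi>0[of 0] C1 by (simp add: B_def)
          obtain k where k: "\<And>j. k \<le> j \<Longrightarrow> K0 * S * 2 powr (- (p - 1) * real_of_int j) \<le> t * B 0"
            using eventually_powr_tail[of "p - 1" "t * B 0" "K0 * S"] p t B0 by auto
          have "A j \<le> t * B j" if "max k 0 \<le> j" for j
          proof -
            have "A j \<le> t * B 0" using A_le[of j] k[of j] that by simp
            also have "\<dots> \<le> t * B j"
              unfolding B_def
              using \<psi>_mono[of j] that t C1 s \<psi>0[of 0] by (intro mult_left_mono powr_mono2) auto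
            finally show ?thesis .
          qed
          then show ?thesis by blast
        qed
      next
        fix e :: real assume e: "0 < e"
        obtain k where k: "C1 * S * 2 powr (- (s - p) * real_of_int k) \<le> e powr s"
          using eventually_powr_tail[of "s - p" "e powr s" "C1 * S"] p e by auto
        have "C1 * \<psi> (- k) \<le> C1 * (?e (- k) powr (s - p) * S)"
          using \<psi>_le[of "- k"] C1 by (intro mult_left_mono) auto
        also have "\<dots> = C1 * S * 2 powr (- (s - p) * real_of_int k)"
          by (simp add: powr_powr algebra_simps)
        also note k
        finally have "B (- k) \<le> (e powr s) powr (1 / s)"
          unfolding B_def using C1 \<psi>0[of "- k"] s by (intro powr_mono2) auto
        also have "\<dots> = e" using e s by (simp add: powr_powr)
        finally show "\<exists>j. B j \<le> e" by blast
      qed (use \<theta> p nonneg in auto)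
      have "(\<integral>\<^sup>+j. ennreal (A j powr ((1 - \<theta>) * p) * B j powr (\<theta> * p)) \<partial>count_space UNIV)
        \<le> (\<integral>\<^sup>+j. ennreal K0 * (ennreal (2 powr ((p - r) * real_of_int j)) * upper_part r (?e j) f)
          + ennreal C1 * (ennreal (2 powr ((p - s) * real_of_int j)) * T j) \<partial>count_space UNIV)"
      proof (rule nn_integral_mono)
        fix j
        \<comment> \<open>Rescalings of \<open>A j\<close> and of the integral inside
          \<open>B j\<close> whose powers of 2 cancel in
          \<open>X powr \<alpha> * Y powr (1 - \<alpha>)\<close>, because
          \<open>(p - 1) * \<alpha> + (p - s) * (1 - \<alpha>) = 0\<close>.\<close>
        define X where "X = K0 * (2 powr ((p - r) * real_of_int j) * a j)"
        define Y where "Y = C1 * (2 powr ((p - s) * real_of_int j) * \<psi> j)"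
        have XY: "0 \<le> X" "0 \<le> Y" using K0 C1 a(2)[of j] \<psi>0[of j] by (auto simp: X_def Y_def)
        have X: "X = 2 powr ((p - 1) * real_of_int j) * A j"
          by (simp add: X_def A_def powr_powr mult.left_commute[of _ K0] mult.assoc[symmetric] powr_add[symmetric])
            (simp add: algebra_simps)
        have Y: "Y = 2 powr ((p - s) * real_of_int j) * (C1 * \<psi> j)" by (simp add: Y_def)
        have "A j powr \<alpha> * B j powr (\<theta> * p) = A j powr \<alpha> * (C1 * \<psi> j) powr (1 - \<alpha>)"
          using s by (simp add: \<alpha> B_def powr_powr)
        also have "\<dots> = X powr \<alpha> * Y powr (1 - \<alpha>)"
        proof -
          have "X powr \<alpha> * Y powr (1 - \<alpha>) =
            (2 powr ((p - 1) * real_of_int j * \<alpha>) * 2 powr ((p - s) * real_of_int j * (1 - \<alpha>)))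
              * (A j powr \<alpha> * (C1 * \<psi> j) powr (1 - \<alpha>))"
            unfolding X Y using nonneg[of j] C1 \<psi>0[of j] by (simp add: powr_mult powr_powr)
          also have "2 powr ((p - 1) * real_of_int j * \<alpha>) * 2 powr ((p - s) * real_of_int j * (1 - \<alpha>))
              = 1"
          proof -
            have "(p - 1) * \<alpha> + (p - s) * (1 - \<alpha>) = p - \<alpha> - s * (1 - \<alpha>)" by (simp add: algebra_simps)
            also have "\<dots> = 0" unfolding \<alpha>(2)[symmetric] by (simp add: \<alpha>_def algebra_simps)
            finally have "(p - 1) * real_of_int j * \<alpha> + (p - s) * real_of_int j * (1 - \<alpha>) = 0"
              by (metis (no_types, opaque_lifting) distrib_right mult.assoc mult.commute mult_zero_left)
            then show ?thesis by (simp add: powr_add[symmetric])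
          qed
          finally show ?thesis by simp
        qed
        also have "\<dots> \<le> X + Y" using XY \<alpha> by (intro powr_weighted_le_add) auto
        finally have "ennreal (A j powr \<alpha> * B j powr (\<theta> * p)) \<le> ennreal X + ennreal Y"
          using XY by (simp add: ennreal_plus[symmetric] ennreal_leI del: ennreal_plus)
        also have "ennreal X
            = ennreal K0 * (ennreal (2 powr ((p - r) * real_of_int j)) * upper_part r (?e j) f)"
          unfolding X_def a(1) using K0 a(2)[of j] by (simp add: ennreal_mult)
        also have "ennreal Y = ennreal C1 * (ennreal (2 powr ((p - s) * real_of_int j)) * T j)"
          unfolding Y_def T using C1 \<psi>0[of j] by (simp add: ennreal_mult)
        finally show "ennreal (A j powr ((1 - \<theta>) * p) * B j powr (\<theta> * p))
          \<le> ennreal K0 * (ennreal (2 powr ((p - r) * real_of_int j)) * upper_part r (?e j) f)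
          + ennreal C1 * (ennreal (2 powr ((p - s) * real_of_int j)) * T j)" by (simp add: \<alpha>_def)
      qed
      also have "\<dots> = ennreal K0
          * (\<integral>\<^sup>+j. ennreal (2 powr ((p - r) * real_of_int j)) * upper_part r (?e j) f \<partial>count_space UNIV)
          + ennreal C1 * (\<integral>\<^sup>+j. ennreal (2 powr ((p - s) * real_of_int j)) * T j \<partial>count_space UNIV)"
        by (subst nn_integral_add, simp, simp, subst nn_integral_cmult, simp, subst nn_integral_cmult, simp, rule refl)
      also have "\<dots> \<le> ennreal K0 * (ennreal (1 / (1 - 2 powr - (p - r))) * power_integral p f)
          + ennreal C1 * (ennreal (1 / (1 - 2 powr - (p - r)) + 1 / (1 - 2 powr - (s - p))) * power_integral p f)"
        unfolding T_def using r p
        by (intro add_mono mult_left_mono upper_part_sum_le truncated_sum_le) auto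
      also have "\<dots> = ennreal C3 * power_integral p f"
      proof -
        have "ennreal C3 = ennreal (K0 * (1 / (1 - 2 powr - (p - r))))
          + ennreal (C1 * (1 / (1 - 2 powr - (p - r)) + 1 / (1 - 2 powr - (s - p))))"
          unfolding C3_def using K0 C1 q by (intro ennreal_plus) auto
        also have "\<dots> = ennreal K0 * ennreal (1 / (1 - 2 powr - (p - r)))
          + ennreal C1 * ennreal (1 / (1 - 2 powr - (p - r)) + 1 / (1 - 2 powr - (s - p)))"
          using K0 C1 by (simp only: ennreal_mult' less_imp_le)
        finally show ?thesis by (simp only: distrib_right mult.assoc)
      qed
      finally have X: "(\<integral>\<^sup>+j. ennreal (A j powr ((1 - \<theta>) * p) * B j powr (\<theta> * p)) \<partial>count_space UNIV)
        \<le> ennreal C3 * power_integral p f" .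
      have c2: "(2 * 2) powr p / (1 - 2 powr - ((1 - \<theta>) * p)) = C2" by (simp add: C2_def \<alpha>_def)
      have c: "ennreal (C2 * C3) = ennreal C2 * ennreal C3"
        using C2 C3 by (simp only: ennreal_mult' less_imp_le)
      show ?thesis using order_trans[OF INT[unfolded c2] mult_left_mono[OF X]]
        unfolding c by (simp only: mult.assoc zero_le)
    qed
  qed
qed

text \<open>Cutting \<open>f\<close> at height \<open>2 ^ j\<close> is enough here; since
  \<open>(1 - \<theta>) * q = q\<^sub>1\<close>, the root in \<open>A j\<close> is undone by its
  exponent.\<close>

lemma dyadic_sum_Lp_Linf_le:
  assumes q: "1 \<le> q\<^sub>1" "q\<^sub>1 < q" and \<theta>: "0 < \<theta>" "\<theta> < 1" and eq: "1 / q = (1 - \<theta>) / q\<^sub>1"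
  shows "\<exists>C>0. \<forall>f. dyadic_sum \<theta> q (\<lambda>t. K_functional (Lp_norm M (ereal q\<^sub>1)) (Lp_norm M \<infinity>) t f)
      \<le> ennreal C * power_integral q f"
proof -
  have pos: "0 < q\<^sub>1" "0 < q" using q by auto
  have \<theta>q: "(1 - \<theta>) * q = q\<^sub>1" "\<theta> * q = q - q\<^sub>1"
  proof -
    show 1: "(1 - \<theta>) * q = q\<^sub>1" using eq pos by (simp add: field_simps)
    then show "\<theta> * q = q - q\<^sub>1" by (simp add: algebra_simps)
  qed
  have q0: "0 < 1 - 2 powr - (q - q\<^sub>1)" using q by (simp add: powr_less_one)
  have q1: "0 < 1 - 2 powr - q\<^sub>1" using pos by (simp add: powr_less_one)
  let ?e = "\<lambda>j::int. 2 powr real_of_int j"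
  define C2 where "C2 = 4 powr q / (1 - 2 powr - q\<^sub>1)"
  have C2: "0 < C2" using q1 by (simp add: C2_def)
  show ?thesis
  proof (intro exI[of _ "C2 * (1 / (1 - 2 powr - (q - q\<^sub>1)))"] conjI allI)
    show posC: "0 < C2 * (1 / (1 - 2 powr - (q - q\<^sub>1)))" using C2 q0 by simp
    fix f
    show "dyadic_sum \<theta> q (\<lambda>t. K_functional (Lp_norm M (ereal q\<^sub>1)) (Lp_norm M \<infinity>) t f)
      \<le> ennreal (C2 * (1 / (1 - 2 powr - (q - q\<^sub>1)))) * power_integral q f"
    proof (cases "power_integral q f")
      case top
      then show ?thesis by (intro le_ennreal_mult_top posC)
    next
      case (real S)
      have "\<exists>a. upper_part q\<^sub>1 (?e j) f = ennreal a \<and> 0 \<le> a \<and> a \<le> ?e j powr (q\<^sub>1 - q) * S" for j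
        using upper_part_finite[of q\<^sub>1 q "?e j" f S] q real by simp
      then obtain a where a: "\<And>j. upper_part q\<^sub>1 (?e j) f = ennreal (a j)" "\<And>j. 0 \<le> a j"
        "\<And>j. a j \<le> ?e j powr (q\<^sub>1 - q) * S" by metis
      define A where "A j = a j powr (1 / q\<^sub>1)" for j
      have nonneg: "0 \<le> A j" for j by (simp add: A_def)
      have INT: "dyadic_sum \<theta> q (\<lambda>t. K_functional (Lp_norm M (ereal q\<^sub>1)) (Lp_norm M \<infinity>) t f)
        \<le> ennreal ((2 * 2) powr q / (1 - 2 powr - ((1 - \<theta>) * q))) *
          (\<integral>\<^sup>+j. ennreal (A j powr ((1 - \<theta>) * q) * ?e j powr (\<theta> * q)) \<partial>count_space UNIV)"
      proof (rule dyadic_sum_le_levels)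
        fix j n
        define u where "u x = (if ?e j < cmod (f x) then f x else 0)" for x
        define v where "v x = (if ?e j < cmod (f x) then 0 else f x)" for x
        have f: "f = u + v" by (auto simp: u_def v_def fun_eq_iff)
        have "power_integral q\<^sub>1 u = upper_part q\<^sub>1 (?e j) f"
          unfolding power_integral_def upper_part_def by (intro nn_integral_cong) (simp add: u_def)
        then have u: "Lp_norm M (ereal q\<^sub>1) u = ennreal (A j)"
          using a by (simp add: Lp_norm_real enn_powr_ennreal A_def)
        have "K_functional (Lp_norm M (ereal q\<^sub>1)) (Lp_norm M \<infinity>) (?e n) f
            \<le> Lp_norm M (ereal q\<^sub>1) u + ennreal (?e n) * Lp_norm M \<infinity> v"
          using f by (intro K_functional_le) auto
        also have "\<dots> \<le> ennreal (A j) + ennreal (?e n) * ennreal (?e j)"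
          unfolding u by (intro add_mono mult_left_mono) (auto simp: Lp_norm_infinity_le_iff v_def
              intro: ennreal_leI)
        also have "\<dots> = ennreal (A j + ?e n * ?e j)"
          using nonneg by (simp add: ennreal_mult ennreal_plus)
        finally show "K_functional (Lp_norm M (ereal q\<^sub>1)) (Lp_norm M \<infinity>) (?e n) f
            \<le> ennreal (A j + ?e n * ?e j)" .
      next
        fix t :: real assume t: "0 < t"
        obtain k where k: "\<And>j. k \<le> j \<Longrightarrow> S * 2 powr (- q * real_of_int j) \<le> t powr q\<^sub>1"
          using eventually_powr_tail[of q "t powr q\<^sub>1" S] pos t by auto
        have "A j \<le> t * ?e j" if "k \<le> j" for j
        proof -
          have "a j \<le> ?e j powr (q\<^sub>1 - q) * S" by (rule a(3))
          also have "\<dots> = (S * 2 powr (- q * real_of_int j)) * ?e j powr q\<^sub>1"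
          proof -
            have "?e j powr (q\<^sub>1 - q) = 2 powr (- q * real_of_int j) * ?e j powr q\<^sub>1"
              by (simp add: powr_powr powr_add[symmetric] algebra_simps)
            then show ?thesis by simp
          qed
          also have "\<dots> \<le> t powr q\<^sub>1 * ?e j powr q\<^sub>1" using k[OF that] by (intro mult_right_mono) auto
          also have "\<dots> = (t * ?e j) powr q\<^sub>1" using t by (simp add: powr_mult)
          finally have "A j \<le> ((t * ?e j) powr q\<^sub>1) powr (1 / q\<^sub>1)"
            unfolding A_def using a(2)[of j] pos by (intro powr_mono2) auto
          also have "\<dots> = t * ?e j" using t pos by (simp add: powr_powr)
          finally show ?thesis .
        qed
        then show "\<exists>k. \<forall>j\<ge>k. A j \<le> t * ?e j" by blast
      next
        fix e :: real assume "0 < e"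
        then have "\<exists>k::int. 1 * 2 powr (- 1 * real_of_int k) \<le> e"
          using eventually_powr_tail[of 1 e 1] by (meson order_refl zero_less_one)
        then obtain k :: int where "1 * 2 powr (- 1 * real_of_int k) \<le> e" by blast
        then show "\<exists>j. ?e j \<le> e" by (intro exI[of _ "- k"]) simp
      qed (use \<theta> q nonneg in \<open>auto simp: powr_add\<close>)
      have "(\<integral>\<^sup>+j. ennreal (A j powr ((1 - \<theta>) * q) * ?e j powr (\<theta> * q)) \<partial>count_space UNIV)
        = (\<integral>\<^sup>+j. ennreal (2 powr ((q - q\<^sub>1) * real_of_int j)) * upper_part q\<^sub>1 (?e j) f \<partial>count_space UNIV)"
      proof (rule nn_integral_cong)
        fix j
        have "A j powr ((1 - \<theta>) * q) = a j"
          unfolding \<theta>q A_def using a(2)[of j] pos by (simp add: powr_powr)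
        moreover have "?e j powr (\<theta> * q) = 2 powr ((q - q\<^sub>1) * real_of_int j)"
          unfolding \<theta>q by (simp add: powr_powr mult.commute)
        ultimately show "ennreal (A j powr ((1 - \<theta>) * q) * ?e j powr (\<theta> * q))
          = ennreal (2 powr ((q - q\<^sub>1) * real_of_int j)) * upper_part q\<^sub>1 (?e j) f"
          using a(2)[of j] by (simp add: a(1) ennreal_mult[symmetric] mult.commute)
      qed
      also have "\<dots> \<le> ennreal (1 / (1 - 2 powr - (q - q\<^sub>1))) * power_integral q f"
        using q by (intro upper_part_sum_le) auto
      finally have X: "(\<integral>\<^sup>+j. ennreal (A j powr ((1 - \<theta>) * q) * ?e j powr (\<theta> * q)) \<partial>count_space UNIV)
        \<le> ennreal (1 / (1 - 2 powr - (q - q\<^sub>1))) * power_integral q f" .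
      have c2: "(2 * 2) powr q / (1 - 2 powr - ((1 - \<theta>) * q)) = C2" by (simp add: C2_def \<theta>q)
      have c: "ennreal (C2 * (1 / (1 - 2 powr - (q - q\<^sub>1))))
          = ennreal C2 * ennreal (1 / (1 - 2 powr - (q - q\<^sub>1)))"
        using C2 by (simp only: ennreal_mult' less_imp_le)
      show ?thesis using order_trans[OF INT[unfolded c2] mult_left_mono[OF X]]
        unfolding c by (simp only: mult.assoc zero_le)
    qed
  qed
qed

end

section \<open>Duality\<close>

text \<open>Norms take the value \<open>top\<close> off their spaces, so inequalities on the whole
  type also give equality of the spaces.\<close>

lemma same_spaceI:
  assumes "0 < C" "0 < C'" "\<And>a. N a \<le> ennreal C * N' a" "\<And>a. N' a \<le> ennreal C' * N a"
  shows "same_space N N'"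
proof -
  have top: "N a < top \<longleftrightarrow> N' a < top" for a
    using assms(3)[of a] assms(4)[of a] ennreal_mult_less_top[of "ennreal C"
    "N' a"] ennreal_mult_less_top[of "ennreal C'" "N a"]
    by (auto intro: le_less_trans)
  have "N a \<le> ennreal (max C C') * N' a" for a
    using assms(3)[of a] mult_right_mono[OF ennreal_leI[OF max.cobounded1[of C C']], of "N' a"] by simp
  moreover have "N' a \<le> ennreal (max C C') * N a" for a
    using assms(4)[of a] mult_right_mono[OF ennreal_leI[OF max.cobounded2[of C' C]], of "N a"] by simp
  ultimately show ?thesis
    unfolding same_space_def space_of_def using top assms(1) by (auto intro!: exI[of _ "max C C'"])
qed

lemma dyadic_norm_less_top_iff: "dyadic_norm \<theta> q K < top \<longleftrightarrow> dyadic_sum \<theta> q K < top"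
  by (simp add: dyadic_norm_def)

lemma K_functional_less_top:
  assumes "dyadic_sum \<theta> q (\<lambda>t. K_functional N\<^sub>0 N\<^sub>1 t a) < top"
  obtains a\<^sub>0 a\<^sub>1 where "a = a\<^sub>0 + a\<^sub>1" "N\<^sub>0 a\<^sub>0 < top" "N\<^sub>1 a\<^sub>1 < top"
proof -
  have "enn_powr (ennreal (2 powr (- \<theta> * real_of_int 0)) * K_functional N\<^sub>0 N\<^sub>1 (2 powr real_of_int 0) a) q < top"
    using dyadic_sum_ge_term[of \<theta> 0 "\<lambda>t. K_functional N\<^sub>0 N\<^sub>1 t a" q] assms by (rule le_less_trans)
  then have "K_functional N\<^sub>0 N\<^sub>1 1 a < top" by simp
  then show ?thesis by (rule K_functional_lessE) (rule that)
qed

text \<open>A lower bound survives multiplication of the infimum by a finite \<open>c\<close>,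
  except that an empty infimum times 0 is 0 in \<open>ennreal\<close>; one decomposition with finite
  norms excludes this.\<close>

lemma K_functional_mult_greatest:
  assumes t: "0 < t" and ex: "a = b\<^sub>0 + b\<^sub>1" "N\<^sub>0 b\<^sub>0 < top" "N\<^sub>1 b\<^sub>1 < top" and c: "c < top"
    and le: "\<And>a\<^sub>0 a\<^sub>1. a = a\<^sub>0 + a\<^sub>1 \<Longrightarrow> N\<^sub>0 a\<^sub>0 < top \<Longrightarrow> N\<^sub>1 a\<^sub>1 < top
        \<Longrightarrow> x \<le> (N\<^sub>0 a\<^sub>0 + ennreal t * N\<^sub>1 a\<^sub>1) * c"
  shows "x \<le> K_functional N\<^sub>0 N\<^sub>1 t a * c"
proof (cases "c = 0")
  case True
  then show ?thesis using le[OF ex] by simp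
next
  case False
  then obtain r where r: "c = ennreal r" "0 < r"
    using c by (cases c) (auto simp: ennreal_eq_0_iff not_le)
  have "ennreal (1 / r) * x \<le> K_functional N\<^sub>0 N\<^sub>1 t a"
  proof (rule K_functional_greatest)
    fix a\<^sub>0 a\<^sub>1 assume "a = a\<^sub>0 + a\<^sub>1" "N\<^sub>0 a\<^sub>0 < top" "N\<^sub>1 a\<^sub>1 < top"
    from le[OF this] have "ennreal (1 / r) * x
        \<le> ennreal (1 / r) * ((N\<^sub>0 a\<^sub>0 + ennreal t * N\<^sub>1 a\<^sub>1) * ennreal r)"
      unfolding r by (rule mult_left_mono) simp
    also have "\<dots> = (N\<^sub>0 a\<^sub>0 + ennreal t * N\<^sub>1 a\<^sub>1) * (ennreal (1 / r) * ennreal r)"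
      by (simp only: mult_ac)
    also have "ennreal (1 / r) * ennreal r = 1" using r by (simp add: ennreal_mult'[symmetric])
    finally show "ennreal (1 / r) * x \<le> N\<^sub>0 a\<^sub>0 + ennreal t * N\<^sub>1 a\<^sub>1" by simp
  qed
  then have "x \<le> ennreal r * K_functional N\<^sub>0 N\<^sub>1 t a" by (rule ennreal_le_div_mult[OF r(2)])
  then show ?thesis by (simp add: r mult.commute)
qed

text \<open>The dual couple carries the inverse scale: the two wanted terms appear as
  \<open>a * c\<close> and \<open>(t * b) * (d / t)\<close> among the products on the right.\<close>

lemma couple_pairing_le:
  fixes a b c d :: ennreal
  assumes "0 < t"
  shows "a * c + b * d \<le> (a + ennreal t * b) * (c + ennreal (1 / t) * d)"
proof -
  have 1: "ennreal t * ennreal (1 / t) = 1" using assms by (simp add: ennreal_mult'[symmetric])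
  have "(ennreal t * b) * (ennreal (1 / t) * d) = (ennreal t * ennreal (1 / t)) * (b * d)"
    by (simp only: mult_ac)
  then have "a * c + b * d = a * c + (ennreal t * b) * (ennreal (1 / t) * d)" unfolding 1 by simp
  also have "\<dots> \<le> (a + ennreal t * b) * (c + ennreal (1 / t) * d)"
    unfolding distrib_right distrib_left by (simp add: add_increasing2 add.assoc add_left_mono)
  finally show ?thesis .
qed

text \<open>Nearest-point projection to a disc in the complex plane does not increase
  distances.\<close>

lemma cmod_truncation:
  assumes "0 \<le> T"
  obtains P :: "complex \<Rightarrow> complex" where "\<And>z y. cmod (P z - P y) \<le> cmod (z - y)" "\<And>z. cmod (P z) \<le> T"
    "\<And>z. cmod z \<le> T \<Longrightarrow> P z = z"
proof (rule that[of "closest_point (cball 0 T)"])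
  have S: "convex (cball (0::complex) T)" "closed (cball (0::complex) T)" "cball (0::complex) T \<noteq> {}"
    using assms by auto
  show "cmod (closest_point (cball 0 T) z - closest_point (cball 0 T) y) \<le> cmod (z - y)" for z y
    using closest_point_lipschitz[OF S, of z y] by (simp add: dist_norm)
  show "cmod (closest_point (cball 0 T) z) \<le> T" for z
    using closest_point_in_set[OF S(2,3), of z] by simp
  show "closest_point (cball 0 T) z = z" if "cmod z \<le> T" for z
    using that by (intro closest_point_self) simp
qed

section \<open>K-functionals modulo constants\<close>

lemma abs_fun_mod_const_eq_iff: "abs_fun_mod_const f = abs_fun_mod_const g \<longleftrightarrow> (\<exists>c. \<forall>x. f x = g x + c)"
  using Quotient_rel_abs2[OF Quotient_fun_mod_const] Quotient_rel[OF Quotient_fun_mod_const, of f g]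
  by (metis fun_mod_const.abs_eq_iff)

lemma abs_fun_mod_const_add: "abs_fun_mod_const (f + g) = abs_fun_mod_const f + abs_fun_mod_const g"
  by (simp add: plus_fun_mod_const.abs_eq plus_fun_def)

lemma abs_fun_mod_const_surj: "\<exists>f. abs_fun_mod_const f = F"
  by (metis Quotient_abs_rep[OF Quotient_fun_mod_const])

lemma mod_const_norm_le: "mod_const_norm N (abs_fun_mod_const f) \<le> N f"
  unfolding mod_const_norm_def by (intro INF_lower) simp

lemma mod_const_norm_lessE:
  assumes "mod_const_norm N F < y"
  obtains f where "abs_fun_mod_const f = F" "N f < y"
  using assms unfolding mod_const_norm_def INF_less_iff by blast

text \<open>A decomposition of \<open>f\<close> induces one of its class with no larger quotient
  norms. The factor \<open>c\<close> leaves room for comparing BMO with the bounded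
  functions.\<close>

lemma K_functional_mod_const_le:
  assumes "0 < t" "1 \<le> c" "\<And>a. M\<^sub>0 a \<le> ennreal c * N\<^sub>0 a" "\<And>a. M\<^sub>1 a \<le> ennreal c * N\<^sub>1 a"
  shows "K_functional (mod_const_norm M\<^sub>0) (mod_const_norm M\<^sub>1) t (abs_fun_mod_const f)
      \<le> ennreal c * K_functional N\<^sub>0 N\<^sub>1 t f"
proof -
  have "ennreal (1 / c) * K_functional (mod_const_norm M\<^sub>0) (mod_const_norm M\<^sub>1) t (abs_fun_mod_const f)
      \<le> K_functional N\<^sub>0 N\<^sub>1 t f"
  proof (rule K_functional_greatest)
    fix a\<^sub>0 a\<^sub>1 assume f: "f = a\<^sub>0 + a\<^sub>1"
    have "K_functional (mod_const_norm M\<^sub>0) (mod_const_norm M\<^sub>1) t (abs_fun_mod_const f)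
      \<le> mod_const_norm M\<^sub>0 (abs_fun_mod_const a\<^sub>0) + ennreal t * mod_const_norm M\<^sub>1 (abs_fun_mod_const a\<^sub>1)"
      using assms f by (intro K_functional_le) (simp_all add: abs_fun_mod_const_add)
    also have "\<dots> \<le> ennreal c * N\<^sub>0 a\<^sub>0 + ennreal t * (ennreal c * N\<^sub>1 a\<^sub>1)"
      by (intro add_mono mult_left_mono order_trans[OF mod_const_norm_le] assms) auto
    also have "\<dots> = ennreal c * (N\<^sub>0 a\<^sub>0 + ennreal t * N\<^sub>1 a\<^sub>1)" by (simp only: distrib_left mult_ac)
    finally have "ennreal (1 / c)
        * K_functional (mod_const_norm M\<^sub>0) (mod_const_norm M\<^sub>1) t (abs_fun_mod_const f)
      \<le> ennreal (1 / c) * (ennreal c * (N\<^sub>0 a\<^sub>0 + ennreal t * N\<^sub>1 a\<^sub>1))" by (rule mult_left_mono) simp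
    also have "\<dots> = (ennreal (1 / c) * ennreal c) * (N\<^sub>0 a\<^sub>0 + ennreal t * N\<^sub>1 a\<^sub>1)"
      by (simp only: mult.assoc)
    also have "ennreal (1 / c) * ennreal c = 1" using assms(2) by (simp add: ennreal_mult'[symmetric])
    finally show "ennreal (1 / c)
        * K_functional (mod_const_norm M\<^sub>0) (mod_const_norm M\<^sub>1) t (abs_fun_mod_const f)
      \<le> N\<^sub>0 a\<^sub>0 + ennreal t * N\<^sub>1 a\<^sub>1" by simp
  qed
  then show ?thesis using assms(2) by (intro ennreal_le_div_mult) auto
qed

text \<open>A representative of the first class is subtracted from \<open>f\<close>; what remains
  differs from any representative of the second class by a constant, which \<open>N\<^sub>1\<close>
  does not see.\<close>

lemma K_functional_le_mod_const:
  assumes t: "0 < t" and const: "\<And>a c. N\<^sub>1 (\<lambda>x. a x + c) = N\<^sub>1 a"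
  shows "K_functional N\<^sub>0 N\<^sub>1 t f
      \<le> K_functional (mod_const_norm N\<^sub>0) (mod_const_norm N\<^sub>1) t (abs_fun_mod_const f)"
proof (rule K_functional_greatest)
  fix A\<^sub>0 A\<^sub>1 assume F: "abs_fun_mod_const f = A\<^sub>0 + A\<^sub>1" and fin: "mod_const_norm N\<^sub>0 A\<^sub>0 < top"
  show "K_functional N\<^sub>0 N\<^sub>1 t f \<le> mod_const_norm N\<^sub>0 A\<^sub>0 + ennreal t * mod_const_norm N\<^sub>1 A\<^sub>1"
  proof (rule ennreal_le_epsilon)
    fix e :: real assume "0 < e"
    then have "mod_const_norm N\<^sub>0 A\<^sub>0 < mod_const_norm N\<^sub>0 A\<^sub>0 + ennreal e"
      using fin by (cases "mod_const_norm N\<^sub>0 A\<^sub>0") (auto simp: ennreal_plus[symmetric] ennreal_less_iff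
          simp del: ennreal_plus)
    then obtain a\<^sub>0 where a\<^sub>0: "abs_fun_mod_const a\<^sub>0 = A\<^sub>0"
      "N\<^sub>0 a\<^sub>0 < mod_const_norm N\<^sub>0 A\<^sub>0 + ennreal e"
      by (rule mod_const_norm_lessE)
    have "N\<^sub>1 (f - a\<^sub>0) \<le> mod_const_norm N\<^sub>1 A\<^sub>1"
      unfolding mod_const_norm_def
    proof (rule INF_greatest, clarify)
      fix a\<^sub>1 assume "A\<^sub>1 = abs_fun_mod_const a\<^sub>1"
      then have "abs_fun_mod_const f = abs_fun_mod_const (a\<^sub>0 + a\<^sub>1)"
        using F a\<^sub>0 by (simp add: abs_fun_mod_const_add)
      then obtain c where "\<forall>x. f x = (a\<^sub>0 + a\<^sub>1) x + c" unfolding abs_fun_mod_const_eq_iff by blast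
      then have "f - a\<^sub>0 = (\<lambda>x. a\<^sub>1 x + c)" by (simp add: fun_eq_iff)
      then show "N\<^sub>1 (f - a\<^sub>0) \<le> N\<^sub>1 a\<^sub>1" by (simp add: const)
    qed
    then have "N\<^sub>0 a\<^sub>0 + ennreal t * N\<^sub>1 (f - a\<^sub>0)
        \<le> (mod_const_norm N\<^sub>0 A\<^sub>0 + ennreal e) + ennreal t * mod_const_norm N\<^sub>1 A\<^sub>1"
      using a\<^sub>0(2) by (intro add_mono mult_left_mono) auto
    moreover have "K_functional N\<^sub>0 N\<^sub>1 t f \<le> N\<^sub>0 a\<^sub>0 + ennreal t * N\<^sub>1 (f - a\<^sub>0)"
      using t by (intro K_functional_le) auto
    ultimately show "K_functional N\<^sub>0 N\<^sub>1 t f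
        \<le> mod_const_norm N\<^sub>0 A\<^sub>0 + ennreal t * mod_const_norm N\<^sub>1 A\<^sub>1 + ennreal e"
      by (simp add: ac_simps)
  qed
qed

context doubling_flow_tree
begin

lemma dyadic_norm_le_Lp_norm:
  assumes "0 < p" "0 < C" "dyadic_sum \<theta> p K \<le> ennreal C * power_integral p f"
  shows "dyadic_norm \<theta> p K \<le> ennreal (C powr (1 / p)) * Lp_norm M (ereal p) f"
proof -
  have "dyadic_norm \<theta> p K \<le> enn_powr (ennreal C * power_integral p f) (1 / p)"
    unfolding dyadic_norm_def using assms by (intro enn_powr_mono) auto
  then show ?thesis using assms by (simp add: enn_powr_cmult Lp_norm_real)
qed

lemma dyadic_norm_H1_Lp_le:
  assumes \<beta>: "8 \<le> \<beta>" and p: "1 < p" "ereal p < p\<^sub>1" and \<theta>: "0 < \<theta>" "\<theta> < 1"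
    and eq: "ereal (1 / p) = ereal (1 - \<theta>) + ereal \<theta> / p\<^sub>1"
  shows "\<exists>C>0. \<forall>f. dyadic_norm \<theta> p (\<lambda>t. K_functional (H1_norm \<beta>) (Lp_norm M p\<^sub>1) t f)
      \<le> ennreal C * Lp_norm M (ereal p) f"
proof -
  have "\<exists>C>0. \<forall>f. dyadic_sum \<theta> p (\<lambda>t. K_functional (H1_norm \<beta>) (Lp_norm M p\<^sub>1) t f)
      \<le> ennreal C * power_integral p f"
  proof (cases p\<^sub>1)
    case (real s)
    have s: "p < s" using p real by simp
    have "1 / p = 1 - \<theta> + \<theta> / s" using eq real p s by (simp add: divide_ereal_def divide_inverse)
    from dyadic_sum_H1_Lp_le[OF \<beta> p(1) s \<theta> this] show ?thesis unfolding real .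
  next
    case PInf
    have "1 / p = 1 - \<theta>" using eq PInf by simp
    from dyadic_sum_H1_Linf_le[OF \<beta> p(1) \<theta> this] show ?thesis unfolding PInf .
  qed (use p in simp)
  then obtain C where C: "0 < C"
    "\<And>f. dyadic_sum \<theta> p (\<lambda>t. K_functional (H1_norm \<beta>) (Lp_norm M p\<^sub>1) t f)
        \<le> ennreal C * power_integral p f" by blast
  show ?thesis
    using C p by (intro exI[of _ "C powr (1 / p)"] conjI allI dyadic_norm_le_Lp_norm) auto
qed

lemma dyadic_norm_Lp_Linf_le:
  assumes q: "1 \<le> q\<^sub>1" "q\<^sub>1 < q" and \<theta>: "0 < \<theta>" "\<theta> < 1" and eq: "1 / q = (1 - \<theta>) / q\<^sub>1"
  shows "\<exists>C>0. \<forall>f. dyadic_norm \<theta> q (\<lambda>t. K_functional (Lp_norm M (ereal q\<^sub>1)) (Lp_norm M \<infinity>) t f)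
      \<le> ennreal C * Lp_norm M (ereal q) f"
proof -
  obtain C where C: "0 < C"
    "\<And>f. dyadic_sum \<theta> q (\<lambda>t. K_functional (Lp_norm M (ereal q\<^sub>1)) (Lp_norm M \<infinity>) t f)
        \<le> ennreal C * power_integral q f"
    using dyadic_sum_Lp_Linf_le[OF assms] by blast
  show ?thesis
    using C q by (intro exI[of _ "C powr (1 / q)"] conjI allI dyadic_norm_le_Lp_norm) auto
qed

lemma Lp_norm_finite_support:
  assumes "finite E" "\<And>x. x \<notin> E \<Longrightarrow> g x = 0" "1 \<le> p"
  shows "Lp_norm M p g < top"
proof (cases p)
  case (real r)
  have "power_integral r g = (\<Sum>x\<in>E. ennreal (m x) * ennreal (cmod (g x) powr r))"
    unfolding power_integral_def using assms by (intro nn_integral_M_finite) auto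
  also have "\<dots> < top" by (simp add: ennreal_mult[symmetric])
  finally show ?thesis using real by (simp add: Lp_norm_real)
next
  case PInf
  have "Lp_norm M \<infinity> g \<le> ennreal (\<Sum>x\<in>E. cmod (g x))"
    unfolding Lp_norm_infinity_le_iff
  proof (intro allI ennreal_leI)
    fix x
    show "cmod (g x) \<le> (\<Sum>x\<in>E. cmod (g x))"
      using assms(1,2) member_le_sum[of x E "\<lambda>x. cmod (g x)"] by (cases "x \<in> E") (auto simp: sum_nonneg)
  qed
  also have "\<dots> < top" by simp
  finally show ?thesis using PInf by simp
qed (use assms in simp)

lemma Lp_norm_exhaustion_le:
  assumes "0 < p" "\<And>n. enn_powr (\<integral>\<^sup>+x\<in>exhaustion n. ennreal (cmod (f x) powr p) \<partial>M) (1 / p) \<le> B"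
  shows "Lp_norm M (ereal p) f \<le> B"
proof -
  have "(\<integral>\<^sup>+x\<in>exhaustion n. ennreal (cmod (f x) powr p) \<partial>M) \<le> enn_powr B p" for n
    using enn_powr_mono[OF assms(2)[of n], of p] assms(1) by simp
  moreover have "power_integral p f = (SUP n. \<integral>\<^sup>+x\<in>exhaustion n. ennreal (cmod (f x) powr p) \<partial>M)"
    unfolding power_integral_def by (rule SUP_exhaustion[symmetric])
  ultimately have "power_integral p f \<le> enn_powr B p" by (auto intro: SUP_least)
  then show ?thesis
    unfolding Lp_norm_real
    using assms(1) enn_powr_mono[of "power_integral p f" "enn_powr B p" "1 / p"] by simp
qed

text \<open>The extremal function \<open>cnj f * cmod f powr (p - 2)\<close> on \<open>E\<close>
  attains the norm. On a finite set the power integral \<open>W\<close> is finite, so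
  \<open>W powr (1 / q)\<close> can be divided out.\<close>

lemma local_Lp_norm_le_by_duality:
  assumes pq: "1 < p" "1 < q" "1 / p + 1 / q = 1" and E: "finite E"
    and dual: "\<And>g. (\<And>x. x \<notin> E \<Longrightarrow> g x = 0) \<Longrightarrow>
      ennreal (cmod (\<Sum>x\<in>E. m x *\<^sub>R (f x * g x))) \<le> B * Lp_norm M (ereal q) g"
  shows "enn_powr (\<integral>\<^sup>+x\<in>E. ennreal (cmod (f x) powr p) \<partial>M) (1 / p) \<le> B"
proof (cases "B = top")
  case False
  define W where "W = (\<Sum>x\<in>E. m x * cmod (f x) powr p)"
  have W0: "0 \<le> W" by (simp add: W_def sum_nonneg)
  have W: "(\<integral>\<^sup>+x\<in>E. ennreal (cmod (f x) powr p) \<partial>M) = ennreal W"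
    unfolding W_def by (rule set_power_integral_finite[OF E])
  show ?thesis
  proof (cases "W = 0")
    case True
    then show ?thesis by (simp add: W)
  next
    case False
    then have Wpos: "0 < W" using W0 by simp
    define g where "g x = (if x \<in> E then cnj (f x) * of_real (cmod (f x) powr (p - 2)) else 0)" for x
    have fg: "f x * g x = of_real (cmod (f x) powr p)" if "x \<in> E" for x
    proof (cases "f x = 0")
      case False
      have "f x * g x = of_real ((cmod (f x))\<^sup>2 * cmod (f x) powr (p - 2))"
      proof -
        have "f x * g x = (f x * cnj (f x)) * of_real (cmod (f x) powr (p - 2))"
          using that by (simp add: g_def)
        also have "f x * cnj (f x) = of_real ((cmod (f x))\<^sup>2)"
          by (metis complex_norm_square of_real_power)
        finally show ?thesis by simp
      qed
      also have "(cmod (f x))\<^sup>2 * cmod (f x) powr (p - 2) = cmod (f x) powr p"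
      proof -
        have "(cmod (f x))\<^sup>2 = cmod (f x) powr 2" using False by simp
        then show ?thesis by (simp only: powr_add[symmetric]) simp
      qed
      finally show ?thesis .
    qed (use pq in simp)
    have norm_g: "cmod (g x) powr q = cmod (f x) powr p" if "x \<in> E" for x
    proof (cases "f x = 0")
      case False
      have "cmod (g x) = cmod (f x) * cmod (f x) powr (p - 2)"
        using that by (simp add: g_def norm_mult)
      also have "\<dots> = cmod (f x) powr (p - 1)"
        using False by (simp add: powr_mult_base)
      finally have "cmod (g x) powr q = cmod (f x) powr ((p - 1) * q)" by (simp add: powr_powr)
      also have "(p - 1) * q = p" using pq by (simp add: field_simps)
      finally show ?thesis .
    qed (use that in \<open>simp add: g_def\<close>)
    have "power_integral q g = (\<integral>\<^sup>+x\<in>E. ennreal (cmod (g x) powr q) \<partial>M)"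
      unfolding power_integral_def by (intro nn_integral_cong) (auto simp: g_def indicator_def)
    also have "\<dots> = ennreal W"
      unfolding set_power_integral_finite[OF E] W_def
      using norm_g by (intro arg_cong[where f = ennreal] sum.cong) auto
    finally have Lg: "Lp_norm M (ereal q) g = ennreal (W powr (1 / q))"
      using W0 by (simp add: Lp_norm_real enn_powr_ennreal)
    have "(\<Sum>x\<in>E. m x *\<^sub>R (f x * g x)) = of_real W"
      unfolding W_def of_real_sum using fg by (intro sum.cong) (auto simp: scaleR_conv_of_real)
    then have "ennreal W \<le> B * ennreal (W powr (1 / q))"
      using dual[of g] W0 unfolding Lg by (auto simp: g_def)
    then have "ennreal (1 / W powr (1 / q)) * ennreal W
        \<le> ennreal (1 / W powr (1 / q)) * (B * ennreal (W powr (1 / q)))"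
      by (rule mult_left_mono) simp
    also have "\<dots> = B * (ennreal (1 / W powr (1 / q)) * ennreal (W powr (1 / q)))"
      by (simp only: mult_ac)
    also have "ennreal (1 / W powr (1 / q)) * ennreal (W powr (1 / q)) = 1"
      using Wpos by (simp add: ennreal_mult'[symmetric])
    also have "ennreal (1 / W powr (1 / q)) * ennreal W = ennreal (W powr (1 / p))"
    proof -
      have "1 / p = 1 - 1 / q" using pq(3) by linarith
      then have "W powr (1 / p) = W powr (1 - 1 / q)" by (simp only:)
      also have "\<dots> = 1 / W powr (1 / q) * W" using Wpos by (simp add: powr_diff)
      finally show ?thesis by (simp add: ennreal_mult'[symmetric])
    qed
    finally show ?thesis using W0 by (simp add: W enn_powr_ennreal)
  qed
qed simp

section \<open>The lower bound for couples of Lebesgue spaces\<close>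

text \<open>The dual couple consists of \<open>L^s\<close>, with \<open>s\<close> conjugate to
  \<open>p\<^sub>1\<close>, and the bounded functions. Its interpolation norm with parameter
  \<open>1 - \<theta>\<close> is bounded by the norm of \<open>L^q\<close> through plain truncation,
  and testing \<open>f\<close> against such functions on finite sets recovers its norm in
  \<open>L^p\<close>.\<close>

lemma Lp_norm_le_interp_L1:
  assumes p: "1 < p" "ereal p < p\<^sub>1" and \<theta>: "0 < \<theta>" "\<theta> < 1"
    and eq: "ereal (1 / p) = ereal (1 - \<theta>) + ereal \<theta> / p\<^sub>1"
  shows "\<exists>C>0. \<forall>f. Lp_norm M (ereal p) f
      \<le> ennreal C * dyadic_norm \<theta> p (\<lambda>t. K_functional (Lp_norm M 1) (Lp_norm M p\<^sub>1) t f)"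
proof -
  define q where "q = p / (p - 1)"
  have q: "1 < q" "1 / p + 1 / q = 1" using p by (auto simp: q_def field_simps)
  \<comment> \<open>For \<open>p\<^sub>1 = \<infinity>\<close> the conjugate exponent is 1; in both
    cases the relation for \<open>1 / p\<close> becomes \<open>1 / q = \<theta> / s\<close>.\<close>
  obtain s :: real where s: "1 \<le> s" "s < q" "1 / q = (1 - (1 - \<theta>)) / s" "1 / p\<^sub>1 + 1 / ereal s = 1"
  proof (cases p\<^sub>1)
    case (real r)
    have r: "p < r" using p real by simp
    define s where "s = r / (r - 1)"
    have 1: "1 / p = 1 - \<theta> + \<theta> / r" using eq real p r by (simp add: divide_ereal_def divide_inverse)
    have s1: "1 / s = 1 - 1 / r" using r p by (simp add: s_def field_simps)
    have s: "1 < s" using r p by (simp add: s_def)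
    have "1 / r < 1 / p" using r p by (simp add: frac_less2)
    then have "1 / q < 1 / s" using s1 q(2) by linarith
    then have "s < q" using s q by (simp add: field_simps)
    moreover have "1 / q = (1 - (1 - \<theta>)) / s"
    proof -
      have "1 / q = \<theta> * (1 - 1 / r)" using q(2) 1 by (simp add: algebra_simps)
      also have "\<dots> = \<theta> / s" unfolding s1[symmetric] by simp
      finally show ?thesis by simp
    qed
    moreover have "1 / p\<^sub>1 + 1 / ereal s = 1"
      using s1 s r p real by (simp add: divide_ereal_def one_ereal_def field_simps)
    ultimately show ?thesis using s by (intro that[of s]) simp_all
  next
    case PInf
    have "1 / p = 1 - \<theta>" using eq PInf by simp
    then have "1 / q = \<theta>" using q(2) by linarith
    then show ?thesis using that[of 1] q PInf by (simp add: one_ereal_def)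
  qed (use p in simp)
  have \<theta>': "0 < 1 - \<theta>" "1 - \<theta> < 1" using \<theta> by auto
  have p1: "1 \<le> p\<^sub>1" using p by (cases p\<^sub>1) auto
  obtain C where C: "0 < C"
    "\<And>g. dyadic_norm (1 - \<theta>) q (\<lambda>t. K_functional (Lp_norm M (ereal s)) (Lp_norm M \<infinity>) t g)
    \<le> ennreal C * Lp_norm M (ereal q) g"
    using dyadic_norm_Lp_Linf_le[OF s(1,2) \<theta>' s(3)] by blast
  show ?thesis
  proof (intro exI[of _ "6 * C"] conjI allI)
    show posC: "0 < 6 * C" using C by simp
    fix f
    let ?K = "\<lambda>t. K_functional (Lp_norm M 1) (Lp_norm M p\<^sub>1) t f"
    let ?dn = "dyadic_norm \<theta> p ?K"
    show "Lp_norm M (ereal p) f \<le> ennreal (6 * C) * ?dn"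
    proof (cases "?dn = top")
      case True
      then show ?thesis by (intro le_ennreal_mult_top posC)
    next
      case False
      then have fin: "dyadic_sum \<theta> p ?K < top" by (simp add: dyadic_norm_def less_top)
      obtain b\<^sub>0 b\<^sub>1 where b: "f = b\<^sub>0 + b\<^sub>1" "Lp_norm M 1 b\<^sub>0 < top" "Lp_norm M p\<^sub>1 b\<^sub>1 < top"
        using K_functional_less_top[OF fin] by blast
      show ?thesis
      proof (rule Lp_norm_exhaustion_le)
        fix n
        let ?E = "exhaustion n"
        show "enn_powr (\<integral>\<^sup>+x\<in>?E. ennreal (cmod (f x) powr p) \<partial>M) (1 / p) \<le> ennreal (6 * C) * ?dn"
        proof (rule local_Lp_norm_le_by_duality[OF p(1) q finite_exhaustion])
          fix g :: "'v \<Rightarrow> complex" assume supp: "\<And>x. x \<notin> ?E \<Longrightarrow> g x = 0"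
          define \<Lambda> where "\<Lambda> G = (\<Sum>x\<in>?E. m x *\<^sub>R (f x * G x))" for G
          have prod_le: "ennreal (\<Sum>x\<in>?E. m x * cmod (a x * G x)) \<le> Lp_norm M r a * Lp_norm M r' G"
            if "1 \<le> r" "1 \<le> r'" "1 / r + 1 / r' = 1" for a G and r r' :: ereal
          proof -
            have "ennreal (\<Sum>x\<in>?E. m x * cmod (a x * G x)) = (\<integral>\<^sup>+x\<in>?E. ennreal (cmod (a x * G x)) \<partial>M)"
              using set_power_integral_finite[OF finite_exhaustion[of n], of "\<lambda>x. a x * G x" 1] by simp
            also have "\<dots> \<le> (\<integral>\<^sup>+x. ennreal (cmod (a x * G x)) \<partial>M)"
              by (intro nn_integral_mono) (auto simp: indicator_def)
            also have "\<dots> \<le> Lp_norm M r a * Lp_norm M r' G" by (rule Lp_Holder[OF that])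
            finally show ?thesis .
          qed
          have "ennreal (norm (\<Lambda> g)) \<le> ennreal 6 * (dyadic_norm \<theta> p ?K *
            dyadic_norm (1 - \<theta>) q (\<lambda>t. K_functional (Lp_norm M (ereal s)) (Lp_norm M \<infinity>) t g))"
          proof (rule functional_le_dyadic_norms[OF \<theta> p(1) q])
            show "Lp_norm M (ereal s) (x - y) \<le> Lp_norm M (ereal s) x + Lp_norm M (ereal s) y" for x y
              using s by (intro Lp_norm_triangle_diff) (simp add: one_ereal_def)
            show "Lp_norm M \<infinity> (x - y) \<le> Lp_norm M \<infinity> x + Lp_norm M \<infinity> y" for x y
              by (intro Lp_norm_triangle_diff) simp
            show "\<Lambda> (x + y) = \<Lambda> x + \<Lambda> y" for x y
              by (simp add: \<Lambda>_def distrib_left scaleR_add_right sum.distrib)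
            show "Lp_norm M (ereal s) 0 = 0" "Lp_norm M \<infinity> 0 = 0"
              using s Lp_norm_zero[of "ereal s"] Lp_norm_zero[of \<infinity>]
              by (simp_all add: zero_fun_def one_ereal_def)
            show gs: "Lp_norm M (ereal s) g < top" "Lp_norm M \<infinity> g < top"
              using s supp
              by (auto intro!: Lp_norm_finite_support[OF finite_exhaustion] simp: one_ereal_def)
            show "dyadic_sum \<theta> p ?K < top" by (rule fin)
            have "Lp_norm M (ereal q) g < top"
              using q supp
              by (intro Lp_norm_finite_support[OF finite_exhaustion]) (auto simp: one_ereal_def)
            then have "ennreal C * Lp_norm M (ereal q) g < top" by (simp add: ennreal_mult_less_top)
            then show "dyadic_sum (1 - \<theta>) q (\<lambda>t. K_functional (Lp_norm M (ereal s)) (Lp_norm M \<infinity>) t g)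
                < top"
              unfolding dyadic_norm_less_top_iff[symmetric]
              using C(2)[of g] by (rule le_less_trans[rotated])
            fix t :: real and G
            assume t: "0 < t" and G: "Lp_norm M (ereal s) G < top" "Lp_norm M \<infinity> G < top"
            show "ennreal (norm (\<Lambda> G))
                \<le> ?K t * (Lp_norm M \<infinity> G + ennreal (1 / t) * Lp_norm M (ereal s) G)"
            proof (rule K_functional_mult_greatest[OF t b(1), of "Lp_norm M 1"
              "Lp_norm M p\<^sub>1", OF b(2,3)])
              show "Lp_norm M \<infinity> G + ennreal (1 / t) * Lp_norm M (ereal s) G < top"
                using G by (simp add: ennreal_mult_less_top)
              fix a\<^sub>0 a\<^sub>1 assume a: "f = a\<^sub>0 + a\<^sub>1"
              have "norm (\<Lambda> G) \<le> (\<Sum>x\<in>?E. m x * cmod (a\<^sub>0 x * G x) + m x * cmod (a\<^sub>1 x * G x))"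
                unfolding \<Lambda>_def
              proof (rule sum_norm_le)
                fix x
                show "norm (m x *\<^sub>R (f x * G x)) \<le> m x * cmod (a\<^sub>0 x * G x) + m x * cmod (a\<^sub>1 x * G x)"
                  using norm_triangle_ineq[of "a\<^sub>0 x * G x" "a\<^sub>1 x * G x"]
                  by (simp add: a distrib_right distrib_left[symmetric] mult_left_mono)
              qed
              then have "ennreal (norm (\<Lambda> G))
                  \<le> ennreal ((\<Sum>x\<in>?E. m x * cmod (a\<^sub>0 x * G x)) + (\<Sum>x\<in>?E. m x * cmod (a\<^sub>1 x * G x)))"
                by (intro ennreal_leI) (simp add: sum.distrib)
              also have "\<dots>
                  = ennreal (\<Sum>x\<in>?E. m x * cmod (a\<^sub>0 x * G x)) + ennreal (\<Sum>x\<in>?E. m x * cmod (a\<^sub>1 x * G x))"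
                by (intro ennreal_plus sum_nonneg) auto
              also have "\<dots>
                  \<le> Lp_norm M 1 a\<^sub>0 * Lp_norm M \<infinity> G + Lp_norm M p\<^sub>1 a\<^sub>1 * Lp_norm M (ereal s) G"
                using s p1 by (intro add_mono prod_le) (auto simp: one_ereal_def)
              also have "\<dots>
                  \<le> (Lp_norm M 1 a\<^sub>0 + ennreal t * Lp_norm M p\<^sub>1 a\<^sub>1) * (Lp_norm M \<infinity> G + ennreal (1 / t) * Lp_norm M (ereal s) G)"
                by (rule couple_pairing_le[OF t])
              finally show "ennreal (norm (\<Lambda> G))
                  \<le> (Lp_norm M 1 a\<^sub>0 + ennreal t * Lp_norm M p\<^sub>1 a\<^sub>1) * (Lp_norm M \<infinity> G + ennreal (1 / t) * Lp_norm M (ereal s) G)" .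
            qed
          qed
          also have "\<dots> \<le> ennreal 6 * (?dn * (ennreal C * Lp_norm M (ereal q) g))"
            by (intro mult_left_mono C(2)) auto
          also have "\<dots> = ennreal (6 * C) * ?dn * Lp_norm M (ereal q) g"
          proof -
            have "ennreal (6 * C) = ennreal 6 * ennreal C" by (rule ennreal_mult') simp
            then show ?thesis by (simp only: mult_ac)
          qed
          finally show "ennreal (cmod (\<Sum>x\<in>?E. m x *\<^sub>R (f x * g x)))
              \<le> ennreal (6 * C) * ?dn * Lp_norm M (ereal q) g"
            by (simp add: \<Lambda>_def)
        qed
      qed (use p in simp)
    qed
  qed
qed

section \<open>Interpolation with \<open>BMO\<close>\<close>

lemma exhaustion_admissible:
  assumes "8 \<le> \<beta>"
  shows "exhaustion n \<in> admissible \<beta>"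
  using dyadic_exhaustion[OF assms] dyadic_admissible by blast

lemma w_exhaustion_pos: "0 < w (exhaustion n)"
  using exhaustion_admissible[of 8 n] admissible_nonempty[of 8] by (intro w_pos finite_exhaustion) auto

text \<open>The functional \<open>G \<mapsto> \<integral> f G dm\<close> need not make sense on \<open>H1\<close> for unbounded \<open>f\<close>; since \<open>g\<close> has
  finite support, \<open>f\<close> may be truncated first.\<close>

lemma BMO_pairing_le:
  assumes \<beta>: "8 \<le> \<beta>" and q: "1 \<le> q\<^sub>1" "q\<^sub>1 < q" and \<theta>: "0 < \<theta>" "\<theta> < 1" and eq: "1 / q = (1 - \<theta>) / q\<^sub>1"
    and p: "1 < p" "1 / q + 1 / p = 1"
  shows "\<exists>C>0. \<forall>f g n. dyadic_norm \<theta> q (\<lambda>t. K_functional (Lp_norm M (ereal q\<^sub>1)) (BMO_norm \<beta>) t f)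
      < top \<longrightarrow>
    (\<forall>x. x \<notin> exhaustion n \<longrightarrow> g x = 0) \<longrightarrow> (\<Sum>x\<in>exhaustion n. m x *\<^sub>R g x) = 0 \<longrightarrow>
    ennreal (cmod (\<Sum>x\<in>exhaustion n. m x *\<^sub>R (f x * g x))) \<le>
      ennreal C * dyadic_norm \<theta> q (\<lambda>t. K_functional (Lp_norm M (ereal q\<^sub>1)) (BMO_norm \<beta>) t f) * Lp_norm M (ereal p) g"
proof -
  \<comment> \<open>The conjugate exponent of \<open>q\<^sub>1\<close>, infinite for
    \<open>q\<^sub>1 = 1\<close>; the couple of H1 and \<open>L^s\<close> then meets
    \<open>L^p\<close> at the parameter \<open>1 - \<theta>\<close>.\<close>
  obtain s :: ereal where s: "1 \<le> s" "ereal p < s" "1 / ereal q\<^sub>1 + 1 / s = 1"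
    "ereal (1 / p) = ereal (1 - (1 - \<theta>)) + ereal (1 - \<theta>) / s"
  proof (cases "q\<^sub>1 = 1")
    case True
    have "1 / p = \<theta>" using p(2) eq True by simp
    then show ?thesis using True by (intro that[of \<infinity>]) (simp_all add: one_ereal_def)
  next
    case False
    then have q1: "1 < q\<^sub>1" using q by simp
    define r where "r = q\<^sub>1 / (q\<^sub>1 - 1)"
    have r: "1 < r" "1 / r = 1 - 1 / q\<^sub>1" using q1 by (auto simp: r_def field_simps)
    have "1 / q < 1 / q\<^sub>1" using q by (simp add: frac_less2)
    then have "1 / r < 1 / p" using r(2) p(2) by linarith
    then have pr: "p < r" using frac_le[of 1 1 r p] r(1) by (force simp: not_le[symmetric])
    have "1 / p = 1 - (1 - \<theta>) * (1 / q\<^sub>1)" using p(2) eq by simp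
    also have "\<dots> = \<theta> + (1 - \<theta>) * (1 / r)" unfolding r(2) by (simp add: algebra_simps)
    finally have "1 / p = \<theta> + (1 - \<theta>) / r" by simp
    then show ?thesis
      using r pr q1 p by (intro that[of "ereal r"]) (simp_all
          add: divide_ereal_def divide_inverse one_ereal_def)
  qed
  have \<theta>': "0 < 1 - \<theta>" "1 - \<theta> < 1" using \<theta> by auto
  have q': "1 < q" using q by simp
  obtain C where C: "0 < C" "\<And>g. dyadic_norm (1 - \<theta>) p (\<lambda>t. K_functional (H1_norm \<beta>) (Lp_norm M s) t g)
    \<le> ennreal C * Lp_norm M (ereal p) g"
    using dyadic_norm_H1_Lp_le[OF \<beta> p(1) s(2) \<theta>' s(4)] by blast
  show ?thesis
  proof (intro exI[of _ "12 * C"] conjI allI impI)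
    show "0 < 12 * C" using C by simp
    fix f g :: "'v \<Rightarrow> complex" and n
    let ?K = "\<lambda>t. K_functional (Lp_norm M (ereal q\<^sub>1)) (BMO_norm \<beta>) t f"
    let ?dn = "dyadic_norm \<theta> q ?K"
    let ?E = "exhaustion n"
    assume dn: "?dn < top" and supp: "\<forall>x. x \<notin> ?E \<longrightarrow> g x = 0" and mean: "(\<Sum>x\<in>?E. m x *\<^sub>R g x) = 0"
    have fin: "dyadic_sum \<theta> q ?K < top" using dn by (simp add: dyadic_norm_less_top_iff)
    obtain b\<^sub>0 b\<^sub>1 where b: "f = b\<^sub>0 + b\<^sub>1" "Lp_norm M (ereal q\<^sub>1) b\<^sub>0 < top" "BMO_norm \<beta> b\<^sub>1 < top"
      using K_functional_less_top[OF fin] by blast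
    \<comment> \<open>A bound for \<open>f\<close> on the support of \<open>g\<close>: projecting
      the values of \<open>f\<close> to the disc of radius \<open>T\<close> does not change the
      pairing with \<open>g\<close>, and the pairing becomes defined on all of H1.\<close>
    define T where "T = (\<Sum>x\<in>?E. cmod (f x))"
    have T: "0 \<le> T" "\<And>x. x \<in> ?E \<Longrightarrow> cmod (f x) \<le> T"
      using member_le_sum[of _ ?E "\<lambda>x. cmod (f x)"] finite_exhaustion by (auto simp: T_def sum_nonneg)
    obtain P :: "complex \<Rightarrow> complex" where P: "\<And>z y. cmod (P z - P y) \<le> cmod (z - y)"
      "\<And>z. cmod (P z) \<le> T"
      "\<And>z. cmod z \<le> T \<Longrightarrow> P z = z" using cmod_truncation[OF T(1)] by blast
    have bounded_BMO: "BMO_norm \<beta> \<phi> < top" if "\<And>x. cmod (\<phi> x) \<le> T" for \<phi>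
    proof -
      have "Lp_norm M \<infinity> \<phi> \<le> ennreal T"
        unfolding Lp_norm_infinity_le_iff using that by (auto intro: ennreal_leI)
      then have "2 * Lp_norm M \<infinity> \<phi> < top" by (auto simp: ennreal_mult_less_top intro: le_less_trans)
      then show ?thesis using BMO_norm_le_infinity by (rule le_less_trans[rotated])
    qed
    define \<Lambda> where "\<Lambda> G = (LINT x|M. P (f x) * G x)" for G
    have int: "integrable M (\<lambda>x. P (\<phi> x) * G x)" if "H1_norm \<beta> G < top" for \<phi> G
      using P(2) that by (intro H1_BMO_pairing(1)[of "\<lambda>x. P (\<phi> x)" T \<beta>] bounded_BMO)
    have g_eq: "\<Lambda> g = (\<Sum>x\<in>?E. m x *\<^sub>R (f x * g x))"
    proof -
      have "\<Lambda> g = (\<Sum>x\<in>?E. m x *\<^sub>R (P (f x) * g x))"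
        unfolding \<Lambda>_def using supp by (intro integral_M_finite(2) finite_exhaustion) auto
      also have "\<dots> = (\<Sum>x\<in>?E. m x *\<^sub>R (f x * g x))" using P(3) T(2) by (intro sum.cong) auto
      finally show ?thesis .
    qed
    \<comment> \<open>The factor 2 in front of \<open>?K t\<close> pays for truncating the BMO
      part.\<close>
    have "ennreal (norm (\<Lambda> g)) \<le> ennreal 6 * (dyadic_norm \<theta> q (\<lambda>t. ennreal 2 * ?K t) *
      dyadic_norm (1 - \<theta>) p (\<lambda>t. K_functional (H1_norm \<beta>) (Lp_norm M s) t g))"
    proof (rule functional_le_dyadic_norms[OF \<theta> q' p])
      show "H1_norm \<beta> (x - y) \<le> H1_norm \<beta> x + H1_norm \<beta> y" for x y by (rule H1_norm_diff)
      show "Lp_norm M s (x - y) \<le> Lp_norm M s x + Lp_norm M s y" for x y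
        by (rule Lp_norm_triangle_diff[OF s(1)])
      show "\<Lambda> (x + y) = \<Lambda> x + \<Lambda> y" if "H1_norm \<beta> x < top" "H1_norm \<beta> y < top" for x y
        unfolding \<Lambda>_def using int[OF that(1)] int[OF that(2)] by (simp add: distrib_left)
      show "H1_norm \<beta> 0 = 0" "Lp_norm M s 0 = 0" using s(1) by (simp_all add: zero_fun_def)
      \<comment> \<open>Mean zero and support in an admissible set make \<open>g\<close> a multiple
        of an atom.\<close>
      have "H1_norm \<beta> g \<le> ennreal ((\<Sum>x\<in>?E. cmod (g x)) * w ?E)"
      proof (rule H1_norm_le_mean_zero[OF exhaustion_admissible[OF \<beta>] _ _ mean])
        show "cmod (g x) \<le> (\<Sum>x\<in>?E. cmod (g x))" for x
          using supp member_le_sum[of x ?E "\<lambda>x. cmod (g x)"] finite_exhaustion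
          by (cases "x \<in> ?E") (auto simp: sum_nonneg)
      qed (use supp in auto)
      then show "H1_norm \<beta> g < top" by (auto intro: le_less_trans)
      show "Lp_norm M s g < top"
        using supp s(1) by (intro Lp_norm_finite_support[OF finite_exhaustion]) auto
      have "dyadic_norm \<theta> q (\<lambda>t. ennreal 2 * ?K t) \<le> ennreal 2 * ?dn"
        using q' by (intro dyadic_norm_mono) auto
      also have "\<dots> < top" using dn by (simp add: ennreal_mult_less_top)
      finally show "dyadic_sum \<theta> q (\<lambda>t. ennreal 2 * ?K t) < top" by (simp add: dyadic_norm_less_top_iff)
      have "Lp_norm M (ereal p) g < top"
        using p supp by (intro Lp_norm_finite_support[OF finite_exhaustion]) (auto simp: one_ereal_def)
      then have "ennreal C * Lp_norm M (ereal p) g < top" by (simp add: ennreal_mult_less_top)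
      then show "dyadic_sum (1 - \<theta>) p (\<lambda>t. K_functional (H1_norm \<beta>) (Lp_norm M s) t g) < top"
        unfolding dyadic_norm_less_top_iff[symmetric] using C(2)[of g] by (rule le_less_trans[rotated])
      fix t :: real and G assume t: "0 < t" and G: "H1_norm \<beta> G < top" "Lp_norm M s G < top"
      have "ennreal (norm (\<Lambda> G)) \<le> ?K t * (ennreal 2 * (Lp_norm M s G + ennreal (1 / t) * H1_norm \<beta> G))"
      proof (rule K_functional_mult_greatest[OF t b(1), of "Lp_norm M (ereal q\<^sub>1)"
        "BMO_norm \<beta>", OF b(2,3)])
        show "ennreal 2 * (Lp_norm M s G + ennreal (1 / t) * H1_norm \<beta> G) < top"
          using G by (simp add: ennreal_mult_less_top)
        fix a\<^sub>0 a\<^sub>1 assume a: "f = a\<^sub>0 + a\<^sub>1" "Lp_norm M (ereal q\<^sub>1) a\<^sub>0 < top"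
        \<comment> \<open>Truncation does not respect sums. Splitting off \<open>P a\<^sub>1\<close>
          keeps the BMO part truncated, and the difference that remains is dominated by
          \<open>a\<^sub>0\<close> because \<open>P\<close> does not increase distances.\<close>
        define d where "d x = P (f x) - P (a\<^sub>1 x)" for x
        have d_le: "cmod (d x) \<le> cmod (a\<^sub>0 x)" for x using P(1)[of "f x" "a\<^sub>1 x"] by (simp add: d_def a)
        have intd: "integrable M (\<lambda>x. d x * G x)"
          unfolding d_def left_diff_distrib by (intro Bochner_Integration.integrable_diff int G)
        have "\<Lambda> G = (LINT x|M. d x * G x + P (a\<^sub>1 x) * G x)"
          unfolding \<Lambda>_def by (intro Bochner_Integration.integral_cong) (auto simp: d_def algebra_simps)
        also have "\<dots> = (LINT x|M. d x * G x) + (LINT x|M. P (a\<^sub>1 x) * G x)"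
          by (intro Bochner_Integration.integral_add intd int G)
        finally have "ennreal (norm (\<Lambda> G))
            \<le> ennreal (norm (LINT x|M. d x * G x)) + ennreal (norm (LINT x|M. P (a\<^sub>1 x) * G x))"
          by (simp add: ennreal_plus[symmetric] ennreal_leI norm_triangle_ineq del: ennreal_plus)
        also have "\<dots> \<le> Lp_norm M (ereal q\<^sub>1) a\<^sub>0 * Lp_norm M s G + (2 * BMO_norm \<beta> a\<^sub>1) * H1_norm \<beta> G"
        proof (rule add_mono)
          have "ennreal (norm (LINT x|M. d x * G x)) \<le> (\<integral>\<^sup>+x. ennreal (norm (d x * G x)) \<partial>M)"
            by (rule integral_norm_bound_ennreal[OF intd])
          also have "\<dots> \<le> Lp_norm M (ereal q\<^sub>1) d * Lp_norm M s G"
            using q s by (intro Lp_Holder) (auto simp: one_ereal_def)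
          also have "\<dots> \<le> Lp_norm M (ereal q\<^sub>1) a\<^sub>0 * Lp_norm M s G"
            using q by (intro mult_right_mono Lp_norm_mono d_le) (auto simp: one_ereal_def)
          finally show "ennreal (norm (LINT x|M. d x * G x))
              \<le> Lp_norm M (ereal q\<^sub>1) a\<^sub>0 * Lp_norm M s G" .
          have "ennreal (norm (LINT x|M. P (a\<^sub>1 x) * G x)) \<le> BMO_norm \<beta> (\<lambda>x. P (a\<^sub>1 x)) * H1_norm \<beta> G"
            using P(2) G by (intro H1_BMO_pairing(2)[of "\<lambda>x. P (a\<^sub>1 x)" T \<beta>] bounded_BMO)
          also have "\<dots> \<le> (2 * BMO_norm \<beta> a\<^sub>1) * H1_norm \<beta> G"
            by (intro mult_right_mono BMO_norm_Lipschitz P(1)) auto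
          finally show "ennreal (norm (LINT x|M. P (a\<^sub>1 x) * G x))
              \<le> (2 * BMO_norm \<beta> a\<^sub>1) * H1_norm \<beta> G" .
        qed
        also have "\<dots> \<le> (Lp_norm M (ereal q\<^sub>1) a\<^sub>0 + ennreal t * BMO_norm \<beta> a\<^sub>1) *
          (ennreal 2 * (Lp_norm M s G + ennreal (1 / t) * H1_norm \<beta> G))"
        proof -
          have "Lp_norm M (ereal q\<^sub>1) a\<^sub>0 * Lp_norm M s G + (2 * BMO_norm \<beta> a\<^sub>1) * H1_norm \<beta> G
            \<le> 2 * (Lp_norm M (ereal q\<^sub>1) a\<^sub>0 * Lp_norm M s G + BMO_norm \<beta> a\<^sub>1 * H1_norm \<beta> G)"
            unfolding distrib_left mult.assoc by (intro add_right_mono) (simp add: mult_2)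
          also have "\<dots> \<le> 2
              * ((Lp_norm M (ereal q\<^sub>1) a\<^sub>0 + ennreal t * BMO_norm \<beta> a\<^sub>1) * (Lp_norm M s G + ennreal (1 / t) * H1_norm \<beta> G))"
            by (intro mult_left_mono couple_pairing_le t) auto
          finally show ?thesis by (simp only: mult_ac ennreal_numeral)
        qed
        finally show "ennreal (norm (\<Lambda> G)) \<le> (Lp_norm M (ereal q\<^sub>1) a\<^sub>0 + ennreal t * BMO_norm \<beta> a\<^sub>1) *
          (ennreal 2 * (Lp_norm M s G + ennreal (1 / t) * H1_norm \<beta> G))" .
      qed
      then show "ennreal (norm (\<Lambda> G))
          \<le> (ennreal 2 * ?K t) * (Lp_norm M s G + ennreal (1 / t) * H1_norm \<beta> G)"
        by (simp only: mult_ac)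
    qed
    also have "\<dots> \<le> ennreal 6 * ((ennreal 2 * ?dn) * (ennreal C * Lp_norm M (ereal p) g))"
      using q' by (intro mult_left_mono mult_mono C(2) dyadic_norm_mono) auto
    also have "\<dots> = (ennreal 6 * ennreal 2 * ennreal C) * ?dn * Lp_norm M (ereal p) g"
      by (simp only: mult_ac)
    also have "ennreal 6 * ennreal 2 * ennreal C = ennreal (12 * C)"
      using C by (simp add: ennreal_mult'[symmetric] del: ennreal_numeral)
    finally show "ennreal (cmod (\<Sum>x\<in>?E. m x *\<^sub>R (f x * g x)))
        \<le> ennreal (12 * C) * ?dn * Lp_norm M (ereal p) g"
      by (simp add: g_eq)
  qed
qed

text \<open>Jensen's inequality in the form \<open>avg_powr_le\<close>.\<close>

lemma Lp_norm_average_le: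
  assumes E: "finite E" "0 < w E" and p: "1 < p" and supp: "\<And>x. x \<notin> E \<Longrightarrow> g x = 0"
  shows "Lp_norm M (ereal p) (\<lambda>x. if x \<in> E then average E g else 0) \<le> Lp_norm M (ereal p) g"
proof -
  have fin: "power_integral p h = ennreal (\<Sum>x\<in>E. m x * cmod (h x) powr p)"
    if "\<And>x. x \<notin> E \<Longrightarrow> h x = 0" for h
  proof -
    have "power_integral p h = (\<integral>\<^sup>+x\<in>E. ennreal (cmod (h x) powr p) \<partial>M)"
      unfolding power_integral_def using that by (intro nn_integral_cong) (auto simp: indicator_def)
    then show ?thesis by (simp add: set_power_integral_finite E)
  qed
  have "(\<Sum>x\<in>E. m x * cmod (if x \<in> E then average E g else 0) powr p) = w E * cmod (average E g) powr p"
    by (simp add: sum_distrib_right)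
  also have "\<dots> \<le> w E * avg E g powr p"
    using E p by (intro mult_left_mono powr_mono2 cmod_average_le) auto
  also have "\<dots> \<le> (\<Sum>x\<in>E. m x * cmod (g x) powr p)"
    using avg_powr_le[OF E p, of g] by (simp add: mult.commute)
  finally show ?thesis
    unfolding Lp_norm_real
    using p supp by (subst fin, simp, subst fin, simp) (auto intro!: enn_powr_mono ennreal_leI)
qed

text \<open>The pairing is controlled only for test functions of mean zero. Pairing \<open>f\<close>
  minus its mean with \<open>g\<close> is the same as pairing \<open>f\<close> with \<open>g\<close>
  minus the mean of \<open>g\<close>, and subtracting that mean at most doubles the norm of
  \<open>g\<close>.\<close>

lemma Lp_oscillation_le:
  assumes \<beta>: "8 \<le> \<beta>" and q: "1 \<le> q\<^sub>1" "q\<^sub>1 < q" and \<theta>: "0 < \<theta>" "\<theta> < 1" and eq: "1 / q = (1 - \<theta>) / q\<^sub>1"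
  shows "\<exists>C>0. \<forall>f n. dyadic_norm \<theta> q (\<lambda>t. K_functional (Lp_norm M (ereal q\<^sub>1)) (BMO_norm \<beta>) t f) < top \<longrightarrow>
    enn_powr (\<integral>\<^sup>+x\<in>exhaustion n. ennreal (cmod (f x - average (exhaustion n) f) powr q) \<partial>M) (1 / q) \<le>
      ennreal C * dyadic_norm \<theta> q (\<lambda>t. K_functional (Lp_norm M (ereal q\<^sub>1)) (BMO_norm \<beta>) t f)"
proof -
  define p where "p = q / (q - 1)"
  have q': "1 < q" using q by simp
  have p: "1 < p" "1 / q + 1 / p = 1" using q' by (auto simp: p_def field_simps)
  obtain C where C: "0 < C"
    "\<And>f g n. dyadic_norm \<theta> q (\<lambda>t. K_functional (Lp_norm M (ereal q\<^sub>1)) (BMO_norm \<beta>) t f) < top \<Longrightarrow>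
    (\<forall>x. x \<notin> exhaustion n \<longrightarrow> g x = 0) \<Longrightarrow> (\<Sum>x\<in>exhaustion n. m x *\<^sub>R g x) = 0 \<Longrightarrow>
    ennreal (cmod (\<Sum>x\<in>exhaustion n. m x *\<^sub>R (f x * g x))) \<le>
      ennreal C * dyadic_norm \<theta> q (\<lambda>t. K_functional (Lp_norm M (ereal q\<^sub>1)) (BMO_norm \<beta>) t f) * Lp_norm M (ereal p) g"
    using BMO_pairing_le[OF \<beta> q \<theta> eq p] by blast
  show ?thesis
  proof (intro exI[of _ "2 * C"] conjI allI impI)
    show "0 < 2 * C" using C by simp
    fix f :: "'v \<Rightarrow> complex" and n
    let ?dn = "dyadic_norm \<theta> q (\<lambda>t. K_functional (Lp_norm M (ereal q\<^sub>1)) (BMO_norm \<beta>) t f)"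
    let ?E = "exhaustion n"
    assume dn: "?dn < top"
    have E: "finite ?E" "0 < w ?E" by (rule finite_exhaustion, rule w_exhaustion_pos)
    show "enn_powr (\<integral>\<^sup>+x\<in>?E. ennreal (cmod (f x - average ?E f) powr q) \<partial>M) (1 / q)
        \<le> ennreal (2 * C) * ?dn"
    proof (rule local_Lp_norm_le_by_duality[OF q' p(1) p(2) E(1)])
      fix g :: "'v \<Rightarrow> complex" assume supp: "\<And>x. x \<notin> ?E \<Longrightarrow> g x = 0"
      define h where "h x = (if x \<in> ?E then average ?E g else 0)" for x
      define k where "k x = g x - h x" for x
      have k: "(\<Sum>x\<in>?E. m x *\<^sub>R k x) = 0"
        using sum_mean_diff[OF E, of g] by (simp add: k_def h_def)
      have "(\<Sum>x\<in>?E. m x *\<^sub>R ((f x - average ?E f) * g x))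
        = (\<Sum>x\<in>?E. m x *\<^sub>R (f x * k x)) - average ?E f * (\<Sum>x\<in>?E. m x *\<^sub>R k x) + (\<Sum>x\<in>?E. m x *\<^sub>R (f x - average ?E f)) * average ?E g"
        unfolding sum_distrib_left sum_distrib_right sum_subtractf[symmetric] sum.distrib[symmetric]
        by (intro sum.cong) (auto simp: k_def h_def algebra_simps)
      also have "\<dots> = (\<Sum>x\<in>?E. m x *\<^sub>R (f x * k x))" using k sum_mean_diff[OF E, of f] by simp
      finally have swap: "(\<Sum>x\<in>?E. m x *\<^sub>R ((f x - average ?E f) * g x))
          = (\<Sum>x\<in>?E. m x *\<^sub>R (f x * k x))" .
      have "\<forall>x. x \<notin> ?E \<longrightarrow> k x = 0" using supp by (simp add: k_def h_def)
      from C(2)[OF dn this k]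
      have "ennreal (cmod (\<Sum>x\<in>?E. m x *\<^sub>R ((f x - average ?E f) * g x)))
          \<le> ennreal C * ?dn * Lp_norm M (ereal p) k"
        unfolding swap .
      also have "\<dots> \<le> ennreal C * ?dn * (2 * Lp_norm M (ereal p) g)"
      proof (intro mult_left_mono)
        have "Lp_norm M (ereal p) k \<le> Lp_norm M (ereal p) g + Lp_norm M (ereal p) h"
          using Lp_norm_triangle_diff[of "ereal p" g h] p
          by (simp add: k_def[abs_def] fun_diff_def one_ereal_def)
        also have "\<dots> \<le> Lp_norm M (ereal p) g + Lp_norm M (ereal p) g"
          unfolding h_def[abs_def] using supp p E by (intro add_left_mono Lp_norm_average_le) auto
        finally show "Lp_norm M (ereal p) k \<le> 2 * Lp_norm M (ereal p) g" by (simp add: mult_2)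
      qed simp
      also have "\<dots> = ennreal (2 * C) * ?dn * Lp_norm M (ereal p) g"
        using ennreal_mult'[of 2 C] by (simp add: mult_ac)
      finally show "ennreal (cmod (\<Sum>x\<in>?E. m x *\<^sub>R ((f x - average ?E f) * g x)))
          \<le> ennreal (2 * C) * ?dn * Lp_norm M (ereal p) g" .
    qed
  qed
qed

text \<open>The averages of \<open>f\<close> over the exhaustion need a limit point, for which
  boundedness suffices: all members contain a common point \<open>x0\<close>, where the oscillation
  bound keeps the averages near \<open>f x0\<close>. Subtracting a limit point \<open>z\<close>
  brings \<open>f\<close> into \<open>L^q\<close>.\<close>

lemma Lp_norm_mod_const_le:
  assumes \<beta>: "8 \<le> \<beta>" and q: "1 \<le> q\<^sub>1" "q\<^sub>1 < q" and \<theta>: "0 < \<theta>" "\<theta> < 1" and eq: "1 / q = (1 - \<theta>) / q\<^sub>1"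
  shows "\<exists>C>0. \<forall>f. mod_const_norm (Lp_norm M (ereal q)) (abs_fun_mod_const f) \<le>
      ennreal C * dyadic_norm \<theta> q (\<lambda>t. K_functional (Lp_norm M (ereal q\<^sub>1)) (BMO_norm \<beta>) t f)"
proof -
  have q': "1 < q" using q by simp
  obtain C where C: "0 < C"
    "\<And>f n. dyadic_norm \<theta> q (\<lambda>t. K_functional (Lp_norm M (ereal q\<^sub>1)) (BMO_norm \<beta>) t f) < top \<Longrightarrow>
    enn_powr (\<integral>\<^sup>+x\<in>exhaustion n. ennreal (cmod (f x - average (exhaustion n) f) powr q) \<partial>M) (1 / q) \<le>
      ennreal C * dyadic_norm \<theta> q (\<lambda>t. K_functional (Lp_norm M (ereal q\<^sub>1)) (BMO_norm \<beta>) t f)"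
    using Lp_oscillation_le[OF assms] by blast
  show ?thesis
  proof (intro exI[of _ C] conjI allI)
    fix f :: "'v \<Rightarrow> complex"
    let ?dn = "dyadic_norm \<theta> q (\<lambda>t. K_functional (Lp_norm M (ereal q\<^sub>1)) (BMO_norm \<beta>) t f)"
    show "mod_const_norm (Lp_norm M (ereal q)) (abs_fun_mod_const f) \<le> ennreal C * ?dn"
    proof (cases "?dn = top")
      case True
      then show ?thesis by (intro le_ennreal_mult_top C(1))
    next
      case False
      then have dn: "?dn < top" by (simp add: less_top)
      define B where "B = enn2real (ennreal C * ?dn)"
      have B: "ennreal C * ?dn = ennreal B" "0 \<le> B"
        using dn by (auto simp: B_def ennreal_mult_less_top)
      define c where "c n = average (exhaustion n) f" for n
      have osc: "(\<Sum>x\<in>exhaustion n. m x * cmod (f x - c n) powr q) \<le> B powr q" for n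
      proof -
        have "enn_powr (ennreal (\<Sum>x\<in>exhaustion n. m x * cmod (f x - c n) powr q)) (1 / q) \<le> ennreal B"
          using C(2)[OF dn, of n]
          unfolding B(1) c_def by (simp add: set_power_integral_finite finite_exhaustion)
        then have "enn_powr (enn_powr (ennreal (\<Sum>x\<in>exhaustion n. m x * cmod (f x - c n) powr q)) (1 / q)) q \<le> enn_powr (ennreal B) q"
          using q' by (intro enn_powr_mono) auto
        then have "ennreal (\<Sum>x\<in>exhaustion n. m x * cmod (f x - c n) powr q) \<le> ennreal (B powr q)"
          using q' B(2) by (simp add: enn_powr_ennreal del: sum_ennreal)
        then show ?thesis by (simp add: ennreal_le_iff)
      qed
      obtain x0 where x0: "x0 \<in> exhaustion 0"
        using w_exhaustion_pos[of 0] by (metis all_not_in_conv less_irrefl sum.empty)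
      have "cmod (c n) \<le> cmod (f x0) + B / m x0 powr (1 / q)" for n
      proof -
        have "x0 \<in> exhaustion n" using x0 exhaustion_mono[of 0 n] by auto
        then have "m x0 * cmod (f x0 - c n) powr q \<le> B powr q"
          using osc[of n] member_le_sum[of x0 "exhaustion n"
          "\<lambda>x. m x * cmod (f x - c n) powr q"] finite_exhaustion[of n]
          by simp
        then have "cmod (f x0 - c n) powr q \<le> B powr q / m x0"
          using m_pos[of x0] by (simp add: field_simps)
        then have "(cmod (f x0 - c n) powr q) powr (1 / q) \<le> (B powr q / m x0) powr (1 / q)"
          using q' by (intro powr_mono2) auto
        then have "cmod (f x0 - c n) \<le> B / m x0 powr (1 / q)"
          using q' B(2) m_pos[of x0] by (simp add: powr_powr powr_divide)
        moreover have "cmod (c n) \<le> cmod (f x0) + cmod (f x0 - c n)"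
          using norm_triangle_ineq4[of "f x0" "f x0 - c n"] by simp
        ultimately show ?thesis by linarith
      qed
      then have "bounded (range c)" unfolding bounded_iff by blast
      then obtain z \<sigma> where \<sigma>: "strict_mono \<sigma>" "(c \<circ> \<sigma>) \<longlonglongrightarrow> z"
        using bounded_imp_convergent_subsequence by blast
      have "mod_const_norm (Lp_norm M (ereal q)) (abs_fun_mod_const f)
          \<le> Lp_norm M (ereal q) (\<lambda>x. f x - z)"
      proof -
        have "abs_fun_mod_const f = abs_fun_mod_const (\<lambda>x. f x - z)"
          unfolding abs_fun_mod_const_eq_iff by (intro exI[of _ z]) simp
        then show ?thesis using mod_const_norm_le by metis
      qed
      also have "\<dots> \<le> ennreal B"
      proof (rule Lp_norm_exhaustion_le)
        fix n
        \<comment> \<open>On a fixed member of the exhaustion the sum is finite and continuous in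
          the subtracted constant; for \<open>j \<ge> n\<close> it is at most the sum over the
          larger member with index \<open>\<sigma> j\<close>, whose own average is
          subtracted.\<close>
        have "(\<lambda>j. \<Sum>x\<in>exhaustion n. m x * cmod (f x - (c \<circ> \<sigma>) j) powr q) \<longlonglongrightarrow> (\<Sum>x\<in>exhaustion n. m x * cmod (f x - z) powr q)"
          using q' by (intro tendsto_intros \<sigma>(2) tendsto_powr2) auto
        moreover have "(\<Sum>x\<in>exhaustion n. m x * cmod (f x - (c \<circ> \<sigma>) j) powr q) \<le> B powr q"
          if "n \<le> j" for j
        proof -
          have "n \<le> \<sigma> j" using that seq_suble[OF \<sigma>(1), of j] by linarith
          then have "(\<Sum>x\<in>exhaustion n. m x * cmod (f x - c (\<sigma> j)) powr q)
              \<le> (\<Sum>x\<in>exhaustion (\<sigma> j). m x * cmod (f x - c (\<sigma> j)) powr q)"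
            using exhaustion_mono finite_exhaustion by (intro sum_mono2) auto
          also have "\<dots> \<le> B powr q" by (rule osc)
          finally show ?thesis by simp
        qed
        ultimately have "(\<Sum>x\<in>exhaustion n. m x * cmod (f x - z) powr q) \<le> B powr q"
          by (intro LIMSEQ_le_const2) auto
        then have "ennreal (\<Sum>x\<in>exhaustion n. m x * cmod (f x - z) powr q) \<le> ennreal (B powr q)"
          by (rule ennreal_leI)
        then have "enn_powr (\<integral>\<^sup>+x\<in>exhaustion n. ennreal (cmod (f x - z) powr q) \<partial>M) (1 / q)
            \<le> enn_powr (ennreal (B powr q)) (1 / q)"
          unfolding set_power_integral_finite[OF finite_exhaustion, symmetric]
          using q' by (intro enn_powr_mono) auto
        also have "\<dots> = ennreal B" using q' B(2) by (simp add: enn_powr_ennreal powr_powr)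
        finally show "enn_powr (\<integral>\<^sup>+x\<in>exhaustion n. ennreal (cmod (f x - z) powr q) \<partial>M) (1 / q)
            \<le> ennreal B" .
      qed (use q' in simp)
      finally show ?thesis by (simp add: B)
    qed
  qed (rule C(1))
qed

section \<open>The three interpolation identities\<close>

text \<open>For the lower bound H1 is enlarged to L1, which only decreases the K-functional.\<close>

lemma interp_H1_Lp_same_space:
  assumes \<beta>: "8 \<le> \<beta>" and p: "1 < p" "ereal p < p\<^sub>1" and \<theta>: "0 < \<theta>" "\<theta> < 1"
    and eq: "ereal (1 / p) = ereal (1 - \<theta>) + ereal \<theta> / p\<^sub>1"
  shows "same_space (interp_norm (H1_norm \<beta>) (Lp_norm M p\<^sub>1) \<theta> (ereal p)) (Lp_norm M (ereal p))"
proof -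
  obtain C where C: "0 < C"
    "\<And>f. dyadic_norm \<theta> p (\<lambda>t. K_functional (H1_norm \<beta>) (Lp_norm M p\<^sub>1) t f)
    \<le> ennreal C * Lp_norm M (ereal p) f"
    using dyadic_norm_H1_Lp_le[OF assms] by blast
  obtain C' where C': "0 < C'"
    "\<And>f. Lp_norm M (ereal p) f
    \<le> ennreal C' * dyadic_norm \<theta> p (\<lambda>t. K_functional (Lp_norm M 1) (Lp_norm M p\<^sub>1) t f)"
    using Lp_norm_le_interp_L1[OF p \<theta> eq] by blast
  show ?thesis
  proof (rule same_spaceI)
    show "0 < 2 * C" "0 < C' * 4" using C C' by auto
    fix f
    have "interp_norm (H1_norm \<beta>) (Lp_norm M p\<^sub>1) \<theta> (ereal p) f
        \<le> ennreal 2 * (ennreal C * Lp_norm M (ereal p) f)"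
      using p \<theta> by (intro order_trans[OF interp_norm_le_dyadic_norm] mult_left_mono C(2)) auto
    then show "interp_norm (H1_norm \<beta>) (Lp_norm M p\<^sub>1) \<theta> (ereal p) f
        \<le> ennreal (2 * C) * Lp_norm M (ereal p) f"
      by (simp add: ennreal_mult' mult.assoc)
    have "Lp_norm M (ereal p) f
        \<le> ennreal C' * dyadic_norm \<theta> p (\<lambda>t. K_functional (Lp_norm M 1) (Lp_norm M p\<^sub>1) t f)"
      by (rule C'(2))
    also have "\<dots> \<le> ennreal C'
        * (ennreal 1 * dyadic_norm \<theta> p (\<lambda>t. K_functional (H1_norm \<beta>) (Lp_norm M p\<^sub>1) t f))"
    proof (intro mult_left_mono dyadic_norm_mono)
      fix t :: real assume t: "0 < t"
      have "K_functional (Lp_norm M 1) (Lp_norm M p\<^sub>1) t f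
          \<le> K_functional (H1_norm \<beta>) (Lp_norm M p\<^sub>1) t f"
      proof (rule K_functional_greatest)
        fix a\<^sub>0 a\<^sub>1 assume "f = a\<^sub>0 + a\<^sub>1"
        then have "K_functional (Lp_norm M 1) (Lp_norm M p\<^sub>1) t f
            \<le> Lp_norm M 1 a\<^sub>0 + ennreal t * Lp_norm M p\<^sub>1 a\<^sub>1"
          using t by (rule K_functional_le)
        also have "\<dots> \<le> H1_norm \<beta> a\<^sub>0 + ennreal t * Lp_norm M p\<^sub>1 a\<^sub>1" by (intro add_right_mono L1_le_H1)
        finally show "K_functional (Lp_norm M 1) (Lp_norm M p\<^sub>1) t f
            \<le> H1_norm \<beta> a\<^sub>0 + ennreal t * Lp_norm M p\<^sub>1 a\<^sub>1" .
      qed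
      then show "K_functional (Lp_norm M 1) (Lp_norm M p\<^sub>1) t f
          \<le> ennreal 1 * K_functional (H1_norm \<beta>) (Lp_norm M p\<^sub>1) t f" by simp
    qed (use p in auto)
    also have "\<dots> \<le> ennreal C'
        * (ennreal 1 * (ennreal 4 * interp_norm (H1_norm \<beta>) (Lp_norm M p\<^sub>1) \<theta> (ereal p) f))"
      using p \<theta> by (intro mult_left_mono dyadic_norm_le_interp_norm) auto
    also have "\<dots> = ennreal (C' * 4) * interp_norm (H1_norm \<beta>) (Lp_norm M p\<^sub>1) \<theta> (ereal p) f"
      using C' by (simp add: ennreal_mult mult.assoc)
    finally show "Lp_norm M (ereal p) f
        \<le> ennreal (C' * 4) * interp_norm (H1_norm \<beta>) (Lp_norm M p\<^sub>1) \<theta> (ereal p) f" .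
  qed
qed

text \<open>\<open>N\<close> may be any norm above that of the first Lebesgue space: it is this norm
  itself in the second identity and, with \<open>q\<^sub>1 = 1\<close>, the norm of H1 in the
  third.\<close>

lemma mod_const_norm_le_interp:
  assumes \<beta>: "8 \<le> \<beta>" and q: "1 \<le> q\<^sub>1" "q\<^sub>1 < q" and \<theta>: "0 < \<theta>" "\<theta> < 1" and eq: "1 / q = (1 - \<theta>) / q\<^sub>1"
    and N: "\<And>f. Lp_norm M (ereal q\<^sub>1) f \<le> N f"
  shows "\<exists>C>0. \<forall>F. mod_const_norm (Lp_norm M (ereal q)) F \<le>
    ennreal C * interp_norm (mod_const_norm N) (mod_const_norm (BMO_norm \<beta>)) \<theta> (ereal q) F"
proof -
  obtain C where C: "0 < C" "\<And>f. mod_const_norm (Lp_norm M (ereal q)) (abs_fun_mod_const f) \<le>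
      ennreal C * dyadic_norm \<theta> q (\<lambda>t. K_functional (Lp_norm M (ereal q\<^sub>1)) (BMO_norm \<beta>) t f)"
    using Lp_norm_mod_const_le[OF \<beta> q \<theta> eq] by blast
  show ?thesis
  proof (intro exI[of _ "C * 4"] conjI allI)
    show "0 < C * 4" using C by simp
    fix F :: "'v fun_mod_const"
    obtain f where F: "F = abs_fun_mod_const f" using abs_fun_mod_const_surj by metis
    let ?K = "\<lambda>t. K_functional (mod_const_norm N) (mod_const_norm (BMO_norm \<beta>)) t F"
    have "mod_const_norm (Lp_norm M (ereal q)) F
        \<le> ennreal C * dyadic_norm \<theta> q (\<lambda>t. K_functional (Lp_norm M (ereal q\<^sub>1)) (BMO_norm \<beta>) t f)"
      unfolding F by (rule C(2))
    also have "\<dots> \<le> ennreal C * (ennreal 1 * dyadic_norm \<theta> q ?K)"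
    proof (intro mult_left_mono dyadic_norm_mono)
      fix t :: real assume t: "0 < t"
      have "K_functional (Lp_norm M (ereal q\<^sub>1)) (BMO_norm \<beta>) t f \<le> K_functional N (BMO_norm \<beta>) t f"
      proof (rule K_functional_greatest)
        fix a\<^sub>0 a\<^sub>1 assume "f = a\<^sub>0 + a\<^sub>1"
        then have "K_functional (Lp_norm M (ereal q\<^sub>1)) (BMO_norm \<beta>) t f
            \<le> Lp_norm M (ereal q\<^sub>1) a\<^sub>0 + ennreal t * BMO_norm \<beta> a\<^sub>1"
          using t by (rule K_functional_le)
        also have "\<dots> \<le> N a\<^sub>0 + ennreal t * BMO_norm \<beta> a\<^sub>1" by (intro add_right_mono N)
        finally show "K_functional (Lp_norm M (ereal q\<^sub>1)) (BMO_norm \<beta>) t f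
            \<le> N a\<^sub>0 + ennreal t * BMO_norm \<beta> a\<^sub>1" .
      qed
      also have "\<dots> \<le> ?K t" unfolding F using t BMO_norm_add_const by (rule K_functional_le_mod_const)
      finally show "K_functional (Lp_norm M (ereal q\<^sub>1)) (BMO_norm \<beta>) t f \<le> ennreal 1 * ?K t" by simp
    qed (use q in auto)
    also have "\<dots> \<le> ennreal C
        * (ennreal 1 * (ennreal 4 * interp_norm (mod_const_norm N) (mod_const_norm (BMO_norm \<beta>)) \<theta> (ereal q) F))"
      using q \<theta> by (intro mult_left_mono dyadic_norm_le_interp_norm) auto
    also have "\<dots> = ennreal (C * 4)
        * interp_norm (mod_const_norm N) (mod_const_norm (BMO_norm \<beta>)) \<theta> (ereal q) F"
      using C by (simp add: ennreal_mult mult.assoc)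
    finally show "mod_const_norm (Lp_norm M (ereal q)) F \<le>
      ennreal (C * 4) * interp_norm (mod_const_norm N) (mod_const_norm (BMO_norm \<beta>)) \<theta> (ereal q) F" .
  qed
qed

text \<open>The bounded functions embed into BMO with norm at most 2; another 2 from the passage to
  the dyadic norm makes the constant 4. The bound for every representative then passes to the
  infimum.\<close>

lemma interp_mod_const_le:
  assumes q: "1 \<le> q" and \<theta>: "0 < \<theta>" "\<theta> < 1" and C: "0 < C"
    and N: "\<And>f. dyadic_norm \<theta> q (\<lambda>t. K_functional N (Lp_norm M \<infinity>) t f)
        \<le> ennreal C * Lp_norm M (ereal q) f"
  shows "interp_norm (mod_const_norm N) (mod_const_norm (BMO_norm \<beta>)) \<theta> (ereal q) F \<le>
    ennreal (4 * C) * mod_const_norm (Lp_norm M (ereal q)) F"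
proof -
  have le: "interp_norm (mod_const_norm N) (mod_const_norm (BMO_norm \<beta>)) \<theta> (ereal q) F
    \<le> ennreal (4 * C) * Lp_norm M (ereal q) f" if F: "abs_fun_mod_const f = F" for f
  proof -
    have "interp_norm (mod_const_norm N) (mod_const_norm (BMO_norm \<beta>)) \<theta> (ereal q) F
      \<le> ennreal 2 * dyadic_norm \<theta> q (\<lambda>t. K_functional (mod_const_norm N) (mod_const_norm (BMO_norm \<beta>)) t F)"
      using q \<theta> by (intro interp_norm_le_dyadic_norm) auto
    also have "\<dots> \<le> ennreal 2 * (ennreal 2 * dyadic_norm \<theta> q (\<lambda>t. K_functional N (Lp_norm M \<infinity>) t f))"
      unfolding F[symmetric]
    proof (intro mult_left_mono dyadic_norm_mono K_functional_mod_const_le)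
      show "N a \<le> ennreal 2 * N a" for a by (simp add: mult_2 add_increasing2)
      show "BMO_norm \<beta> a \<le> ennreal 2 * Lp_norm M \<infinity> a" for a using BMO_norm_le_infinity[of \<beta> a] by simp
    qed (use q in auto)
    also have "\<dots> \<le> ennreal 2 * (ennreal 2 * (ennreal C * Lp_norm M (ereal q) f))"
      by (intro mult_left_mono N) auto
    also have "\<dots> = (ennreal 2 * ennreal 2 * ennreal C) * Lp_norm M (ereal q) f"
      by (simp only: mult.assoc)
    also have "ennreal 2 * ennreal 2 * ennreal C = ennreal (4 * C)"
      using C by (simp add: ennreal_mult'[symmetric] del: ennreal_numeral)
    finally show ?thesis .
  qed
  have "ennreal (1 / (4 * C))
      * interp_norm (mod_const_norm N) (mod_const_norm (BMO_norm \<beta>)) \<theta> (ereal q) F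
    \<le> mod_const_norm (Lp_norm M (ereal q)) F"
    unfolding mod_const_norm_def[of "Lp_norm M (ereal q)"]
  proof (rule INF_greatest)
    fix f assume "f \<in> {f. abs_fun_mod_const f = F}"
    then have "ennreal (1 / (4 * C))
        * interp_norm (mod_const_norm N) (mod_const_norm (BMO_norm \<beta>)) \<theta> (ereal q) F
      \<le> ennreal (1 / (4 * C)) * (ennreal (4 * C) * Lp_norm M (ereal q) f)"
      by (intro mult_left_mono le) auto
    also have "\<dots> = (ennreal (1 / (4 * C)) * ennreal (4 * C)) * Lp_norm M (ereal q) f"
      by (simp only: mult.assoc)
    also have "ennreal (1 / (4 * C)) * ennreal (4 * C) = 1"
      using C by (simp add: ennreal_mult'[symmetric])
    finally show "ennreal (1 / (4 * C))
        * interp_norm (mod_const_norm N) (mod_const_norm (BMO_norm \<beta>)) \<theta> (ereal q) F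
      \<le> Lp_norm M (ereal q) f" by simp
  qed
  then show ?thesis using C by (intro ennreal_le_div_mult) auto
qed

lemma interp_Lp_BMO_same_space:
  assumes \<beta>: "8 \<le> \<beta>" and q: "1 \<le> q\<^sub>1" "q\<^sub>1 < q" and \<theta>: "0 < \<theta>" "\<theta> < 1" and eq: "1 / q = (1 - \<theta>) / q\<^sub>1"
  shows "same_space (interp_norm (mod_const_norm (Lp_norm M (ereal q\<^sub>1))) (mod_const_norm (BMO_norm \<beta>)) \<theta> (ereal q))
    (mod_const_norm (Lp_norm M (ereal q)))"
proof -
  obtain C where C: "0 < C"
    "\<And>f. dyadic_norm \<theta> q (\<lambda>t. K_functional (Lp_norm M (ereal q\<^sub>1)) (Lp_norm M \<infinity>) t f)
    \<le> ennreal C * Lp_norm M (ereal q) f"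
    using dyadic_norm_Lp_Linf_le[OF q \<theta> eq] by blast
  obtain C' where C': "0 < C'" "\<And>F. mod_const_norm (Lp_norm M (ereal q)) F \<le>
    ennreal C' * interp_norm (mod_const_norm (Lp_norm M (ereal q\<^sub>1))) (mod_const_norm (BMO_norm \<beta>)) \<theta> (ereal q) F"
    using mod_const_norm_le_interp[OF \<beta> q \<theta> eq order.refl] by blast
  show ?thesis
    by (rule same_spaceI[of "4 * C" C']) (use C C' q \<theta> in \<open>auto intro: interp_mod_const_le\<close>)
qed

text \<open>The two inequalities come from different couples: BMO shrinks to the bounded functions
  in one of them, H1 grows to L1 in the other.\<close>

lemma interp_H1_BMO_same_space:
  assumes \<beta>: "8 \<le> \<beta>" and q: "1 < q" and \<theta>: "0 < \<theta>" "\<theta> < 1" and eq: "1 / q = 1 - \<theta>"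
  shows "same_space (interp_norm (mod_const_norm (H1_norm \<beta>)) (mod_const_norm (BMO_norm \<beta>)) \<theta> (ereal q))
    (mod_const_norm (Lp_norm M (ereal q)))"
proof -
  have "ereal (1 / q) = ereal (1 - \<theta>) + ereal \<theta> / \<infinity>" using eq by simp
  then obtain C where C: "0 < C"
    "\<And>f. dyadic_norm \<theta> q (\<lambda>t. K_functional (H1_norm \<beta>) (Lp_norm M \<infinity>) t f)
    \<le> ennreal C * Lp_norm M (ereal q) f"
    using dyadic_norm_H1_Lp_le[OF \<beta> q _ \<theta>, of \<infinity>] by auto
  have L1: "Lp_norm M (ereal 1) f \<le> H1_norm \<beta> f"
    for f using L1_le_H1[of f \<beta>] by (simp add: one_ereal_def)
  have "1 / q = (1 - \<theta>) / 1" using eq by simp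
  from mod_const_norm_le_interp[OF \<beta> order.refl q \<theta> this L1]
  obtain C' where C': "0 < C'" "\<And>F. mod_const_norm (Lp_norm M (ereal q)) F \<le>
    ennreal C' * interp_norm (mod_const_norm (H1_norm \<beta>)) (mod_const_norm (BMO_norm \<beta>)) \<theta> (ereal q) F" by blast
  show ?thesis
    by (rule same_spaceI[of "4 * C" C']) (use C C' q \<theta> in \<open>auto intro: interp_mod_const_le\<close>)
qed

end

theorem theorem5p2:
  fixes adj :: "'v \<Rightarrow> 'v \<Rightarrow> bool" and \<omega> :: "nat \<Rightarrow> 'v" and m :: "'v \<Rightarrow> real" and \<beta> :: real
  assumes "flow_tree adj \<omega> m"
    and "flow_tree.locally_doubling adj m"
    and "\<beta> \<ge> 12"
  defines "L \<equiv> Lp_norm (flow_tree.flow_measure m)"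
    and "H1 \<equiv> flow_tree.H1_norm adj \<omega> m \<beta>"
    and "BMO \<equiv> flow_tree.BMO_norm adj \<omega> m \<beta>"
  shows "(\<forall>(p::real) (p\<^sub>1::ereal) (\<theta>::real).
            1 < p \<and> ereal p < p\<^sub>1 \<and> 0 < \<theta> \<and> \<theta> < 1
            \<and> ereal (1 / p) = ereal (1 - \<theta>) + ereal \<theta> / p\<^sub>1 \<longrightarrow>
            same_space (interp_norm H1 (L p\<^sub>1) \<theta> (ereal p)) (L (ereal p)))
       \<and> (\<forall>(q\<^sub>1::real) (q::real) (\<theta>::real).
            1 \<le> q\<^sub>1 \<and> q\<^sub>1 < q \<and> 0 < \<theta> \<and> \<theta> < 1 \<and> 1 / q = (1 - \<theta>) / q\<^sub>1 \<longrightarrow>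
            same_space
              (interp_norm (mod_const_norm (L (ereal q\<^sub>1))) (mod_const_norm BMO) \<theta> (ereal q))
              (mod_const_norm (L (ereal q))))
       \<and> (\<forall>(q::real) (\<theta>::real).
            1 < q \<and> 0 < \<theta> \<and> \<theta> < 1 \<and> 1 / q = 1 - \<theta> \<longrightarrow>
            same_space
              (interp_norm (mod_const_norm H1) (mod_const_norm BMO) \<theta> (ereal q))
              (mod_const_norm (L (ereal q))))"
proof -
  interpret flow_tree adj \<omega> m by (rule assms(1))
  interpret doubling_flow_tree adj \<omega> m by unfold_locales (rule assms(2))
  have \<beta>: "8 \<le> \<beta>" using assms(3) by simp
  show ?thesis
    unfolding L_def H1_def BMO_def
    using interp_H1_Lp_same_space[OF \<beta>] interp_Lp_BMO_same_space[OF \<beta>] interp_H1_BMO_same_space[OF \<beta>] by blast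
qed

end
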